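(* Let $K$ be a finite connected 2-complex, and let $\{K_i\to K\}$ be an infinite collection of finite-sheeted covering spaces. Suppose that $\{\pi_1(K_i)\}$ has linear growth of mod $p$ homology for some prime $p$. For each $i$, pick a basis for $H^1(K_i;\mathbb{F}_p)$, represent each basis element by a cellular cocycle, and let $\mathcal{C}_i$ be the subspace spanned by these cocycles in the space of cellular 1-dimensional mod $p$ cochains on $K_i$, viewed as a linear code with respect to the natural basis indexed by the 1-cells of $K_i$. Then either $\pi_1(K)$ is large or the codes $\mathcal{C}_i$ are asymptotically good.
   Context: Covering spaces are connected and have the lifted cell structure. Convention: the attaching map of each 2-cell of a 2-complex is cellular, in the sense that the boundary path of the 2-cell is a concatenation of finitely many paths, each of which is a homeomorphism onto a 1-cell. For a group $H$, $d_p(H)=\dim_{\mathbb{F}_p} H_1(H;\mathbb{F}_p)$. A collection $\{G_i\}$ of finite index subgroups of $G$ has linear growth of mod $p$ homology if $\inf_i d_p(G_i)/[G:G_i]>0$; here $\pi_1(K_i)$ is viewed as a finite index subgroup of $G=\pi_1(K)$. A group is large if it has a finite index subgroup that admits a surjective homomorphism onto a non-abelian free group. A linear code is a subspace $\mathcal{C}$ of $(\mathbb{F}_p)^n$. Its Hamming distance $d$ is the smallest number of non-zero coordinates in a non-trivial element of $\mathcal{C}$. Its rate is $\dim(\mathcal{C})/n$. An infinite (indexed) collection of codes is asymptotically good if the rate $\dim(\mathcal{C})/n$ and the ratio $d/n$ are both bounded away from zero over the collection. *)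

theory Defs
  imports
    "HOL-Analysis.Analysis"
    "HOL-Algebra.Coset"
    "HOL-Library.Function_Algebras"
    "HOL-Library.Disjoint_Sets"
    "Berlekamp_Zassenhaus.Finite_Field"
begin

section \<open>Linear algebra in spaces of functions\<close>

definition fscale :: "'k::field \<Rightarrow> ('x \<Rightarrow> 'k) \<Rightarrow> 'x \<Rightarrow> 'k" where
  "fscale a f = (\<lambda>x. a * f x)"

interpretation fun_space: vector_space "fscale :: 'k::field \<Rightarrow> ('x \<Rightarrow> 'k) \<Rightarrow> 'x \<Rightarrow> 'k"
  by standard (auto simp: fscale_def fun_eq_iff algebra_simps)

text \<open>For subspaces \<open>U \<subseteq> W\<close>: the cosets \<open>s + U\<close> with \<open>s \<in> S\<close> are pairwise distinct and form a
  basis of the quotient space \<open>W / U\<close>. So \<open>S\<close> consists of one representative for each element of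
  a basis of \<open>W / U\<close>.\<close>

definition quotient_basis ::
  "('x \<Rightarrow> 'k::field) set \<Rightarrow> ('x \<Rightarrow> 'k) set \<Rightarrow> ('x \<Rightarrow> 'k) set \<Rightarrow> bool" where
  "quotient_basis W U S \<longleftrightarrow>
     fun_space.span (S \<union> U) = W \<and>
     (\<forall>T a. finite T \<and> T \<subseteq> S \<and> (\<Sum>s\<in>T. fscale (a s) s) \<in> U \<longrightarrow> (\<forall>s\<in>T. a s = 0))"

definition quotient_dim :: "('x \<Rightarrow> 'k::field) set \<Rightarrow> ('x \<Rightarrow> 'k) set \<Rightarrow> nat" where
  "quotient_dim W U = card (SOME S. quotient_basis W U S)"


section \<open>First homology of a group\<close>

text \<open>\<open>H\<^sub>1(G; k)\<close> is computed from the inhomogeneous bar complex with trivial coefficients: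
  \<open>C\<^sub>n\<close> is the \<open>k\<close>-vector space on \<open>G\<^sup>n\<close>, \<open>\<partial>[g|h] = [h] - [gh] + [g]\<close>, and \<open>\<partial>[g] = 0\<close>, so that
  every 1-chain is a cycle.\<close>

definition bar_generator :: "'g \<Rightarrow> 'g \<Rightarrow> 'k::field" where
  "bar_generator g = (\<lambda>x. if x = g then 1 else 0)"

definition bar_chains1 :: "('g, 'm) monoid_scheme \<Rightarrow> ('g \<Rightarrow> 'k::field) set" where
  "bar_chains1 G = {c. finite {g. c g \<noteq> 0} \<and> {g. c g \<noteq> 0} \<subseteq> carrier G}"

definition bar_boundaries1 :: "('g, 'm) monoid_scheme \<Rightarrow> ('g \<Rightarrow> 'k::field) set" where
  "bar_boundaries1 G = fun_space.span
     {bar_generator h - bar_generator (g \<otimes>\<^bsub>G\<^esub> h) + bar_generator g | g h.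
        g \<in> carrier G \<and> h \<in> carrier G}"

text \<open>The field \<open>\<bbbF>\<^sub>p\<close> is the type \<open>'p mod_ring\<close> of integers modulo the prime \<open>p = CARD('p)\<close>.\<close>

definition d_p :: "'p::prime_card itself \<Rightarrow> ('g, 'm) monoid_scheme \<Rightarrow> nat" where
  "d_p _ G = quotient_dim (bar_chains1 G :: ('g \<Rightarrow> 'p mod_ring) set) (bar_boundaries1 G)"

definition finite_index_subgroup :: "'g set \<Rightarrow> ('g, 'm) monoid_scheme \<Rightarrow> bool" where
  "finite_index_subgroup H G \<longleftrightarrow> subgroup H G \<and> finite (rcosets\<^bsub>G\<^esub> H)"

definition linear_growth_mod_p ::
  "'p::prime_card itself \<Rightarrow> ('g, 'm) monoid_scheme \<Rightarrow> 'i set \<Rightarrow> ('i \<Rightarrow> 'g set) \<Rightarrow> bool" where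
  "linear_growth_mod_p P G I H \<longleftrightarrow>
     (\<forall>i\<in>I. finite_index_subgroup (H i) G) \<and>
     (INF i\<in>I. real (d_p P (G\<lparr>carrier := H i\<rparr>)) / real (card (rcosets\<^bsub>G\<^esub> (H i)))) > 0"


section \<open>Free groups and large groups\<close>

text \<open>The letter \<open>(x, True)\<close> stands for the generator \<open>x\<close> and \<open>(x, False)\<close> for its inverse.\<close>

definition inv_letter :: "'x \<times> bool \<Rightarrow> 'x \<times> bool" where
  "inv_letter a = (fst a, \<not> snd a)"

definition reduced_word :: "('x \<times> bool) list \<Rightarrow> bool" where
  "reduced_word w \<longleftrightarrow> (\<forall>j. Suc j < length w \<longrightarrow> w ! Suc j \<noteq> inv_letter (w ! j))"

text \<open>Left multiplication of a reduced word by a letter, with free cancellation.\<close>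

fun push_letter :: "'x \<times> bool \<Rightarrow> ('x \<times> bool) list \<Rightarrow> ('x \<times> bool) list" where
  "push_letter a [] = [a]"
| "push_letter a (b # w) = (if b = inv_letter a then w else a # b # w)"

definition free_group :: "'x set \<Rightarrow> ('x \<times> bool) list monoid" where
  "free_group X =
     \<lparr>carrier = {w. reduced_word w \<and> fst ` set w \<subseteq> X},
      mult = (\<lambda>u v. foldr push_letter u v),
      one = []\<rparr>"

text \<open>If a subgroup of \<open>G\<close> surjects onto a free group then the rank of the latter is at most the
  cardinality of \<open>G\<close>. Hence it is no restriction to take the free generators from the type of
  elements of \<open>G\<close>.\<close>

definition large :: "('g, 'm) monoid_scheme \<Rightarrow> bool" where
  "large G \<longleftrightarrow>
     (\<exists>H (X :: 'g set) \<phi>.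
        finite_index_subgroup H G \<and>
        (\<exists>u\<in>carrier (free_group X). \<exists>v\<in>carrier (free_group X).
           u \<otimes>\<^bsub>free_group X\<^esub> v \<noteq> v \<otimes>\<^bsub>free_group X\<^esub> u) \<and>
        \<phi> \<in> hom (G\<lparr>carrier := H\<rparr>) (free_group X) \<and>
        \<phi> ` H = carrier (free_group X))"


section \<open>Fundamental group\<close>

definition based_loop :: "'a::topological_space set \<Rightarrow> 'a \<Rightarrow> (real \<Rightarrow> 'a) \<Rightarrow> bool" where
  "based_loop S x g \<longleftrightarrow> path g \<and> path_image g \<subseteq> S \<and> pathstart g = x \<and> pathfinish g = x"

definition path_class :: "'a::topological_space set \<Rightarrow> (real \<Rightarrow> 'a) \<Rightarrow> (real \<Rightarrow> 'a) set" where
  "path_class S g = {h. homotopic_paths S g h}"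

definition pi1 :: "'a::topological_space set \<Rightarrow> 'a \<Rightarrow> (real \<Rightarrow> 'a) set monoid" where
  "pi1 S x =
     \<lparr>carrier = {path_class S g | g. based_loop S x g},
      mult = (\<lambda>A B. {k. \<exists>g\<in>A. \<exists>h\<in>B. homotopic_paths S (g +++ h) k}),
      one = path_class S (\<lambda>_. x)\<rparr>"

text \<open>The image of \<open>q\<^sub>* : \<pi>\<^sub>1(Y, y) \<rightarrow> \<pi>\<^sub>1(S, q y)\<close>, which is how the fundamental group of a
  covering space is viewed as a subgroup of the fundamental group of the base.\<close>

definition pi1_image ::
  "'b::topological_space set \<Rightarrow> 'b \<Rightarrow> ('b \<Rightarrow> 'a) \<Rightarrow> 'a::topological_space set \<Rightarrow> (real \<Rightarrow> 'a) set set"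
  where
  "pi1_image Y y q S = {path_class S (q \<circ> g) | g. based_loop Y y g}"


section \<open>2-complexes\<close>

text \<open>The 1-cells and 2-cells carry index types. Characteristic maps matter on the closed
  interval \<open>{0..1}\<close> and on the closed unit disc only.\<close>

record ('a, 'e, 'f) two_complex =
  points :: "'a set"
  zero_cells :: "'a set"
  one_cells :: "'e set"
  char1 :: "'e \<Rightarrow> real \<Rightarrow> 'a"
  two_cells :: "'f set"
  char2 :: "'f \<Rightarrow> complex \<Rightarrow> 'a"

definition open_1cell :: "('a, 'e, 'f) two_complex \<Rightarrow> 'e \<Rightarrow> 'a set" where
  "open_1cell X e = char1 X e ` {0<..<1}"

definition open_2cell :: "('a, 'e, 'f) two_complex \<Rightarrow> 'f \<Rightarrow> 'a set" where
  "open_2cell X f = char2 X f ` ball 0 1"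

definition boundary_path :: "('a, 'e, 'f) two_complex \<Rightarrow> 'f \<Rightarrow> real \<Rightarrow> 'a" where
  "boundary_path X f = (\<lambda>t. char2 X f (cis (2 * pi * t)))"

text \<open>On \<open>{a..b}\<close> the path \<open>\<gamma>\<close> runs homeomorphically once over the 1-cell \<open>fst s\<close>, in the direction
  of its characteristic map if \<open>snd s\<close> and in the opposite direction otherwise. The homeomorphism
  is with the parameter interval of the 1-cell, as the two ends of a 1-cell may coincide in \<open>X\<close>.\<close>

definition traverses ::
  "('a, 'e, 'f) two_complex \<Rightarrow> (real \<Rightarrow> 'a) \<Rightarrow> real \<Rightarrow> real \<Rightarrow> 'e \<times> bool \<Rightarrow> bool" where
  "traverses X \<gamma> a b s \<longleftrightarrow>
     fst s \<in> one_cells X \<and>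
     (\<exists>h h'. homeomorphism {a..b} {0..1} h h' \<and>
             h a = (if snd s then 0 else 1) \<and>
             (\<forall>t\<in>{a..b}. \<gamma> t = char1 X (fst s) (h t)))"

definition is_boundary_word ::
  "('a, 'e, 'f) two_complex \<Rightarrow> 'f \<Rightarrow> ('e \<times> bool) list \<Rightarrow> bool" where
  "is_boundary_word X f w \<longleftrightarrow>
     (\<exists>t :: nat \<Rightarrow> real. t 0 = 0 \<and> t (length w) = 1 \<and>
        (\<forall>j<length w. t j < t (Suc j) \<and> traverses X (boundary_path X f) (t j) (t (Suc j)) (w ! j)))"

text \<open>For finitely many cells in a Hausdorff space, the conditions below characterise CW complexes
  (the weak topology is automatic). The last conjunct is the convention on attaching maps, and it
  contains the usual condition that the boundary of a 2-cell lies in the 1-skeleton.\<close>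

definition finite_two_complex :: "('a::t2_space, 'e, 'f) two_complex \<Rightarrow> bool" where
  "finite_two_complex X \<longleftrightarrow>
     finite (zero_cells X) \<and> finite (one_cells X) \<and> finite (two_cells X) \<and>
     (\<forall>e\<in>one_cells X. path (char1 X e) \<and> inj_on (char1 X e) {0<..<1} \<and>
        pathstart (char1 X e) \<in> zero_cells X \<and> pathfinish (char1 X e) \<in> zero_cells X) \<and>
     (\<forall>f\<in>two_cells X. continuous_on (cball 0 1) (char2 X f) \<and> inj_on (char2 X f) (ball 0 1)) \<and>
     points X = zero_cells X \<union> (\<Union>e\<in>one_cells X. open_1cell X e) \<union> (\<Union>f\<in>two_cells X. open_2cell X f) \<and>
     zero_cells X \<inter> (\<Union>e\<in>one_cells X. open_1cell X e) = {} \<and>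
     zero_cells X \<inter> (\<Union>f\<in>two_cells X. open_2cell X f) = {} \<and>
     (\<Union>e\<in>one_cells X. open_1cell X e) \<inter> (\<Union>f\<in>two_cells X. open_2cell X f) = {} \<and>
     disjoint_family_on (open_1cell X) (one_cells X) \<and>
     disjoint_family_on (open_2cell X) (two_cells X) \<and>
     (\<forall>f\<in>two_cells X. \<exists>w. is_boundary_word X f w)"


section \<open>Covering spaces and the lifted cell structure\<close>

definition finite_connected_cover ::
  "'b::topological_space set \<Rightarrow> ('b \<Rightarrow> 'a) \<Rightarrow> 'a::topological_space set \<Rightarrow> bool" where
  "finite_connected_cover Y q S \<longleftrightarrow>
     covering_space Y q S \<and> connected Y \<and> (\<forall>x\<in>S. finite {y \<in> Y. q y = x})"

text \<open>A cell of the cover is a lift of a cell of the base, and such a lift is determined by where it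
  sends the initial point of the interval, respectively the centre of the disc. Accordingly the
  cells are indexed by pairs of a cell of the base and a point of the fibre over that point.\<close>

definition lifted_complex ::
  "'b::topological_space set \<Rightarrow> ('b \<Rightarrow> 'a) \<Rightarrow> ('a, 'e, 'f) two_complex \<Rightarrow>
   ('b, 'e \<times> 'b, 'f \<times> 'b) two_complex" where
  "lifted_complex Y q X =
     \<lparr>points = Y,
      zero_cells = {y \<in> Y. q y \<in> zero_cells X},
      one_cells = {(e, y). e \<in> one_cells X \<and> y \<in> Y \<and> q y = char1 X e 0},
      char1 = (\<lambda>(e, y). SOME g. continuous_on {0..1} g \<and> g ` {0..1} \<subseteq> Y \<and>
                           (\<forall>t\<in>{0..1}. q (g t) = char1 X e t) \<and> g 0 = y),
      two_cells = {(f, y). f \<in> two_cells X \<and> y \<in> Y \<and> q y = char2 X f 0},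
      char2 = (\<lambda>(f, y). SOME g. continuous_on (cball 0 1) g \<and> g ` cball 0 1 \<subseteq> Y \<and>
                           (\<forall>z\<in>cball 0 1. q (g z) = char2 X f z) \<and> g 0 = y)\<rparr>"


section \<open>Cellular cochains\<close>

definition cochains_on :: "'c set \<Rightarrow> ('c \<Rightarrow> 'k::field) set" where
  "cochains_on A = {c. \<forall>x. x \<notin> A \<longrightarrow> c x = 0}"

text \<open>The word is unique in a 2-complex, since the break points are the parameters at which the
  boundary path meets the 0-skeleton.\<close>

definition boundary_word :: "('a, 'e, 'f) two_complex \<Rightarrow> 'f \<Rightarrow> ('e \<times> bool) list" where
  "boundary_word X f = (SOME w. is_boundary_word X f w)"

definition coboundary0 :: "('a, 'e, 'f) two_complex \<Rightarrow> ('a \<Rightarrow> 'k::field) \<Rightarrow> 'e \<Rightarrow> 'k" where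
  "coboundary0 X c = (\<lambda>e. if e \<in> one_cells X then c (char1 X e 1) - c (char1 X e 0) else 0)"

definition coboundary1 :: "('a, 'e, 'f) two_complex \<Rightarrow> ('e \<Rightarrow> 'k::field) \<Rightarrow> 'f \<Rightarrow> 'k" where
  "coboundary1 X c =
     (\<lambda>f. if f \<in> two_cells X
          then (\<Sum>s\<leftarrow>boundary_word X f. if snd s then c (fst s) else - c (fst s)) else 0)"

definition cocycles1 :: "('a, 'e, 'f) two_complex \<Rightarrow> ('e \<Rightarrow> 'k::field) set" where
  "cocycles1 X = {c \<in> cochains_on (one_cells X). coboundary1 X c = (\<lambda>_. 0)}"

definition coboundaries1 :: "('a, 'e, 'f) two_complex \<Rightarrow> ('e \<Rightarrow> 'k::field) set" where
  "coboundaries1 X = coboundary0 X ` cochains_on (zero_cells X)"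

text \<open>Since \<open>H\<^sup>1 = cocycles1 / coboundaries1\<close>, this says that \<open>S\<close> consists of one cellular cocycle
  for each element of some basis of \<open>H\<^sup>1\<close>.\<close>

definition represents_H1_basis :: "('a, 'e, 'f) two_complex \<Rightarrow> ('e \<Rightarrow> 'k::field) set \<Rightarrow> bool" where
  "represents_H1_basis X S \<longleftrightarrow> quotient_basis (cocycles1 X) (coboundaries1 X) S"


section \<open>Linear codes\<close>

text \<open>A code is a subspace of \<open>cochains_on A\<close>, where the finite set \<open>A\<close> indexes the coordinates.\<close>

definition code_rate :: "'c set \<Rightarrow> ('c \<Rightarrow> 'k::field) set \<Rightarrow> real" where
  "code_rate A C = real (fun_space.dim C) / real (card A)"

definition hamming_distance :: "'c set \<Rightarrow> ('c \<Rightarrow> 'k::field) set \<Rightarrow> nat" where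
  "hamming_distance A C = Inf {card {x \<in> A. c x \<noteq> 0} | c. c \<in> C \<and> c \<noteq> (\<lambda>_. 0)}"

definition asymptotically_good ::
  "'i set \<Rightarrow> ('i \<Rightarrow> 'c set) \<Rightarrow> ('i \<Rightarrow> ('c \<Rightarrow> 'k::field) set) \<Rightarrow> bool" where
  "asymptotically_good I A C \<longleftrightarrow>
     (\<exists>\<epsilon>>0. \<forall>i\<in>I. \<epsilon> \<le> code_rate (A i) (C i)) \<and>
     (\<exists>\<epsilon>>0. \<forall>i\<in>I. \<epsilon> \<le> real (hamming_distance (A i) (C i)) / real (card (A i)))"

end

theory Submission
  imports Defs "HOL-Probability.Discrete_Topology"
begin

text \<open>Suppose that some nonzero cocycle \<open>c\<close> in the span of the chosen cocycles on a covering space \<open>Y\<close> has small support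
  compared to the dimension of the first cohomology. As every edge lies on boundedly many 2-cells, counting gives two
  cocycles \<open>z\<^sub>1, z\<^sub>2\<close> that vanish on all 2-cells meeting the support of \<open>c\<close> and are independent on the loops of one component
  \<open>C\<close> of the 1-skeleton minus that support; cut them off outside \<open>C\<close>. As \<open>c\<close> is not a coboundary, the finite cyclic covering
  of \<open>Y\<close> defined by \<open>c\<close> contains copies of \<open>C\<close> on different levels that are joined by paths avoiding the cut-off cocycles.
  Letting \<open>(z\<^sub>1, z\<^sub>2)\<close> act on one level and \<open>z\<^sub>1\<close> on another defines an action of the fundamental group on the product of a
  finite set and a free group of rank two in which commutators of the two kinds of loops act as free generators; the
  stabiliser of a point of the finite set then surjects onto the free group. So if the fundamental group is not large,
  then the minimal distance is bounded below by a fixed multiple of the dimension of the first cohomology, which grows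
  linearly by hypothesis.

  That the action respects homotopies is seen by building the corresponding covering space: first over the 1-skeleton,
  then over the 2-cells, both times by attaching cones.\<close>

text \<open>Every non-zero code word is a non-trivial class, whichever representatives are chosen,
  because their span meets the coboundaries only in 0. Two cocycles on one level are needed for the
  prime 2. With one cocycle on each of two levels the group acting is a free product of two groups
  of order p, for p = 2 infinite dihedral. A free product of A = F_p^2 and B = F_p maps to A x B
  with free kernel of rank (p^2 - 1)(p - 1), at least 3 and generated by commutators; the action
  keeps two of the generators. The cut-off cochains are still cocycles: on a 2-cell that meets the
  support they vanish, and any other 2-cell has its whole boundary inside or outside
  \<open>C\<close>. In the count, dimension is lost once for each edge near the support, at most
  once for each component, of which each support edge accounts for at most two, and once for each
  support edge; this gives the constant. The covering that carries the action has infinite fibres,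
  so its total space cannot be glued from finitely many compact pieces as the complex is. It is
  realised inside a product, with coordinates defined on open subsets, and homotopy lifting in it
  replaces a presentation of the fundamental group.\<close>

section \<open>Homotopies of paths\<close>

text \<open>The straight-line homotopy in the parameter domain \<open>D\<close>, pushed forward by
  \<open>F\<close>. Most explicit homotopies below arise by writing both paths as \<open>F\<close>
  after paths in a convex set with common ends.\<close>

lemma homotopic_paths_convex_image:
  fixes a b :: "real \<Rightarrow> 'v::real_normed_vector"
  assumes "convex D" "continuous_on D F" "F ` D \<subseteq> S"
    and "path a" "path b" "path_image a \<subseteq> D" "path_image b \<subseteq> D"
    and "pathstart a = pathstart b" "pathfinish a = pathfinish b"
  shows "homotopic_paths S (F \<circ> a) (F \<circ> b)"
proof (rule homotopic_paths_continuous_image)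
  show "homotopic_paths D a b"
  proof (rule homotopic_paths_linear)
    show "closed_segment (a t) (b t) \<subseteq> D" if "t \<in> {0..1}" for t
      using assms that by (intro closed_segment_subset) (auto simp: path_image_def)
  qed (use assms in auto)
qed (use assms in auto)

text \<open>Constant paths are written as \<open>\<lambda>_. x\<close> because
  \<open>linepath\<close> asks for a vector space. Both sides are \<open>p\<close> after paths in
  the unit interval with the same ends.\<close>

lemma homotopic_paths_rid_const:
  assumes "path p" "path_image p \<subseteq> S" "x = pathfinish p"
  shows "homotopic_paths S (p +++ (\<lambda>_. x)) p"
proof -
  have "homotopic_paths S (p \<circ> ((\<lambda>t. t) +++ (\<lambda>_. 1))) (p \<circ> (\<lambda>t. t))"
    by (rule homotopic_paths_convex_image[of "{0..1}"])
       (use assms in \<open>auto simp: path_def path_image_def pathstart_def pathfinish_def joinpaths_def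
          intro!: continuous_on_cases_le continuous_intros\<close>)
  moreover have "p \<circ> ((\<lambda>t. t) +++ (\<lambda>_. 1)) = p +++ (\<lambda>_. x)"
    using assms by (auto simp: joinpaths_def pathfinish_def fun_eq_iff)
  ultimately show ?thesis by (simp add: comp_def)
qed

lemma homotopic_paths_lid_const:
  assumes "path p" "path_image p \<subseteq> S" "x = pathstart p"
  shows "homotopic_paths S ((\<lambda>_. x) +++ p) p"
proof -
  have "homotopic_paths S (p \<circ> ((\<lambda>_. 0) +++ (\<lambda>t. t))) (p \<circ> (\<lambda>t. t))"
    by (rule homotopic_paths_convex_image[of "{0..1}"])
       (use assms in \<open>auto simp: path_def path_image_def pathstart_def pathfinish_def joinpaths_def
          intro!: continuous_on_cases_le continuous_intros\<close>)
  moreover have "p \<circ> ((\<lambda>_. 0) +++ (\<lambda>t. t)) = (\<lambda>_. x) +++ p"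
    using assms by (auto simp: joinpaths_def pathstart_def fun_eq_iff)
  ultimately show ?thesis by (simp add: comp_def)
qed

lemma homotopic_paths_rinv_const:
  assumes "path p" "path_image p \<subseteq> S" "x = pathstart p"
  shows "homotopic_paths S (p +++ reversepath p) (\<lambda>_. x)"
proof -
  have "homotopic_paths S (p \<circ> ((\<lambda>t. t) +++ (\<lambda>t. 1 - t))) (p \<circ> (\<lambda>_. 0))"
    by (rule homotopic_paths_convex_image[of "{0..1}"])
       (use assms in \<open>auto simp: path_def path_image_def pathstart_def pathfinish_def joinpaths_def
          intro!: continuous_on_cases_le continuous_intros\<close>)
  moreover have "p \<circ> ((\<lambda>t. t) +++ (\<lambda>t. 1 - t)) = p +++ reversepath p"
    by (auto simp: joinpaths_def reversepath_def fun_eq_iff)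
  ultimately show ?thesis using assms(3) by (simp add: comp_def pathstart_def)
qed

lemma homotopic_paths_linv_const:
  assumes "path p" "path_image p \<subseteq> S" "x = pathfinish p"
  shows "homotopic_paths S (reversepath p +++ p) (\<lambda>_. x)"
  using homotopic_paths_rinv_const[of "reversepath p" S x] assms by simp

text \<open>In the convex unit square the two ways along the boundary from \<open>(0, 0)\<close> to
  \<open>(1, 1)\<close> are homotopic. This turns a deformation that moves the ends of a path into a
  homotopy with fixed ends.\<close>

lemma homotopic_paths_square:
  assumes H: "continuous_on ({0..1} \<times> {0..1}) H" "H ` ({0..1} \<times> {0..1}) \<subseteq> S"
  shows "homotopic_paths S ((\<lambda>t::real. H (t, 0::real)) +++ (\<lambda>s. H (1, s)))
           ((\<lambda>s. H (0, s)) +++ (\<lambda>t. H (t, 1)))"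
proof -
  have "homotopic_paths S (H \<circ> ((\<lambda>t. (t, 0)) +++ (\<lambda>s. (1, s)))) (H \<circ> ((\<lambda>s. (0, s)) +++ (\<lambda>t. (t, 1))))"
    by (rule homotopic_paths_convex_image[of "{0..1} \<times> {0..1}"])
       (use H in \<open>auto simp: path_def path_image_def pathstart_def pathfinish_def joinpaths_def
          intro!: continuous_on_cases_le continuous_intros convex_Times\<close>)
  then show ?thesis unfolding path_compose_join by (simp add: comp_def)
qed

definition sub_path :: "real \<Rightarrow> real \<Rightarrow> (real \<Rightarrow> 'a::topological_space) \<Rightarrow> real \<Rightarrow> 'a" where
  "sub_path u v g = (\<lambda>t. g ((v - u) * t + u))"

lemma affine_in_unit: "\<lbrakk>0 \<le> (u::real); u \<le> 1; 0 \<le> v; v \<le> 1; 0 \<le> t; t \<le> 1\<rbrakk> \<Longrightarrow>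
    0 \<le> (v - u) * t + u \<and> (v - u) * t + u \<le> 1"
  using convexD[of "{0..1::real}" u v "1 - t" t] by (auto simp: algebra_simps)

lemma pathstart_sub_path [simp]: "pathstart (sub_path u v g) = g u"
  and pathfinish_sub_path [simp]: "pathfinish (sub_path u v g) = g v"
  by (auto simp: pathstart_def pathfinish_def sub_path_def)

lemma sub_path_0_1 [simp]: "sub_path 0 1 g = g"
  by (simp add: sub_path_def)

lemma affine_between:
  assumes "0 \<le> (t::real)" "t \<le> 1" "u \<le> v"
  shows "u \<le> (v - u) * t + u" "(v - u) * t + u \<le> v"
  using assms mult_left_le[of t "v - u"] by auto

lemma path_sub_path:
  assumes "continuous_on {u..v} g" "u \<le> v"
  shows "path (sub_path u v g)" "path_image (sub_path u v g) \<subseteq> g ` {u..v}"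
proof -
  have *: "(\<lambda>t. (v - u) * t + u) ` {0..1} \<subseteq> {u..v}"
    using affine_between[OF _ _ assms(2)] by auto
  show "path (sub_path u v g)" unfolding path_def sub_path_def
    by (rule continuous_on_compose2[OF assms(1) _ *]) (intro continuous_intros)
  show "path_image (sub_path u v g) \<subseteq> g ` {u..v}"
    using * by (auto simp: path_image_def sub_path_def)
qed

lemma homotopic_join_sub_paths:
  assumes "continuous_on {u..w} g" "g ` {u..w} \<subseteq> S" "u \<le> v" "v \<le> w"
  shows "homotopic_paths S (sub_path u v g +++ sub_path v w g) (sub_path u w g)"
proof -
  have 1: "a \<le> (b - a) * t + a" "(b - a) * t + a \<le> b" if "0 \<le> t" "t \<le> 1" "a \<le> b" for a b t :: real
    using affine_between[OF that] by auto
  have "homotopic_paths S (g \<circ> ((\<lambda>t. (v - u) * t + u) +++ (\<lambda>t. (w - v) * t + v)))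
          (g \<circ> (\<lambda>t. (w - u) * t + u))"
  proof (rule homotopic_paths_convex_image[of "{u..w}"])
    show "path_image ((\<lambda>t. (v - u) * t + u) +++ (\<lambda>t. (w - v) * t + v)) \<subseteq> {u..w}"
    proof (rule subset_path_image_join; unfold path_image_def; rule image_subsetI)
      fix t :: real assume "t \<in> {0..1}"
      then show "(v - u) * t + u \<in> {u..w}" "(w - v) * t + v \<in> {u..w}"
        using 1[of t u v] 1[of t v w] assms(3,4) unfolding atLeastAtMost_iff by linarith+
    qed
    show "path_image (\<lambda>t. (w - u) * t + u) \<subseteq> {u..w}"
      unfolding path_image_def
    proof (rule image_subsetI)
      fix t :: real assume "t \<in> {0..1}"
      then show "(w - u) * t + u \<in> {u..w}"
        using 1[of t u w] assms(3,4) unfolding atLeastAtMost_iff by linarith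
    qed
    show "path ((\<lambda>t. (v - u) * t + u) +++ (\<lambda>t. (w - v) * t + v))"
      by (rule path_join_imp) (auto simp: path_def pathstart_def pathfinish_def intro!: continuous_intros)
    show "path (\<lambda>t. (w - u) * t + u)" unfolding path_def by (intro continuous_intros)
  qed (use assms in \<open>auto simp: pathstart_def pathfinish_def joinpaths_def\<close>)
  then show ?thesis by (simp add: path_compose_join) (simp add: comp_def sub_path_def)
qed


section \<open>Lifting in covering spaces of topological spaces\<close>

text \<open>The distribution proves these facts for subsets of normed spaces only.\<close>

lemma covering_space_evenly:
  assumes "covering_space C p S" "x \<in> S"
  obtains T v where "x \<in> T" "openin (top_of_set S) T" "\<Union>v = C \<inter> p -` T"
    "\<And>u. u \<in> v \<Longrightarrow> openin (top_of_set C) u" "pairwise disjnt v"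
    "\<And>u. u \<in> v \<Longrightarrow> \<exists>q. homeomorphism u T p q"
  using assms unfolding covering_space_def by metis

text \<open>Over an evenly covered neighbourhood two lifts run either in the same sheet, where
  \<open>p\<close> is injective, or in disjoint sheets. So agreement and disagreement are both open
  conditions; the disjointness of the sheets does the work of a separation axiom on
  \<open>C\<close>.\<close>

lemma covering_lift_unique:
  fixes g1 g2 :: "'x::topological_space \<Rightarrow> 'c::topological_space"
  assumes cov: "covering_space C p S" and T: "connected T"
    and g1: "continuous_on T g1" "g1 ` T \<subseteq> C" and g2: "continuous_on T g2" "g2 ` T \<subseteq> C"
    and eq: "\<And>x. x \<in> T \<Longrightarrow> p (g1 x) = p (g2 x)" and a: "a \<in> T" "g1 a = g2 a" and x: "x \<in> T"
  shows "g1 x = g2 x"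
proof -
  define E where "E = {x \<in> T. g1 x = g2 x}"
  have loc: "\<exists>U. openin (top_of_set T) U \<and> z \<in> U \<and> (\<forall>y\<in>U. g1 y = g2 y \<longleftrightarrow> g1 z = g2 z)" if z: "z \<in> T" for z
  proof -
    have "p (g1 z) \<in> S"
      using cov g1(2) z by (auto simp: covering_space_def)
    then obtain X v where v: "p (g1 z) \<in> X" "openin (top_of_set S) X" "\<Union>v = C \<inter> p -` X"
      "\<And>u. u \<in> v \<Longrightarrow> openin (top_of_set C) u" "pairwise disjnt v"
      "\<And>u. u \<in> v \<Longrightarrow> \<exists>q. homeomorphism u X p q"
      using covering_space_evenly[OF cov] by metis
    have "g1 z \<in> \<Union>v" using v(1) g1(2) z unfolding v(3) by auto
    then obtain u1 where u1: "u1 \<in> v" "g1 z \<in> u1" by blast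
    have "g2 z \<in> \<Union>v" using v(1) g2(2) z eq[OF z] unfolding v(3) by auto
    then obtain u2 where u2: "u2 \<in> v" "g2 z \<in> u2" by blast
    define U where "U = (T \<inter> g1 -` u1) \<inter> (T \<inter> g2 -` u2)"
    have "openin (top_of_set T) U" unfolding U_def
      by (intro openin_Int continuous_openin_preimage[OF g1(1) _ v(4)[OF u1(1)]]
          continuous_openin_preimage[OF g2(1) _ v(4)[OF u2(1)]]) (use g1(2) g2(2) in auto)
    moreover have "z \<in> U" using u1 u2 z by (auto simp: U_def)
    moreover have "g1 y = g2 y \<longleftrightarrow> g1 z = g2 z" if y: "y \<in> U" for y
    proof (cases "u1 = u2")
      case True
      obtain q where "homeomorphism u1 X p q" using v(6) u1 by blast
      then have "inj_on p u1" by (metis homeomorphism_apply1 inj_onI)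
      then show ?thesis using True y u1 u2 eq[OF z] eq[of y] by (auto simp: U_def inj_on_def)
    next
      case False
      then have "disjnt u1 u2" using v(5) u1 u2 by (auto simp: pairwise_def)
      then show ?thesis using y u1 u2 by (auto simp: U_def disjnt_def)
    qed
    ultimately show ?thesis by blast
  qed
  have "openin (top_of_set T) {z \<in> T. (g1 z = g2 z) = b}" for b
  proof (subst openin_subopen, intro ballI)
    fix z assume z: "z \<in> {z \<in> T. (g1 z = g2 z) = b}"
    then obtain U where U: "openin (top_of_set T) U" "z \<in> U" "\<forall>y\<in>U. g1 y = g2 y \<longleftrightarrow> g1 z = g2 z"
      using loc by blast
    moreover have "U \<subseteq> {z \<in> T. (g1 z = g2 z) = b}" using z U(3) openin_imp_subset[OF U(1)] by blast
    ultimately show "\<exists>W. openin (top_of_set T) W \<and> z \<in> W \<and> W \<subseteq> {z \<in> T. (g1 z = g2 z) = b}" by blast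
  qed
  from this[of True] this[of False] have "openin (top_of_set T) E" "openin (top_of_set T) (T - E)"
    by (simp_all add: E_def set_diff_eq Collect_conj_eq[symmetric] cong: conj_cong)
  moreover from this have "closedin (top_of_set T) E"
    by (simp add: closedin_def E_def subset_eq)
  ultimately have "E = {} \<or> E = T" using T by (auto simp: connected_clopen)
  then show ?thesis using a x by (auto simp: E_def)
qed

text \<open>Every starting point over the lower left corner is allowed, so that the lift over an
  adjacent rectangle can begin where the first one ends.\<close>

definition rect_lift where
  "rect_lift C p f a b c d \<longleftrightarrow> (\<forall>\<xi>\<in>C. p \<xi> = f (a, c) \<longrightarrow>
     (\<exists>g. continuous_on ({a..b} \<times> {c..d}) g \<and> g ` ({a..b} \<times> {c..d}) \<subseteq> C \<and> g (a, c) = \<xi> \<and>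
        (\<forall>z\<in>{a..b} \<times> {c..d}. p (g z) = f z)))"

lemma rect_lift_swap:
  fixes f :: "real \<times> real \<Rightarrow> _"
  assumes "rect_lift C p f a b c d"
  shows "rect_lift C p (f \<circ> prod.swap) c d a b"
  unfolding rect_lift_def
proof (intro ballI impI)
  fix \<xi> assume \<xi>: "\<xi> \<in> C" "p \<xi> = (f \<circ> prod.swap) (c, a)"
  then obtain g where g: "continuous_on ({a..b} \<times> {c..d}) g" "g ` ({a..b} \<times> {c..d}) \<subseteq> C" "g (a, c) = \<xi>"
        "\<forall>z\<in>{a..b} \<times> {c..d}. p (g z) = f z"
    using assms by (auto simp: rect_lift_def)
  show "\<exists>g. continuous_on ({c..d} \<times> {a..b}) g \<and> g ` ({c..d} \<times> {a..b}) \<subseteq> C \<and> g (c, a) = \<xi> \<and>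
        (\<forall>z\<in>{c..d} \<times> {a..b}. p (g z) = (f \<circ> prod.swap) z)"
  proof (intro exI[of _ "g \<circ> prod.swap"] conjI)
    show "continuous_on ({c..d} \<times> {a..b}) (g \<circ> prod.swap)"
      by (rule continuous_on_compose[OF continuous_on_swap]) (use g in \<open>simp add: product_swap\<close>)
  qed (use g in \<open>auto simp: image_subset_iff\<close>)
qed

lemma rect_lift_join:
  fixes f :: "real \<times> real \<Rightarrow> 's::topological_space"
    and C :: "'c::topological_space set"
  assumes cov: "covering_space C p S"
    and 1: "rect_lift C p f a b c d" and 2: "rect_lift C p f a b d e"
    and le: "a \<le> b" "c \<le> d" "d \<le> e"
  shows "rect_lift C p f a b c e"
  unfolding rect_lift_def
proof (intro ballI impI)
  fix \<xi> assume \<xi>: "\<xi> \<in> C" "p \<xi> = f (a, c)"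
  obtain g where g: "continuous_on ({a..b} \<times> {c..d}) g" "g ` ({a..b} \<times> {c..d}) \<subseteq> C" "g (a, c) = \<xi>"
        "\<forall>z\<in>{a..b} \<times> {c..d}. p (g z) = f z"
    using 1 \<xi> by (auto simp: rect_lift_def)
  have "g (a, d) \<in> C" "p (g (a, d)) = f (a, d)" using g le by auto
  then obtain h where h: "continuous_on ({a..b} \<times> {d..e}) h" "h ` ({a..b} \<times> {d..e}) \<subseteq> C" "h (a, d) = g (a, d)"
        "\<forall>z\<in>{a..b} \<times> {d..e}. p (h z) = f z"
    using 2 by (auto simp: rect_lift_def)
  \<comment> \<open>On the common side both restrict to lifts of the same path with the same start,
    so they coincide there and can be pasted.\<close>
  have agree: "g (s, d) = h (s, d)" if "s \<in> {a..b}" for s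
  proof (rule covering_lift_unique[OF cov, where T = "{a..b}" and a = a and ?g1.0 = "\<lambda>s. g (s, d)" and ?g2.0 = "\<lambda>s. h (s, d)"])
    show "continuous_on {a..b} (\<lambda>s. g (s, d))"
      by (rule continuous_on_compose2[OF g(1)]) (use le in \<open>auto intro!: continuous_intros\<close>)
    show "continuous_on {a..b} (\<lambda>s. h (s, d))"
      by (rule continuous_on_compose2[OF h(1)]) (use le in \<open>auto intro!: continuous_intros\<close>)
  qed (use g h le that in auto)
  define k where "k z = (if snd z \<le> d then g z else h z)" for z
  have U: "{a..b} \<times> {c..e} = {a..b} \<times> {c..d} \<union> {a..b} \<times> {d..e}"
    using le by auto
  have "continuous_on ({a..b} \<times> {c..e}) k"
    unfolding U k_def by (rule continuous_on_cases) (use g h agree in \<open>auto intro: closed_Times\<close>)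
  then show "\<exists>g. continuous_on ({a..b} \<times> {c..e}) g \<and> g ` ({a..b} \<times> {c..e}) \<subseteq> C \<and> g (a, c) = \<xi> \<and>
        (\<forall>z\<in>{a..b} \<times> {c..e}. p (g z) = f z)"
  proof (intro exI[of _ k] conjI ballI)
    show "k ` ({a..b} \<times> {c..e}) \<subseteq> C"
      using g(2) h(2) by (auto simp: k_def image_subset_iff)
    show "k (a, c) = \<xi>" using g le by (simp add: k_def)
    fix z assume "z \<in> {a..b} \<times> {c..e}"
    then show "p (k z) = f z" using g(4) h(4) by (cases z) (auto simp: k_def)
  qed simp
qed

lemma rect_lift_local:
  fixes f :: "real \<times> real \<Rightarrow> 's::topological_space"
    and C :: "'c::topological_space set"
  assumes cov: "covering_space C p S"
    and f: "continuous_on ({a..b} \<times> {c..d}) f" "f ` ({a..b} \<times> {c..d}) \<subseteq> S"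
    and x: "x \<in> {a..b}" and y: "y \<in> {c..d}"
  shows "\<exists>\<delta>>0. \<forall>a' b' c' d'. a \<le> a' \<and> a' \<le> x \<and> x \<le> b' \<and> b' \<le> b \<and> c \<le> c' \<and> c' \<le> y \<and> y \<le> d' \<and> d' \<le> d \<and>
           b' - a' < \<delta> \<and> d' - c' < \<delta> \<longrightarrow> rect_lift C p f a' b' c' d'"
proof -
  have "f (x, y) \<in> S" using f x y by auto
  then obtain X v where v: "f (x, y) \<in> X" "openin (top_of_set S) X" "\<Union>v = C \<inter> p -` X"
      "\<And>u. u \<in> v \<Longrightarrow> openin (top_of_set C) u" "pairwise disjnt v"
      "\<And>u. u \<in> v \<Longrightarrow> \<exists>q. homeomorphism u X p q"
      using covering_space_evenly[OF cov] by metis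
  let ?R = "{a..b} \<times> {c..d}"
  have "openin (top_of_set ?R) (?R \<inter> f -` X)"
    using f v(2) by (intro continuous_openin_preimage) auto
  moreover have "(x, y) \<in> ?R \<inter> f -` X" using v x y by auto
  ultimately have "\<exists>r>0. ball (x, y) r \<inter> ?R \<subseteq> ?R \<inter> f -` X"
    unfolding openin_contains_ball by blast
  then obtain r where r: "r > 0" "ball (x, y) r \<inter> ?R \<subseteq> ?R \<inter> f -` X" by blast
  show ?thesis
  proof (intro exI conjI allI impI)
    \<comment> \<open>Half the radius, because the distance in the plane is bounded by the sum of
      the two coordinate distances.\<close>
    show "r / 2 > 0" using r by simp
    fix a' b' c' d' assume A: "a \<le> a' \<and> a' \<le> x \<and> x \<le> b' \<and> b' \<le> b \<and> c \<le> c' \<and> c' \<le> y \<and> y \<le> d' \<and> d' \<le> d \<and>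
           b' - a' < r / 2 \<and> d' - c' < r / 2"
    have sub: "{a'..b'} \<times> {c'..d'} \<subseteq> ?R \<inter> f -` X"
    proof -
      have "z \<in> ball (x, y) r \<inter> ?R" if z: "z \<in> {a'..b'} \<times> {c'..d'}" for z
      proof -
        have "dist (x, y) z \<le> \<bar>x - fst z\<bar> + \<bar>y - snd z\<bar>"
          by (cases z) (simp add: dist_prod_def dist_real_def sqrt_sum_squares_le_sum_abs)
        also have "\<dots> < r"
        proof -
          have "a' \<le> fst z" "fst z \<le> b'" "c' \<le> snd z" "snd z \<le> d'" using z by (cases z; simp)+
          then show ?thesis using A by (simp add: abs_if)
        qed
        finally have "z \<in> ball (x, y) r" by simp
        moreover have "z \<in> ?R" using A z by (cases z) simp
        ultimately show ?thesis by simp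
      qed
      then show ?thesis using r by blast
    qed
    show "rect_lift C p f a' b' c' d'"
      unfolding rect_lift_def
    proof (intro ballI impI)
      fix \<xi> assume \<xi>: "\<xi> \<in> C" "p \<xi> = f (a', c')"
      have "(a', c') \<in> {a'..b'} \<times> {c'..d'}" using A by auto
      then have "f (a', c') \<in> X" using subsetD[OF sub] by blast
      then have "\<xi> \<in> \<Union>v" unfolding v(3) using \<xi> by auto
      then obtain u where u: "u \<in> v" "\<xi> \<in> u" by blast
      obtain q where q: "homeomorphism u X p q" using v(6) u by blast
      have "continuous_on ({a'..b'} \<times> {c'..d'}) (q \<circ> f)"
      proof (rule continuous_on_compose)
        show "continuous_on ({a'..b'} \<times> {c'..d'}) f"
          by (rule continuous_on_subset[OF f(1)]) (use sub in blast)
        show "continuous_on (f ` ({a'..b'} \<times> {c'..d'})) q"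
          by (rule continuous_on_subset[OF homeomorphism_cont2[OF q]]) (use sub in blast)
      qed
      moreover have "u \<subseteq> C" using v(4) u openin_imp_subset by blast
      moreover have "q ` X = u" using q by (auto simp: homeomorphism_def)
      ultimately show "\<exists>g. continuous_on ({a'..b'} \<times> {c'..d'}) g \<and> g ` ({a'..b'} \<times> {c'..d'}) \<subseteq> C \<and> g (a', c') = \<xi> \<and>
        (\<forall>z\<in>{a'..b'} \<times> {c'..d'}. p (g z) = f z)"
      proof (intro exI[of _ "q \<circ> f"] conjI)
        show "(q \<circ> f) ` ({a'..b'} \<times> {c'..d'}) \<subseteq> C"
        proof
          fix w assume "w \<in> (q \<circ> f) ` ({a'..b'} \<times> {c'..d'})"
          then obtain z where z: "z \<in> {a'..b'} \<times> {c'..d'}" "w = q (f z)" by (auto simp del: mem_Times_iff)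
          have "f z \<in> X" using subsetD[OF sub z(1)] by auto
          then show "w \<in> C" using z(2) \<open>q ` X = u\<close> \<open>u \<subseteq> C\<close> by blast
        qed
        show "(q \<circ> f) (a', c') = \<xi>" using \<xi> u homeomorphism_apply1[OF q] by (simp flip: \<xi>(2))
        show "\<forall>z\<in>{a'..b'} \<times> {c'..d'}. p ((q \<circ> f) z) = f z"
        proof
          fix z assume "z \<in> {a'..b'} \<times> {c'..d'}"
          then have "f z \<in> X" using subsetD[OF sub] by blast
          then show "p ((q \<circ> f) z) = f z" using homeomorphism_apply2[OF q] by simp
        qed
      qed
    qed
  qed
qed

text \<open>Bisection is used twice: small rectangles stack vertically to liftable strips over short
  horizontal intervals, and the strips are then put side by side. The Bolzano principle takes the
  place of a Lebesgue number.\<close>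

lemma covering_lift_rectangle:
  fixes f :: "real \<times> real \<Rightarrow> 's::topological_space"
    and C :: "'c::topological_space set"
  assumes cov: "covering_space C p S"
    and f: "continuous_on ({a..b} \<times> {c..d}) f" "f ` ({a..b} \<times> {c..d}) \<subseteq> S"
    and le: "a \<le> b" "c \<le> d"
  shows "rect_lift C p f a b c d"
proof -
  have strip: "\<exists>\<delta>>0. \<forall>a' b'. a \<le> a' \<and> a' \<le> x \<and> x \<le> b' \<and> b' \<le> b \<and> b' - a' < \<delta> \<longrightarrow> rect_lift C p f a' b' c d"
    if x: "a \<le> x" "x \<le> b" for x
  proof -
    \<comment> \<open>The admissible width \<open>\<delta>\<close> is part of the property, since
      joining two strips leaves only the smaller of the two widths.\<close>
    define P where "P c' d' \<longleftrightarrow> (c \<le> c' \<and> d' \<le> d \<longrightarrow>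
       (\<exists>\<delta>>0. \<forall>a' b'. a \<le> a' \<and> a' \<le> x \<and> x \<le> b' \<and> b' \<le> b \<and> b' - a' < \<delta> \<longrightarrow> rect_lift C p f a' b' c' d'))" for c' d'
    have "P c d" using le(2)
    proof (induction rule: Bolzano)
      case (trans u v w)
      show ?case unfolding P_def
      proof
        assume A: "c \<le> u \<and> w \<le> d"
        have cu: "c \<le> u \<and> v \<le> d" and cv: "c \<le> v \<and> w \<le> d" using A trans by auto
        obtain d1 where d1: "d1 > 0" "\<And>a' b'. a \<le> a' \<and> a' \<le> x \<and> x \<le> b' \<and> b' \<le> b \<and> b' - a' < d1 \<Longrightarrow> rect_lift C p f a' b' u v"
          using trans(1)[unfolded P_def, rule_format, OF cu] by auto
        obtain d2 where d2: "d2 > 0" "\<And>a' b'. a \<le> a' \<and> a' \<le> x \<and> x \<le> b' \<and> b' \<le> b \<and> b' - a' < d2 \<Longrightarrow> rect_lift C p f a' b' v w"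
          using trans(2)[unfolded P_def, rule_format, OF cv] by auto
        show "\<exists>\<delta>>0. \<forall>a' b'. a \<le> a' \<and> a' \<le> x \<and> x \<le> b' \<and> b' \<le> b \<and> b' - a' < \<delta> \<longrightarrow> rect_lift C p f a' b' u w"
        proof (intro exI[of _ "min d1 d2"] conjI allI impI)
          fix a' b' assume B: "a \<le> a' \<and> a' \<le> x \<and> x \<le> b' \<and> b' \<le> b \<and> b' - a' < min d1 d2"
          show "rect_lift C p f a' b' u w"
            by (rule rect_lift_join[OF cov d1(2) d2(2)]) (use B trans in auto)
        qed (use d1 d2 in simp)
      qed
    next
      case (local y)
      then obtain \<delta> where \<delta>: "\<delta> > 0" "\<forall>a' b' c' d'. a \<le> a' \<and> a' \<le> x \<and> x \<le> b' \<and> b' \<le> b \<and> c \<le> c' \<and> c' \<le> y \<and> y \<le> d' \<and> d' \<le> d \<and>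
           b' - a' < \<delta> \<and> d' - c' < \<delta> \<longrightarrow> rect_lift C p f a' b' c' d'"
        using rect_lift_local[OF cov f, of x y] x by (auto simp del: split_paired_All)
      show ?case
      proof (intro exI[of _ \<delta>] conjI allI impI)
        fix c' d' assume B: "c' \<le> y \<and> y \<le> d' \<and> d' - c' < \<delta>"
        show "P c' d'" unfolding P_def
        proof (intro impI exI[of _ \<delta>] conjI allI)
          fix a' b' assume "c \<le> c' \<and> d' \<le> d" "a \<le> a' \<and> a' \<le> x \<and> x \<le> b' \<and> b' \<le> b \<and> b' - a' < \<delta>"
          then show "rect_lift C p f a' b' c' d'" using \<delta>(2) B by simp
        qed (rule \<delta>(1))
      qed (rule \<delta>(1))
    qed
    then show ?thesis by (auto simp: P_def)
  qed
  define P where "P a' b' \<longleftrightarrow> (a \<le> a' \<and> b' \<le> b \<longrightarrow> rect_lift C p f a' b' c d)" for a' b'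
  have "P a b" using le(1)
  proof (induction rule: Bolzano)
    case (trans u v w)
    show ?case unfolding P_def
    proof
      assume A: "a \<le> u \<and> w \<le> b"
      \<comment> \<open>\<open>rect_lift_join\<close> stacks vertically, so the coordinates are
        exchanged, the rectangles joined, and the coordinates exchanged back.\<close>
      have "rect_lift C p (f \<circ> prod.swap) c d u w"
      proof (rule rect_lift_join[OF cov])
        show "rect_lift C p (f \<circ> prod.swap) c d u v" "rect_lift C p (f \<circ> prod.swap) c d v w"
          by (rule rect_lift_swap; use trans A in \<open>simp add: P_def\<close>)+
      qed (use trans le in auto)
      then have "rect_lift C p ((f \<circ> prod.swap) \<circ> prod.swap) u w c d" by (rule rect_lift_swap)
      then show "rect_lift C p f u w c d" by (simp add: comp_def)
    qed
  next
    case (local x)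
    obtain \<delta> where \<delta>: "\<delta> > 0" "\<forall>a' b'. a \<le> a' \<and> a' \<le> x \<and> x \<le> b' \<and> b' \<le> b \<and> b' - a' < \<delta> \<longrightarrow> rect_lift C p f a' b' c d"
      using strip[of x] local by blast
    then show ?case unfolding P_def by (intro exI[of _ \<delta>] conjI allI impI) auto
  qed
  then show ?thesis by (simp add: P_def)
qed

text \<open>A path is treated as a map on a rectangle of height zero.\<close>

lemma covering_lift_path:
  fixes C :: "'c::topological_space set" and S :: "'s::topological_space set"
  assumes cov: "covering_space C p S" and g: "path g" "path_image g \<subseteq> S" and \<xi>: "\<xi> \<in> C" "p \<xi> = pathstart g"
  obtains h where "path h" "path_image h \<subseteq> C" "pathstart h = \<xi>" "\<And>t. t \<in> {0..1} \<Longrightarrow> p (h t) = g t"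
proof -
  have "rect_lift C p (g \<circ> fst :: real \<times> real \<Rightarrow> 's) 0 1 0 0"
  proof (rule covering_lift_rectangle[OF cov _ _ zero_le_one order.refl])
    show "continuous_on ({0..1} \<times> {0..0}) (g \<circ> fst)"
      by (rule continuous_on_compose) (use g in \<open>auto simp: path_def intro!: continuous_intros\<close>)
  qed (use g in \<open>auto simp: path_image_def\<close>)
  moreover have "p \<xi> = (g \<circ> fst :: real \<times> real \<Rightarrow> 's) (0, 0)" using \<xi> by (simp add: pathstart_def)
  ultimately obtain G where "continuous_on ({0..1} \<times> {0..0}) G" "G ` ({0..1} \<times> {0..0}) \<subseteq> C" "G (0, 0) = \<xi>"
        "\<forall>z\<in>{0..1} \<times> {0..0}. p (G z) = (g \<circ> fst :: real \<times> real \<Rightarrow> 's) z"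
    using \<xi>(1) unfolding rect_lift_def by blast
  then have G: "continuous_on ({0..1} \<times> {0}) G" "\<And>t. t \<in> {0..1} \<Longrightarrow> G (t, 0) \<in> C" "G (0, 0) = \<xi>"
        "\<And>t. t \<in> {0..1} \<Longrightarrow> p (G (t, 0)) = g t"
    by (auto simp: image_subset_iff)
  show thesis
  proof
    show "path (\<lambda>t. G (t, 0))" unfolding path_def
      by (rule continuous_on_compose2[OF G(1)]) (auto intro!: continuous_intros)
  qed (use G in \<open>auto simp: path_image_def pathstart_def\<close>)
qed

lemma path_lift_unique:
  fixes C :: "'c::topological_space set"
  assumes cov: "covering_space C p S"
    and "path g" "path_image g \<subseteq> C" "path h" "path_image h \<subseteq> C" "\<And>t. t \<in> {0..1} \<Longrightarrow> p (g t) = p (h t)"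
    and "s \<in> {0..1}" "g s = h s" and "t \<in> {0..1}"
  shows "g t = h t"
  by (rule covering_lift_unique[OF cov, where T = "{0..1}" and a = s])
     (use assms in \<open>auto simp: path_def path_image_def\<close>)

text \<open>The homotopy is lifted from the common start, and the four sides of the lifted square
  are identified by unique path lifting. The sides over the fixed ends lift constant paths, so they
  are constant; in particular the lifts have the same end.\<close>

lemma homotopic_paths_lift:
  fixes C :: "'c::topological_space set" and S :: "'s::topological_space set"
  assumes cov: "covering_space C p S" and hom: "homotopic_paths S g1 g2"
    and h1: "path h1" "path_image h1 \<subseteq> C" "\<And>t. t \<in> {0..1} \<Longrightarrow> p (h1 t) = g1 t"
    and h2: "path h2" "path_image h2 \<subseteq> C" "\<And>t. t \<in> {0..1} \<Longrightarrow> p (h2 t) = g2 t"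
    and st: "pathstart h1 = pathstart h2"
  shows "homotopic_paths C h1 h2"
proof -
  obtain H where H: "continuous_on ({0..1} \<times> {0..1}) H" "H \<in> ({0..1} \<times> {0..1}) \<rightarrow> S"
     "\<forall>x \<in> {0..1}. H (0, x) = g1 x" "\<forall>x \<in> {0..1}. H (1, x) = g2 x"
     "\<forall>t \<in> {0..1::real}. pathstart (H \<circ> Pair t) = pathstart g1 \<and> pathfinish (H \<circ> Pair t) = pathfinish g1"
    using hom unfolding homotopic_paths by blast
  have "rect_lift C p H 0 1 0 1"
    using H by (intro covering_lift_rectangle[OF cov]) auto
  moreover have "h1 0 \<in> C" "p (h1 0) = H (0, 0)" using h1 H by (auto simp: path_image_def)
  ultimately obtain k where k: "continuous_on ({0..1} \<times> {0..1}) k" "k ` ({0..1} \<times> {0..1}) \<subseteq> C" "k (0, 0) = h1 0"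
        "\<forall>z\<in>{0..1} \<times> {0..1}. p (k z) = H z"
    unfolding rect_lift_def by metis
  have ck: "continuous_on {0..1} (\<lambda>t. k (t, x))" "continuous_on {0..1} (\<lambda>t. k (x, t))" if "x \<in> {0..1}" for x
    using that by (auto intro!: continuous_on_compose2[OF k(1)] continuous_intros)
  have kC: "k (s, t) \<in> C" and kH: "p (k (s, t)) = H (s, t)" if "s \<in> {0..1}" "t \<in> {0..1}" for s t
    using k(2,4) that by auto
  have h1C: "h1 t \<in> C" and h2C: "h2 t \<in> C" if "t \<in> {0..1}" for t
    using h1(2) h2(2) that by (auto simp: path_image_def)
  have Hl: "H (s, 0) = g1 0" and Hr: "H (s, 1) = g1 1" if "s \<in> {0..1}" for s
    using H(5) that by (auto simp: pathstart_def pathfinish_def)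
  have k0: "k (0, t) = h1 t" if t: "t \<in> {0..1}" for t
  proof (rule path_lift_unique[OF cov _ _ h1(1,2) _ _ _ t, where s = 0])
    show "p (k (0, t)) = p (h1 t)" if "t \<in> {0..1}" for t using kH[of 0 t] H(3) h1(3) that by simp
  qed (use ck(2)[of 0] kC k(3) in \<open>auto simp: path_def path_image_def\<close>)
  have kl: "k (t, 0) = h1 0" if t: "t \<in> {0..1}" for t
  proof (rule path_lift_unique[OF cov _ _ _ _ _ _ _ t, where s = 0 and g = "\<lambda>t. k (t, 0)" and h = "\<lambda>_. h1 0"])
    show "p (k (t, 0)) = p (h1 0)" if "t \<in> {0..1}" for t using kH[of t 0] Hl h1(3)[of 0] that by simp
  qed (use ck(1)[of 0] kC h1C[of 0] k(3) in \<open>auto simp: path_def path_image_def\<close>)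
  have kr: "k (t, 1) = h1 1" if t: "t \<in> {0..1}" for t
  proof (rule path_lift_unique[OF cov _ _ _ _ _ _ _ t, where s = 0 and g = "\<lambda>t. k (t, 1)" and h = "\<lambda>_. h1 1"])
    show "p (k (t, 1)) = p (h1 1)" if "t \<in> {0..1}" for t using kH[of t 1] Hr h1(3)[of 1] that by simp
  qed (use ck(1)[of 1] kC h1C[of 1] k0[of 1] in \<open>auto simp: path_def path_image_def\<close>)
  have k1: "k (1, t) = h2 t" if t: "t \<in> {0..1}" for t
  proof (rule path_lift_unique[OF cov _ _ h2(1,2) _ _ _ t, where s = 0])
    show "p (k (1, t)) = p (h2 t)" if "t \<in> {0..1}" for t using kH[of 1 t] H(4) h2(3) that by simp
  qed (use ck(2)[of 1] kC kl[of 1] st in \<open>auto simp: path_def path_image_def pathstart_def\<close>)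
  show ?thesis unfolding homotopic_paths
  proof (intro exI[of _ k] conjI ballI)
    show "k \<in> {0..1} \<times> {0..1} \<rightarrow> C" using k(2) by auto
  qed (use k(1) k0 k1 kl kr in \<open>auto simp: pathstart_def pathfinish_def\<close>)
qed


section \<open>Spaces with attached cones, and coverings of them\<close>

section \<open>Attaching cones\<close>

text \<open>A continuous map from a compact space to a Hausdorff space is closed, hence a quotient
  map onto its image.\<close>

lemma continuous_on_compact_quotient:
  fixes \<Phi> :: "'x::topological_space \<Rightarrow> 'y::t2_space" and f :: "'y \<Rightarrow> 'z::topological_space"
  assumes "compact D" "continuous_on D \<Phi>" "continuous_on D (\<lambda>z. f (\<Phi> z))"
  shows "continuous_on (\<Phi> ` D) f"
  unfolding continuous_on_closed_invariant
proof (intro allI impI)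
  fix B :: "'z set" assume "closed B"
  then have "closedin (top_of_set D) (D \<inter> (\<lambda>z. f (\<Phi> z)) -` B)"
    using assms(3) continuous_closedin_preimage by blast
  then have "compact (D \<inter> (\<lambda>z. f (\<Phi> z)) -` B)"
    using assms(1) closedin_compact by blast
  then have "compact (\<Phi> ` (D \<inter> (\<lambda>z. f (\<Phi> z)) -` B))"
    by (intro compact_continuous_image continuous_on_subset[OF assms(2)]) auto
  then have "closed (\<Phi> ` (D \<inter> (\<lambda>z. f (\<Phi> z)) -` B))" by (rule compact_imp_closed)
  then show "\<exists>A. closed A \<and> A \<inter> \<Phi> ` D = f -` B \<inter> \<Phi> ` D"
    by (intro exI[of _ "\<Phi> ` (D \<inter> (\<lambda>z. f (\<Phi> z)) -` B)"] conjI) auto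
qed

lemma compact_diff_openin:
  assumes "compact K" "openin (top_of_set K) U"
  shows "compact (K - U)"
proof -
  obtain O' where "open O'" "U = K \<inter> O'" using assms(2) by (auto simp: openin_open)
  then have "K - U = K - O'" by auto
  then show ?thesis using assms(1) \<open>open O'\<close> by (simp add: compact_diff)
qed

text \<open>\<open>S\<close> arises from \<open>M\<close> by attaching for each \<open>c \<in> C\<close> a cone with apex \<open>\<Psi> c 0 0\<close> along \<open>\<Psi> c 1\<close>. A 1-cell is the cone over
  \<open>B = {0, 1}\<close>, and a 2-cell in polar coordinates is a cone over \<open>B = {0..1}\<close> with the sides \<open>\<theta> = 0\<close> and \<open>\<theta> = 1\<close> identified.\<close>

locale cone_complex =
  fixes S M :: "'a::t2_space set" and C :: "'c set" and B :: "real set"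
    and \<Psi> :: "'c \<Rightarrow> real \<Rightarrow> real \<Rightarrow> 'a"
  assumes finite_C: "finite C" and compact_B: "compact B" and zero_B: "0 \<in> B"
    and compact_M: "compact M"
    and cont: "c \<in> C \<Longrightarrow> continuous_on ({0..1} \<times> B) (\<lambda>z. \<Psi> c (fst z) (snd z))"
    and S_eq: "S = M \<union> {\<Psi> c \<rho> \<theta> | c \<rho> \<theta>. c \<in> C \<and> 0 \<le> \<rho> \<and> \<rho> < 1 \<and> \<theta> \<in> B}"
    and bd: "\<lbrakk>c \<in> C; \<theta> \<in> B\<rbrakk> \<Longrightarrow> \<Psi> c 1 \<theta> \<in> M"
    and interior_notin: "\<lbrakk>c \<in> C; \<theta> \<in> B; 0 \<le> \<rho>; \<rho> < 1\<rbrakk> \<Longrightarrow> \<Psi> c \<rho> \<theta> \<notin> M"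
    and inj: "\<lbrakk>c \<in> C; c' \<in> C; \<theta> \<in> B; \<theta>' \<in> B; 0 \<le> \<rho>; \<rho> < 1; 0 \<le> \<rho>'; \<rho>' < 1; \<Psi> c \<rho> \<theta> = \<Psi> c' \<rho>' \<theta>'\<rbrakk> \<Longrightarrow>
       c = c' \<and> \<rho> = \<rho>' \<and> (\<rho> = 0 \<or> (\<forall>\<sigma>. \<Psi> c \<sigma> \<theta> = \<Psi> c \<sigma> \<theta>'))"
    and apex: "\<lbrakk>c \<in> C; \<theta> \<in> B\<rbrakk> \<Longrightarrow> \<Psi> c 0 \<theta> = \<Psi> c 0 0"
begin

lemma cell_in_S: "\<lbrakk>c \<in> C; \<theta> \<in> B; 0 \<le> \<rho>; \<rho> \<le> 1\<rbrakk> \<Longrightarrow> \<Psi> c \<rho> \<theta> \<in> S"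
  using bd unfolding S_eq by (cases "\<rho> = 1") force+

lemma M_subset: "M \<subseteq> S"
  by (auto simp: S_eq)

lemma S_cases:
  assumes "p \<in> S"
  obtains "p \<in> M" | c \<rho> \<theta> where "c \<in> C" "0 \<le> \<rho>" "\<rho> < 1" "\<theta> \<in> B" "p = \<Psi> c \<rho> \<theta>" "p \<notin> M"
  using assms interior_notin unfolding S_eq by blast

lemma inj_le:
  assumes "c \<in> C" "c' \<in> C" "\<theta> \<in> B" "\<theta>' \<in> B" "0 \<le> \<rho>" "\<rho> < 1" "0 \<le> \<rho>'" "\<rho>' \<le> 1" "\<Psi> c \<rho> \<theta> = \<Psi> c' \<rho>' \<theta>'"
  shows "c = c' \<and> \<rho> = \<rho>' \<and> (\<rho> = 0 \<or> (\<forall>\<sigma>. \<Psi> c \<sigma> \<theta> = \<Psi> c \<sigma> \<theta>'))"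
proof (cases "\<rho>' = 1")
  case True
  then show ?thesis using assms interior_notin[of c \<theta> \<rho>] bd[of c' \<theta>'] by simp
next
  case False
  then have "\<rho>' < 1" using assms(8) by simp
  then show ?thesis using inj[of c c' \<theta> \<theta>' \<rho> \<rho>'] assms by blast
qed

lemma cont_radius: "\<lbrakk>c \<in> C; \<theta> \<in> B\<rbrakk> \<Longrightarrow> continuous_on {0..1} (\<lambda>\<rho>. \<Psi> c \<rho> \<theta>)"
  using continuous_on_compose2[OF cont, where s = "{0..1}" and f = "\<lambda>\<rho>. (\<rho>, \<theta>)"]
  by (simp add: continuous_intros image_subset_iff)

text \<open>The complement of \<open>A\<close> in \<open>S\<close> is cut out by finitely many
  compact images, which are closed in the Hausdorff ambient space. So \<open>S\<close> carries the
  quotient topology of \<open>M\<close> and the cones, and openness can be tested in cone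
  coordinates.\<close>

lemma openinI:
  assumes A: "A \<subseteq> S" and "openin (top_of_set M) (A \<inter> M)"
    and "\<And>c. c \<in> C \<Longrightarrow> openin (top_of_set ({0..1} \<times> B)) {z \<in> {0..1} \<times> B. \<Psi> c (fst z) (snd z) \<in> A}"
  shows "openin (top_of_set S) A"
proof -
  let ?D = "{0..1::real} \<times> B"
  let ?P = "\<lambda>c z. \<Psi> c (fst z) (snd z)"
  have cD: "compact ?D" using compact_B by (intro compact_Times) auto
  define K where "K = (M - A \<inter> M) \<union> (\<Union>c\<in>C. ?P c ` (?D - {z \<in> ?D. ?P c z \<in> A}))"
  have "compact (M - A \<inter> M)"
    by (rule compact_diff_openin[OF compact_M assms(2)])
  moreover have "compact (?P c ` (?D - {z \<in> ?D. ?P c z \<in> A}))" if "c \<in> C" for c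
  proof (rule compact_continuous_image)
    show "compact (?D - {z \<in> ?D. ?P c z \<in> A})"
      by (rule compact_diff_openin[OF cD assms(3)[OF that]])
    show "continuous_on (?D - {z \<in> ?D. ?P c z \<in> A}) (?P c)"
      by (rule continuous_on_subset[OF cont[OF that]]) auto
  qed
  ultimately have "closed K" unfolding K_def
    using finite_C by (intro compact_imp_closed compact_Un compact_UN) auto
  moreover have "A = S \<inter> - K"
  proof (intro equalityI subsetI)
    fix p assume "p \<in> A"
    then show "p \<in> S \<inter> - K" using A by (auto simp: K_def)
  next
    fix p assume p: "p \<in> S \<inter> - K"
    then have "p \<in> S" by simp
    then show "p \<in> A"
    proof (cases rule: S_cases)
      case (2 c \<rho> \<theta>)
      then have "(\<rho>, \<theta>) \<in> ?D" by simp
      then show ?thesis using p 2(1,5) unfolding K_def by force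
    qed (use p in \<open>auto simp: K_def\<close>)
  qed
  ultimately show ?thesis by (metis open_Compl openin_open_Int)
qed

text \<open>The angle is determined only up to the identifications allowed by \<open>inj\<close>,
  hence the choice; what is built from \<open>coord\<close> has to be shown independent of
  it.\<close>

definition coord :: "'a \<Rightarrow> 'c \<times> real \<times> real" where
  "coord p = (SOME (c, \<rho>, \<theta>). c \<in> C \<and> 0 \<le> \<rho> \<and> \<rho> < 1 \<and> \<theta> \<in> B \<and> p = \<Psi> c \<rho> \<theta>)"

lemma coordE:
  assumes "p \<in> S" "p \<notin> M"
  obtains c \<rho> \<theta> where "coord p = (c, \<rho>, \<theta>)" "c \<in> C" "0 \<le> \<rho>" "\<rho> < 1" "\<theta> \<in> B" "p = \<Psi> c \<rho> \<theta>"
proof -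
  obtain c0 \<rho>0 \<theta>0 where "c0 \<in> C" "0 \<le> \<rho>0" "\<rho>0 < 1" "\<theta>0 \<in> B" "p = \<Psi> c0 \<rho>0 \<theta>0"
    using assms by (cases rule: S_cases) auto
  then have "\<exists>x. case x of (c, \<rho>, \<theta>) \<Rightarrow> c \<in> C \<and> 0 \<le> \<rho> \<and> \<rho> < 1 \<and> \<theta> \<in> B \<and> p = \<Psi> c \<rho> \<theta>"
    by (intro exI[of _ "(c0, \<rho>0, \<theta>0)"]) simp
  from someI_ex[OF this] show thesis
    using that unfolding coord_def[symmetric] by (cases "coord p") auto
qed

text \<open>The radial flow into \<open>M\<close>, which it reaches at \<open>s = 1\<close>. At an
  apex the direction depends on the choice in \<open>coord\<close>, so continuity is available only
  away from the apexes.\<close>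

definition rad :: "'a \<Rightarrow> real \<Rightarrow> 'a" where
  "rad p s = (if p \<in> M \<or> p \<notin> S then p else case coord p of (c, \<rho>, \<theta>) \<Rightarrow> \<Psi> c (\<rho> + s * (1 - \<rho>)) \<theta>)"

lemma rad_0 [simp]: "rad p 0 = p"
  by (auto simp: rad_def split: prod.split elim: coordE)

lemma rad_M: "p \<in> M \<Longrightarrow> rad p s = p"
  by (simp add: rad_def)

text \<open>By the last clause of \<open>inj\<close>, two sets of coordinates of a point off the
  apex describe the same radius, so the choice in \<open>coord\<close> has no influence.\<close>

lemma rad_cell:
  assumes "c \<in> C" "0 < \<rho>" "\<rho> \<le> 1" "\<theta> \<in> B"
  shows "rad (\<Psi> c \<rho> \<theta>) s = \<Psi> c (\<rho> + s * (1 - \<rho>)) \<theta>"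
proof (cases "\<rho> = 1")
  case True
  then show ?thesis using bd assms by (simp add: rad_M)
next
  case False
  then have n: "\<Psi> c \<rho> \<theta> \<notin> M" "\<Psi> c \<rho> \<theta> \<in> S" using assms interior_notin cell_in_S by auto
  obtain c' \<rho>' \<theta>' where *: "coord (\<Psi> c \<rho> \<theta>) = (c', \<rho>', \<theta>')" "c' \<in> C" "0 \<le> \<rho>'" "\<rho>' < 1" "\<theta>' \<in> B" "\<Psi> c \<rho> \<theta> = \<Psi> c' \<rho>' \<theta>'"
    using coordE[OF n(2,1)] by metis
  have e: "c = c'" "\<rho> = \<rho>'" "\<And>\<sigma>. \<Psi> c \<sigma> \<theta> = \<Psi> c \<sigma> \<theta>'"
    using inj[of c c' \<theta> \<theta>' \<rho> \<rho>'] * assms False by auto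
  have "rad (\<Psi> c \<rho> \<theta>) s = \<Psi> c' (\<rho>' + s * (1 - \<rho>')) \<theta>'" using n *(1) by (simp add: rad_def)
  then show ?thesis unfolding e(1,2)[symmetric] by (simp only: e(3))
qed

lemma rad_in_S: "\<lbrakk>p \<in> S; 0 \<le> s; s \<le> 1\<rbrakk> \<Longrightarrow> rad p s \<in> S"
proof (cases "p \<in> M")
  case False
  assume p: "p \<in> S" "0 \<le> s" "s \<le> 1"
  then obtain c \<rho> \<theta> where *: "coord p = (c, \<rho>, \<theta>)" "c \<in> C" "0 \<le> \<rho>" "\<rho> < 1" "\<theta> \<in> B"
    using coordE False by metis
  then have "0 \<le> \<rho> + s * (1 - \<rho>) \<and> \<rho> + s * (1 - \<rho>) \<le> 1"
    using affine_in_unit[of \<rho> 1 s] p by (simp add: mult.commute add.commute)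
  then show ?thesis using p False * by (simp add: rad_def cell_in_S)
qed (simp add: rad_M)

lemma rad_1: "p \<in> S \<Longrightarrow> rad p 1 \<in> M"
  by (auto simp: rad_def elim!: coordE intro!: bd)

lemma path_rad:
  assumes "p \<in> S"
  shows "path (rad p)" "path_image (rad p) \<subseteq> S" "pathstart (rad p) = p" "pathfinish (rad p) = rad p 1"
proof -
  show "path (rad p)"
  proof (cases "p \<in> M")
    case True
    then show ?thesis by (simp add: rad_def path_def)
  next
    case False
    then obtain c \<rho> \<theta> where *: "coord p = (c, \<rho>, \<theta>)" "c \<in> C" "0 \<le> \<rho>" "\<rho> < 1" "\<theta> \<in> B"
      using coordE assms by metis
    have "continuous_on {0..1} (\<lambda>s. \<Psi> c (\<rho> + s * (1 - \<rho>)) \<theta>)"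
    proof (rule continuous_on_compose2[OF cont_radius])
      show "(\<lambda>s. \<rho> + s * (1 - \<rho>)) ` {0..1} \<subseteq> {0..1}"
        using affine_in_unit[of \<rho> 1] * by (auto simp: mult.commute add.commute)
    qed (use * in \<open>auto intro!: continuous_intros\<close>)
    then show ?thesis using False assms * by (simp add: rad_def path_def)
  qed
  show "path_image (rad p) \<subseteq> S" using rad_in_S assms by (auto simp: path_image_def)
qed (auto simp: pathstart_def pathfinish_def)

text \<open>For \<open>\<epsilon> = 0\<close> this is \<open>S\<close> without the apexes.\<close>

definition outer :: "real \<Rightarrow> 'a set" where
  "outer \<epsilon> = M \<union> {\<Psi> c \<rho> \<theta> | c \<rho> \<theta>. c \<in> C \<and> \<epsilon> < \<rho> \<and> \<rho> \<le> 1 \<and> \<theta> \<in> B}"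

lemma cell_in_outer_iff:
  assumes "c \<in> C" "0 \<le> \<rho>" "\<rho> \<le> 1" "\<theta> \<in> B" "0 \<le> \<epsilon>" "\<epsilon> < 1"
  shows "\<Psi> c \<rho> \<theta> \<in> outer \<epsilon> \<longleftrightarrow> \<epsilon> < \<rho>"
proof
  assume "\<Psi> c \<rho> \<theta> \<in> outer \<epsilon>"
  then consider "\<Psi> c \<rho> \<theta> \<in> M" | c' \<rho>' \<theta>' where "c' \<in> C" "\<epsilon> < \<rho>'" "\<rho>' \<le> 1" "\<theta>' \<in> B" "\<Psi> c \<rho> \<theta> = \<Psi> c' \<rho>' \<theta>'"
    by (auto simp: outer_def)
  then show "\<epsilon> < \<rho>"
  proof cases
    case 1
    then show ?thesis using interior_notin[of c \<theta> \<rho>] assms by force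
  next
    case 2
    then show ?thesis using inj_le[of c c' \<theta> \<theta>' \<rho> \<rho>'] assms by force
  qed
qed (use assms in \<open>auto simp: outer_def\<close>)

lemma openin_fst_greater: "openin (top_of_set ({0..1} \<times> B)) {z \<in> {0..1} \<times> B. (\<epsilon>::real) < fst z}"
proof -
  have "{z \<in> {0..1} \<times> B. \<epsilon> < fst z} = ({0..1} \<times> B) \<inter> fst -` {\<epsilon><..}" by auto
  moreover have "open (fst -` {\<epsilon><..} :: (real \<times> real) set)"
    by (intro open_vimage continuous_on_fst continuous_on_id) auto
  ultimately show ?thesis by (metis openin_open_Int)
qed

lemma openin_fst_less: "openin (top_of_set ({0..1} \<times> B)) {z \<in> {0..1} \<times> B. fst z < (\<epsilon>::real)}"
proof -
  have "{z \<in> {0..1} \<times> B. fst z < \<epsilon>} = ({0..1} \<times> B) \<inter> fst -` {..<\<epsilon>}" by auto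
  moreover have "open (fst -` {..<\<epsilon>} :: (real \<times> real) set)"
    by (intro open_vimage continuous_on_fst continuous_on_id) auto
  ultimately show ?thesis by (metis openin_open_Int)
qed

lemma outer_subset: "0 \<le> \<epsilon> \<Longrightarrow> outer \<epsilon> \<subseteq> S"
  using M_subset cell_in_S by (auto simp: outer_def)

lemma openin_outer:
  assumes "0 \<le> \<epsilon>" "\<epsilon> < 1"
  shows "openin (top_of_set S) (outer \<epsilon>)"
proof (rule openinI[OF outer_subset[OF assms(1)]])
  show "openin (top_of_set M) (outer \<epsilon> \<inter> M)"
    by (simp add: outer_def Int_absorb1)
  fix c assume "c \<in> C"
  then have "{z \<in> {0..1} \<times> B. \<Psi> c (fst z) (snd z) \<in> outer \<epsilon>} = {z \<in> {0..1} \<times> B. \<epsilon> < fst z}"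
    using cell_in_outer_iff assms by auto
  then show "openin (top_of_set ({0..1} \<times> B)) {z \<in> {0..1} \<times> B. \<Psi> c (fst z) (snd z) \<in> outer \<epsilon>}"
    using openin_fst_greater by simp
qed

text \<open>The positive bound on the radius makes the parameter domain compact and keeps it away
  from the apexes, so that continuity can be tested on parameters; the finitely many closed pieces
  are pasted afterwards.\<close>

lemma continuous_on_rad:
  assumes "0 < \<epsilon>"
  shows "continuous_on (outer \<epsilon> \<times> {0..1}) (\<lambda>z. rad (fst z) (snd z))"
proof -
  let ?f = "\<lambda>z. rad (fst z) (snd z)"
  define Q where "Q c = (\<lambda>z. (\<Psi> c (fst (fst z)) (snd (fst z)), snd z)) ` (({\<epsilon>..1} \<times> B) \<times> {0..1::real})" for c
  have cD: "compact (({\<epsilon>..1} \<times> B) \<times> {0..1::real})" using compact_B by (intro compact_Times) auto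
  have cm: "continuous_on (({\<epsilon>..1} \<times> B) \<times> {0..1::real}) (\<lambda>z. (\<Psi> c (fst (fst z)) (snd (fst z)), snd z))" if "c \<in> C" for c
    using assms by (intro continuous_on_Pair continuous_on_compose2[OF cont[OF that]] continuous_intros) auto
  have c1: "continuous_on (Q c) ?f" if "c \<in> C" for c
    unfolding Q_def
  proof (rule continuous_on_compact_quotient[OF cD cm[OF that]])
    have "continuous_on (({\<epsilon>..1} \<times> B) \<times> {0..1::real}) (\<lambda>z. \<Psi> c (fst (fst z) + snd z * (1 - fst (fst z))) (snd (fst z)))"
    proof (rule continuous_on_compose2[OF cont[OF that], where f = "\<lambda>z. (fst (fst z) + snd z * (1 - fst (fst z)), snd (fst z))", simplified fst_conv snd_conv])
      show "(\<lambda>z. (fst (fst z) + snd z * (1 - fst (fst z)), snd (fst z))) ` (({\<epsilon>..1} \<times> B) \<times> {0..1}) \<subseteq> {0..1} \<times> B"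
        using affine_in_unit[of _ 1] assms by (auto simp: mult.commute add.commute)
    qed (intro continuous_intros)
    then show "continuous_on (({\<epsilon>..1} \<times> B) \<times> {0..1::real}) (\<lambda>z. rad (fst (\<Psi> c (fst (fst z)) (snd (fst z)), snd z)) (snd (\<Psi> c (fst (fst z)) (snd (fst z)), snd z)))"
      by (rule continuous_on_eq) (use that assms in \<open>auto simp: rad_cell\<close>)
  qed
  have "continuous_on (M \<times> {0..1} \<union> (\<Union>c\<in>C. Q c)) ?f"
  proof (rule continuous_on_closed_Un)
    show "closed (M \<times> {0..1::real})" using compact_M by (intro closed_Times compact_imp_closed) auto
    have cQ: "closed (Q c)" if "c \<in> C" for c
      unfolding Q_def by (intro compact_imp_closed compact_continuous_image cm[OF that] cD)
    then show "closed (\<Union>c\<in>C. Q c)" using finite_C by auto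
    show "continuous_on (M \<times> {0..1}) ?f"
      by (rule continuous_on_eq[where f = fst]) (auto simp: rad_M intro!: continuous_intros)
    show "continuous_on (\<Union>c\<in>C. Q c) ?f"
      using finite_C cQ c1 by (intro continuous_on_closed_Union) auto
  qed
  then show ?thesis
  proof (rule continuous_on_subset)
    show "outer \<epsilon> \<times> {0..1} \<subseteq> M \<times> {0..1} \<union> (\<Union>c\<in>C. Q c)"
    proof (rule subsetI)
      fix z :: "'a \<times> real" assume z: "z \<in> outer \<epsilon> \<times> {0..1}"
      then consider "fst z \<in> M" | c \<rho> \<theta> where "c \<in> C" "\<epsilon> < \<rho>" "\<rho> \<le> 1" "\<theta> \<in> B" "fst z = \<Psi> c \<rho> \<theta>"
        by (auto simp: outer_def)
      then show "z \<in> M \<times> {0..1} \<union> (\<Union>c\<in>C. Q c)"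
      proof cases
        case 2
        then have "z \<in> Q c" unfolding Q_def using z by (intro image_eqI[of _ _ "((\<rho>, \<theta>), snd z)"]) (auto simp: prod_eq_iff)
        then show ?thesis using 2 by auto
      qed (use z in \<open>auto simp: mem_Times_iff\<close>)
    qed
  qed
qed

definition inner :: "'c \<Rightarrow> 'a set" where
  "inner c = {\<Psi> c \<rho> \<theta> | \<rho> \<theta>. 0 \<le> \<rho> \<and> \<rho> < 1/2 \<and> \<theta> \<in> B}"

text \<open>The contraction of an open cone to its apex. It replaces \<open>rad\<close> near the
  apex.\<close>

definition shrink :: "'a \<Rightarrow> real \<Rightarrow> 'a" where
  "shrink p s = (case coord p of (c, \<rho>, \<theta>) \<Rightarrow> \<Psi> c ((1 - s) * \<rho>) \<theta>)"

lemma shrink_cell: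
  assumes "c \<in> C" "0 \<le> \<rho>" "\<rho> < 1" "\<theta> \<in> B"
  shows "shrink (\<Psi> c \<rho> \<theta>) s = \<Psi> c ((1 - s) * \<rho>) \<theta>"
proof -
  have n: "\<Psi> c \<rho> \<theta> \<notin> M" "\<Psi> c \<rho> \<theta> \<in> S" using assms interior_notin cell_in_S by auto
  obtain c' \<rho>' \<theta>' where *: "coord (\<Psi> c \<rho> \<theta>) = (c', \<rho>', \<theta>')" "c' \<in> C" "0 \<le> \<rho>'" "\<rho>' < 1" "\<theta>' \<in> B" "\<Psi> c \<rho> \<theta> = \<Psi> c' \<rho>' \<theta>'"
    using coordE[OF n(2,1)] by metis
  then have "c = c' \<and> \<rho> = \<rho>' \<and> (\<rho> = 0 \<or> (\<forall>\<sigma>. \<Psi> c \<sigma> \<theta> = \<Psi> c \<sigma> \<theta>'))"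
    using inj[of c c' \<theta> \<theta>' \<rho> \<rho>'] assms by auto
  then show ?thesis using * assms apex[of c \<theta>] apex[of c \<theta>'] by (auto simp: shrink_def)
qed

lemma cell_in_inner_iff:
  assumes "c \<in> C" "c' \<in> C" "0 \<le> \<rho>" "\<rho> \<le> 1" "\<theta> \<in> B"
  shows "\<Psi> c \<rho> \<theta> \<in> inner c' \<longleftrightarrow> \<rho> < 1/2 \<and> c = c'"
proof
  assume "\<Psi> c \<rho> \<theta> \<in> inner c'"
  then obtain \<rho>' \<theta>' where "\<Psi> c' \<rho>' \<theta>' = \<Psi> c \<rho> \<theta>" "0 \<le> \<rho>'" "\<rho>' < 1/2" "\<theta>' \<in> B" by (auto simp: inner_def)
  then show "\<rho> < 1/2 \<and> c = c'" using inj_le[of c' c \<theta>' \<theta> \<rho>' \<rho>] assms by auto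
qed (use assms in \<open>auto simp: inner_def\<close>)

lemma openin_inner:
  assumes "c \<in> C"
  shows "openin (top_of_set S) (inner c)"
proof (rule openinI)
  show "inner c \<subseteq> S" using cell_in_S assms by (auto simp: inner_def)
  have "inner c \<inter> M = {}" using interior_notin assms by (fastforce simp: inner_def)
  then show "openin (top_of_set M) (inner c \<inter> M)" by simp
  fix c' assume c': "c' \<in> C"
  show "openin (top_of_set ({0..1} \<times> B)) {z \<in> {0..1} \<times> B. \<Psi> c' (fst z) (snd z) \<in> inner c}"
  proof (cases "c = c'")
    case True
    have "{z \<in> {0..1} \<times> B. \<Psi> c' (fst z) (snd z) \<in> inner c} = {z \<in> {0..1} \<times> B. fst z < 1/2}"
      using cell_in_inner_iff assms c' True by auto
    then show ?thesis using openin_fst_less[of "1/2"] by (simp only:)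
  next
    case False
    have "{z \<in> {0..1} \<times> B. \<Psi> c' (fst z) (snd z) \<in> inner c} = {}"
      using cell_in_inner_iff assms c' False by auto
    then show ?thesis by (metis openin_empty)
  qed
qed

lemma continuous_on_shrink:
  assumes "c \<in> C"
  shows "continuous_on (inner c \<times> {0..1}) (\<lambda>z. shrink (fst z) (snd z))"
proof -
  let ?D = "({0..1/2::real} \<times> B) \<times> {0..1::real}"
  have "continuous_on ((\<lambda>z. (\<Psi> c (fst (fst z)) (snd (fst z)), snd z)) ` ?D) (\<lambda>z. shrink (fst z) (snd z))"
  proof (rule continuous_on_compact_quotient)
    show "compact ?D" using compact_B by (intro compact_Times compact_Icc) auto
    show "continuous_on ?D (\<lambda>z. (\<Psi> c (fst (fst z)) (snd (fst z)), snd z))"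
      by (intro continuous_on_Pair continuous_on_compose2[OF cont[OF assms]] continuous_intros) auto
    have "continuous_on ?D (\<lambda>z. \<Psi> c ((1 - snd z) * fst (fst z)) (snd (fst z)))"
    proof (rule continuous_on_compose2[OF cont[OF assms], where f = "\<lambda>z. ((1 - snd z) * fst (fst z), snd (fst z))", simplified fst_conv snd_conv])
      show "(\<lambda>z. ((1 - snd z) * fst (fst z), snd (fst z))) ` ?D \<subseteq> {0..1} \<times> B"
        by (auto intro!: mult_le_one)
    qed (intro continuous_intros)
    then show "continuous_on ?D (\<lambda>z. shrink (fst (\<Psi> c (fst (fst z)) (snd (fst z)), snd z)) (snd (\<Psi> c (fst (fst z)) (snd (fst z)), snd z)))"
      by (rule continuous_on_eq) (use assms in \<open>auto simp: shrink_cell\<close>)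
  qed
  then show ?thesis
  proof (rule continuous_on_subset)
    show "inner c \<times> {0..1} \<subseteq> (\<lambda>z. (\<Psi> c (fst (fst z)) (snd (fst z)), snd z)) ` ?D"
    proof (rule subsetI)
      fix z :: "'a \<times> real" assume z: "z \<in> inner c \<times> {0..1}"
      then obtain \<rho> \<theta> where "fst z = \<Psi> c \<rho> \<theta>" "0 \<le> \<rho>" "\<rho> < 1/2" "\<theta> \<in> B"
        by (auto simp: inner_def)
      then show "z \<in> (\<lambda>z. (\<Psi> c (fst (fst z)) (snd (fst z)), snd z)) ` ?D"
        using z by (intro image_eqI[of _ _ "((\<rho>, \<theta>), snd z)"]) (auto simp: prod_eq_iff)
    qed
  qed
qed

end


lemma path_const [simp]: "path (\<lambda>_. x)"
  by (simp add: path_def)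

lemma path_image_const [simp]: "path_image (\<lambda>_. x) = {x}"
  by (auto simp: path_image_def)

lemma pathstart_const [simp]: "pathstart (\<lambda>_. x) = x"
  and pathfinish_const [simp]: "pathfinish (\<lambda>_. x) = x"
  by (auto simp: pathstart_def pathfinish_def)

section \<open>Cutting paths into pieces near the base and pieces near an apex\<close>

context cone_complex
begin

definition radius_in :: "'c \<Rightarrow> real \<Rightarrow> real \<Rightarrow> 'a" where
  "radius_in c \<theta> = (\<lambda>t. \<Psi> c (1 - t) \<theta>)"

definition radius_out :: "'c \<Rightarrow> real \<Rightarrow> real \<Rightarrow> 'a" where
  "radius_out c \<theta> = (\<lambda>t. \<Psi> c t \<theta>)"

lemma radius_convex_image:
  fixes f :: "real \<Rightarrow> real"
  assumes "c \<in> C" "\<theta> \<in> B" "continuous_on {0..1} f" "f ` {0..1} \<subseteq> {0..1}"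
    and "continuous_on {0..1} h" "h ` {0..1} \<subseteq> {0..1}" "f 0 = h 0" "f 1 = h 1"
  shows "homotopic_paths S (\<lambda>t. \<Psi> c (f t) \<theta>) (\<lambda>t. \<Psi> c (h t) \<theta>)"
  using homotopic_paths_convex_image[OF _ cont_radius[OF assms(1,2)], of S f h] assms cell_in_S
  by (auto simp: path_def path_image_def pathstart_def pathfinish_def comp_def image_subset_iff)

text \<open>Once its ends are connected radially with \<open>M\<close>, \<open>h\<close> becomes
  homotopic to a member of \<open>MM\<close>. The ends of \<open>h\<close> are arbitrary, as they
  must be for the pieces of a subdivision.\<close>

definition radially :: "((real \<Rightarrow> 'a) \<Rightarrow> bool) \<Rightarrow> (real \<Rightarrow> 'a) \<Rightarrow> bool" where
  "radially MM h \<longleftrightarrow> path h \<and> path_image h \<subseteq> S \<and> (\<exists>m. MM m \<and> path m \<and> path_image m \<subseteq> S \<and>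
     pathstart m = rad (pathstart h) 1 \<and> pathfinish m = rad (pathfinish h) 1 \<and>
     homotopic_paths S (h +++ rad (pathfinish h)) (rad (pathstart h) +++ m))"

text \<open>The radius at the common point is a side of both squares, which therefore paste along
  it.\<close>

lemma radially_join:
  assumes join: "\<And>g h. \<lbrakk>MM g; MM h; path g; path h; pathfinish g = pathstart h\<rbrakk> \<Longrightarrow> MM (g +++ h)"
    and "radially MM h" "radially MM h'" "pathfinish h = pathstart h'" "homotopic_paths S (h +++ h') k"
  shows "radially MM k"
proof -
  define a b c where "a = rad (pathstart h)" and "b = rad (pathfinish h)" and "c = rad (pathfinish h')"
  note hh = assms(4)
  obtain m where m: "MM m" "path m" "path_image m \<subseteq> S" "pathstart m = rad (pathstart h) 1"
      "pathfinish m = rad (pathfinish h) 1" "homotopic_paths S (h +++ b) (a +++ m)"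
    using assms(2) unfolding radially_def a_def b_def by auto
  obtain m' where m': "MM m'" "path m'" "path_image m' \<subseteq> S" "pathstart m' = rad (pathfinish h) 1"
      "pathfinish m' = rad (pathfinish h') 1" "homotopic_paths S (h' +++ c) (b +++ m')"
    using assms(3) unfolding radially_def b_def c_def hh by auto
  have h: "path h" "path_image h \<subseteq> S" "path h'" "path_image h' \<subseteq> S"
    using assms(2,3) by (auto simp: radially_def)
  then have S: "pathstart h \<in> S" "pathfinish h \<in> S" "pathfinish h' \<in> S" by auto
  note abc = path_rad[OF S(1), folded a_def] path_rad[OF S(2), folded b_def] path_rad[OF S(3), folded c_def]
  have k: "path k" "path_image k \<subseteq> S" "pathstart k = pathstart h" "pathfinish k = pathfinish h'"
    using homotopic_paths_imp_path[OF assms(5)] homotopic_paths_imp_subset[OF assms(5)]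
      homotopic_paths_imp_pathstart[OF assms(5)] homotopic_paths_imp_pathfinish[OF assms(5)] by auto
  have ends: "pathfinish b = pathstart m'" "pathfinish a = pathstart m" "pathfinish m = pathstart m'"
    using m m' abc by (auto simp: a_def b_def)
  have "homotopic_paths S (k +++ c) ((h +++ h') +++ c)"
    by (rule homotopic_paths_join) (use assms(5) abc k in \<open>auto intro: homotopic_paths_sym\<close>)
  also have "homotopic_paths S \<dots> (h +++ (h' +++ c))"
    by (rule homotopic_paths_sym, rule homotopic_paths_assoc) (use h abc hh in auto)
  also have "homotopic_paths S \<dots> (h +++ (b +++ m'))"
    by (rule homotopic_paths_join) (use h m' hh in auto)
  also have "homotopic_paths S \<dots> ((h +++ b) +++ m')"
    by (rule homotopic_paths_assoc) (use h abc hh m' ends in auto)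
  also have "homotopic_paths S \<dots> ((a +++ m) +++ m')"
    by (rule homotopic_paths_join) (use m m' ends in auto)
  also have "homotopic_paths S \<dots> (a +++ (m +++ m'))"
    by (rule homotopic_paths_sym, rule homotopic_paths_assoc) (use abc m m' ends in auto)
  finally have "homotopic_paths S (k +++ c) (a +++ (m +++ m'))" .
  moreover have "MM (m +++ m')" using join m m' ends by auto
  ultimately show ?thesis unfolding radially_def
    using k m m' ends by (intro conjI exI[of _ "m +++ m'"]) (auto simp: a_def c_def subset_path_image_join)
qed

text \<open>Here the flow \<open>rad\<close> is continuous and provides the square; its far side is
  the required path in \<open>M\<close>.\<close>

lemma radially_outer:
  assumes base: "\<And>g. \<lbrakk>path g; path_image g \<subseteq> M\<rbrakk> \<Longrightarrow> MM g"
    and h: "path h" "path_image h \<subseteq> outer \<epsilon>" and \<epsilon>: "0 < \<epsilon>"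
  shows "radially MM h"
proof -
  define H where "H = (\<lambda>z. rad (h (fst z)) (snd z))"
  have hO: "h t \<in> outer \<epsilon>" if "t \<in> {0..1}" for t using h that by (auto simp: path_image_def)
  have hS: "h t \<in> S" if "t \<in> {0..1}" for t using hO[OF that] outer_subset[of \<epsilon>] \<epsilon> by auto
  have cH: "continuous_on ({0..1} \<times> {0..1}) H"
    unfolding H_def
    by (rule continuous_on_compose2[OF continuous_on_rad[OF \<epsilon>], where f = "\<lambda>z. (h (fst z), snd z)", simplified fst_conv snd_conv])
       (use h hO in \<open>auto simp: path_def intro!: continuous_intros continuous_on_compose2[of "{0..1}" h]\<close>)
  have HS: "H ` ({0..1} \<times> {0..1}) \<subseteq> S"
    using hS rad_in_S by (auto simp: H_def)
  define m where "m = (\<lambda>t. rad (h t) 1)"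
  have "homotopic_paths S ((\<lambda>t::real. H (t, 0)) +++ (\<lambda>s. H (1, s))) ((\<lambda>s. H (0, s)) +++ (\<lambda>t. H (t, 1)))"
    by (rule homotopic_paths_square[OF cH HS])
  then have hom: "homotopic_paths S (h +++ rad (pathfinish h)) (rad (pathstart h) +++ m)"
    by (simp add: H_def m_def pathstart_def pathfinish_def)
  have m: "path m" unfolding path_def m_def
    by (rule continuous_on_compose2[OF cH, where f = "\<lambda>t. (t, 1)", unfolded H_def, simplified fst_conv snd_conv])
       (auto intro!: continuous_intros)
  have mM: "path_image m \<subseteq> M" using hS rad_1 by (auto simp: path_image_def m_def)
  show ?thesis unfolding radially_def
    using hom m mM M_subset base[OF m mM] h hS
    by (intro conjI exI[of _ m]) (auto simp: m_def pathstart_def pathfinish_def path_image_def)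
qed

text \<open>The outward flow breaks down at the apex. Instead \<open>h\<close> is contracted to the
  apex, which makes it homotopic to the way from its start to the apex and from there out to its
  end. Completing both ways to full radii yields a diameter.\<close>

lemma radially_inner:
  assumes diam: "\<And>c \<theta> \<theta>'. \<lbrakk>c \<in> C; \<theta> \<in> B; \<theta>' \<in> B\<rbrakk> \<Longrightarrow> MM (radius_in c \<theta> +++ radius_out c \<theta>')"
    and h: "path h" "path_image h \<subseteq> inner c" and c: "c \<in> C"
  shows "radially MM h"
proof -
  define H where "H = (\<lambda>z. shrink (h (fst z)) (snd z))"
  have hI: "h t \<in> inner c" if "t \<in> {0..1}" for t using h that by (auto simp: path_image_def)
  have IS: "inner c \<subseteq> S" using cell_in_S c by (auto simp: inner_def)
  have hS: "path_image h \<subseteq> S" using h IS by auto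
  have cH: "continuous_on ({0..1} \<times> {0..1}) H"
    unfolding H_def
    by (rule continuous_on_compose2[OF continuous_on_shrink[OF c], where f = "\<lambda>z. (h (fst z), snd z)", simplified fst_conv snd_conv])
       (use h hI in \<open>auto simp: path_def intro!: continuous_intros continuous_on_compose2[of "{0..1}" h]\<close>)
  have coords: "\<exists>\<rho> \<theta>. coord p = (c, \<rho>, \<theta>) \<and> 0 \<le> \<rho> \<and> \<rho> < 1 \<and> \<theta> \<in> B \<and> p = \<Psi> c \<rho> \<theta> \<and> p \<notin> M" if p: "p \<in> inner c" for p
  proof -
    have pM: "p \<in> S" "p \<notin> M" using p IS interior_notin c by (auto simp: inner_def)
    then obtain c' \<rho> \<theta> where *: "coord p = (c', \<rho>, \<theta>)" "c' \<in> C" "0 \<le> \<rho>" "\<rho> < 1" "\<theta> \<in> B" "p = \<Psi> c' \<rho> \<theta>"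
      using coordE by metis
    then have "c' = c" using p cell_in_inner_iff[of c' c \<rho> \<theta>] c by auto
    then show ?thesis using * pM by auto
  qed
  define A where "A = \<Psi> c 0 0"
  have HS: "H ` ({0..1} \<times> {0..1}) \<subseteq> S"
  proof (rule image_subsetI)
    fix z :: "real \<times> real" assume z: "z \<in> {0..1} \<times> {0..1}"
    then obtain \<rho> \<theta> where "coord (h (fst z)) = (c, \<rho>, \<theta>)" "0 \<le> \<rho>" "\<rho> < 1" "\<theta> \<in> B"
      using coords[OF hI, of "fst z"] by auto
    then show "H z \<in> S" using z c by (auto simp: H_def shrink_def intro!: cell_in_S mult_le_one)
  qed
  have e0: "shrink (h t) 0 = h t" and e1: "shrink (h t) 1 = A" if t: "t \<in> {0..1}" for t
    using coords[OF hI[OF t]] apex c by (auto simp: shrink_def A_def)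
  obtain \<rho>0 \<theta>0 where p0: "coord (h 0) = (c, \<rho>0, \<theta>0)" "0 \<le> \<rho>0" "\<rho>0 < 1" "\<theta>0 \<in> B" "h 0 = \<Psi> c \<rho>0 \<theta>0" "h 0 \<notin> M"
    using coords[OF hI, of 0] by auto
  obtain \<rho>1 \<theta>1 where p1: "coord (h 1) = (c, \<rho>1, \<theta>1)" "0 \<le> \<rho>1" "\<rho>1 < 1" "\<theta>1 \<in> B" "h 1 = \<Psi> c \<rho>1 \<theta>1" "h 1 \<notin> M"
    using coords[OF hI, of 1] by auto
  have h01: "h 0 \<in> S" "h 1 \<in> S" using hI IS by auto
  define in0 in1 where "in0 = (\<lambda>s. \<Psi> c ((1 - s) * \<rho>0) \<theta>0)" and "in1 = (\<lambda>s. \<Psi> c ((1 - s) * \<rho>1) \<theta>1)"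
  define \<kappa>0 \<kappa>1 where "\<kappa>0 = rad (h 0)" and "\<kappa>1 = rad (h 1)"
  have \<kappa>: "\<kappa>0 = (\<lambda>s. \<Psi> c (\<rho>0 + s * (1 - \<rho>0)) \<theta>0)" "\<kappa>1 = (\<lambda>s. \<Psi> c (\<rho>1 + s * (1 - \<rho>1)) \<theta>1)"
    using p0 p1 h01 by (auto simp: \<kappa>0_def \<kappa>1_def rad_def fun_eq_iff)
  define I O' where "I = radius_in c \<theta>0" and "O' = radius_out c \<theta>1"
  have r01: "0 \<le> \<rho> + s * (1 - \<rho>)" "\<rho> + s * (1 - \<rho>) \<le> 1" "0 \<le> (1 - s) * \<rho>" "(1 - s) * \<rho> \<le> 1"
    if "0 \<le> \<rho>" "\<rho> < 1" "0 \<le> s" "s \<le> 1" for s \<rho> :: real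
    using affine_in_unit[of \<rho> 1 s] that by (auto simp: mult.commute add.commute intro!: mult_le_one)

  have path_line: "path (\<lambda>t. \<Psi> c (f t) \<theta>) \<and> path_image (\<lambda>t. \<Psi> c (f t) \<theta>) \<subseteq> S"
    if "\<theta> \<in> B" "continuous_on {0..1} f" "f ` {0..1} \<subseteq> {0..1}" for f \<theta>
    using radius_convex_image[OF c that(1) that(2,3) that(2,3)] by simp
  have pin0: "path in0 \<and> path_image in0 \<subseteq> S" unfolding in0_def
    by (rule path_line) (use p0 r01 in \<open>auto intro!: continuous_intros\<close>)
  have pin1: "path in1 \<and> path_image in1 \<subseteq> S" unfolding in1_def
    by (rule path_line) (use p1 r01 in \<open>auto intro!: continuous_intros\<close>)
  have pI: "path I \<and> path_image I \<subseteq> S" unfolding I_def radius_in_def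
    by (rule path_line) (use p0 in \<open>auto intro!: continuous_intros\<close>)
  have pO: "path O' \<and> path_image O' \<subseteq> S" unfolding O'_def radius_out_def
    by (rule path_line) (use p1 in \<open>auto intro!: continuous_intros\<close>)
  note pk = path_rad[OF h01(1), folded \<kappa>0_def] path_rad[OF h01(2), folded \<kappa>1_def]
  have ends: "pathstart in0 = h 0" "pathfinish in0 = A" "pathstart in1 = h 1" "pathfinish in1 = A"
    "pathstart I = \<Psi> c 1 \<theta>0" "pathfinish I = A" "pathstart O' = A" "pathfinish O' = \<Psi> c 1 \<theta>1"
    "pathstart \<kappa>0 = h 0" "pathfinish \<kappa>0 = \<Psi> c 1 \<theta>0" "pathstart \<kappa>1 = h 1" "pathfinish \<kappa>1 = \<Psi> c 1 \<theta>1"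
    using p0 p1 apex c unfolding in0_def in1_def I_def O'_def radius_in_def radius_out_def \<kappa> A_def
    by (simp_all add: pathstart_def pathfinish_def apex)
  \<comment> \<open>Both sides lie on the radius through the start of \<open>h\<close>, so the
    homotopy takes place in an interval; likewise in \<open>ii\<close> for the end.\<close>
  have i: "homotopic_paths S (\<kappa>0 +++ I) in0"
  proof -
    have "homotopic_paths S (\<lambda>t. \<Psi> c (((\<lambda>s. \<rho>0 + s * (1 - \<rho>0)) +++ (\<lambda>t. 1 - t)) t) \<theta>0) (\<lambda>s. \<Psi> c ((1 - s) * \<rho>0) \<theta>0)"
    proof (rule radius_convex_image[OF c, where f = "(\<lambda>s. \<rho>0 + s * (1 - \<rho>0)) +++ (\<lambda>t. 1 - t)" and h = "\<lambda>s. (1 - s) * \<rho>0" and \<theta> = \<theta>0])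
      show "continuous_on {0..1} ((\<lambda>s. \<rho>0 + s * (1 - \<rho>0)) +++ (\<lambda>t. 1 - t))"
        unfolding path_def[symmetric]
        by (rule path_join_imp) (auto simp: path_def pathstart_def pathfinish_def intro!: continuous_intros)
      show "((\<lambda>s. \<rho>0 + s * (1 - \<rho>0)) +++ (\<lambda>t. 1 - t)) ` {0..1} \<subseteq> {0..1}"
        unfolding path_image_def[symmetric]
        by (rule subset_path_image_join) (use p0 r01 in \<open>auto simp: path_image_def\<close>)
      show "(\<lambda>s. (1 - s) * \<rho>0) ` {0..1} \<subseteq> {0..1}" using p0 r01 by auto
      show "continuous_on {0..1} (\<lambda>s. (1 - s) * \<rho>0)" by (intro continuous_intros)
    qed (simp_all add: p0(4) joinpaths_def)
    moreover have "(\<lambda>t. \<Psi> c (((\<lambda>s. \<rho>0 + s * (1 - \<rho>0)) +++ (\<lambda>t. 1 - t)) t) \<theta>0) = \<kappa>0 +++ I"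
      by (auto simp: \<kappa> I_def radius_in_def joinpaths_def fun_eq_iff)
    ultimately show ?thesis by (simp add: in0_def)
  qed
  have ii: "homotopic_paths S (in1 +++ O') \<kappa>1"
  proof -
    have "homotopic_paths S (\<lambda>t. \<Psi> c (((\<lambda>s. (1 - s) * \<rho>1) +++ (\<lambda>t. t)) t) \<theta>1) (\<lambda>s. \<Psi> c (\<rho>1 + s * (1 - \<rho>1)) \<theta>1)"
    proof (rule radius_convex_image[OF c, where f = "(\<lambda>s. (1 - s) * \<rho>1) +++ (\<lambda>t. t)" and h = "\<lambda>s. \<rho>1 + s * (1 - \<rho>1)" and \<theta> = \<theta>1])
      show "continuous_on {0..1} ((\<lambda>s. (1 - s) * \<rho>1) +++ (\<lambda>t. t))"
        unfolding path_def[symmetric]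
        by (rule path_join_imp) (auto simp: path_def pathstart_def pathfinish_def intro!: continuous_intros)
      show "((\<lambda>s. (1 - s) * \<rho>1) +++ (\<lambda>t. t)) ` {0..1} \<subseteq> {0..1}"
        unfolding path_image_def[symmetric]
        by (rule subset_path_image_join) (use p1 r01 in \<open>auto simp: path_image_def\<close>)
      show "(\<lambda>s. \<rho>1 + s * (1 - \<rho>1)) ` {0..1} \<subseteq> {0..1}" using p1 r01 by auto
      show "continuous_on {0..1} (\<lambda>s. \<rho>1 + s * (1 - \<rho>1))" by (intro continuous_intros)
    qed (simp_all add: p1(4) joinpaths_def)
    moreover have "(\<lambda>t. \<Psi> c (((\<lambda>s. (1 - s) * \<rho>1) +++ (\<lambda>t. t)) t) \<theta>1) = in1 +++ O'"
      by (auto simp: in1_def O'_def radius_out_def joinpaths_def fun_eq_iff)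
    ultimately show ?thesis by (simp add: \<kappa>)
  qed
  \<comment> \<open>The square traced by the contraction; its far side is constant at the
    apex.\<close>
  have sq: "homotopic_paths S (h +++ in1) (in0 +++ (\<lambda>_. A))"
  proof -
    have b: "(\<lambda>s. H (1, s)) = in1" "(\<lambda>s. H (0, s)) = in0"
      using p0 p1 by (auto simp: H_def shrink_def in0_def in1_def)
    have a: "homotopic_paths S h (\<lambda>t. H (t, 0))"
      by (rule homotopic_paths_eq) (use h hS e0 in \<open>auto simp: H_def\<close>)
    have d: "homotopic_paths S (\<lambda>t. H (t, 1)) (\<lambda>_. A)"
      by (rule homotopic_paths_sym, rule homotopic_paths_eq) (use e1 c cell_in_S[of c 0 0] zero_B in \<open>auto simp: H_def A_def\<close>)
    have "homotopic_paths S (h +++ in1) ((\<lambda>t. H (t, 0)) +++ in1)"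
      by (rule homotopic_paths_join) (use a pin1 ends in \<open>auto simp: pathfinish_def\<close>)
    also have "homotopic_paths S \<dots> (in0 +++ (\<lambda>t. H (t, 1)))"
      using homotopic_paths_square[OF cH HS] unfolding b .
    also have "homotopic_paths S \<dots> (in0 +++ (\<lambda>_. A))"
      by (rule homotopic_paths_join) (use d pin0 ends e1[of 0] in \<open>auto simp: pathstart_def H_def\<close>)
    finally show ?thesis .
  qed
  have hf: "pathfinish h = h 1" "pathstart h = h 0" by (auto simp: pathfinish_def pathstart_def)
  have "homotopic_paths S (h +++ \<kappa>1) (h +++ (in1 +++ O'))"
    by (rule homotopic_paths_join) (use h hS ii hf ends in \<open>auto intro: homotopic_paths_sym\<close>)
  also have "homotopic_paths S \<dots> ((h +++ in1) +++ O')"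
    by (rule homotopic_paths_assoc) (use h hS hf ends pin1 pO in auto)
  also have "homotopic_paths S \<dots> ((in0 +++ (\<lambda>_. A)) +++ O')"
    by (rule homotopic_paths_join) (use sq pO ends in auto)
  also have "homotopic_paths S \<dots> (in0 +++ O')"
    by (rule homotopic_paths_join, rule homotopic_paths_rid_const) (use pin0 pO ends in auto)
  also have "homotopic_paths S \<dots> ((\<kappa>0 +++ I) +++ O')"
    by (rule homotopic_paths_join) (use i pO ends in \<open>auto intro: homotopic_paths_sym\<close>)
  also have "homotopic_paths S \<dots> (\<kappa>0 +++ (I +++ O'))"
    by (rule homotopic_paths_sym, rule homotopic_paths_assoc) (use pk pI pO ends in auto)
  finally have "homotopic_paths S (h +++ \<kappa>1) (\<kappa>0 +++ (I +++ O'))" .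
  moreover have "MM (I +++ O')" using diam[OF c] p0 p1 by (simp add: I_def O'_def)
  ultimately show ?thesis unfolding radially_def
    using h hS pI pO ends hf pk by (intro conjI exI[of _ "I +++ O'"]) (auto simp: \<kappa>0_def \<kappa>1_def subset_path_image_join)
qed

text \<open>An induction principle for paths up to homotopy, in place of a cellular approximation
  theorem. By bisection a path is a product of pieces, each of which lies in some
  \<open>outer \<epsilon>\<close> or in some \<open>inner c\<close>.\<close>

lemma paths_generated:
  assumes hom: "\<And>g h. \<lbrakk>homotopic_paths S g h; MM g\<rbrakk> \<Longrightarrow> MM h"
    and join: "\<And>g h. \<lbrakk>MM g; MM h; path g; path h; pathfinish g = pathstart h\<rbrakk> \<Longrightarrow> MM (g +++ h)"
    and base: "\<And>g. \<lbrakk>path g; path_image g \<subseteq> M\<rbrakk> \<Longrightarrow> MM g"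
    and diam: "\<And>c \<theta> \<theta>'. \<lbrakk>c \<in> C; \<theta> \<in> B; \<theta>' \<in> B\<rbrakk> \<Longrightarrow> MM (radius_in c \<theta> +++ radius_out c \<theta>')"
    and g: "path g" "path_image g \<subseteq> S" "pathstart g \<in> M" "pathfinish g \<in> M"
  shows "MM g"
proof -
  define P where "P a b \<longleftrightarrow> (0 \<le> a \<and> b \<le> 1 \<longrightarrow> radially MM (sub_path a b g))" for a b
  have cg: "continuous_on {a..b} g" "g ` {a..b} \<subseteq> S" if "0 \<le> a" "b \<le> 1" for a b
    using g(1,2) that by (auto simp: path_def path_image_def intro: continuous_on_subset)
  have loc: "\<exists>d>0. \<forall>a b. a \<le> x \<and> x \<le> b \<and> b - a < d \<longrightarrow> P a b" if x: "0 \<le> x" "x \<le> 1" for x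
  proof -
    have main: ?thesis if U: "openin (top_of_set S) U" "g x \<in> U" and
      R: "\<And>h. \<lbrakk>path h; path_image h \<subseteq> U\<rbrakk> \<Longrightarrow> radially MM h" for U
    proof -
      have "openin (top_of_set {0..1}) ({0..1} \<inter> g -` U)"
        using g(1,2) by (intro continuous_openin_preimage[OF _ _ U(1)]) (auto simp: path_def path_image_def)
      moreover have "x \<in> {0..1} \<inter> g -` U" using U x by auto
      ultimately have "\<exists>d>0. ball x d \<inter> {0..1} \<subseteq> {0..1} \<inter> g -` U"
        unfolding openin_contains_ball by blast
      then obtain d where d: "d > 0" "ball x d \<inter> {0..1} \<subseteq> {0..1} \<inter> g -` U" by blast
      show ?thesis
      proof (intro exI[of _ d] conjI allI impI d(1))
        fix a b assume ab: "a \<le> x \<and> x \<le> b \<and> b - a < d"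
        show "P a b" unfolding P_def
        proof
          assume ab1: "0 \<le> a \<and> b \<le> 1"
          have sub: "g ` {a..b} \<subseteq> U"
          proof (rule image_subsetI)
            fix t assume "t \<in> {a..b}"
            then have "t \<in> ball x d \<inter> {0..1}" using ab ab1 by (auto simp: dist_real_def)
            then show "g t \<in> U" using d(2) by blast
          qed
          show "radially MM (sub_path a b g)"
            by (rule R) (use path_sub_path[OF cg(1), of a b] ab ab1 sub in auto)
        qed
      qed
    qed
    have "g x \<in> S" using g(2) x by (auto simp: path_image_def)
    \<comment> \<open>Off the apex, half of the radius serves as \<open>\<epsilon>\<close>; the apex
      itself lies in \<open>inner c\<close>.\<close>
    then have "(\<exists>\<epsilon>>0. \<epsilon> < 1 \<and> g x \<in> outer \<epsilon>) \<or> (\<exists>c\<in>C. g x \<in> inner c)"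
    proof (cases rule: S_cases)
      case 1
      then show ?thesis by (intro disjI1 exI[of _ "1/2"]) (auto simp: outer_def)
    next
      case (2 c \<rho> \<theta>)
      show ?thesis
      proof (cases "\<rho> = 0")
        case True
        have "g x \<in> inner c" unfolding inner_def
          using 2 True by (intro CollectI exI[of _ 0] exI[of _ \<theta>]) simp
        then show ?thesis using 2(1) by blast
      next
        case False
        then have "g x \<in> outer (\<rho> / 2)" using 2 by (subst 2(5), subst cell_in_outer_iff) auto
        then show ?thesis using 2 False by (intro disjI1 exI[of _ "\<rho> / 2"]) auto
      qed
    qed
    then show ?thesis
    proof (elim disjE exE bexE conjE)
      fix \<epsilon> assume \<epsilon>: "0 < \<epsilon>" "\<epsilon> < 1" "g x \<in> outer \<epsilon>"
      show ?thesis
      proof (rule main[OF openin_outer \<epsilon>(3)])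
        show "radially MM h" if "path h" "path_image h \<subseteq> outer \<epsilon>" for h
          by (rule radially_outer[where MM = MM, OF _ that \<epsilon>(1)]) (rule base)
      qed (use \<epsilon> in auto)
    next
      fix c assume c: "c \<in> C" "g x \<in> inner c"
      show ?thesis
      proof (rule main[OF openin_inner[OF c(1)] c(2)])
        show "radially MM h" if "path h" "path_image h \<subseteq> inner c" for h
          by (rule radially_inner[where MM = MM, OF _ that c(1)]) (rule diam)
      qed
    qed
  qed
  have "P 0 1" using zero_le_one
  proof (induction rule: Bolzano)
    case (trans a b c)
    show ?case unfolding P_def
    proof
      assume A: "0 \<le> a \<and> c \<le> 1"
      show "radially MM (sub_path a c g)"
      proof (rule radially_join[where MM = MM])
        show "MM (g +++ h)" if "MM g" "MM h" "path g" "path h" "pathfinish g = pathstart h" for g h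
          by (rule join[OF that])
        show "radially MM (sub_path a b g)" "radially MM (sub_path b c g)"
          using trans A by (auto simp: P_def)
        show "homotopic_paths S (sub_path a b g +++ sub_path b c g) (sub_path a c g)"
          by (rule homotopic_join_sub_paths[OF cg]) (use A trans in auto)
      qed auto
    qed
  next
    case (local x)
    then show ?case by (rule loc)
  qed
  then have "radially MM g" by (simp add: P_def)
  then obtain m where m: "MM m" "path m" "path_image m \<subseteq> S"
     "pathstart m = rad (pathstart g) 1" "pathfinish m = rad (pathfinish g) 1"
     "homotopic_paths S (g +++ rad (pathfinish g)) (rad (pathstart g) +++ m)"
    unfolding radially_def by auto
  have r: "rad (pathstart g) = (\<lambda>_. pathstart g)" "rad (pathfinish g) = (\<lambda>_. pathfinish g)"
    using g by (auto simp: rad_M)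
  have "homotopic_paths S m ((\<lambda>_. pathstart g) +++ m)"
    by (rule homotopic_paths_sym, rule homotopic_paths_lid_const) (use m r in auto)
  also have "homotopic_paths S \<dots> (g +++ (\<lambda>_. pathfinish g))"
    using m(6) unfolding r by (rule homotopic_paths_sym)
  also have "homotopic_paths S \<dots> g"
    by (rule homotopic_paths_rid_const) (use g in auto)
  finally show ?thesis using m(1) by (rule hom)
qed

end


section \<open>Extending a covering over attached cones\<close>

text \<open>A topology that makes a partially defined map continuous if its domain is open and its
  restriction to the domain is continuous: \<open>Base\<close> stands for ``undefined''.\<close>

datatype 'a pointed = Base | Pt (the_Pt: 'a)

instantiation pointed :: (topological_space) topological_space
begin

definition open_pointed :: "'a pointed set \<Rightarrow> bool" where
  "open_pointed W \<longleftrightarrow> W = UNIV \<or> (Base \<notin> W \<and> open (Pt -` W))"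

instance
proof
  show "open (UNIV :: 'a pointed set)" by (simp add: open_pointed_def)
  show "open (S \<inter> T)" if "open S" "open T" for S T :: "'a pointed set"
    using that by (auto simp: open_pointed_def)
  show "open (\<Union>K)" if "\<forall>S\<in>K. open S" for K :: "'a pointed set set"
  proof (cases "UNIV \<in> K")
    case False
    then have "\<forall>S\<in>K. Base \<notin> S \<and> open (Pt -` S)" using that by (metis open_pointed_def)
    then show ?thesis by (auto simp: open_pointed_def vimage_Union)
  qed (auto simp: open_pointed_def)
qed

end

lemma open_Pt: "open U \<Longrightarrow> open (Pt ` U)"
  by (auto simp: open_pointed_def inj_vimage_image_eq inj_def)

lemma continuous_on_pointedI:
  fixes f :: "'a::topological_space \<Rightarrow> 'b::topological_space pointed"
  assumes "\<And>U. open U \<Longrightarrow> openin (top_of_set D) {x \<in> D. f x \<in> Pt ` U}"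
  shows "continuous_on D f"
  unfolding continuous_on_open_invariant
proof (intro allI impI)
  fix W :: "'b pointed set" assume "open W"
  then consider "W = UNIV" | "W = Pt ` (Pt -` W)" "open (Pt -` W)"
    unfolding open_pointed_def by (metis image_vimage_eq Int_absorb2 pointed.exhaust rangeI subsetI)
  then show "\<exists>A. open A \<and> A \<inter> D = f -` W \<inter> D"
  proof cases
    case 1
    then show ?thesis by (intro exI[of _ UNIV]) auto
  next
    case 2
    from assms[OF 2(2)] obtain A where "open A" "{x \<in> D. f x \<in> W} = D \<inter> A"
      unfolding 2(1)[symmetric] by (auto simp: openin_open)
    then show ?thesis by (intro exI[of _ A]) auto
  qed
qed

lemma continuous_on_Pt [continuous_intros]:
  fixes g :: "'a::topological_space \<Rightarrow> 'b::topological_space"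
  shows "continuous_on D g \<Longrightarrow> continuous_on D (\<lambda>x. Pt (g x))"
proof (rule continuous_on_pointedI)
  fix U :: "'b set" assume "continuous_on D g" "open U"
  moreover have "{x \<in> D. Pt (g x) \<in> Pt ` U} = D \<inter> g -` U" by auto
  ultimately show "openin (top_of_set D) {x \<in> D. Pt (g x) \<in> Pt ` U}"
    by (simp add: continuous_openin_preimage_gen)
qed

lemma continuous_on_snd_apply:
  "continuous_on UNIV (\<lambda>t::'x::topological_space \<times> ('k \<Rightarrow> 'y::topological_space). snd t k)"
  by (rule continuous_on_compose2[OF continuous_on_product_coordinates continuous_on_snd[OF continuous_on_id]]) auto

text \<open>Over a cone the sheets are labelled by the points \<open>l\<close> over \<open>\<Psi> c 1 0\<close>, and \<open>lft c l\<close> is the lift of the attaching map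
  to the sheet \<open>l\<close>. For a 2-cell \<open>lift_compat\<close> says that its boundary lifts to closed paths.\<close>

locale cone_cover = cone_complex S M C B \<Psi>
  for S M :: "'a::t2_space set" and C :: "'c set" and B \<Psi> +
  fixes T :: "'t::topological_space set" and p :: "'t \<Rightarrow> 'a" and lft :: "'c \<Rightarrow> 't \<Rightarrow> real \<Rightarrow> 't"
  assumes cov: "covering_space T p M"
    and lift_cont: "\<lbrakk>c \<in> C; l \<in> T; p l = \<Psi> c 1 0\<rbrakk> \<Longrightarrow> continuous_on B (lft c l)"
    and lift_in: "\<lbrakk>c \<in> C; l \<in> T; p l = \<Psi> c 1 0; \<theta> \<in> B\<rbrakk> \<Longrightarrow> lft c l \<theta> \<in> T \<and> p (lft c l \<theta>) = \<Psi> c 1 \<theta>"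
    and lift_surj: "\<lbrakk>c \<in> C; \<theta> \<in> B; \<xi> \<in> T; p \<xi> = \<Psi> c 1 \<theta>\<rbrakk> \<Longrightarrow> \<exists>l\<in>T. p l = \<Psi> c 1 0 \<and> lft c l \<theta> = \<xi>"
    and lift_inj: "\<lbrakk>c \<in> C; \<theta> \<in> B; l \<in> T; l' \<in> T; p l = \<Psi> c 1 0; p l' = \<Psi> c 1 0; lft c l \<theta> = lft c l' \<theta>\<rbrakk> \<Longrightarrow> l = l'"
    and lift_compat: "\<lbrakk>c \<in> C; \<theta> \<in> B; \<theta>' \<in> B; l \<in> T; p l = \<Psi> c 1 0; \<And>\<sigma>. \<Psi> c \<sigma> \<theta> = \<Psi> c \<sigma> \<theta>'\<rbrakk> \<Longrightarrow> lft c l \<theta> = lft c l \<theta>'"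
begin

definition Lab :: "'c \<Rightarrow> 't set" where
  "Lab c = {l \<in> T. p l = \<Psi> c 1 0}"

text \<open>A point of the new space is recorded by its image in \<open>S\<close> and by partial
  coordinates. The coordinate \<open>None\<close> is the point of \<open>T\<close> reached by the
  radial flow and is undefined at the apexes; the coordinate \<open>Some c\<close> is the sheet and
  is defined inside the cell \<open>c\<close> only. Both domains are open, so \<open>Total\<close>
  can carry the subspace topology of a product.\<close>

definition base_pt :: "'t \<Rightarrow> 'a \<times> ('c option \<Rightarrow> 't pointed)" where
  "base_pt \<xi> = (p \<xi>, \<lambda>k. case k of None \<Rightarrow> Pt \<xi> | Some _ \<Rightarrow> Base)"

definition cell_pt :: "'c \<Rightarrow> 't \<Rightarrow> real \<Rightarrow> real \<Rightarrow> 'a \<times> ('c option \<Rightarrow> 't pointed)" where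
  "cell_pt c l \<rho> \<theta> = (\<Psi> c \<rho> \<theta>, \<lambda>k. case k of
      None \<Rightarrow> if \<rho> > 0 then Pt (lft c l \<theta>) else Base
    | Some c' \<Rightarrow> if c' = c \<and> \<rho> < 1 then Pt l else Base)"

definition Total :: "('a \<times> ('c option \<Rightarrow> 't pointed)) set" where
  "Total = base_pt ` T \<union> {cell_pt c l \<rho> \<theta> | c l \<rho> \<theta>. c \<in> C \<and> l \<in> Lab c \<and> 0 \<le> \<rho> \<and> \<rho> < 1 \<and> \<theta> \<in> B}"

lemma fst_base_pt [simp]: "fst (base_pt \<xi>) = p \<xi>"
  and fst_cell_pt [simp]: "fst (cell_pt c l \<rho> \<theta>) = \<Psi> c \<rho> \<theta>"
  by (auto simp: base_pt_def cell_pt_def)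

lemma cell_pt_1: "\<lbrakk>c \<in> C; l \<in> Lab c; \<theta> \<in> B\<rbrakk> \<Longrightarrow> cell_pt c l 1 \<theta> = base_pt (lft c l \<theta>)"
  using lift_in by (auto simp: base_pt_def cell_pt_def Lab_def fun_eq_iff split: option.split)

lemma p_in_M: "\<xi> \<in> T \<Longrightarrow> p \<xi> \<in> M"
  using cov by (auto simp: covering_space_def)

lemma cell_pt_in_Total:
  assumes "c \<in> C" "l \<in> Lab c" "0 \<le> \<rho>" "\<rho> \<le> 1" "\<theta> \<in> B"
  shows "cell_pt c l \<rho> \<theta> \<in> Total"
proof (cases "\<rho> = 1")
  case True
  then show ?thesis using assms lift_in cell_pt_1 by (auto simp: Total_def Lab_def)
next
  case False
  then have "\<rho> < 1" using assms by simp
  then show ?thesis using assms unfolding Total_def by blast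
qed

text \<open>Independence of the choice of cone coordinates; this is what \<open>lift_compat\<close>
  is for.\<close>

lemma cell_pt_eq:
  assumes "c \<in> C" "l \<in> Lab c" "0 \<le> \<rho>" "\<rho> < 1" "\<theta> \<in> B" "c' \<in> C" "0 \<le> \<rho>'" "\<rho>' < 1" "\<theta>' \<in> B"
    and "\<Psi> c \<rho> \<theta> = \<Psi> c' \<rho>' \<theta>'"
  shows "cell_pt c l \<rho> \<theta> = cell_pt c' l \<rho>' \<theta>'"
proof -
  have *: "c = c'" "\<rho> = \<rho>'" "\<rho> = 0 \<or> (\<forall>\<sigma>. \<Psi> c \<sigma> \<theta> = \<Psi> c \<sigma> \<theta>')"
    using inj[OF assms(1,6,5,9,3,4,7,8,10)] by auto
  have "lft c l \<theta> = lft c l \<theta>'" if "\<rho> \<noteq> 0"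
    by (rule lift_compat) (use * that assms in \<open>auto simp: Lab_def\<close>)
  then show ?thesis using * assms(3,10) by (auto simp: cell_pt_def)
qed

lemma continuous_on_base_pt: "continuous_on T base_pt"
  unfolding base_pt_def
proof (intro continuous_on_Pair continuous_on_coordinatewise_then_product)
  show "continuous_on T p" using cov by (rule covering_space_imp_continuous)
  show "continuous_on T (\<lambda>\<xi>. case k of None \<Rightarrow> Pt \<xi> | Some x \<Rightarrow> Base)" for k
    by (cases k) (auto intro!: continuous_intros)
qed

lemma continuous_on_cell_pt:
  assumes "c \<in> C" "l \<in> Lab c"
  shows "continuous_on ({0..1} \<times> B) (\<lambda>z. cell_pt c l (fst z) (snd z))"
  unfolding cell_pt_def
proof (intro continuous_on_Pair continuous_on_coordinatewise_then_product)
  let ?D = "{0..1::real} \<times> B"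
  show "continuous_on ?D (\<lambda>z. \<Psi> c (fst z) (snd z))" by (rule cont[OF assms(1)])
  fix k
  show "continuous_on ?D (\<lambda>z. case k of None \<Rightarrow> if fst z > 0 then Pt (lft c l (snd z)) else Base
      | Some c' \<Rightarrow> if c' = c \<and> fst z < 1 then Pt l else Base)"
  proof (cases k)
    case None
    have "continuous_on ?D (\<lambda>z. if fst z > 0 then Pt (lft c l (snd z)) else Base)"
    proof (rule continuous_on_pointedI)
      fix U :: "'t set" assume "open U"
      moreover have "continuous_on ?D (\<lambda>z. lft c l (snd z))"
        by (rule continuous_on_compose2[OF lift_cont]) (use assms in \<open>auto simp: Lab_def intro!: continuous_intros\<close>)
      ultimately have "openin (top_of_set ?D) (?D \<inter> (\<lambda>z. lft c l (snd z)) -` U)"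
        by (simp add: continuous_openin_preimage_gen)
      then have "openin (top_of_set ?D) (?D \<inter> (\<lambda>z. lft c l (snd z)) -` U \<inter> {z \<in> ?D. 0 < fst z})"
        by (rule openin_Int[OF _ openin_fst_greater])
      moreover have "{z \<in> ?D. (if fst z > 0 then Pt (lft c l (snd z)) else Base) \<in> Pt ` U} =
          ?D \<inter> (\<lambda>z. lft c l (snd z)) -` U \<inter> {z \<in> ?D. 0 < fst z}" by auto
      ultimately show "openin (top_of_set ?D) {z \<in> ?D. (if fst z > 0 then Pt (lft c l (snd z)) else Base) \<in> Pt ` U}"
        by (simp only:)
    qed
    then show ?thesis using None by simp
  next
    case (Some c')
    show ?thesis
    proof (cases "c' = c")
      case True
      have "continuous_on ?D (\<lambda>z. if fst z < 1 then Pt l else Base)"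
      proof (rule continuous_on_pointedI)
        fix U :: "'t set" assume "open U"
        have "{z \<in> ?D. (if fst z < 1 then Pt l else Base) \<in> Pt ` U} = (if l \<in> U then {z \<in> ?D. fst z < 1} else {})"
          by auto
        then show "openin (top_of_set ?D) {z \<in> ?D. (if fst z < 1 then Pt l else Base) \<in> Pt ` U}"
          using openin_fst_less[of 1] by (simp only: openin_empty split: if_split) simp
      qed
      then show ?thesis using Some True by simp
    qed (use Some in simp)
  qed
qed

lemma Total_over_cell:
  assumes "t \<in> Total" "fst t \<notin> M"
  obtains c l \<rho> \<theta> where "c \<in> C" "l \<in> Lab c" "0 \<le> \<rho>" "\<rho> < 1" "\<theta> \<in> B" "t = cell_pt c l \<rho> \<theta>"
proof -
  have "t \<notin> base_pt ` T" using assms(2) p_in_M by auto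
  then show thesis using assms(1) that unfolding Total_def by blast
qed

lemma Total_over_M: "Total \<inter> fst -` M = base_pt ` T"
proof
  show "Total \<inter> fst -` M \<subseteq> base_pt ` T"
  proof
    fix t assume t: "t \<in> Total \<inter> fst -` M"
    show "t \<in> base_pt ` T"
    proof (rule ccontr)
      assume "t \<notin> base_pt ` T"
      then obtain c l \<rho> \<theta> where *: "c \<in> C" "0 \<le> \<rho>" "\<rho> < 1" "\<theta> \<in> B" "t = cell_pt c l \<rho> \<theta>"
        using t unfolding Total_def by blast
      then have "fst t \<notin> M" using interior_notin by simp
      then show False using t by simp
    qed
  qed
qed (use p_in_M in \<open>auto simp: Total_def\<close>)

lemma fst_Total:
  assumes "t \<in> Total"
  shows "fst t \<in> S"
proof (cases "fst t \<in> M")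
  case False
  obtain c l \<rho> \<theta> where "c \<in> C" "l \<in> Lab c" "0 \<le> \<rho>" "\<rho> < 1" "\<theta> \<in> B" "t = cell_pt c l \<rho> \<theta>"
    by (rule Total_over_cell[OF assms False])
  then show ?thesis using cell_in_S by simp
qed (use M_subset in auto)

definition open_cell :: "'c \<Rightarrow> 'a set" where
  "open_cell c = {\<Psi> c \<rho> \<theta> | \<rho> \<theta>. 0 \<le> \<rho> \<and> \<rho> < 1 \<and> \<theta> \<in> B}"

lemma cell_in_open_cell_iff:
  assumes "c \<in> C" "c' \<in> C" "0 \<le> \<rho>" "\<rho> \<le> 1" "\<theta> \<in> B"
  shows "\<Psi> c \<rho> \<theta> \<in> open_cell c' \<longleftrightarrow> \<rho> < 1 \<and> c = c'"
proof
  assume "\<Psi> c \<rho> \<theta> \<in> open_cell c'"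
  then obtain \<rho>' \<theta>' where "\<Psi> c' \<rho>' \<theta>' = \<Psi> c \<rho> \<theta>" "0 \<le> \<rho>'" "\<rho>' < 1" "\<theta>' \<in> B" by (auto simp: open_cell_def)
  then show "\<rho> < 1 \<and> c = c'" using inj_le[of c' c \<theta>' \<theta> \<rho>' \<rho>] assms by auto
qed (use assms in \<open>auto simp: open_cell_def\<close>)

lemma open_cell_subset: "c \<in> C \<Longrightarrow> open_cell c \<subseteq> S"
  using cell_in_S by (auto simp: open_cell_def)

lemma open_cell_notin_M: "c \<in> C \<Longrightarrow> open_cell c \<inter> M = {}"
  using interior_notin by (auto simp: open_cell_def)

lemma openin_cell_subset:
  assumes "c \<in> C" "A \<subseteq> open_cell c"
    and "openin (top_of_set ({0..1} \<times> B)) {z \<in> {0..1} \<times> B. fst z < 1 \<and> \<Psi> c (fst z) (snd z) \<in> A}"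
  shows "openin (top_of_set S) A"
proof (rule openinI)
  show "A \<subseteq> S" using open_cell_subset assms by blast
  have "A \<inter> M = {}" using open_cell_notin_M assms by blast
  then show "openin (top_of_set M) (A \<inter> M)" by simp
  fix c' assume c': "c' \<in> C"
  show "openin (top_of_set ({0..1} \<times> B)) {z \<in> {0..1} \<times> B. \<Psi> c' (fst z) (snd z) \<in> A}"
  proof (cases "c' = c")
    case True
    have "{z \<in> {0..1} \<times> B. \<Psi> c' (fst z) (snd z) \<in> A} = {z \<in> {0..1} \<times> B. fst z < 1 \<and> \<Psi> c (fst z) (snd z) \<in> A}"
      using cell_in_open_cell_iff[OF assms(1,1)] assms(2) True by auto
    then show ?thesis using assms(3) by (simp only:)
  next
    case False
    have "{z \<in> {0..1} \<times> B. \<Psi> c' (fst z) (snd z) \<in> A} = {}"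
      using cell_in_open_cell_iff[OF c' assms(1)] assms(2) False by auto
    then show ?thesis by (metis openin_empty)
  qed
qed

lemma openin_open_cell: "c \<in> C \<Longrightarrow> openin (top_of_set S) (open_cell c)"
proof (rule openin_cell_subset)
  assume "c \<in> C"
  then have "{z \<in> {0..1} \<times> B. fst z < 1 \<and> \<Psi> c (fst z) (snd z) \<in> open_cell c} = {z \<in> {0..1} \<times> B. fst z < 1}"
    using cell_in_open_cell_iff by auto
  then show "openin (top_of_set ({0..1} \<times> B)) {z \<in> {0..1} \<times> B. fst z < 1 \<and> \<Psi> c (fst z) (snd z) \<in> open_cell c}"
    using openin_fst_less[of 1] by (simp only:)
qed auto

lemma continuous_onI_openin:
  fixes f :: "'a \<Rightarrow> 'd::topological_space"
  assumes "X \<subseteq> S" "\<And>W. open W \<Longrightarrow> openin (top_of_set S) {x \<in> X. f x \<in> W}"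
  shows "continuous_on X f"
  unfolding continuous_on_open_invariant
proof (intro allI impI)
  fix W :: "'d set" assume "open W"
  from assms(2)[OF this] obtain A where "open A" "{x \<in> X. f x \<in> W} = S \<inter> A" by (auto simp: openin_open)
  then show "\<exists>A. open A \<and> A \<inter> X = f -` W \<inter> X" using assms(1) by (intro exI[of _ A]) blast
qed

definition cell_section :: "'t \<Rightarrow> 'a \<Rightarrow> 'a \<times> ('c option \<Rightarrow> 't pointed)" where
  "cell_section l x = (case coord x of (c, \<rho>, \<theta>) \<Rightarrow> cell_pt c l \<rho> \<theta>)"

lemma cell_section:
  assumes "c \<in> C" "l \<in> Lab c" "0 \<le> \<rho>" "\<rho> < 1" "\<theta> \<in> B"
  shows "cell_section l (\<Psi> c \<rho> \<theta>) = cell_pt c l \<rho> \<theta>"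
proof -
  obtain c' \<rho>' \<theta>' where *: "coord (\<Psi> c \<rho> \<theta>) = (c', \<rho>', \<theta>')" "c' \<in> C" "0 \<le> \<rho>'" "\<rho>' < 1" "\<theta>' \<in> B" "\<Psi> c \<rho> \<theta> = \<Psi> c' \<rho>' \<theta>'"
  proof -
    have "\<Psi> c \<rho> \<theta> \<in> S" "\<Psi> c \<rho> \<theta> \<notin> M" using assms interior_notin cell_in_S by auto
    then show thesis by (rule coordE) (use that in blast)
  qed
  then have "cell_pt c l \<rho> \<theta> = cell_pt c' l \<rho>' \<theta>'" using cell_pt_eq assms by blast
  then show ?thesis using *(1) by (simp add: cell_section_def)
qed

text \<open>The coordinate \<open>Some c\<close> separates the sheets over an open cell. The inverse
  of the projection on a sheet keeps the label and reads off the cone coordinates.\<close>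

lemma evenly_covered_cell:
  assumes c: "c \<in> C"
  defines "v \<equiv> (\<lambda>l. {cell_pt c l \<rho> \<theta> | \<rho> \<theta>. 0 \<le> \<rho> \<and> \<rho> < 1 \<and> \<theta> \<in> B}) ` Lab c"
  shows "\<Union>v = Total \<inter> fst -` open_cell c \<and> (\<forall>u\<in>v. openin (top_of_set Total) u) \<and> pairwise disjnt v \<and>
    (\<forall>u\<in>v. \<exists>q. homeomorphism u (open_cell c) fst q)"
proof (intro conjI ballI)
  show "\<Union>v = Total \<inter> fst -` open_cell c"
  proof (intro equalityI subsetI)
    fix t assume "t \<in> \<Union>v"
    then obtain l \<rho> \<theta> where *: "l \<in> Lab c" "t = cell_pt c l \<rho> \<theta>" "0 \<le> \<rho>" "\<rho> < 1" "\<theta> \<in> B"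
      by (auto simp: v_def)
    then have "t \<in> Total" using c by (auto intro: cell_pt_in_Total)
    moreover have "fst t \<in> open_cell c" using * unfolding open_cell_def by auto
    ultimately show "t \<in> Total \<inter> fst -` open_cell c" by simp
  next
    fix t assume t: "t \<in> Total \<inter> fst -` open_cell c"
    then have "fst t \<notin> M" using open_cell_notin_M[OF c] by auto
    then obtain c' l \<rho> \<theta> where *: "c' \<in> C" "l \<in> Lab c'" "0 \<le> \<rho>" "\<rho> < 1" "\<theta> \<in> B" "t = cell_pt c' l \<rho> \<theta>"
      using Total_over_cell t by blast
    then have "c' = c" using cell_in_open_cell_iff[of c' c \<rho> \<theta>] c t by auto
    then show "t \<in> \<Union>v" using * by (auto simp: v_def)
  qed
  show "pairwise disjnt v"
  proof (rule pairwiseI)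
    fix u u' assume "u \<in> v" "u' \<in> v" "u \<noteq> u'"
    then obtain l l' where l: "u = {cell_pt c l \<rho> \<theta> | \<rho> \<theta>. 0 \<le> \<rho> \<and> \<rho> < 1 \<and> \<theta> \<in> B}"
       "u' = {cell_pt c l' \<rho> \<theta> | \<rho> \<theta>. 0 \<le> \<rho> \<and> \<rho> < 1 \<and> \<theta> \<in> B}" "l \<noteq> l'"
      by (auto simp: v_def)
    have "snd t (Some c) = Pt l" if "t \<in> u" for t using that l by (auto simp: cell_pt_def)
    moreover have "snd t (Some c) = Pt l'" if "t \<in> u'" for t using that l by (auto simp: cell_pt_def)
    ultimately show "disjnt u u'" using l(3) unfolding disjnt_iff by (metis pointed.inject)
  qed
  fix u assume "u \<in> v"
  then obtain l where l: "l \<in> Lab c" and u: "u = {cell_pt c l \<rho> \<theta> | \<rho> \<theta>. 0 \<le> \<rho> \<and> \<rho> < 1 \<and> \<theta> \<in> B}"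
    by (auto simp: v_def)
  show "openin (top_of_set Total) u"
  proof -
    have "l \<in> T" "p l = \<Psi> c 1 0" using l by (auto simp: Lab_def)
    then obtain X V where V: "\<Psi> c 1 0 \<in> X" "openin (top_of_set M) X" "\<Union>V = T \<inter> p -` X"
      "\<And>u. u \<in> V \<Longrightarrow> openin (top_of_set T) u" "pairwise disjnt V" "\<And>u. u \<in> V \<Longrightarrow> \<exists>q. homeomorphism u X p q"
      using covering_space_evenly[OF cov, of "\<Psi> c 1 0"] p_in_M by metis
    have "l \<in> \<Union>V" unfolding V(3) using \<open>l \<in> T\<close> \<open>p l = _\<close> V(1) by simp
    then obtain w where w: "w \<in> V" "l \<in> w" by blast
    obtain U where U: "open U" "w = T \<inter> U" using V(4)[OF w(1)] by (auto simp: openin_open)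
    obtain q where q: "homeomorphism w X p q" using V(6) w by blast
    \<comment> \<open>A sheet of \<open>p\<close> around \<open>l\<close> contains no other label,
      so an open condition on the coordinate \<open>Some c\<close> pins the label down.\<close>
    have sep: "l' = l" if "l' \<in> Lab c" "l' \<in> U" for l'
    proof -
      have "l' \<in> w" "p l' = p l" using that U(2) \<open>p l = _\<close> by (auto simp: Lab_def)
      then show ?thesis using homeomorphism_apply1[OF q, of l] homeomorphism_apply1[OF q, of l'] w(2) by simp
    qed
    obtain A where A: "open A" "open_cell c = S \<inter> A" using openin_open_cell[OF c] by (auto simp: openin_open)
    have "u = Total \<inter> ({t. fst t \<in> A} \<inter> {t. snd t (Some c) \<in> Pt ` U})"
    proof (intro equalityI subsetI)
      fix t assume "t \<in> u"
      then obtain \<rho> \<theta> where t: "t = cell_pt c l \<rho> \<theta>" "0 \<le> \<rho>" "\<rho> < 1" "\<theta> \<in> B" using u by auto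
      have "fst t \<in> open_cell c" using t by (auto simp: open_cell_def)
      moreover have "t \<in> Total" using t c l by (auto intro: cell_pt_in_Total)
      moreover have "snd t (Some c) = Pt l" using t by (simp add: cell_pt_def)
      ultimately show "t \<in> Total \<inter> ({t. fst t \<in> A} \<inter> {t. snd t (Some c) \<in> Pt ` U})" using A w U by auto
    next
      fix t assume t: "t \<in> Total \<inter> ({t. fst t \<in> A} \<inter> {t. snd t (Some c) \<in> Pt ` U})"
      then have "fst t \<notin> M" by (auto simp: Total_def base_pt_def interior_notin)
      then obtain c' l' \<rho> \<theta> where *: "c' \<in> C" "l' \<in> Lab c'" "0 \<le> \<rho>" "\<rho> < 1" "\<theta> \<in> B" "t = cell_pt c' l' \<rho> \<theta>"
        using Total_over_cell t by blast
      have "snd t (Some c) \<in> Pt ` U" using t by simp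
      then have "c' = c" "l' \<in> U" using * by (auto simp: cell_pt_def split: if_splits)
      then have "l' = l" using sep * by auto
      then show "t \<in> u" using * \<open>c' = c\<close> u by auto
    qed
    moreover have "open ({t. fst t \<in> A} \<inter> {t::'a \<times> ('c option \<Rightarrow> 't pointed). snd t (Some c) \<in> Pt ` U})"
    proof (intro open_Int)
      show "open {t::'a \<times> ('c option \<Rightarrow> 't pointed). fst t \<in> A}"
        using open_vimage[OF A(1), of fst] by (simp add: vimage_def continuous_on_fst)
      show "open {t::'a \<times> ('c option \<Rightarrow> 't pointed). snd t (Some c) \<in> Pt ` U}"
        using continuous_on_snd_apply[of "Some c"] open_vimage[OF open_Pt[OF U(1)]] by (simp add: vimage_def)
    qed
    ultimately show ?thesis by (metis openin_open_Int)
  qed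
  show "\<exists>q. homeomorphism u (open_cell c) fst q"
  proof (rule exI[of _ "cell_section l"], rule homeomorphismI)
    show "continuous_on u fst" by (intro continuous_intros)
    show "continuous_on (open_cell c) (cell_section l)"
    proof (rule continuous_onI_openin[OF open_cell_subset[OF c]])
      fix W :: "('a \<times> ('c option \<Rightarrow> 't pointed)) set" assume "open W"
      show "openin (top_of_set S) {x \<in> open_cell c. cell_section l x \<in> W}"
      proof (rule openin_cell_subset[OF c])
        have "openin (top_of_set ({0..1} \<times> B)) (({0..1} \<times> B) \<inter> (\<lambda>z. cell_pt c l (fst z) (snd z)) -` W)"
          using continuous_on_cell_pt[OF c l] \<open>open W\<close> by (simp add: continuous_openin_preimage_gen)
        then have "openin (top_of_set ({0..1} \<times> B)) ({z \<in> {0..1} \<times> B. fst z < 1} \<inter> (({0..1} \<times> B) \<inter> (\<lambda>z. cell_pt c l (fst z) (snd z)) -` W))"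
          by (rule openin_Int[OF openin_fst_less])
        moreover have "{z \<in> {0..1} \<times> B. fst z < 1 \<and> \<Psi> c (fst z) (snd z) \<in> {x \<in> open_cell c. cell_section l x \<in> W}} =
           {z \<in> {0..1} \<times> B. fst z < 1} \<inter> (({0..1} \<times> B) \<inter> (\<lambda>z. cell_pt c l (fst z) (snd z)) -` W)"
          using cell_section[OF c l] cell_in_open_cell_iff[OF c c] by auto
        ultimately show "openin (top_of_set ({0..1} \<times> B)) {z \<in> {0..1} \<times> B. fst z < 1 \<and> \<Psi> c (fst z) (snd z) \<in> {x \<in> open_cell c. cell_section l x \<in> W}}"
          by (simp only:)
      qed auto
    qed
    show "fst ` u \<subseteq> open_cell c"
    proof (rule image_subsetI)
      fix t assume "t \<in> u"
      then obtain \<rho> \<theta> where "t = cell_pt c l \<rho> \<theta>" "0 \<le> \<rho>" "\<rho> < 1" "\<theta> \<in> B" unfolding u by blast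
      then show "fst t \<in> open_cell c" unfolding open_cell_def by auto
    qed
    show "cell_section l ` open_cell c \<subseteq> u"
    proof (rule image_subsetI)
      fix x assume "x \<in> open_cell c"
      then obtain \<rho> \<theta> where "x = \<Psi> c \<rho> \<theta>" "0 \<le> \<rho>" "\<rho> < 1" "\<theta> \<in> B" by (auto simp: open_cell_def)
      then show "cell_section l x \<in> u" using cell_section[OF c l] unfolding u by blast
    qed
    show "cell_section l (fst t) = t" if "t \<in> u" for t
      using that cell_section[OF c l] unfolding u by auto
    show "fst (cell_section l x) = x" if "x \<in> open_cell c" for x
      using that cell_section[OF c l] unfolding open_cell_def by auto
  qed
qed

text \<open>A local section \<open>q\<close> of \<open>p\<close> extends along radii: the label over
  \<open>x\<close> is the one whose lift passes through \<open>q (rad x 1)\<close>.\<close>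

definition outer_section :: "('a \<Rightarrow> 't) \<Rightarrow> 'a \<Rightarrow> 'a \<times> ('c option \<Rightarrow> 't pointed)" where
  "outer_section q x = (if x \<in> M then base_pt (q x) else case coord x of (c, \<rho>, \<theta>) \<Rightarrow>
     cell_pt c (THE l. l \<in> Lab c \<and> lft c l \<theta> = q (rad x 1)) \<rho> \<theta>)"

lemma outer_section_cell:
  assumes c: "c \<in> C" "l \<in> Lab c" "0 < \<rho>" "\<rho> \<le> 1" "\<theta> \<in> B" and q: "q (\<Psi> c 1 \<theta>) = lft c l \<theta>"
  shows "outer_section q (\<Psi> c \<rho> \<theta>) = cell_pt c l \<rho> \<theta>"
proof (cases "\<rho> = 1")
  case True
  then show ?thesis using bd[of c \<theta>] c q cell_pt_1 by (simp add: outer_section_def)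
next
  case False
  then have \<rho>: "0 \<le> \<rho>" "\<rho> < 1" using c by auto
  have nM: "\<Psi> c \<rho> \<theta> \<notin> M" "\<Psi> c \<rho> \<theta> \<in> S" using c \<rho> interior_notin cell_in_S by auto
  obtain c' \<rho>' \<theta>' where *: "coord (\<Psi> c \<rho> \<theta>) = (c', \<rho>', \<theta>')" "c' \<in> C" "0 \<le> \<rho>'" "\<rho>' < 1" "\<theta>' \<in> B" "\<Psi> c \<rho> \<theta> = \<Psi> c' \<rho>' \<theta>'"
    using coordE[OF nM(2,1)] by metis
  have e: "c' = c" "\<rho>' = \<rho>" "\<And>\<sigma>. \<Psi> c \<sigma> \<theta> = \<Psi> c \<sigma> \<theta>'"
    using inj[OF c(1) *(2) c(5) *(5) \<rho> *(3,4,6)] c(3) by auto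
  have l\<theta>: "lft c l \<theta>' = lft c l \<theta>"
    using lift_compat[of c \<theta> \<theta>' l] e c * by (auto simp: Lab_def)
  have "(THE l. l \<in> Lab c \<and> lft c l \<theta>' = q (rad (\<Psi> c \<rho> \<theta>) 1)) = l"
  proof (rule the_equality)
    have "rad (\<Psi> c \<rho> \<theta>) 1 = \<Psi> c 1 \<theta>" using rad_cell[OF c(1,3,4,5)] by simp
    then show a: "l \<in> Lab c \<and> lft c l \<theta>' = q (rad (\<Psi> c \<rho> \<theta>) 1)" using c q l\<theta> by simp
    show "l' = l" if "l' \<in> Lab c \<and> lft c l' \<theta>' = q (rad (\<Psi> c \<rho> \<theta>) 1)" for l'
      using lift_inj[of c \<theta>' l' l] that a c * by (auto simp: Lab_def)
  qed
  then have "outer_section q (\<Psi> c \<rho> \<theta>) = cell_pt c l \<rho> \<theta>'"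
    using nM * e by (simp add: outer_section_def)
  also have "\<dots> = cell_pt c l \<rho> \<theta>"
    by (rule cell_pt_eq) (use c \<rho> * e in auto)
  finally show ?thesis .
qed

lemma rad_1_cell: "\<lbrakk>c \<in> C; 0 < \<rho>; \<rho> \<le> 1; \<theta> \<in> B\<rbrakk> \<Longrightarrow> rad (\<Psi> c \<rho> \<theta>) 1 = \<Psi> c 1 \<theta>"
  using rad_cell by simp

lemma openin_radial_preimage:
  assumes X: "openin (top_of_set M) X"
  shows "openin (top_of_set S) {x \<in> outer 0. rad x 1 \<in> X}"
proof (rule openinI)
  show "{x \<in> outer 0. rad x 1 \<in> X} \<subseteq> S" using outer_subset[of 0] by auto
  have "X \<subseteq> M" using X openin_imp_subset by blast
  then have "{x \<in> outer 0. rad x 1 \<in> X} \<inter> M = X" by (auto simp: rad_M outer_def)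
  then show "openin (top_of_set M) ({x \<in> outer 0. rad x 1 \<in> X} \<inter> M)" using X by simp
  fix c assume c: "c \<in> C"
  let ?D = "{0..1::real} \<times> B"
  have "continuous_on ?D (\<lambda>z. \<Psi> c 1 (snd z))"
    by (rule continuous_on_compose2[OF cont[OF c], where f = "\<lambda>z. (1, snd z)", simplified fst_conv snd_conv])
       (auto intro!: continuous_intros)
  then have "openin (top_of_set ?D) (?D \<inter> (\<lambda>z. \<Psi> c 1 (snd z)) -` X)"
    by (rule continuous_openin_preimage[OF _ _ X]) (use bd c in auto)
  then have "openin (top_of_set ?D) ({z \<in> ?D. 0 < fst z} \<inter> (?D \<inter> (\<lambda>z. \<Psi> c 1 (snd z)) -` X))"
    by (rule openin_Int[OF openin_fst_greater])
  moreover have "{z \<in> ?D. \<Psi> c (fst z) (snd z) \<in> {x \<in> outer 0. rad x 1 \<in> X}} =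
     {z \<in> ?D. 0 < fst z} \<inter> (?D \<inter> (\<lambda>z. \<Psi> c 1 (snd z)) -` X)"
    using cell_in_outer_iff[OF c, of _ _ 0] rad_1_cell[OF c] by auto
  ultimately show "openin (top_of_set ?D) {z \<in> ?D. \<Psi> c (fst z) (snd z) \<in> {x \<in> outer 0. rad x 1 \<in> X}}"
    by (simp only:)
qed

lemma Total_over_outer:
  assumes "t \<in> Total" "fst t \<in> outer 0"
  obtains \<xi> where "\<xi> \<in> T" "t = base_pt \<xi>" |
    c l \<rho> \<theta> where "c \<in> C" "l \<in> Lab c" "0 < \<rho>" "\<rho> < 1" "\<theta> \<in> B" "t = cell_pt c l \<rho> \<theta>"
proof (cases "fst t \<in> M")
  case True
  then have "t \<in> base_pt ` T" using Total_over_M assms by blast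
  then show thesis using that by blast
next
  case False
  then obtain c l \<rho> \<theta> where *: "c \<in> C" "l \<in> Lab c" "0 \<le> \<rho>" "\<rho> < 1" "\<theta> \<in> B" "t = cell_pt c l \<rho> \<theta>"
    using Total_over_cell assms by blast
  then have "0 < \<rho>" using cell_in_outer_iff[of c \<rho> \<theta> 0] assms by auto
  then show thesis using * that by blast
qed

text \<open>An evenly covered subset \<open>X\<close> of \<open>M\<close> is thickened to the set
  \<open>X'\<close> of points that flow into it. The sheets over \<open>X'\<close> extend those over
  \<open>X\<close> and are recognised by the coordinate \<open>None\<close>.\<close>

lemma evenly_covered_base:
  assumes X: "openin (top_of_set M) X" and V: "\<Union>V = T \<inter> p -` X"
      "\<And>u. u \<in> V \<Longrightarrow> openin (top_of_set T) u" "pairwise disjnt V" "\<And>u. u \<in> V \<Longrightarrow> \<exists>q. homeomorphism u X p q"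
  defines "X' \<equiv> {x \<in> outer 0. rad x 1 \<in> X}"
  defines "v \<equiv> (\<lambda>u. {t \<in> Total. fst t \<in> X' \<and> snd t None \<in> Pt ` u}) ` V"
  shows "\<Union>v = Total \<inter> fst -` X' \<and> (\<forall>u\<in>v. openin (top_of_set Total) u) \<and> pairwise disjnt v \<and>
    (\<forall>u\<in>v. \<exists>q. homeomorphism u X' fst q)"
proof (intro conjI ballI)
  have X'S: "openin (top_of_set S) X'" unfolding X'_def by (rule openin_radial_preimage[OF X])
  have XM: "X \<subseteq> M" using X openin_imp_subset by blast
  have inV: "\<exists>u\<in>V. snd t None \<in> Pt ` u" if t: "t \<in> Total" "fst t \<in> X'" for t
  proof -
    have "fst t \<in> outer 0" using t by (simp add: X'_def)
    with t(1) have "\<exists>\<xi>\<in>T. snd t None = Pt \<xi> \<and> p \<xi> \<in> X"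
    proof (cases rule: Total_over_outer)
      case (1 \<xi>)
      then show ?thesis using t(2) p_in_M by (auto simp: base_pt_def X'_def rad_M)
    next
      case (2 c l \<rho> \<theta>)
      then show ?thesis using t(2) lift_in[of c l \<theta>] rad_1_cell[of c \<rho> \<theta>]
        by (auto simp: cell_pt_def X'_def Lab_def)
    qed
    then obtain \<xi> where "\<xi> \<in> \<Union>V" "snd t None = Pt \<xi>" unfolding V(1) by auto
    then show ?thesis by auto
  qed
  then show "\<Union>v = Total \<inter> fst -` X'" by (auto simp: v_def)
  show "pairwise disjnt v"
  proof (rule pairwiseI)
    fix a b assume "a \<in> v" "b \<in> v" "a \<noteq> b"
    then obtain u w where uw: "u \<in> V" "w \<in> V" "u \<noteq> w" and ab: "a = {t \<in> Total. fst t \<in> X' \<and> snd t None \<in> Pt ` u}"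
        "b = {t \<in> Total. fst t \<in> X' \<and> snd t None \<in> Pt ` w}"
      by (auto simp: v_def)
    have "disjnt u w" using V(3) uw by (auto simp: pairwise_def)
    then show "disjnt a b" unfolding ab by (auto simp: disjnt_iff)
  qed
  fix a assume "a \<in> v"
  then obtain u where u: "u \<in> V" and a: "a = {t \<in> Total. fst t \<in> X' \<and> snd t None \<in> Pt ` u}"
    by (auto simp: v_def)
  have uT: "u \<subseteq> T" using V(2)[OF u] openin_imp_subset by blast
  show "openin (top_of_set Total) a"
  proof -
    obtain U where U: "open U" "u = T \<inter> U" using V(2)[OF u] by (auto simp: openin_open)
    obtain A where A: "open A" "X' = S \<inter> A" using X'S by (auto simp: openin_open)
    have "a = Total \<inter> ({t. fst t \<in> A} \<inter> {t. snd t None \<in> Pt ` U})"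
    proof (intro equalityI subsetI)
      fix t assume "t \<in> a"
      then show "t \<in> Total \<inter> ({t. fst t \<in> A} \<inter> {t. snd t None \<in> Pt ` U})"
        unfolding a A(2) U(2) by auto
    next
      fix t assume t: "t \<in> Total \<inter> ({t. fst t \<in> A} \<inter> {t. snd t None \<in> Pt ` U})"
      then have t': "fst t \<in> X'" using fst_Total A(2) by auto
      obtain w where "w \<in> V" "snd t None \<in> Pt ` w" using inV[of t] t t' by auto
      moreover from this have "w \<subseteq> T" using V(2) openin_imp_subset by blast
      ultimately have "snd t None \<in> Pt ` u" using t U(2) by auto
      then show "t \<in> a" using t t' a by auto
    qed
    moreover have "open ({t. fst t \<in> A} \<inter> {t::'a \<times> ('c option \<Rightarrow> 't pointed). snd t None \<in> Pt ` U})"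
    proof (intro open_Int)
      show "open {t::'a \<times> ('c option \<Rightarrow> 't pointed). fst t \<in> A}"
        using open_vimage[OF A(1), of fst] by (simp add: vimage_def continuous_on_fst)
      show "open {t::'a \<times> ('c option \<Rightarrow> 't pointed). snd t None \<in> Pt ` U}"
        using continuous_on_snd_apply[of None] open_vimage[OF open_Pt[OF U(1)]] by (simp add: vimage_def)
    qed
    ultimately show ?thesis by (metis openin_open_Int)
  qed
  obtain q where q: "homeomorphism u X p q" using V(4) u by blast
  have qu: "q x \<in> u" "p (q x) = x" if "x \<in> X" for x
    using q that homeomorphism_image2[OF q] homeomorphism_apply2[OF q] by auto
  have qp: "q (p \<xi>) = \<xi>" if "\<xi> \<in> u" for \<xi> using homeomorphism_apply1[OF q that] .
  have pu: "p \<xi> \<in> X" if "\<xi> \<in> u" for \<xi> using V(1) u that by blast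
  show "\<exists>q. homeomorphism a X' fst q"
  proof (rule exI[of _ "outer_section q"], rule homeomorphismI)
    show "continuous_on a fst" by (intro continuous_intros)
    show "fst ` a \<subseteq> X'" by (auto simp: a)
    have os: "outer_section q x \<in> a \<and> fst (outer_section q x) = x" if x: "x \<in> X'" for x
    proof (cases "x \<in> M")
      case True
      then have "x \<in> X" using x by (simp add: X'_def rad_M)
      then show ?thesis using True x qu[of x] uT
        by (auto simp: outer_section_def a Total_def) (auto simp: base_pt_def)
    next
      case False
      then obtain c \<rho> \<theta> where *: "c \<in> C" "0 < \<rho>" "\<rho> \<le> 1" "\<theta> \<in> B" "x = \<Psi> c \<rho> \<theta>"
        using x by (auto simp: X'_def outer_def)
      then have xX: "\<Psi> c 1 \<theta> \<in> X" using x rad_1_cell[of c \<rho> \<theta>] by (simp add: X'_def)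
      then obtain l where l: "l \<in> Lab c" "lft c l \<theta> = q (\<Psi> c 1 \<theta>)"
        using lift_surj[of c \<theta> "q (\<Psi> c 1 \<theta>)"] * qu[OF xX] uT by (auto simp: Lab_def)
      then have o: "outer_section q x = cell_pt c l \<rho> \<theta>" using outer_section_cell * by simp
      have "cell_pt c l \<rho> \<theta> \<in> Total" using * l by (intro cell_pt_in_Total) auto
      then show ?thesis using o * l x qu[OF xX] by (auto simp: a) (auto simp: cell_pt_def)
    qed
    then show "outer_section q ` X' \<subseteq> a" "\<And>y. y \<in> X' \<Longrightarrow> fst (outer_section q y) = y" by auto
    show "outer_section q (fst t) = t" if t: "t \<in> a" for t
    proof -
      have "t \<in> Total" "fst t \<in> outer 0" "snd t None \<in> Pt ` u" using t by (auto simp: a X'_def)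
      from this(1,2) show ?thesis
      proof (cases rule: Total_over_outer)
        case (1 \<xi>)
        then have "\<xi> \<in> u" using \<open>snd t None \<in> _\<close> by (auto simp: base_pt_def)
        then show ?thesis using 1 qp p_in_M by (auto simp: outer_section_def)
      next
        case (2 c l \<rho> \<theta>)
        then have "lft c l \<theta> \<in> u" using \<open>snd t None \<in> _\<close> by (auto simp: cell_pt_def)
        then have "q (\<Psi> c 1 \<theta>) = lft c l \<theta>" using qp[of "lft c l \<theta>"] lift_in[of c l \<theta>] 2 by (simp add: Lab_def)
        then show ?thesis using outer_section_cell 2 by auto
      qed
    qed
    show "continuous_on X' (outer_section q)"
    proof (rule continuous_onI_openin)
      show X'sub: "X' \<subseteq> S" using X'S openin_imp_subset by blast
      fix W :: "('a \<times> ('c option \<Rightarrow> 't pointed)) set" assume W: "open W"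
      show "openin (top_of_set S) {x \<in> X'. outer_section q x \<in> W}"
      \<comment> \<open>Openness is tested on \<open>M\<close> and in cone coordinates; there the
        preimage is a union over the labels, on each part of which the section is a single
        \<open>cell_pt\<close>.\<close>
      proof (rule openinI)
        show "{x \<in> X'. outer_section q x \<in> W} \<subseteq> S" using X'sub by auto
        have "continuous_on X (\<lambda>x. base_pt (q x))"
          by (rule continuous_on_compose2[OF continuous_on_base_pt homeomorphism_cont2[OF q]]) (use qu uT in auto)
        then have "openin (top_of_set X) (X \<inter> (\<lambda>x. base_pt (q x)) -` W)"
          using W by (simp add: continuous_openin_preimage_gen)
        then have "openin (top_of_set M) (X \<inter> (\<lambda>x. base_pt (q x)) -` W)"
          using X openin_trans by blast
        moreover have "{x \<in> X'. outer_section q x \<in> W} \<inter> M = X \<inter> (\<lambda>x. base_pt (q x)) -` W"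
          using XM by (auto simp: X'_def rad_M outer_section_def outer_def)
        ultimately show "openin (top_of_set M) ({x \<in> X'. outer_section q x \<in> W} \<inter> M)" by (simp only:)
        fix c assume c: "c \<in> C"
        let ?D = "{0..1::real} \<times> B"
        have "openin (top_of_set ?D) ({z \<in> ?D. 0 < fst z} \<inter> (?D \<inter> (\<lambda>z. lft c l (snd z)) -` u) \<inter>
            (?D \<inter> (\<lambda>z. cell_pt c l (fst z) (snd z)) -` W))" if l: "l \<in> Lab c" for l
        proof (rule openin_Int[OF openin_Int[OF openin_fst_greater]])
          show "openin (top_of_set ?D) (?D \<inter> (\<lambda>z. cell_pt c l (fst z) (snd z)) -` W)"
            using continuous_on_cell_pt[OF c l] W by (simp add: continuous_openin_preimage_gen)
          have "continuous_on ?D (\<lambda>z. lft c l (snd z))"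
            by (rule continuous_on_compose2[OF lift_cont]) (use c l in \<open>auto simp: Lab_def intro!: continuous_intros\<close>)
          then show "openin (top_of_set ?D) (?D \<inter> (\<lambda>z. lft c l (snd z)) -` u)"
            by (rule continuous_openin_preimage[OF _ _ V(2)[OF u]]) (use lift_in c l in \<open>auto simp: Lab_def\<close>)
        qed
        then have "openin (top_of_set ?D) (\<Union>l\<in>Lab c. {z \<in> ?D. 0 < fst z} \<inter> (?D \<inter> (\<lambda>z. lft c l (snd z)) -` u) \<inter>
            (?D \<inter> (\<lambda>z. cell_pt c l (fst z) (snd z)) -` W))" by (intro openin_Union) auto
        moreover have "{z \<in> ?D. \<Psi> c (fst z) (snd z) \<in> {x \<in> X'. outer_section q x \<in> W}} =
          (\<Union>l\<in>Lab c. {z \<in> ?D. 0 < fst z} \<inter> (?D \<inter> (\<lambda>z. lft c l (snd z)) -` u) \<inter>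
            (?D \<inter> (\<lambda>z. cell_pt c l (fst z) (snd z)) -` W))" (is "?L = ?R")
        proof (intro equalityI subsetI)
          fix z assume z: "z \<in> ?L"
          obtain \<rho> \<theta> where zz: "z = (\<rho>, \<theta>)" by fastforce
          have *: "0 < \<rho>" "\<rho> \<le> 1" "\<theta> \<in> B"
            using z cell_in_outer_iff[OF c, of \<rho> \<theta> 0] by (auto simp: zz X'_def)
          then have xX: "\<Psi> c 1 \<theta> \<in> X" using z rad_1_cell[OF c *] by (simp add: X'_def zz)
          then obtain l where l: "l \<in> Lab c" "lft c l \<theta> = q (\<Psi> c 1 \<theta>)"
            using lift_surj[of c \<theta> "q (\<Psi> c 1 \<theta>)"] * c qu[OF xX] uT by (auto simp: Lab_def)
          then have "outer_section q (\<Psi> c \<rho> \<theta>) = cell_pt c l \<rho> \<theta>" using outer_section_cell * c by simp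
          moreover have "lft c l \<theta> \<in> u" using l(2) qu[OF xX] by simp
          ultimately show "z \<in> ?R" using z l(1) * by (auto simp: zz intro!: bexI[of _ l])
        next
          fix z assume "z \<in> ?R"
          then obtain l where l: "l \<in> Lab c" "z \<in> ?D" "0 < fst z" "lft c l (snd z) \<in> u" "cell_pt c l (fst z) (snd z) \<in> W"
            by auto
          obtain \<rho> \<theta> where zz: "z = (\<rho>, \<theta>)" by fastforce
          have *: "0 < \<rho>" "\<rho> \<le> 1" "\<theta> \<in> B" using l by (auto simp: zz)
          have "q (\<Psi> c 1 \<theta>) = lft c l \<theta>" "\<Psi> c 1 \<theta> \<in> X"
            using qp[of "lft c l \<theta>"] pu[of "lft c l \<theta>"] lift_in[of c l \<theta>] l c * by (auto simp: Lab_def zz)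
          then show "z \<in> ?L" using outer_section_cell[OF c l(1) *] l rad_1_cell[OF c *] cell_in_outer_iff[OF c, of \<rho> \<theta> 0] *
            by (auto simp: zz X'_def)
        qed
        ultimately show "openin (top_of_set ?D) {z \<in> ?D. \<Psi> c (fst z) (snd z) \<in> {x \<in> X'. outer_section q x \<in> W}}"
          by (simp only:)
      qed
    qed
  qed
qed

text \<open>Points of \<open>M\<close> have radially thickened evenly covered neighbourhoods; for
  all other points the open cell itself serves.\<close>

theorem covering_Total: "covering_space Total fst S"
proof
  show "continuous_on Total fst" by (intro continuous_intros)
  show "fst ` Total = S"
  proof (intro equalityI subsetI)
    fix x assume "x \<in> fst ` Total"
    then show "x \<in> S" using fst_Total by auto
  next
    fix x assume "x \<in> S"
    then show "x \<in> fst ` Total"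
    proof (cases rule: S_cases)
      case 1
      then obtain \<xi> where "\<xi> \<in> T" "p \<xi> = x" using cov by (auto simp: covering_space_def)
      then show ?thesis by (intro image_eqI[of _ _ "base_pt \<xi>"]) (auto simp: Total_def)
    next
      case (2 c \<rho> \<theta>)
      obtain l where "l \<in> T" "p l = \<Psi> c 1 0"
        using cov bd[OF 2(1) zero_B] by (auto simp: covering_space_def)
      then have "cell_pt c l \<rho> \<theta> \<in> Total" using 2 by (intro cell_pt_in_Total) (auto simp: Lab_def)
      then show ?thesis using 2 by (intro image_eqI[of _ _ "cell_pt c l \<rho> \<theta>"]) auto
    qed
  qed
  fix x assume "x \<in> S"
  then show "\<exists>X. x \<in> X \<and> openin (top_of_set S) X \<and> (\<exists>v. \<Union> v = Total \<inter> fst -` X \<and>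
     (\<forall>u\<in>v. openin (top_of_set Total) u) \<and> pairwise disjnt v \<and> (\<forall>u\<in>v. \<exists>q. homeomorphism u X fst q))"
  proof (cases rule: S_cases)
    case 1
    obtain X V where V: "x \<in> X" "openin (top_of_set M) X" "\<Union>V = T \<inter> p -` X"
      "\<And>u. u \<in> V \<Longrightarrow> openin (top_of_set T) u" "pairwise disjnt V" "\<And>u. u \<in> V \<Longrightarrow> \<exists>q. homeomorphism u X p q"
      using covering_space_evenly[OF cov 1] by metis
    have x': "x \<in> {x \<in> outer 0. rad x 1 \<in> X}" using 1 V(1) by (simp add: rad_M outer_def)
    show ?thesis
      by (rule exI, rule conjI, rule x', rule conjI, rule openin_radial_preimage[OF V(2)], rule exI,
          rule evenly_covered_base[OF V(2-6)])
  next
    case (2 c \<rho> \<theta>)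
    have "x \<in> open_cell c" unfolding open_cell_def using 2 by blast
    show ?thesis
      by (rule exI, rule conjI, rule \<open>x \<in> open_cell c\<close>, rule conjI, rule openin_open_cell[OF 2(1)], rule exI,
          rule evenly_covered_cell[OF 2(1)])
  qed
qed

end


section \<open>Edge words and the monodromy of combinatorially given coverings\<close>

section \<open>Ends of lifted paths\<close>

text \<open>Unique lifting makes the choice harmless. As a function of \<open>\<xi>\<close> this is
  the monodromy along \<open>g\<close>.\<close>

definition lift_end :: "'c::topological_space set \<Rightarrow> ('c \<Rightarrow> 's) \<Rightarrow> (real \<Rightarrow> 's::topological_space) \<Rightarrow> 'c \<Rightarrow> 'c" where
  "lift_end C p g \<xi> = (SOME \<zeta>. \<exists>h. path h \<and> path_image h \<subseteq> C \<and> pathstart h = \<xi> \<and> pathfinish h = \<zeta> \<and>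
     (\<forall>t\<in>{0..1}. p (h t) = g t))"

lemma lift_endI:
  assumes "covering_space C p S" "path h" "path_image h \<subseteq> C" "\<And>t. t \<in> {0..1} \<Longrightarrow> p (h t) = g t"
  shows "lift_end C p g (pathstart h) = pathfinish h"
  unfolding lift_end_def
proof (rule some_equality)
  show "\<exists>k. path k \<and> path_image k \<subseteq> C \<and> pathstart k = pathstart h \<and> pathfinish k = pathfinish h \<and> (\<forall>t\<in>{0..1}. p (k t) = g t)"
    using assms by blast
  fix \<zeta> assume "\<exists>k. path k \<and> path_image k \<subseteq> C \<and> pathstart k = pathstart h \<and> pathfinish k = \<zeta> \<and> (\<forall>t\<in>{0..1}. p (k t) = g t)"
  then obtain k where k: "path k" "path_image k \<subseteq> C" "pathstart k = pathstart h" "pathfinish k = \<zeta>" "\<forall>t\<in>{0..1}. p (k t) = g t"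
    by blast
  have "k 1 = h 1"
    by (rule path_lift_unique[OF assms(1) k(1,2) assms(2,3), of 0])
       (use k(3,5) assms(4) in \<open>auto simp: pathstart_def\<close>)
  then show "\<zeta> = pathfinish h" using k(4) by (simp add: pathfinish_def)
qed

lemma lift_endE:
  assumes "covering_space C p S" "path g" "path_image g \<subseteq> S" "\<xi> \<in> C" "p \<xi> = pathstart g"
  obtains h where "path h" "path_image h \<subseteq> C" "pathstart h = \<xi>" "pathfinish h = lift_end C p g \<xi>"
    "\<And>t. t \<in> {0..1} \<Longrightarrow> p (h t) = g t"
proof -
  obtain h where h: "path h" "path_image h \<subseteq> C" "pathstart h = \<xi>" "\<And>t. t \<in> {0..1} \<Longrightarrow> p (h t) = g t"
    using covering_lift_path[OF assms] by blast
  then show thesis using that lift_endI[OF assms(1) h(1,2,4)] by metis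
qed

lemma lift_end_in:
  assumes "covering_space C p S" "path g" "path_image g \<subseteq> S" "\<xi> \<in> C" "p \<xi> = pathstart g"
  shows "lift_end C p g \<xi> \<in> C" "p (lift_end C p g \<xi>) = pathfinish g"
proof -
  obtain h where h: "path h" "path_image h \<subseteq> C" "pathstart h = \<xi>" "pathfinish h = lift_end C p g \<xi>"
    "\<And>t. t \<in> {0..1} \<Longrightarrow> p (h t) = g t"
    using lift_endE[OF assms] by metis
  show "lift_end C p g \<xi> \<in> C" using h(2,4) by (metis pathfinish_in_path_image subsetD)
  show "p (lift_end C p g \<xi>) = pathfinish g" using h(4) h(5)[of 1] by (simp add: pathfinish_def)
qed

lemma lift_end_homotopic:
  assumes cov: "covering_space C p S" and hom: "homotopic_paths S g g'" and \<xi>: "\<xi> \<in> C" "p \<xi> = pathstart g"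
  shows "lift_end C p g \<xi> = lift_end C p g' \<xi>"
proof -
  have g: "path g" "path g'" "path_image g \<subseteq> S" "path_image g' \<subseteq> S" "pathstart g = pathstart g'"
    using homotopic_paths_imp_path[OF hom] homotopic_paths_imp_subset[OF hom] homotopic_paths_imp_pathstart[OF hom] by auto
  obtain h where h: "path h" "path_image h \<subseteq> C" "pathstart h = \<xi>" "pathfinish h = lift_end C p g \<xi>"
    "\<And>t. t \<in> {0..1} \<Longrightarrow> p (h t) = g t"
    using lift_endE[OF cov g(1,3) \<xi>] by metis
  have "p \<xi> = pathstart g'" using \<xi> g by simp
  then obtain h' where h': "path h'" "path_image h' \<subseteq> C" "pathstart h' = \<xi>" "pathfinish h' = lift_end C p g' \<xi>"
    "\<And>t. t \<in> {0..1} \<Longrightarrow> p (h' t) = g' t"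
    using lift_endE[OF cov g(2,4) \<xi>(1)] by metis
  have "homotopic_paths C h h'"
    by (rule homotopic_paths_lift[OF cov hom h(1,2,5) h'(1,2,5)]) (simp_all add: h(3) h'(3))
  then show ?thesis using homotopic_paths_imp_pathfinish h(4) h'(4) by metis
qed

lemma joinpaths_lift:
  assumes "\<And>t. t \<in> {0..1} \<Longrightarrow> p (h t) = g t" "\<And>t. t \<in> {0..1} \<Longrightarrow> p (h' t) = g' t" "t \<in> {0..1}"
  shows "p ((h +++ h') t) = (g +++ g') t"
  using assms by (auto simp: joinpaths_def)

lemma lift_end_join:
  assumes cov: "covering_space C p S" and g: "path g" "path_image g \<subseteq> S" and g': "path g'" "path_image g' \<subseteq> S"
    and gg': "pathfinish g = pathstart g'" and \<xi>: "\<xi> \<in> C" "p \<xi> = pathstart g"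
  shows "lift_end C p (g +++ g') \<xi> = lift_end C p g' (lift_end C p g \<xi>)"
proof -
  obtain h where h: "path h" "path_image h \<subseteq> C" "pathstart h = \<xi>" "pathfinish h = lift_end C p g \<xi>"
    "\<And>t. t \<in> {0..1} \<Longrightarrow> p (h t) = g t"
    using lift_endE[OF cov g \<xi>] by metis
  have "p (lift_end C p g \<xi>) = pathstart g'" using lift_end_in[OF cov g \<xi>] gg' by simp
  then obtain h' where h': "path h'" "path_image h' \<subseteq> C" "pathstart h' = lift_end C p g \<xi>"
    "pathfinish h' = lift_end C p g' (lift_end C p g \<xi>)" "\<And>t. t \<in> {0..1} \<Longrightarrow> p (h' t) = g' t"
    using lift_endE[OF cov g' lift_end_in(1)[OF cov g \<xi>]] by metis
  have "path (h +++ h')" "path_image (h +++ h') \<subseteq> C"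
    using h h' by (auto simp: subset_path_image_join)
  moreover have "p ((h +++ h') t) = (g +++ g') t" if "t \<in> {0..1}" for t
    using joinpaths_lift[of p h g h' g' t] h(5) h'(5) that by blast
  ultimately have "lift_end C p (g +++ g') (pathstart (h +++ h')) = pathfinish (h +++ h')"
    by (rule lift_endI[OF cov])
  then show ?thesis using h(3) h'(4) by simp
qed

lemma lift_end_reverse:
  assumes cov: "covering_space C p S" and g: "path g" "path_image g \<subseteq> S" and \<xi>: "\<xi> \<in> C" "p \<xi> = pathstart g"
  shows "lift_end C p (reversepath g) (lift_end C p g \<xi>) = \<xi>"
proof -
  obtain h where h: "path h" "path_image h \<subseteq> C" "pathstart h = \<xi>" "pathfinish h = lift_end C p g \<xi>"
    "\<And>t. t \<in> {0..1} \<Longrightarrow> p (h t) = g t"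
    using lift_endE[OF cov g \<xi>] by metis
  have "path (reversepath h)" "path_image (reversepath h) \<subseteq> C" using h by auto
  moreover have "p (reversepath h t) = reversepath g t" if "t \<in> {0..1}" for t
    using h(5)[of "1 - t"] that by (simp add: reversepath_def)
  ultimately have "lift_end C p (reversepath g) (pathstart (reversepath h)) = pathfinish (reversepath h)"
    by (rule lift_endI[OF cov])
  then show ?thesis using h by simp
qed

lemma lift_end_const:
  assumes "covering_space C p S" "\<xi> \<in> C" "p \<xi> = x"
  shows "lift_end C p (\<lambda>_. x) \<xi> = \<xi>"
  using lift_endI[OF assms(1), of "\<lambda>_. \<xi>"] assms by auto


section \<open>Edge words\<close>

definition edge_path :: "('a::topological_space, 'e, 'f) two_complex \<Rightarrow> 'e \<times> bool \<Rightarrow> real \<Rightarrow> 'a" where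
  "edge_path X s = (if snd s then char1 X (fst s) else reversepath (char1 X (fst s)))"

fun walk :: "('a::topological_space, 'e, 'f) two_complex \<Rightarrow> 'a \<Rightarrow> ('e \<times> bool) list \<Rightarrow> 'a \<Rightarrow> bool" where
  "walk X u [] v \<longleftrightarrow> u = v"
| "walk X u (s # w) v \<longleftrightarrow> fst s \<in> one_cells X \<and> pathstart (edge_path X s) = u \<and> walk X (pathfinish (edge_path X s)) w v"

fun word_path :: "('a::topological_space, 'e, 'f) two_complex \<Rightarrow> 'a \<Rightarrow> ('e \<times> bool) list \<Rightarrow> real \<Rightarrow> 'a" where
  "word_path X u [] = (\<lambda>_. u)"
| "word_path X u (s # w) = edge_path X s +++ word_path X (pathfinish (edge_path X s)) w"

definition flip_word :: "('e \<times> bool) list \<Rightarrow> ('e \<times> bool) list" where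
  "flip_word w = rev (map inv_letter w)"

lemma edge_path_inv_letter: "edge_path X (inv_letter s) = reversepath (edge_path X s)"
  by (auto simp: edge_path_def inv_letter_def)

lemma fst_inv_letter [simp]: "fst (inv_letter s) = fst s"
  and snd_inv_letter [simp]: "snd (inv_letter s) = (\<not> snd s)"
  and inv_letter_inv_letter [simp]: "inv_letter (inv_letter s) = s"
  by (auto simp: inv_letter_def)

lemma walk_append: "walk X u (w @ w') v \<longleftrightarrow> (\<exists>x. walk X u w x \<and> walk X x w' v)"
  by (induction w arbitrary: u) auto

lemma walk_flip: "walk X u w v \<Longrightarrow> walk X v (flip_word w) u"
proof (induction w arbitrary: u)
  case (Cons s w)
  then show ?case by (auto simp: flip_word_def walk_append edge_path_inv_letter)
qed (simp add: flip_word_def)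

lemma flip_word_Nil [simp]: "flip_word [] = []"
  and flip_word_Cons: "flip_word (s # w) = flip_word w @ [inv_letter s]"
  by (auto simp: flip_word_def)

definition skeleton :: "('a::topological_space, 'e, 'f) two_complex \<Rightarrow> 'a set" where
  "skeleton X = zero_cells X \<union> (\<Union>e\<in>one_cells X. char1 X e ` {0..1})"

text \<open>Isolated from \<open>finite_two_complex\<close> so that it applies to lifted complexes
  as well: their points belong to a type that is not assumed to be of class
  \<open>t2_space\<close>.\<close>

definition edges_are_paths :: "('a::topological_space, 'e, 'f) two_complex \<Rightarrow> bool" where
  "edges_are_paths X \<longleftrightarrow> (\<forall>e\<in>one_cells X. path (char1 X e) \<and>
     pathstart (char1 X e) \<in> zero_cells X \<and> pathfinish (char1 X e) \<in> zero_cells X)"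

lemma edge_path_props:
  assumes "edges_are_paths X" "fst s \<in> one_cells X"
  shows "path (edge_path X s)" "path_image (edge_path X s) \<subseteq> skeleton X"
    "pathstart (edge_path X s) \<in> zero_cells X" "pathfinish (edge_path X s) \<in> zero_cells X"
  using assms unfolding edges_are_paths_def edge_path_def skeleton_def path_image_def[symmetric]
  by (auto split: if_splits)

lemma word_path_props:
  assumes "edges_are_paths X" "walk X u w v" "u \<in> zero_cells X"
  shows "path (word_path X u w) \<and> path_image (word_path X u w) \<subseteq> skeleton X \<and>
    pathstart (word_path X u w) = u \<and> pathfinish (word_path X u w) = v \<and> v \<in> zero_cells X"
  using assms(2,3)
proof (induction w arbitrary: u)
  case (Cons s w)
  note E = edge_path_props[OF assms(1), of s]
  have "path (word_path X (pathfinish (edge_path X s)) w) \<and> path_image (word_path X (pathfinish (edge_path X s)) w) \<subseteq> skeleton X \<and>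
    pathstart (word_path X (pathfinish (edge_path X s)) w) = pathfinish (edge_path X s) \<and>
    pathfinish (word_path X (pathfinish (edge_path X s)) w) = v \<and> v \<in> zero_cells X"
    by (rule Cons.IH) (use Cons.prems E in auto)
  then show ?case using E Cons.prems by (auto simp: subset_path_image_join)
qed (auto simp: skeleton_def)

lemma word_path_append:
  assumes "edges_are_paths X" "walk X u w x" "walk X x w' v" "u \<in> zero_cells X" "skeleton X \<subseteq> S"
  shows "homotopic_paths S (word_path X u (w @ w')) (word_path X u w +++ word_path X x w')"
  using assms(2,4)
proof (induction w arbitrary: u)
  case Nil
  have "path (word_path X x w') \<and> path_image (word_path X x w') \<subseteq> skeleton X \<and>
    pathstart (word_path X x w') = x \<and> pathfinish (word_path X x w') = v \<and> v \<in> zero_cells X"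
    by (rule word_path_props[OF assms(1,3)]) (use Nil in simp)
  then show ?case using Nil assms(5)
    by (auto intro!: homotopic_paths_sym[OF homotopic_paths_lid_const])
next
  case (Cons s w)
  let ?y = "pathfinish (edge_path X s)"
  have E: "path (edge_path X s)" "path_image (edge_path X s) \<subseteq> S" "?y \<in> zero_cells X"
    using edge_path_props[OF assms(1), of s] Cons.prems assms(5) by auto
  have W: "path (word_path X ?y w)" "path_image (word_path X ?y w) \<subseteq> S" "pathstart (word_path X ?y w) = ?y"
     "pathfinish (word_path X ?y w) = x" "x \<in> zero_cells X"
    using word_path_props[OF assms(1), of ?y w x] Cons.prems E assms(5) by auto
  have W': "path (word_path X x w')" "path_image (word_path X x w') \<subseteq> S" "pathstart (word_path X x w') = x"
    using word_path_props[OF assms(1,3) W(5)] assms(5) by auto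
  have IH: "homotopic_paths S (word_path X ?y (w @ w')) (word_path X ?y w +++ word_path X x w')"
    by (rule Cons.IH) (use Cons.prems E in auto)
  have "pathstart (word_path X ?y (w @ w')) = ?y"
    using homotopic_paths_imp_pathstart[OF IH] W by simp
  then have "homotopic_paths S (edge_path X s +++ word_path X ?y (w @ w')) (edge_path X s +++ (word_path X ?y w +++ word_path X x w'))"
    by (intro homotopic_paths_join IH) (use E in auto)
  also have "homotopic_paths S \<dots> ((edge_path X s +++ word_path X ?y w) +++ word_path X x w')"
    by (rule homotopic_paths_assoc) (use E W W' in auto)
  finally show ?case by simp
qed

text \<open>Otherwise the value 1 is attained before \<open>b\<close>, and by the intermediate value
  theorem the value \<open>h b\<close> is attained up to there a second time.\<close>

lemma homeomorphism_interval_end: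
  fixes h :: "real \<Rightarrow> real"
  assumes hom: "homeomorphism {a..b} {0..1} h h'" and ab: "a \<le> b" and a: "h a = 0"
  shows "h b = 1"
proof (rule ccontr)
  assume b: "h b \<noteq> 1"
  have im: "h ` {a..b} = {0..1}" and ct: "continuous_on {a..b} h"
    using hom by (auto simp: homeomorphism_def)
  have inj: "inj_on h {a..b}" using homeomorphism_apply1[OF hom] by (rule inj_on_inverseI)
  have "1 \<in> h ` {a..b}" unfolding im by simp
  then obtain c where c: "c \<in> {a..b}" "h c = 1" by (metis imageE)
  have hb: "h b \<in> {0..1}" using im ab by (metis atLeastAtMost_iff imageI order_refl)
  have "continuous_on {a..c} h" using ct c by (auto intro: continuous_on_subset)
  then obtain d where "a \<le> d" "d \<le> c" "h d = h b"
    using IVT'[of h a "h b" c] a c hb by auto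
  then have "d = b" using inj c ab by (auto simp: inj_on_def)
  then have "c = b" using \<open>d \<le> c\<close> c by auto
  then show False using c b by simp
qed

text \<open>A straight line in the parameter interval deforms the homeomorphism to the identity or
  to the reversal, with ends fixed.\<close>

lemma traverses_homotopic:
  assumes X: "edges_are_paths X" and tr: "traverses X \<gamma> a b s" and ab: "a < b"
  shows "fst s \<in> one_cells X \<and> \<gamma> a = pathstart (edge_path X s) \<and> \<gamma> b = pathfinish (edge_path X s) \<and>
    homotopic_paths (skeleton X) (sub_path a b \<gamma>) (edge_path X s)"
proof -
  let ?e = "fst s"
  obtain h h' where e: "?e \<in> one_cells X" and h: "homeomorphism {a..b} {0..1} h h'"
      "h a = (if snd s then 0 else 1)" "\<forall>t\<in>{a..b}. \<gamma> t = char1 X ?e (h t)"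
    using tr unfolding traverses_def by blast
  have hb: "h b = (if snd s then 1 else 0)"
  proof (cases "snd s")
    case True
    then show ?thesis using homeomorphism_interval_end[OF h(1)] ab h(2) by simp
  next
    case False
    have "homeomorphism {0..1::real} {0..1} (\<lambda>t. 1 - t) (\<lambda>t. 1 - t)"
      by (rule homeomorphismI) (auto intro!: continuous_intros)
    from homeomorphism_interval_end[OF homeomorphism_compose[OF h(1) this]] show ?thesis
      using ab h(2) False by simp
  qed
  have him: "h ` {a..b} = {0..1}" and ch: "continuous_on {a..b} h" using h(1) by (auto simp: homeomorphism_def)
  have cX: "continuous_on {0..1} (char1 X ?e)" using X e by (auto simp: edges_are_paths_def path_def)
  have sk: "char1 X ?e ` {0..1} \<subseteq> skeleton X" using e by (auto simp: skeleton_def)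
  have gs: "sub_path a b \<gamma> t = (char1 X ?e \<circ> sub_path a b h) t" if "t \<in> {0..1}" for t
    using h(3) affine_between[of t a b] that ab by (auto simp: sub_path_def)
  have ph: "path (sub_path a b h)" "path_image (sub_path a b h) \<subseteq> {0..1}"
    using path_sub_path[OF ch] ab him by auto
  define k where "k = (if snd s then (\<lambda>t::real. t) else (\<lambda>t. 1 - t))"
  have "homotopic_paths (skeleton X) (char1 X ?e \<circ> sub_path a b h) (char1 X ?e \<circ> k)"
    by (rule homotopic_paths_convex_image[OF _ cX sk ph(1) _ ph(2)])
       (use h(2) hb in \<open>auto simp: k_def path_def path_image_def pathstart_def pathfinish_def sub_path_def intro!: continuous_intros\<close>)
  moreover have "char1 X ?e \<circ> k = edge_path X s"
    by (auto simp: k_def edge_path_def reversepath_def comp_def)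
  ultimately have hom: "homotopic_paths (skeleton X) (char1 X ?e \<circ> sub_path a b h) (edge_path X s)" by simp
  have "homotopic_paths (skeleton X) (char1 X ?e \<circ> sub_path a b h) (sub_path a b \<gamma>)"
    by (rule homotopic_paths_eq)
       (use homotopic_paths_imp_path[OF hom] homotopic_paths_imp_subset[OF hom] gs in auto)
  then have "homotopic_paths (skeleton X) (sub_path a b \<gamma>) (edge_path X s)"
    using hom homotopic_paths_sym homotopic_paths_trans by blast
  then show ?thesis using e homotopic_paths_imp_pathstart[of "skeleton X" "sub_path a b \<gamma>" "edge_path X s"]
      homotopic_paths_imp_pathfinish[of "skeleton X" "sub_path a b \<gamma>" "edge_path X s"] by simp
qed

lemma traversing_word:
  assumes X: "edges_are_paths X"
    and "\<And>j. j < length w \<Longrightarrow> t j < t (Suc j) \<and> traverses X \<gamma> (t j) (t (Suc j)) (w ! j)"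
    and "continuous_on {t 0..t (length w)} \<gamma>" "\<gamma> ` {t 0..t (length w)} \<subseteq> skeleton X"
  shows "walk X (\<gamma> (t 0)) w (\<gamma> (t (length w))) \<and>
    homotopic_paths (skeleton X) (sub_path (t 0) (t (length w)) \<gamma>) (word_path X (\<gamma> (t 0)) w)"
  using assms(2-4)
proof (induction w arbitrary: t)
  case Nil
  then show ?case by (simp add: sub_path_def)
next
  case (Cons s w)
  let ?t = "\<lambda>j. t (Suc j)"
  have inc: "t (Suc 0) \<le> t (Suc j)" if "j \<le> length w" for j
    using that
  proof (induction j)
    case (Suc j)
    then show ?case using Cons.prems(1)[of "Suc j"] by auto
  qed simp
  have t01: "t 0 < t (Suc 0)" and tr: "traverses X \<gamma> (t 0) (t (Suc 0)) s" using Cons.prems(1)[of 0] by auto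
  have tn: "t (Suc 0) \<le> t (Suc (length w))" using inc by simp
  note E = traverses_homotopic[OF X tr t01]
  have IH: "walk X (\<gamma> (?t 0)) w (\<gamma> (?t (length w))) \<and>
    homotopic_paths (skeleton X) (sub_path (?t 0) (?t (length w)) \<gamma>) (word_path X (\<gamma> (?t 0)) w)"
  proof (rule Cons.IH)
    show "?t j < ?t (Suc j) \<and> traverses X \<gamma> (?t j) (?t (Suc j)) (w ! j)" if "j < length w" for j
      using Cons.prems(1)[of "Suc j"] that by simp
    show "continuous_on {?t 0..?t (length w)} \<gamma>"
      by (rule continuous_on_subset[OF Cons.prems(2)]) (use t01 in auto)
    show "\<gamma> ` {?t 0..?t (length w)} \<subseteq> skeleton X"
      using Cons.prems(3) t01 by (force simp: image_subset_iff)
  qed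
  have "homotopic_paths (skeleton X) (sub_path (t 0) (t (Suc 0)) \<gamma> +++ sub_path (t (Suc 0)) (t (Suc (length w))) \<gamma>)
     (sub_path (t 0) (t (Suc (length w))) \<gamma>)"
    by (rule homotopic_join_sub_paths) (use Cons.prems less_imp_le[OF t01] tn in simp_all)
  moreover have "homotopic_paths (skeleton X) (sub_path (t 0) (t (Suc 0)) \<gamma> +++ sub_path (t (Suc 0)) (t (Suc (length w))) \<gamma>)
     (edge_path X s +++ word_path X (\<gamma> (t (Suc 0))) w)"
    by (rule homotopic_paths_join) (use E IH in auto)
  ultimately have "homotopic_paths (skeleton X) (sub_path (t 0) (t (Suc (length w))) \<gamma>)
     (edge_path X s +++ word_path X (\<gamma> (t (Suc 0))) w)"
    using homotopic_paths_sym homotopic_paths_trans by blast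
  then show ?case using E IH by simp
qed

lemma boundary_word_homotopic:
  assumes X: "edges_are_paths X" and w: "is_boundary_word X f w"
    and \<gamma>: "path (boundary_path X f)"
  shows "w \<noteq> []" "walk X (boundary_path X f 0) w (boundary_path X f 1)"
    "homotopic_paths (skeleton X) (boundary_path X f) (word_path X (boundary_path X f 0) w)"
    "path_image (boundary_path X f) \<subseteq> skeleton X"
proof -
  obtain t :: "nat \<Rightarrow> real" where t: "t 0 = 0" "t (length w) = 1"
     "\<And>j. j < length w \<Longrightarrow> t j < t (Suc j) \<and> traverses X (boundary_path X f) (t j) (t (Suc j)) (w ! j)"
    using w unfolding is_boundary_word_def by blast
  show "w \<noteq> []" using t(1,2) by auto
  have cover: "boundary_path X f s \<in> skeleton X" if "s \<in> {0..t n}" "n \<le> length w" "0 < n" for n s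
    using that
  proof (induction n)
    case (Suc n)
    show ?case
    proof (cases "s \<ge> t n")
      case True
      obtain h h' where e: "fst (w ! n) \<in> one_cells X" and h: "homeomorphism {t n..t (Suc n)} {0..1} h h'"
          "\<forall>u\<in>{t n..t (Suc n)}. boundary_path X f u = char1 X (fst (w ! n)) (h u)"
        using t(3)[of n] Suc.prems unfolding traverses_def by auto
      have s: "s \<in> {t n..t (Suc n)}" using True Suc.prems by simp
      then have "h s \<in> {0..1}" using homeomorphism_image1[OF h(1)] by blast
      then have "boundary_path X f s \<in> char1 X (fst (w ! n)) ` {0..1}" using h(2) s by blast
      then show ?thesis unfolding skeleton_def using e by blast
    next
      case False
      then have "n \<noteq> 0" using t(1) Suc.prems by (cases n) auto
      then show ?thesis using Suc False by auto
    qed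
  qed simp
  then show im: "path_image (boundary_path X f) \<subseteq> skeleton X"
    using t(2) \<open>w \<noteq> []\<close> by (force simp: path_image_def)
  have "walk X (boundary_path X f (t 0)) w (boundary_path X f (t (length w))) \<and>
    homotopic_paths (skeleton X) (sub_path (t 0) (t (length w)) (boundary_path X f)) (word_path X (boundary_path X f (t 0)) w)"
    by (rule traversing_word[OF X t(3)]) (use im \<gamma> t in \<open>auto simp: path_def path_image_def\<close>)
  then show "walk X (boundary_path X f 0) w (boundary_path X f 1)"
    "homotopic_paths (skeleton X) (boundary_path X f) (word_path X (boundary_path X f 0) w)"
    using t by auto
qed


section \<open>The cells of a 2-complex as cones\<close>

locale fin_complex =
  fixes K :: "('a::t2_space, 'e, 'f) two_complex"
  assumes fin: "finite_two_complex K"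
begin

lemma finite_cells: "finite (zero_cells K)" "finite (one_cells K)" "finite (two_cells K)"
  using fin by (auto simp: finite_two_complex_def)

lemma edges: "edges_are_paths K"
  using fin by (auto simp: finite_two_complex_def edges_are_paths_def)

lemma char1_props:
  assumes "e \<in> one_cells K"
  shows "continuous_on {0..1} (char1 K e)" "inj_on (char1 K e) {0<..<1}" "char1 K e 0 \<in> zero_cells K" "char1 K e 1 \<in> zero_cells K"
  using fin assms by (auto simp: finite_two_complex_def path_def pathstart_def pathfinish_def)

lemma char2_props:
  assumes "f \<in> two_cells K"
  shows "continuous_on (cball 0 1) (char2 K f)" "inj_on (char2 K f) (ball 0 1)" "\<exists>w. is_boundary_word K f w"
  using fin assms by (auto simp: finite_two_complex_def)

lemma cells_disjoint:
  "zero_cells K \<inter> (\<Union>e\<in>one_cells K. open_1cell K e) = {}"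
  "zero_cells K \<inter> (\<Union>f\<in>two_cells K. open_2cell K f) = {}"
  "(\<Union>e\<in>one_cells K. open_1cell K e) \<inter> (\<Union>f\<in>two_cells K. open_2cell K f) = {}"
  "disjoint_family_on (open_1cell K) (one_cells K)"
  "disjoint_family_on (open_2cell K) (two_cells K)"
  using fin unfolding finite_two_complex_def by blast+

lemma skeleton_eq: "skeleton K = zero_cells K \<union> (\<Union>e\<in>one_cells K. open_1cell K e)"
proof -
  have "char1 K e t \<in> zero_cells K \<union> open_1cell K e" if "e \<in> one_cells K" "0 \<le> t" "t \<le> 1" for e t
    using char1_props(3,4)[OF that(1)] that(2,3) by (cases "t = 0"; cases "t = 1") (auto simp: open_1cell_def)
  then show ?thesis by (fastforce simp: skeleton_def open_1cell_def)
qed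

lemma points_eq: "points K = skeleton K \<union> (\<Union>f\<in>two_cells K. open_2cell K f)"
  using fin unfolding finite_two_complex_def skeleton_eq by simp

lemma zero_subset_skeleton: "zero_cells K \<subseteq> skeleton K"
  and skeleton_subset: "skeleton K \<subseteq> points K"
  by (auto simp: skeleton_def points_eq)

lemma char1_in_skeleton: "\<lbrakk>e \<in> one_cells K; 0 \<le> t; t \<le> 1\<rbrakk> \<Longrightarrow> char1 K e t \<in> skeleton K"
  unfolding skeleton_def by (intro UnI2 UN_I[of e] imageI) auto

lemma compact_skeleton: "compact (skeleton K)"
proof -
  have "compact (char1 K e ` {0..1})" if "e \<in> one_cells K" for e
    using char1_props(1)[OF that] by (intro compact_continuous_image) auto
  then have "compact (\<Union>e\<in>one_cells K. char1 K e ` {0..1})" using finite_cells by (intro compact_UN)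
  then show ?thesis unfolding skeleton_def by (rule compact_Un[OF finite_imp_compact[OF finite_cells(1)]])
qed

lemma path_boundary: 
  assumes "f \<in> two_cells K"
  shows "path (boundary_path K f)"
  unfolding path_def boundary_path_def
  by (rule continuous_on_compose2[OF char2_props(1)[OF assms]]) (auto intro!: continuous_intros)

lemma boundary_in_skeleton:
  assumes "f \<in> two_cells K" "0 \<le> t" "t \<le> 1"
  shows "boundary_path K f t \<in> skeleton K"
proof -
  obtain w where "is_boundary_word K f w" using char2_props(3)[OF assms(1)] by blast
  from boundary_word_homotopic(4)[OF edges this path_boundary[OF assms(1)]] show ?thesis
    using assms(2,3) by (force simp: path_image_def)
qed

lemma boundary_start: "boundary_path K f 0 = boundary_path K f 1"
  by (simp add: boundary_path_def)

lemma boundary_start_in: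
  assumes "f \<in> two_cells K"
  shows "boundary_path K f 0 \<in> zero_cells K"
proof -
  obtain w where w: "is_boundary_word K f w" using char2_props(3)[OF assms] by blast
  note W = boundary_word_homotopic[OF edges w path_boundary[OF assms]]
  obtain s w' where "w = s # w'" using W(1) by (cases w) auto
  then show ?thesis using W(2) edge_path_props[OF edges, of s] by auto
qed

text \<open>The apex is the midpoint of the edge, \<open>\<theta>\<close> selects the half that
  leads to the end \<open>\<theta>\<close>, and \<open>\<rho>\<close> is the position on this
  half.\<close>

sublocale graph: cone_complex "skeleton K" "zero_cells K" "one_cells K" "{0, 1::real}"
  "\<lambda>e \<rho> \<theta>. char1 K e ((1 + (2 * \<theta> - 1) * \<rho>) / 2)"
proof
  let ?\<Psi> = "\<lambda>e \<rho> \<theta>. char1 K e ((1 + (2 * \<theta> - 1) * \<rho>) / 2)"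
  have inside: "0 < (1 + (2 * \<theta> - 1) * \<rho>) / 2 \<and> (1 + (2 * \<theta> - 1) * \<rho>) / 2 < 1" if "\<theta> \<in> {0, 1}" "0 \<le> \<rho>" "\<rho> < 1" for \<theta> \<rho> :: real
    using that by auto
  show "finite (one_cells K)" "compact (zero_cells K)" using finite_cells by (auto intro: finite_imp_compact)
  show "continuous_on ({0..1} \<times> {0, 1}) (\<lambda>z. ?\<Psi> e (fst z) (snd z))" if "e \<in> one_cells K" for e
    by (rule continuous_on_compose2[OF char1_props(1)[OF that]]) (auto intro!: continuous_intros)
  have in_open: "?\<Psi> e \<rho> \<theta> \<in> open_1cell K e" if "\<theta> \<in> {0, 1}" "0 \<le> \<rho>" "\<rho> < 1" for e \<theta> \<rho>
    using inside[OF that] by (auto simp: open_1cell_def)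
  have open_in: "\<exists>\<rho> \<theta>. x = ?\<Psi> e \<rho> \<theta> \<and> 0 \<le> \<rho> \<and> \<rho> < 1 \<and> \<theta> \<in> {0, 1}" if x: "x \<in> open_1cell K e" for e x
  proof -
    obtain t where t: "x = char1 K e t" "0 < t" "t < 1" using x by (auto simp: open_1cell_def)
    show ?thesis
    proof (cases "t \<le> 1/2")
      case True
      then show ?thesis using t by (intro exI[of _ "1 - 2 * t"] exI[of _ 0]) auto
    next
      case False
      then show ?thesis using t by (intro exI[of _ "2 * t - 1"] exI[of _ 1]) auto
    qed
  qed
  show "skeleton K = zero_cells K \<union> {?\<Psi> e \<rho> \<theta> | e \<rho> \<theta>. e \<in> one_cells K \<and> 0 \<le> \<rho> \<and> \<rho> < 1 \<and> \<theta> \<in> {0, 1}}"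
    unfolding skeleton_eq using in_open open_in by blast
  show "?\<Psi> e 1 \<theta> \<in> zero_cells K" if "e \<in> one_cells K" "\<theta> \<in> {0, 1}" for e \<theta>
    using that char1_props by auto
  show "?\<Psi> e \<rho> \<theta> \<notin> zero_cells K" if "e \<in> one_cells K" "\<theta> \<in> {0, 1}" "0 \<le> \<rho>" "\<rho> < 1" for e \<theta> \<rho>
    using in_open[OF that(2-4)] that(1) cells_disjoint(1) by blast
  fix e e' \<theta> \<theta>' \<rho> \<rho>' assume A: "e \<in> one_cells K" "e' \<in> one_cells K" "\<theta> \<in> {0, 1}" "\<theta>' \<in> {0, 1}" "0 \<le> \<rho>" "\<rho> < 1"
    "0 \<le> \<rho>'" "\<rho>' < (1::real)" and eq: "?\<Psi> e \<rho> \<theta> = ?\<Psi> e' \<rho>' \<theta>'"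
  have "e = e'" using in_open[OF A(3,5,6), of e] in_open[OF A(4,7,8), of e'] eq A(1,2) cells_disjoint(4)
    unfolding disjoint_family_on_def by auto
  moreover have "(1 + (2 * \<theta> - 1) * \<rho>) / 2 = (1 + (2 * \<theta>' - 1) * \<rho>') / 2"
    using inj_onD[OF char1_props(2)[OF A(1)] eq[folded \<open>e = e'\<close>]] inside[OF A(3,5,6)] inside[OF A(4,7,8)] by simp
  ultimately show "e = e' \<and> \<rho> = \<rho>' \<and> (\<rho> = 0 \<or> (\<forall>\<sigma>. ?\<Psi> e \<sigma> \<theta> = ?\<Psi> e \<sigma> \<theta>'))"
    using A by auto
qed auto

sublocale disc: cone_complex "points K" "skeleton K" "two_cells K" "{0..1::real}"
  "\<lambda>f \<rho> \<theta>. char2 K f (of_real \<rho> * cis (2 * pi * \<theta>))"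
proof
  let ?\<Psi> = "\<lambda>f \<rho> \<theta>. char2 K f (of_real \<rho> * cis (2 * pi * \<theta>))"
  have nrm: "norm (of_real \<rho> * cis (2 * pi * \<theta>)) = \<rho>" if "0 \<le> \<rho>" for \<rho> \<theta> :: real
    using that by (simp add: norm_mult)
  show "finite (two_cells K)" by (rule finite_cells)
  show "compact (skeleton K)" by (rule compact_skeleton)
  show "continuous_on ({0..1} \<times> {0..1}) (\<lambda>z. ?\<Psi> f (fst z) (snd z))" if "f \<in> two_cells K" for f
    by (rule continuous_on_compose2[OF char2_props(1)[OF that]]) (auto simp: norm_mult intro!: continuous_intros)
  have in_open: "?\<Psi> f \<rho> \<theta> \<in> open_2cell K f" if "0 \<le> \<rho>" "\<rho> < 1" for f \<theta> \<rho>
    using that nrm unfolding open_2cell_def by (intro imageI) (simp add: norm_mult)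
  have open_in: "\<exists>\<rho> \<theta>. x = ?\<Psi> f \<rho> \<theta> \<and> 0 \<le> \<rho> \<and> \<rho> < 1 \<and> \<theta> \<in> {0..1}" if x: "x \<in> open_2cell K f" for f x
  proof -
    obtain z where z: "x = char2 K f z" "norm z < 1" using x by (auto simp: open_2cell_def)
    obtain \<theta> where \<theta>: "0 \<le> \<theta>" "\<theta> < 2 * pi" "z = of_real (norm z) * cis \<theta>"
      using Arg2pi[of z] by (metis (no_types) Arg2pi_eq cis_conv_exp)
    then have "\<theta> / (2 * pi) \<in> {0..1}" "2 * pi * (\<theta> / (2 * pi)) = \<theta>" by (auto simp: field_simps)
    then show ?thesis using z \<theta> by (intro exI[of _ "norm z"] exI[of _ "\<theta> / (2 * pi)"]) auto
  qed
  show "points K = skeleton K \<union> {?\<Psi> f \<rho> \<theta> | f \<rho> \<theta>. f \<in> two_cells K \<and> 0 \<le> \<rho> \<and> \<rho> < 1 \<and> \<theta> \<in> {0..1}}"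
    unfolding points_eq using in_open open_in by blast
  show "?\<Psi> f 1 \<theta> \<in> skeleton K" if "f \<in> two_cells K" "\<theta> \<in> {0..1}" for f \<theta>
    using boundary_in_skeleton[OF that(1), of \<theta>] that(2) by (simp add: boundary_path_def)
  show "?\<Psi> f \<rho> \<theta> \<notin> skeleton K" if "f \<in> two_cells K" "\<theta> \<in> {0..1}" "0 \<le> \<rho>" "\<rho> < 1" for f \<theta> \<rho>
    using in_open[OF that(3,4), of f \<theta>] that(1) cells_disjoint(2,3) unfolding skeleton_eq by blast
  fix f f' \<theta> \<theta>' \<rho> \<rho>' assume A: "f \<in> two_cells K" "f' \<in> two_cells K" "\<theta> \<in> {0..1}" "\<theta>' \<in> {0..1}" "0 \<le> \<rho>" "\<rho> < 1"
    "0 \<le> \<rho>'" "\<rho>' < (1::real)" and eq: "?\<Psi> f \<rho> \<theta> = ?\<Psi> f' \<rho>' \<theta>'"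
  have "f = f'" using in_open[OF A(5,6), of f \<theta>] in_open[OF A(7,8), of f' \<theta>'] eq A(1,2) cells_disjoint(5)
    unfolding disjoint_family_on_def by auto
  moreover have e: "of_real \<rho> * cis (2 * pi * \<theta>) = of_real \<rho>' * cis (2 * pi * \<theta>')"
    by (rule inj_onD[OF char2_props(2)[OF A(1)] eq[folded \<open>f = f'\<close>]]) (use nrm A in \<open>simp_all add: norm_mult\<close>)
  moreover have "\<rho> = \<rho>'" using arg_cong[OF e, of norm] nrm A by simp
  ultimately show "f = f' \<and> \<rho> = \<rho>' \<and> (\<rho> = 0 \<or> (\<forall>\<sigma>. ?\<Psi> f \<sigma> \<theta> = ?\<Psi> f \<sigma> \<theta>'))"
    by (cases "\<rho> = 0") auto
qed auto

text \<open>The generating pieces of \<open>graph.paths_generated\<close> are paths in the finite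
  vertex set, which are constant, and diameters of edges. Up to homotopy a diameter is trivial, the
  edge, or its reverse.\<close>

lemma paths_are_words_in_skeleton:
  assumes "path g" "path_image g \<subseteq> skeleton K" "pathstart g \<in> zero_cells K" "pathfinish g \<in> zero_cells K"
  shows "\<exists>w. walk K (pathstart g) w (pathfinish g) \<and> homotopic_paths (skeleton K) g (word_path K (pathstart g) w)"
proof -
  define MM where "MM g \<longleftrightarrow> pathstart g \<in> zero_cells K \<and> (\<exists>w. walk K (pathstart g) w (pathfinish g) \<and>
      homotopic_paths (skeleton K) g (word_path K (pathstart g) w))" for g
  have "MM g"
  proof (rule graph.paths_generated[OF _ _ _ _ assms])
    fix g h assume gh: "homotopic_paths (skeleton K) g h" "MM g"
    then show "MM h"
      using homotopic_paths_imp_pathstart[OF gh(1)] homotopic_paths_imp_pathfinish[OF gh(1)]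
        homotopic_paths_trans[OF homotopic_paths_sym[OF gh(1)]] by (auto simp: MM_def)
  next
    fix g h assume gh: "MM g" "MM h" "path g" "path h" "pathfinish g = pathstart h"
    obtain w where w: "walk K (pathstart g) w (pathfinish g)" "homotopic_paths (skeleton K) g (word_path K (pathstart g) w)"
      using gh by (auto simp: MM_def)
    obtain w' where w': "walk K (pathfinish g) w' (pathfinish h)" "homotopic_paths (skeleton K) h (word_path K (pathfinish g) w')"
      using gh by (auto simp: MM_def)
    have v: "pathstart g \<in> zero_cells K" using gh by (simp add: MM_def)
    have "homotopic_paths (skeleton K) (g +++ h) (word_path K (pathstart g) w +++ word_path K (pathfinish g) w')"
      by (rule homotopic_paths_join[OF w(2) w'(2) gh(5)])
    also have "homotopic_paths (skeleton K) \<dots> (word_path K (pathstart g) (w @ w'))"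
      by (rule homotopic_paths_sym, rule word_path_append[OF edges w(1) w'(1) v]) simp
    finally show "MM (g +++ h)" using w w' v by (auto simp: MM_def walk_append intro!: exI[of _ "w @ w'"])
  next
    fix g assume g: "path g" "path_image g \<subseteq> zero_cells K"
    \<comment> \<open>A non-empty connected finite set in a Hausdorff space is a point, so the path
      stands still.\<close>
    have "connected (path_image g)" using g(1) by (rule connected_path_image)
    moreover have "finite (path_image g)" using g(2) finite_cells(1) finite_subset by blast
    moreover define x where "x = pathstart g"
    ultimately have x: "path_image g = {x}"
    proof -
      have "closed {x}" "closed (path_image g - {x})"
        using \<open>finite (path_image g)\<close> by (auto intro: finite_imp_closed)
      moreover have "x \<in> path_image g" by (simp add: x_def pathstart_in_path_image)
      ultimately have "(path_image g - {x}) \<inter> path_image g = {}"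
        using \<open>connected (path_image g)\<close>[unfolded connected_closed, simplified, rule_format, of "{x}" "path_image g - {x}"] by auto
      then show ?thesis using \<open>x \<in> path_image g\<close> by auto
    qed
    then have gx: "g t = x" if "t \<in> {0..1}" for t using that by (auto simp: path_image_def)
    have "homotopic_paths (skeleton K) g (\<lambda>_. x)"
      by (rule homotopic_paths_eq) (use g gx zero_subset_skeleton in auto)
    then show "MM g" using g x gx[of 0] gx[of 1]
      by (auto simp: MM_def pathstart_def pathfinish_def intro!: exI[of _ "[]"])
  next
    fix e \<theta> \<theta>' assume e: "e \<in> one_cells K" "\<theta> \<in> {0, 1::real}" "\<theta>' \<in> {0, 1::real}"
    let ?g = "graph.radius_in e \<theta> +++ graph.radius_out e \<theta>'"
    define k where "k = (\<lambda>t. (1 + (2 * \<theta> - 1) * (1 - t)) / 2) +++ (\<lambda>t. (1 + (2 * \<theta>' - 1) * t) / 2)"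
    have g: "?g = char1 K e \<circ> k"
      unfolding k_def path_compose_join by (simp add: graph.radius_in_def graph.radius_out_def comp_def)
    have c: "continuous_on {0..1} (char1 K e)" "char1 K e ` {0..1} \<subseteq> skeleton K"
      using char1_props(1)[OF e(1)] char1_in_skeleton[OF e(1)] by auto
    have k: "path k" unfolding k_def
      by (rule path_join_imp) (auto simp: path_def pathstart_def pathfinish_def intro!: continuous_intros)
    have ki: "path_image k \<subseteq> {0..1}" unfolding k_def
      by (rule subset_path_image_join) (use e in \<open>auto simp: path_image_def\<close>)
    have kse: "pathstart k = \<theta>" "pathfinish k = \<theta>'" by (auto simp: k_def pathstart_def pathfinish_def joinpaths_def)
    have hom: "homotopic_paths (skeleton K) ?g (char1 K e \<circ> h)"
      if "path h" "path_image h \<subseteq> {0..1}" "pathstart h = \<theta>" "pathfinish h = \<theta>'" for h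
      unfolding g by (rule homotopic_paths_convex_image[OF _ c k that(1) ki that(2)]) (use that kse in auto)
    have ends: "pathstart ?g = char1 K e \<theta>" "pathfinish ?g = char1 K e \<theta>'"
      unfolding g using kse by (simp_all add: pathstart_def pathfinish_def)
    have mm: "MM ?g" if "walk K (char1 K e \<theta>) w (char1 K e \<theta>')" "homotopic_paths (skeleton K) ?g (word_path K (char1 K e \<theta>) w)" for w
      using that ends e char1_props(3,4)[OF e(1)] by (auto simp: MM_def)
    have join_const: "homotopic_paths (skeleton K) (edge_path K s +++ (\<lambda>_. pathfinish (edge_path K s))) (edge_path K s)" if "fst s = e" for s
      using edge_path_props[OF edges, of s] that e by (intro homotopic_paths_rid_const) auto
    show "MM ?g"
    proof (cases "\<theta> = \<theta>'")
      case True
      have "homotopic_paths (skeleton K) ?g (char1 K e \<circ> (\<lambda>_. \<theta>))" by (rule hom) (use e True in auto)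
      then show ?thesis using True by (intro mm[of "[]"]) (auto simp: comp_def)
    next
      case False
      show ?thesis
      proof (cases "\<theta> = 0")
        case True
        then have "\<theta>' = 1" using False e by auto
        have "homotopic_paths (skeleton K) ?g (char1 K e \<circ> (\<lambda>t. t))"
          by (rule hom) (use True \<open>\<theta>' = 1\<close> in \<open>auto simp: path_def path_image_def pathstart_def pathfinish_def\<close>)
        then have "homotopic_paths (skeleton K) ?g (edge_path K (e, True))" by (simp add: edge_path_def comp_def)
        from homotopic_paths_trans[OF this homotopic_paths_sym[OF join_const[of "(e, True)", OF fst_conv]]] show ?thesis
          using True \<open>\<theta>' = 1\<close> e
          by (intro mm[of "[(e, True)]"]) (auto simp: edge_path_def pathstart_def pathfinish_def)
      next
        case False
        then have "\<theta> = 1" "\<theta>' = 0" using \<open>\<theta> \<noteq> \<theta>'\<close> e by auto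
        have "homotopic_paths (skeleton K) ?g (char1 K e \<circ> (\<lambda>t. 1 - t))"
          by (rule hom) (use \<open>\<theta> = 1\<close> \<open>\<theta>' = 0\<close> in \<open>auto simp: path_def path_image_def pathstart_def pathfinish_def intro!: continuous_intros\<close>)
        then have "homotopic_paths (skeleton K) ?g (edge_path K (e, False))"
          by (simp add: edge_path_def reversepath_def comp_def)
        from homotopic_paths_trans[OF this homotopic_paths_sym[OF join_const[of "(e, False)", OF fst_conv]]] show ?thesis
          using \<open>\<theta> = 1\<close> \<open>\<theta>' = 0\<close> e
          by (intro mm[of "[(e, False)]"]) (auto simp: edge_path_def reversepath_def pathstart_def pathfinish_def)
      qed
    qed
  qed
  then show ?thesis by (auto simp: MM_def)
qed

text \<open>A straight line in the closed disc deforms a broken diameter to an arc of the boundary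
  circle.\<close>

lemma paths_push_to_skeleton:
  assumes "path g" "path_image g \<subseteq> points K" "pathstart g \<in> skeleton K" "pathfinish g \<in> skeleton K"
  shows "\<exists>h. path h \<and> path_image h \<subseteq> skeleton K \<and> homotopic_paths (points K) g h"
proof -
  define MM where "MM g \<longleftrightarrow> (\<exists>h. path h \<and> path_image h \<subseteq> skeleton K \<and> homotopic_paths (points K) g h)" for g
  have "MM g"
  proof (rule disc.paths_generated[OF _ _ _ _ assms])
    fix g h assume "homotopic_paths (points K) g h" "MM g"
    then show "MM h" unfolding MM_def using homotopic_paths_trans[OF homotopic_paths_sym] by blast
  next
    fix g h assume gh: "MM g" "MM h" "path g" "path h" "pathfinish g = pathstart h"
    obtain g' where g': "path g'" "path_image g' \<subseteq> skeleton K" "homotopic_paths (points K) g g'" using gh(1) by (auto simp: MM_def)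
    obtain h' where h': "path h'" "path_image h' \<subseteq> skeleton K" "homotopic_paths (points K) h h'" using gh(2) by (auto simp: MM_def)
    have "pathfinish g' = pathstart h'"
      using homotopic_paths_imp_pathfinish[OF g'(3)] homotopic_paths_imp_pathstart[OF h'(3)] gh(5) by simp
    moreover have "homotopic_paths (points K) (g +++ h) (g' +++ h')"
      by (rule homotopic_paths_join[OF g'(3) h'(3) gh(5)])
    ultimately show "MM (g +++ h)" unfolding MM_def using g' h'
      by (intro exI[of _ "g' +++ h'"]) (auto simp: subset_path_image_join)
  next
    fix g assume "path g" "path_image g \<subseteq> skeleton K"
    then show "MM g" unfolding MM_def using skeleton_subset by (intro exI[of _ g]) auto
  next
    fix f \<theta> \<theta>' assume f: "f \<in> two_cells K" "\<theta> \<in> {0..1::real}" "\<theta>' \<in> {0..1::real}"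
    let ?g = "disc.radius_in f \<theta> +++ disc.radius_out f \<theta>'"
    define k where "k = (\<lambda>t. of_real (1 - t) * cis (2 * pi * \<theta>)) +++ (\<lambda>t. of_real t * cis (2 * pi * \<theta>'))"
    define h where "h t = cis (2 * pi * ((\<theta>' - \<theta>) * t + \<theta>))" for t
    have g: "?g = char2 K f \<circ> k"
      unfolding k_def path_compose_join by (simp add: disc.radius_in_def disc.radius_out_def comp_def)
    have in01: "(\<theta>' - \<theta>) * t + \<theta> \<in> {0..1}" if "t \<in> {0..1}" for t
      using affine_in_unit[of \<theta> \<theta>' t] f that by auto
    have "homotopic_paths (points K) ?g (char2 K f \<circ> h)"
      unfolding g
    proof (rule homotopic_paths_convex_image[OF _ char2_props(1)[OF f(1)]])
      show "char2 K f ` cball 0 1 \<subseteq> points K"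
      proof (rule image_subsetI)
        fix z :: complex assume z: "z \<in> cball 0 1"
        obtain \<theta> where \<theta>: "0 \<le> \<theta>" "\<theta> < 2 * pi" "z = of_real (norm z) * cis \<theta>"
          using Arg2pi[of z] by (metis (no_types) Arg2pi_eq cis_conv_exp)
        then have "\<theta> / (2 * pi) \<in> {0..1}" "2 * pi * (\<theta> / (2 * pi)) = \<theta>" by (auto simp: field_simps)
        then show "char2 K f z \<in> points K"
          using disc.cell_in_S[OF f(1), of "\<theta> / (2 * pi)" "norm z"] z \<theta>(3) by simp
      qed
      show "path k" unfolding k_def
        by (rule path_join_imp) (auto simp: path_def pathstart_def pathfinish_def intro!: continuous_intros)
      show "path_image k \<subseteq> cball 0 1" unfolding k_def
        by (rule subset_path_image_join) (auto simp: path_image_def norm_mult simp flip: of_real_diff)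
      show "path h" unfolding h_def path_def by (intro continuous_intros)
      show "path_image h \<subseteq> cball 0 1" by (auto simp: h_def path_image_def)
    qed (auto simp: k_def h_def pathstart_def pathfinish_def joinpaths_def)
    moreover have "char2 K f \<circ> h = (\<lambda>t. boundary_path K f ((\<theta>' - \<theta>) * t + \<theta>))"
      by (auto simp: h_def boundary_path_def)
    moreover have "path_image (\<lambda>t. boundary_path K f ((\<theta>' - \<theta>) * t + \<theta>)) \<subseteq> skeleton K"
      using boundary_in_skeleton[OF f(1)] in01 by (auto simp: path_image_def)
    ultimately show "MM ?g" unfolding MM_def using homotopic_paths_imp_path by metis
  qed
  then show ?thesis by (simp add: MM_def)
qed

theorem paths_are_words:
  assumes "path g" "path_image g \<subseteq> points K" "pathstart g \<in> zero_cells K" "pathfinish g \<in> zero_cells K"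
  shows "\<exists>w. walk K (pathstart g) w (pathfinish g) \<and> homotopic_paths (points K) g (word_path K (pathstart g) w)"
proof -
  have "pathstart g \<in> skeleton K" "pathfinish g \<in> skeleton K" using assms(3,4) zero_subset_skeleton by auto
  from paths_push_to_skeleton[OF assms(1,2) this]
  obtain h where h: "path h" "path_image h \<subseteq> skeleton K" "homotopic_paths (points K) g h" by (elim exE conjE)
  have e: "pathstart h = pathstart g" "pathfinish h = pathfinish g"
    using homotopic_paths_imp_pathstart[OF h(3)] homotopic_paths_imp_pathfinish[OF h(3)] by auto
  obtain w where w: "walk K (pathstart g) w (pathfinish g)" "homotopic_paths (skeleton K) h (word_path K (pathstart g) w)"
    using paths_are_words_in_skeleton[OF h(1,2)] assms(3,4) e by auto
  have "homotopic_paths (points K) g (word_path K (pathstart g) w)"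
    by (rule homotopic_paths_trans[OF h(3) homotopic_paths_subset[OF w(2) skeleton_subset]])
  then show ?thesis using w(1) by blast
qed

end


section \<open>Transport along edge words\<close>

definition transport_letter ::
  "('a::topological_space, 'e, 'f) two_complex \<Rightarrow> ('a \<Rightarrow> 'z set) \<Rightarrow> ('e \<Rightarrow> 'z \<Rightarrow> 'z) \<Rightarrow> 'e \<times> bool \<Rightarrow> 'z \<Rightarrow> 'z" where
  "transport_letter K F \<tau> s z =
     (if snd s then \<tau> (fst s) z else inv_into (F (char1 K (fst s) 0)) (\<tau> (fst s)) z)"

fun transport ::
  "('a::topological_space, 'e, 'f) two_complex \<Rightarrow> ('a \<Rightarrow> 'z set) \<Rightarrow> ('e \<Rightarrow> 'z \<Rightarrow> 'z) \<Rightarrow> ('e \<times> bool) list \<Rightarrow> 'z \<Rightarrow> 'z" where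
  "transport K F \<tau> [] z = z"
| "transport K F \<tau> (s # w) z = transport K F \<tau> w (transport_letter K F \<tau> s z)"

locale edge_transport = fin_complex K
  for K :: "('a::t2_space, 'e, 'f) two_complex" +
  fixes F :: "'a \<Rightarrow> 'z set" and \<tau> :: "'e \<Rightarrow> 'z \<Rightarrow> 'z"
  assumes bij: "e \<in> one_cells K \<Longrightarrow> bij_betw (\<tau> e) (F (char1 K e 0)) (F (char1 K e 1))"
    and nonempty: "v \<in> zero_cells K \<Longrightarrow> F v \<noteq> {}"
    and closed: "\<lbrakk>f \<in> two_cells K; z \<in> F (boundary_path K f 0)\<rbrakk> \<Longrightarrow>
       \<exists>w. is_boundary_word K f w \<and> transport K F \<tau> w z = z"
begin

abbreviation trans1 where "trans1 \<equiv> transport_letter K F \<tau>"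
abbreviation trans where "trans \<equiv> transport K F \<tau>"

text \<open>The fibres are sets without a topology; the wrapper \<open>discrete\<close> supplies the
  discrete one.\<close>

definition T0 :: "('a \<times> 'z discrete) set" where
  "T0 = {(v, discrete z) | v z. v \<in> zero_cells K \<and> z \<in> F v}"

lemma covering_T0: "covering_space T0 fst (zero_cells K)"
proof
  show "continuous_on T0 fst" by (intro continuous_intros)
  show "fst ` T0 = zero_cells K" using nonempty by (force simp: T0_def)
  fix v assume v: "v \<in> zero_cells K"
  have "closed (zero_cells K - {v})" using finite_cells(1) by (intro finite_imp_closed) auto
  then have ov: "open (- (zero_cells K - {v}))" by (rule open_Compl)
  have "zero_cells K \<inter> - (zero_cells K - {v}) = {v}" using v by auto
  then have o: "openin (top_of_set (zero_cells K)) {v}" using ov by (metis openin_open_Int)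
  show "\<exists>X. v \<in> X \<and> openin (top_of_set (zero_cells K)) X \<and> (\<exists>V. \<Union> V = T0 \<inter> fst -` X \<and>
     (\<forall>u\<in>V. openin (top_of_set T0) u) \<and> pairwise disjnt V \<and> (\<forall>u\<in>V. \<exists>q. homeomorphism u X fst q))"
  proof (intro exI[of _ "{v}"] conjI o exI[of _ "(\<lambda>z. {(v, discrete z)}) ` F v"] ballI)
    show "\<Union> ((\<lambda>z. {(v, discrete z)}) ` F v) = T0 \<inter> fst -` {v}" using v by (auto simp: T0_def)
    show "pairwise disjnt ((\<lambda>z. {(v, discrete z)}) ` F v)"
      by (auto simp: pairwise_def disjnt_def discrete_inject)
    fix u assume "u \<in> (\<lambda>z. {(v, discrete z)}) ` F v"
    then obtain z where z: "z \<in> F v" "u = {(v, discrete z)}" by auto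
    have "u = T0 \<inter> (- (zero_cells K - {v})) \<times> {discrete z}" using z v by (auto simp: T0_def)
    moreover have "open ((- (zero_cells K - {v})) \<times> {discrete z})" by (intro open_Times ov open_discrete)
    ultimately show "openin (top_of_set T0) u" by (metis openin_open_Int)
    show "\<exists>q. homeomorphism u {v} fst q"
      by (rule exI[of _ "\<lambda>_. (v, discrete z)"]) (auto simp: homeomorphism_def z)
  qed simp
qed

text \<open>Labels are the points over the initial vertex of the edge; at the other end the lift is
  prescribed by \<open>\<tau>\<close>.\<close>

definition lft1 :: "'e \<Rightarrow> 'a \<times> 'z discrete \<Rightarrow> real \<Rightarrow> 'a \<times> 'z discrete" where
  "lft1 e l \<theta> = (if \<theta> = 0 then l else (char1 K e 1, discrete (\<tau> e (of_discrete (snd l)))))"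

sublocale G: cone_cover "skeleton K" "zero_cells K" "one_cells K" "{0, 1::real}"
  "\<lambda>e \<rho> \<theta>. char1 K e ((1 + (2 * \<theta> - 1) * \<rho>) / 2)" T0 fst lft1
proof
  show "covering_space T0 fst (zero_cells K)" by (rule covering_T0)
  fix e assume e: "e \<in> one_cells K"
  note b = bij_betwE[OF bij[OF e]] bij_betw_imp_inj_on[OF bij[OF e]] bij_betw_imp_surj_on[OF bij[OF e]]
  {
    fix l assume l: "l \<in> T0" "fst l = char1 K e ((1 + (2 * 0 - 1) * 1) / 2)"
    show "continuous_on {0, 1} (lft1 e l)" by (rule continuous_on_finite) auto
    fix \<theta> :: real assume "\<theta> \<in> {0, 1}"
    then show "lft1 e l \<theta> \<in> T0 \<and> fst (lft1 e l \<theta>) = char1 K e ((1 + (2 * \<theta> - 1) * 1) / 2)"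
      using l b(1) char1_props(4)[OF e] by (auto simp: lft1_def T0_def discrete_inverse)
  next
    fix \<theta> :: real and \<xi> assume A: "\<theta> \<in> {0, 1}" "\<xi> \<in> T0" "fst \<xi> = char1 K e ((1 + (2 * \<theta> - 1) * 1) / 2)"
    show "\<exists>l\<in>T0. fst l = char1 K e ((1 + (2 * 0 - 1) * 1) / 2) \<and> lft1 e l \<theta> = \<xi>"
    proof (cases "\<theta> = 0")
      case True
      then show ?thesis using A by (intro bexI[of _ \<xi>]) (auto simp: lft1_def)
    next
      case False
      then obtain z where z: "\<xi> = (char1 K e 1, discrete z)" "z \<in> F (char1 K e 1)" using A by (auto simp: T0_def)
      then obtain z0 where "z0 \<in> F (char1 K e 0)" "\<tau> e z0 = z" using b(3) by (metis imageE)
      then show ?thesis using z False char1_props(3)[OF e]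
        by (intro bexI[of _ "(char1 K e 0, discrete z0)"]) (auto simp: lft1_def T0_def discrete_inverse)
    qed
  next
    fix \<theta> :: real and l l' assume A: "\<theta> \<in> {0, 1}" "l \<in> T0" "l' \<in> T0" "fst l = char1 K e ((1 + (2 * 0 - 1) * 1) / 2)"
      "fst l' = char1 K e ((1 + (2 * 0 - 1) * 1) / 2)" "lft1 e l \<theta> = lft1 e l' \<theta>"
    then obtain z z' where z: "l = (char1 K e 0, discrete z)" "z \<in> F (char1 K e 0)"
        "l' = (char1 K e 0, discrete z')" "z' \<in> F (char1 K e 0)"
      by (auto simp: T0_def)
    show "l = l'"
    proof (cases "\<theta> = 0")
      case True
      then show ?thesis using A(6) by (simp add: lft1_def)
    next
      case False
      then have "\<tau> e z = \<tau> e z'" using A(6) z by (simp add: lft1_def discrete_inverse discrete_inject)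
      then have "z = z'" using inj_onD[OF b(2)] z by blast
      then show ?thesis using z by simp
    qed
  next
    fix \<theta> \<theta>' :: real and l assume A: "\<theta> \<in> {0, 1}" "\<theta>' \<in> {0, 1}"
      and eq: "\<And>\<sigma>. char1 K e ((1 + (2 * \<theta> - 1) * \<sigma>) / 2) = char1 K e ((1 + (2 * \<theta>' - 1) * \<sigma>) / 2)"
    \<comment> \<open>Evaluation at radius 1/2 gives interior points of the edge, where the
      characteristic map is injective. So equal radii have equal \<open>\<theta>\<close>, and the
      compatibility condition holds trivially.\<close>
    have "(1 + (2 * \<theta> - 1) * (1/2)) / 2 = (1 + (2 * \<theta>' - 1) * (1/2)) / 2"
      by (rule inj_onD[OF char1_props(2)[OF e] eq]) (use A in auto)
    then show "lft1 e l \<theta> = lft1 e l \<theta>'" using A by auto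
  }
qed

definition vert :: "'a \<Rightarrow> 'z \<Rightarrow> 'a \<times> ('e option \<Rightarrow> ('a \<times> 'z discrete) pointed)" where
  "vert v z = G.base_pt (v, discrete z)"

lemma fst_vert [simp]: "fst (vert v z) = v"
  by (simp add: vert_def)

lemma vert_in: "\<lbrakk>v \<in> zero_cells K; z \<in> F v\<rbrakk> \<Longrightarrow> vert v z \<in> G.Total"
proof -
  assume "v \<in> zero_cells K" "z \<in> F v"
  then have "(v, discrete z) \<in> T0" unfolding T0_def by blast
  then show ?thesis unfolding vert_def G.Total_def by blast
qed

lemma vert_eq_iff: "vert v z = vert v z' \<longleftrightarrow> z = z'"
  by (auto simp: vert_def G.base_pt_def fun_eq_iff discrete_inject split: option.splits)

lemma over_vertex:
  assumes "\<xi> \<in> G.Total" "fst \<xi> = v" "v \<in> zero_cells K"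
  obtains z where "z \<in> F v" "\<xi> = vert v z"
proof -
  have "\<xi> \<in> G.base_pt ` T0" using G.Total_over_M assms by auto
  then show thesis using that assms(2) by (auto simp: T0_def vert_def)
qed

lemma lift_edge:
  assumes e: "e \<in> one_cells K" and z: "z \<in> F (char1 K e 0)"
  shows "lift_end G.Total fst (char1 K e) (vert (char1 K e 0) z) = vert (char1 K e 1) (\<tau> e z)"
proof -
  define l where "l = (char1 K e 0, discrete z)"
  have "l \<in> T0" using z char1_props(3)[OF e] unfolding l_def T0_def by blast
  then have l: "l \<in> G.Lab e" by (simp add: l_def G.Lab_def)
  \<comment> \<open>The lift stays on the sheet \<open>l\<close> and runs from the initial end to
    the apex and on to the other end.\<close>
  define a b where "a = (\<lambda>t. G.cell_pt e l (1 - t) 0)" and "b = (\<lambda>t. G.cell_pt e l t 1)"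
  have "path a" unfolding a_def path_def
    by (rule continuous_on_compose2[OF G.continuous_on_cell_pt[OF e l], where f = "\<lambda>t. (1 - t, 0)", simplified fst_conv snd_conv])
       (auto intro!: continuous_intros)
  moreover have "path b" unfolding b_def path_def
    by (rule continuous_on_compose2[OF G.continuous_on_cell_pt[OF e l], where f = "\<lambda>t. (t, 1)", simplified fst_conv snd_conv])
       (auto intro!: continuous_intros)
  moreover have ab: "pathfinish a = pathstart b"
    by (simp add: a_def b_def pathfinish_def pathstart_def G.cell_pt_def)
  ultimately have "path (a +++ b)" by simp
  moreover have "path_image a \<subseteq> G.Total" "path_image b \<subseteq> G.Total"
    using e l by (auto simp: a_def b_def path_image_def intro!: G.cell_pt_in_Total)
  then have "path_image (a +++ b) \<subseteq> G.Total" by (rule subset_path_image_join)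
  moreover have "fst ((a +++ b) t) = char1 K e t" for t
    by (simp add: joinpaths_def a_def b_def)
  ultimately have "lift_end G.Total fst (char1 K e) (pathstart (a +++ b)) = pathfinish (a +++ b)"
    by (rule lift_endI[OF G.covering_Total])
  then show ?thesis
    using G.cell_pt_1[OF e l, of 0] G.cell_pt_1[OF e l, of 1]
    by (simp add: a_def b_def pathstart_def pathfinish_def lft1_def l_def vert_def discrete_inverse joinpaths_def)
qed

lemma trans1_in:
  assumes "fst s \<in> one_cells K" "z \<in> F (pathstart (edge_path K s))"
  shows "trans1 s z \<in> F (pathfinish (edge_path K s))"
proof (cases "snd s")
  case True
  then show ?thesis using assms bij_betwE[OF bij[OF assms(1)]]
    by (simp add: edge_path_def transport_letter_def pathstart_def pathfinish_def)
next
  case False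
  then show ?thesis using assms bij_betw_imp_surj_on[OF bij[OF assms(1)]]
    by (simp add: edge_path_def transport_letter_def reversepath_def pathstart_def pathfinish_def inv_into_into)
qed

lemma lift_letter:
  assumes s: "fst s \<in> one_cells K" and z: "z \<in> F (pathstart (edge_path K s))"
  shows "lift_end G.Total fst (edge_path K s) (vert (pathstart (edge_path K s)) z) = vert (pathfinish (edge_path K s)) (trans1 s z)"
proof (cases "snd s")
  case True
  then show ?thesis using lift_edge[OF s] z by (simp add: edge_path_def transport_letter_def pathstart_def pathfinish_def)
next
  case False
  let ?e = "fst s"
  have z1: "z \<in> F (char1 K ?e 1)" using z False by (simp add: edge_path_def reversepath_def pathstart_def)
  define z0 where "z0 = inv_into (F (char1 K ?e 0)) (\<tau> ?e) z"
  have z0: "z0 \<in> F (char1 K ?e 0)" "\<tau> ?e z0 = z"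
    using z1 bij_betw_imp_surj_on[OF bij[OF s]] by (auto simp: z0_def inv_into_into f_inv_into_f)
  have "lift_end G.Total fst (reversepath (char1 K ?e)) (lift_end G.Total fst (char1 K ?e) (vert (char1 K ?e 0) z0)) = vert (char1 K ?e 0) z0"
    by (rule lift_end_reverse[OF G.covering_Total])
       (use char1_props[OF s] z0 edge_path_props[OF edges, of "(?e, True)"] s vert_in in \<open>auto simp: edge_path_def pathstart_def\<close>)
  then show ?thesis using False lift_edge[OF s z0(1)] z0
    by (simp add: edge_path_def transport_letter_def z0_def reversepath_def pathstart_def pathfinish_def)
qed

lemma lift_word:
  assumes "walk K u w v" "u \<in> zero_cells K" "z \<in> F u"
  shows "lift_end G.Total fst (word_path K u w) (vert u z) = vert v (trans w z) \<and> trans w z \<in> F v"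
  using assms
proof (induction w arbitrary: u z)
  case Nil
  then show ?case using lift_end_const[OF G.covering_Total] vert_in by simp
next
  case (Cons s w)
  let ?y = "pathfinish (edge_path K s)"
  note E = edge_path_props[OF edges, of s]
  have s: "fst s \<in> one_cells K" "pathstart (edge_path K s) = u" using Cons.prems by auto
  have IH: "lift_end G.Total fst (word_path K ?y w) (vert ?y (trans1 s z)) = vert v (trans w (trans1 s z)) \<and> trans w (trans1 s z) \<in> F v"
    by (rule Cons.IH) (use Cons.prems E trans1_in[of s z] s in auto)
  have W: "path (word_path K ?y w) \<and> path_image (word_path K ?y w) \<subseteq> skeleton K \<and>
    pathstart (word_path K ?y w) = ?y \<and> pathfinish (word_path K ?y w) = v \<and> v \<in> zero_cells K"
    by (rule word_path_props[OF edges]) (use Cons.prems E in auto)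
  have "lift_end G.Total fst (edge_path K s +++ word_path K ?y w) (vert u z) =
      lift_end G.Total fst (word_path K ?y w) (lift_end G.Total fst (edge_path K s) (vert u z))"
    by (rule lift_end_join[OF G.covering_Total]) (use E W s Cons.prems vert_in in auto)
  then show ?case using IH lift_letter[OF s(1)] s Cons.prems by simp
qed

definition lft2 where
  "lft2 f l = (SOME h. path h \<and> path_image h \<subseteq> G.Total \<and> pathstart h = l \<and>
     (\<forall>t\<in>{0..1}. fst (h t) = boundary_path K f t))"

text \<open>That the lift closes up is where \<open>closed\<close> enters: in the skeleton the
  boundary path is homotopic to a word path, and along word paths the lifts are computed by
  \<open>trans\<close>.\<close>

lemma lft2:
  assumes f: "f \<in> two_cells K" and l: "l \<in> G.Total" "fst l = boundary_path K f 0"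
  shows "path (lft2 f l)" "path_image (lft2 f l) \<subseteq> G.Total" "lft2 f l 0 = l"
    "t \<in> {0..1} \<Longrightarrow> fst (lft2 f l t) = boundary_path K f t" "lft2 f l 1 = l"
proof -
  have b: "path (boundary_path K f)" "path_image (boundary_path K f) \<subseteq> skeleton K"
    using path_boundary[OF f] boundary_in_skeleton[OF f] by (auto simp: path_image_def)
  have "\<exists>h. path h \<and> path_image h \<subseteq> G.Total \<and> pathstart h = l \<and> (\<forall>t\<in>{0..1}. fst (h t) = boundary_path K f t)"
  proof -
    have "fst l = pathstart (boundary_path K f)" using l(2) by (simp add: pathstart_def)
    then obtain h where "path h" "path_image h \<subseteq> G.Total" "pathstart h = l" "\<And>t. t \<in> {0..1} \<Longrightarrow> fst (h t) = boundary_path K f t"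
      using covering_lift_path[OF G.covering_Total b l(1)] by blast
    then show ?thesis by blast
  qed
  from someI_ex[OF this]
  have *: "path (lft2 f l) \<and> path_image (lft2 f l) \<subseteq> G.Total \<and> pathstart (lft2 f l) = l \<and>
      (\<forall>t\<in>{0..1}. fst (lft2 f l t) = boundary_path K f t)"
    unfolding lft2_def .
  then show **: "path (lft2 f l)" "path_image (lft2 f l) \<subseteq> G.Total" "lft2 f l 0 = l"
    and ***: "t \<in> {0..1} \<Longrightarrow> fst (lft2 f l t) = boundary_path K f t" for t
    by (auto simp: pathstart_def)
  let ?v = "boundary_path K f 0"
  have v: "?v \<in> zero_cells K" by (rule boundary_start_in[OF f])
  obtain z where z: "z \<in> F ?v" "l = vert ?v z" using over_vertex[OF l v] by metis
  obtain w where w: "is_boundary_word K f w" "trans w z = z" using closed[OF f z(1)] by blast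
  note W = boundary_word_homotopic[OF edges w(1) b(1)]
  have "lft2 f l 1 = lift_end G.Total fst (boundary_path K f) l"
    using lift_endI[OF G.covering_Total **(1,2) ***] **(3) by (simp add: pathstart_def pathfinish_def)
  also have "\<dots> = lift_end G.Total fst (word_path K ?v w) l"
    by (rule lift_end_homotopic[OF G.covering_Total W(3) l(1)]) (simp add: l(2) pathstart_def)
  also have "\<dots> = l"
    using lift_word[OF W(2) v z(1)] z w(2) boundary_start[of f] by simp
  finally show "lft2 f l 1 = l" .
qed

sublocale D: cone_cover "points K" "skeleton K" "two_cells K" "{0..1::real}"
  "\<lambda>f \<rho> \<theta>. char2 K f (of_real \<rho> * cis (2 * pi * \<theta>))" G.Total fst lft2
proof
  let ?\<Psi> = "\<lambda>f \<rho> \<theta>. char2 K f (of_real \<rho> * cis (2 * pi * \<theta>))"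
  have b: "?\<Psi> f 1 \<theta> = boundary_path K f \<theta>" for f \<theta> by (simp add: boundary_path_def)
  show "covering_space G.Total fst (skeleton K)" by (rule G.covering_Total)
  fix f assume f: "f \<in> two_cells K"
  {
    fix l assume "l \<in> G.Total" "fst l = ?\<Psi> f 1 0"
    then have l: "l \<in> G.Total" "fst l = boundary_path K f 0" by (simp_all add: boundary_path_def)
    show "continuous_on {0..1} (lft2 f l)" using lft2(1)[OF f l] by (simp add: path_def)
    fix \<theta> :: real assume \<theta>: "\<theta> \<in> {0..1}"
    then show "lft2 f l \<theta> \<in> G.Total \<and> fst (lft2 f l \<theta>) = ?\<Psi> f 1 \<theta>"
      using lft2(2,4)[OF f l] unfolding b by (auto simp: path_image_def)
    fix \<theta>' :: real assume \<theta>': "\<theta>' \<in> {0..1}" and eq: "\<And>\<sigma>. ?\<Psi> f \<sigma> \<theta> = ?\<Psi> f \<sigma> \<theta>'"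
    \<comment> \<open>Equality at radius 1/2 forces the angles to differ by full turns. Apart from
      equal angles this leaves only \<open>0\<close> and \<open>1\<close>, where the lift closes
      up.\<close>
    have "of_real (1/2) * cis (2 * pi * \<theta>) = of_real (1/2) * cis (2 * pi * \<theta>')"
      by (rule inj_onD[OF char2_props(2)[OF f] eq]) (simp_all add: norm_mult)
    then have "cis (2 * pi * \<theta>) = cis (2 * pi * \<theta>')" by simp
    then obtain n :: int where n: "2 * pi * \<theta> = 2 * pi * \<theta>' + 2 * pi * n"
      using sin_cos_eq_iff[of "2 * pi * \<theta>" "2 * pi * \<theta>'"] by (auto simp: complex_eq_iff)
    then have "2 * pi * \<theta> = 2 * pi * (\<theta>' + n)" by (simp add: algebra_simps)
    then have n: "\<theta> = \<theta>' + n" by simp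
    then have "-1 \<le> n" "n \<le> 1" using \<theta> \<theta>' by auto
    then consider "n = 0" | "n = 1" | "n = -1" by linarith
    then have "\<theta> = \<theta>' \<or> {\<theta>, \<theta>'} = {0, 1}" using \<theta> \<theta>' n by cases auto
    then show "lft2 f l \<theta> = lft2 f l \<theta>'" using lft2(3,5)[OF f l] by (auto simp: doubleton_eq_iff)
  next
    fix \<theta> :: real and \<xi> assume A: "\<theta> \<in> {0..1}" "\<xi> \<in> G.Total" "fst \<xi> = ?\<Psi> f 1 \<theta>"
    \<comment> \<open>The boundary path is run backwards from \<open>\<xi>\<close> to find the label
      of its sheet.\<close>
    define g where "g = (\<lambda>t. boundary_path K f (\<theta> * (1 - t)))"
    have in01: "\<theta> * (1 - t) \<in> {0..1}" if "t \<in> {0..1}" for t using A(1) that by (auto intro: mult_le_one)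
    have g: "path g"
      unfolding path_def g_def
      by (rule continuous_on_compose2[OF path_boundary[OF f, unfolded path_def]]) (use in01 in \<open>auto intro!: continuous_intros\<close>)
    have gi: "path_image g \<subseteq> skeleton K"
      unfolding path_image_def g_def
    proof (rule image_subsetI)
      fix t :: real assume "t \<in> {0..1}"
      from in01[OF this] show "boundary_path K f (\<theta> * (1 - t)) \<in> skeleton K" by (intro boundary_in_skeleton[OF f]) auto
    qed
    have "fst \<xi> = pathstart g" using A(3) by (simp add: g_def pathstart_def boundary_path_def)
    then obtain h where h: "path h" "path_image h \<subseteq> G.Total" "pathstart h = \<xi>" "\<And>t. t \<in> {0..1} \<Longrightarrow> fst (h t) = g t"
      using covering_lift_path[OF G.covering_Total g gi A(2)] by blast
    define l where "l = h 1"
    have l: "l \<in> G.Total" "fst l = boundary_path K f 0" using h by (auto simp: l_def path_image_def g_def)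
    have "lft2 f l (\<theta> * 1) = h (1 - 1)"
    proof (rule path_lift_unique[OF G.covering_Total, of "\<lambda>s. lft2 f l (\<theta> * s)" "\<lambda>s. h (1 - s)" 0 1])
      have i: "\<theta> * s \<in> {0..1}" if "s \<in> {0..1}" for s using A(1) that by (auto intro: mult_le_one)
      show "path (\<lambda>s. lft2 f l (\<theta> * s))"
        unfolding path_def by (rule continuous_on_compose2[OF lft2(1)[OF f l, unfolded path_def]]) (use i in \<open>auto intro!: continuous_intros\<close>)
      show "path_image (\<lambda>s. lft2 f l (\<theta> * s)) \<subseteq> G.Total" using lft2(2)[OF f l] i by (auto simp: path_image_def)
      show "path (\<lambda>s. h (1 - s))" using path_reversepath[of h] h(1) by (simp add: reversepath_def)
      show "path_image (\<lambda>s. h (1 - s)) \<subseteq> G.Total" using path_image_reversepath[of h] h(2) by (simp add: reversepath_def)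
      show "fst (lft2 f l (\<theta> * t)) = fst (h (1 - t))" if "t \<in> {0..1}" for t
        using lft2(4)[OF f l i[OF that]] h(4)[of "1 - t"] that by (simp add: g_def)
    qed (use lft2(3)[OF f l] in \<open>auto simp: l_def\<close>)
    then have "lft2 f l \<theta> = \<xi>" using h(3) by (simp add: pathstart_def)
    then show "\<exists>l\<in>G.Total. fst l = ?\<Psi> f 1 0 \<and> lft2 f l \<theta> = \<xi>" using l unfolding b by blast
  next
    fix \<theta> :: real and l l' assume \<theta>: "\<theta> \<in> {0..1}" and A: "l \<in> G.Total" "l' \<in> G.Total" "fst l = ?\<Psi> f 1 0"
      "fst l' = ?\<Psi> f 1 0" "lft2 f l \<theta> = lft2 f l' \<theta>"
    have l: "l \<in> G.Total" "fst l = boundary_path K f 0" "l' \<in> G.Total" "fst l' = boundary_path K f 0"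
      using A by (simp_all add: boundary_path_def)
    have "lft2 f l 0 = lft2 f l' 0"
      by (rule path_lift_unique[OF G.covering_Total lft2(1,2)[OF f l(1,2)] lft2(1,2)[OF f l(3,4)] _ \<theta> A(5)])
         (use lft2(4)[OF f l(1,2)] lft2(4)[OF f l(3,4)] in auto)
    then show "l = l'" using lft2(3) f l by simp
  }
qed

text \<open>Homotopic paths have the same monodromy in the covering \<open>D.Total\<close> of the
  whole complex, and there the monodromy along a word is given by \<open>trans\<close>. This stands
  in for a presentation of the fundamental group by generators and relators.\<close>

theorem transport_homotopic:
  assumes u: "u \<in> zero_cells K" and w: "walk K u w v" and w': "walk K u w' v"
    and hom: "homotopic_paths (points K) (word_path K u w) (word_path K u w')" and z: "z \<in> F u"
  shows "trans w z = trans w' z"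
proof -
  have *: "lift_end D.Total fst (word_path K u w) (D.base_pt (vert u z)) = D.base_pt (vert v (trans w z))"
    if w: "walk K u w v" for w
  proof -
    note W = word_path_props[OF edges w u]
    obtain h where h: "path h" "path_image h \<subseteq> G.Total" "pathstart h = vert u z"
      "pathfinish h = lift_end G.Total fst (word_path K u w) (vert u z)" "\<And>t. t \<in> {0..1} \<Longrightarrow> fst (h t) = word_path K u w t"
    proof -
      have "path (word_path K u w)" "path_image (word_path K u w) \<subseteq> skeleton K" "fst (vert u z) = pathstart (word_path K u w)"
        using W by simp_all
      from lift_endE[OF G.covering_Total this(1,2) vert_in[OF u z] this(3)] show thesis using that by blast
    qed
    have "path (D.base_pt \<circ> h)"
      by (rule path_continuous_image[OF h(1)]) (rule continuous_on_subset[OF D.continuous_on_base_pt h(2)])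
    moreover have "path_image (D.base_pt \<circ> h) \<subseteq> D.Total"
      using h(2) unfolding path_image_compose D.Total_def by blast
    moreover have "fst ((D.base_pt \<circ> h) t) = word_path K u w t" if "t \<in> {0..1}" for t
      using h(5)[OF that] by simp
    ultimately have "lift_end D.Total fst (word_path K u w) (pathstart (D.base_pt \<circ> h)) = pathfinish (D.base_pt \<circ> h)"
      by (rule lift_endI[OF D.covering_Total])
    then show ?thesis using h(3,4) lift_word[OF w u z] by (simp add: pathstart_compose pathfinish_compose)
  qed
  have "D.base_pt (vert u z) \<in> D.Total" using vert_in[OF u z] by (simp add: D.Total_def)
  then have "lift_end D.Total fst (word_path K u w) (D.base_pt (vert u z)) = lift_end D.Total fst (word_path K u w') (D.base_pt (vert u z))"
    by (rule lift_end_homotopic[OF D.covering_Total hom]) (use word_path_props[OF edges w u] in simp)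
  \<comment> \<open>The coordinate \<open>None\<close> recovers the point of the covering of the
    skeleton.\<close>
  then have "snd (D.base_pt (vert v (trans w z))) None = snd (D.base_pt (vert v (trans w' z))) None"
    unfolding *[OF w] *[OF w'] by simp
  then show ?thesis by (simp add: D.base_pt_def vert_eq_iff)
qed

end


section \<open>Finite connected covers and their cells\<close>

section \<open>Path connectedness\<close>

lemma openin_finite_t1:
  fixes V :: "'a::t1_space set"
  assumes "finite V" "A \<subseteq> V"
  shows "openin (top_of_set V) A"
proof -
  have "closed (V - A)" using assms by (intro finite_imp_closed) auto
  moreover have "A = V \<inter> - (V - A)" using assms by auto
  ultimately show ?thesis by (metis open_Compl openin_open_Int)
qed

text \<open>The path component of \<open>x\<close> in \<open>U\<close>, empty for \<open>x\<close>
  outside \<open>U\<close>.\<close>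

definition path_piece :: "'a::topological_space set \<Rightarrow> 'a \<Rightarrow> 'a set" where
  "path_piece U x = {y. \<exists>g. path g \<and> path_image g \<subseteq> U \<and> pathstart g = x \<and> pathfinish g = y}"

lemma path_piece_trans:
  assumes "y \<in> path_piece U x" "z \<in> path_piece U y"
  shows "z \<in> path_piece U x"
proof -
  obtain g where g: "path g" "path_image g \<subseteq> U" "pathstart g = x" "pathfinish g = y" using assms(1) by (auto simp: path_piece_def)
  obtain h where h: "path h" "path_image h \<subseteq> U" "pathstart h = y" "pathfinish h = z" using assms(2) by (auto simp: path_piece_def)
  show ?thesis unfolding path_piece_def using g h
    by (intro CollectI exI[of _ "g +++ h"]) (auto simp: subset_path_image_join)
qed

lemma path_piece_sym: "y \<in> path_piece U x \<Longrightarrow> x \<in> path_piece U y"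
proof -
  assume "y \<in> path_piece U x"
  then obtain g where "path g" "path_image g \<subseteq> U" "pathstart g = x" "pathfinish g = y" by (auto simp: path_piece_def)
  then show ?thesis unfolding path_piece_def by (intro CollectI exI[of _ "reversepath g"]) auto
qed

lemma path_piece_refl: "x \<in> U \<Longrightarrow> x \<in> path_piece U x"
  unfolding path_piece_def by (intro CollectI exI[of _ "\<lambda>_. x"]) auto

lemma path_piece_subset: "path_piece U x \<subseteq> U"
  by (auto simp: path_piece_def)

text \<open>Around each of its points the parameter space of a cone contains arbitrarily small connected sets;
  this is what makes the path components of open sets open.\<close>

lemma openin_preimage_path_piece:
  fixes \<Psi> :: "real \<times> real \<Rightarrow> 'a::topological_space" and D :: "(real \<times> real) set"
  assumes c: "continuous_on D \<Psi>" and im: "\<Psi> ` D \<subseteq> S" and U: "openin (top_of_set S) U" and \<delta>: "\<delta> > 0"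
    and convex: "\<And>z. z \<in> D \<Longrightarrow> convex (ball z \<delta> \<inter> D)"
  shows "openin (top_of_set D) {z \<in> D. \<Psi> z \<in> path_piece U x}"
proof (subst openin_contains_ball, intro conjI ballI)
  show "{z \<in> D. \<Psi> z \<in> path_piece U x} \<subseteq> D" by auto
  fix z assume z: "z \<in> {z \<in> D. \<Psi> z \<in> path_piece U x}"
  have "openin (top_of_set D) (D \<inter> \<Psi> -` U)" by (rule continuous_openin_preimage[OF c _ U]) (use im in auto)
  moreover have "z \<in> D \<inter> \<Psi> -` U" using z path_piece_subset[of U x] by auto
  ultimately obtain r where r: "r > 0" "ball z r \<inter> D \<subseteq> D \<inter> \<Psi> -` U"
    unfolding openin_contains_ball by blast
  show "\<exists>e>0. ball z e \<inter> D \<subseteq> {z \<in> D. \<Psi> z \<in> path_piece U x}"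
  proof (intro exI[of _ "min r \<delta>"] conjI subsetI)
    show "min r \<delta> > 0" using r \<delta> by simp
    fix z' assume z': "z' \<in> ball z (min r \<delta>) \<inter> D"
    have cv: "convex (ball z (min r \<delta>) \<inter> D)"
    proof -
      have "ball z (min r \<delta>) \<inter> D = ball z r \<inter> (ball z \<delta> \<inter> D)" by auto
      then show ?thesis using convex[of z] z by (simp add: convex_Int)
    qed
    have zz: "z \<in> ball z (min r \<delta>) \<inter> D" using z r \<delta> by auto
    have seg: "closed_segment z z' \<subseteq> ball z (min r \<delta>) \<inter> D" by (rule closed_segment_subset[OF zz z' cv])
    have "\<Psi> z' \<in> path_piece U (\<Psi> z)" unfolding path_piece_def
    proof (intro CollectI exI[of _ "\<Psi> \<circ> linepath z z'"] conjI)
      show "path (\<Psi> \<circ> linepath z z')"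
        by (rule path_continuous_image) (use seg in \<open>auto intro: continuous_on_subset[OF c]\<close>)
      show "path_image (\<Psi> \<circ> linepath z z') \<subseteq> U"
        using seg r(2) unfolding path_image_compose path_image_linepath by fastforce
    qed (simp_all add: pathstart_compose pathfinish_compose)
    then show "z' \<in> {z \<in> D. \<Psi> z \<in> path_piece U x}" using z z' path_piece_trans by blast
  qed
qed

context fin_complex
begin

text \<open>This is local path connectedness of the complex. Openness is tested in cone coordinates,
  for the 2-cells and inside the skeleton for the edges.\<close>

lemma openin_path_piece:
  assumes U: "openin (top_of_set (points K)) U"
  shows "openin (top_of_set (points K)) (path_piece U x)"
proof (rule disc.openinI)
  have US: "U \<subseteq> points K" using U openin_imp_subset by blast
  then show "path_piece U x \<subseteq> points K" using path_piece_subset by blast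
  show "openin (top_of_set (skeleton K)) (path_piece U x \<inter> skeleton K)"
  proof (rule graph.openinI)
    show "openin (top_of_set (zero_cells K)) (path_piece U x \<inter> skeleton K \<inter> zero_cells K)"
      by (rule openin_finite_t1[OF finite_cells(1)]) auto
    fix e assume e: "e \<in> one_cells K"
    let ?D = "{0..1::real} \<times> {0, 1::real}"
    have sk: "char1 K e ((1 + (2 * snd z - 1) * fst z) / 2) \<in> skeleton K" if "z \<in> ?D" for z
      by (rule graph.cell_in_S[OF e]) (use that in auto)
    have "openin (top_of_set ?D) {z \<in> ?D. char1 K e ((1 + (2 * snd z - 1) * fst z) / 2) \<in> path_piece U x}"
    proof (rule openin_preimage_path_piece[OF graph.cont[OF e] _ U, of 1])
      show "(\<lambda>z. char1 K e ((1 + (2 * snd z - 1) * fst z) / 2)) ` ?D \<subseteq> points K"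
        using sk skeleton_subset by blast
      fix z assume z: "z \<in> ?D"
      \<comment> \<open>A ball of radius 1 meets only one of the two halves of the edge, which makes
        the intersection convex.\<close>
      have "ball z 1 \<inter> ?D = ball z 1 \<inter> ({0..1} \<times> {snd z})"
      proof -
        have "\<bar>snd z - snd y\<bar> < 1" if "y \<in> ball z 1" for y
          using dist_snd_le[of z y] that by (simp add: dist_real_def)
        then show ?thesis using z by force
      qed
      then show "convex (ball z 1 \<inter> ?D)" by (simp add: convex_Int convex_Times)
    qed simp
    moreover have "{z \<in> ?D. char1 K e ((1 + (2 * snd z - 1) * fst z) / 2) \<in> path_piece U x} =
        {z \<in> ?D. char1 K e ((1 + (2 * snd z - 1) * fst z) / 2) \<in> path_piece U x \<inter> skeleton K}"
      by (intro Collect_cong) (use sk in auto)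
    ultimately show "openin (top_of_set ?D) {z \<in> ?D. char1 K e ((1 + (2 * snd z - 1) * fst z) / 2) \<in> path_piece U x \<inter> skeleton K}"
      by simp
  qed auto
  fix f assume f: "f \<in> two_cells K"
  show "openin (top_of_set ({0..1} \<times> {0..1})) {z \<in> {0..1} \<times> {0..1}. char2 K f (of_real (fst z) * cis (2 * pi * snd z)) \<in> path_piece U x}"
    by (rule openin_preimage_path_piece[OF disc.cont[OF f] _ U, of 1])
       (use disc.cell_in_S[OF f] in \<open>auto intro!: convex_Int convex_Times\<close>)
qed

text \<open>The sheets inherit local path connectedness from the complex, so the path components of
  \<open>Y\<close> are open, and connectedness does the rest.\<close>

lemma cover_path_connected:
  fixes Y :: "'b::topological_space set"
  assumes cov: "covering_space Y q (points K)" and conn: "connected Y" and y: "y \<in> Y" "y' \<in> Y"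
  obtains g where "path g" "path_image g \<subseteq> Y" "pathstart g = y" "pathfinish g = y'"
proof -
  have loc: "\<exists>O'. openin (top_of_set Y) O' \<and> z \<in> O' \<and> O' \<subseteq> path_piece Y z" if z: "z \<in> Y" for z
  proof -
    have "q z \<in> points K" using cov z by (auto simp: covering_space_def)
    then obtain T v where v: "q z \<in> T" "openin (top_of_set (points K)) T" "\<Union>v = Y \<inter> q -` T"
      "\<And>u. u \<in> v \<Longrightarrow> openin (top_of_set Y) u" "\<And>u. u \<in> v \<Longrightarrow> \<exists>k. homeomorphism u T q k"
      using covering_space_evenly[OF cov] by metis
    have "z \<in> \<Union>v" unfolding v(3) using z v(1) by simp
    then obtain u where u: "u \<in> v" "z \<in> u" by blast
    obtain k where k: "homeomorphism u T q k" using v(5) u by blast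
    have uY: "u \<subseteq> Y" using v(4)[OF u(1)] openin_imp_subset by blast
    let ?W = "path_piece T (q z)"
    have cq: "continuous_on Y q" using cov by (rule covering_space_imp_continuous)
    have "openin (top_of_set Y) (Y \<inter> q -` ?W)"
      by (rule continuous_openin_preimage[OF cq _ openin_path_piece[OF v(2)]]) (use cov in \<open>auto simp: covering_space_def\<close>)
    then have "openin (top_of_set Y) (u \<inter> (Y \<inter> q -` ?W))" using v(4)[OF u(1)] by (rule openin_Int[rotated])
    moreover have "z \<in> u \<inter> (Y \<inter> q -` ?W)" using u z path_piece_refl[OF v(1)] by auto
    moreover have "u \<inter> (Y \<inter> q -` ?W) \<subseteq> path_piece Y z"
    proof
      fix y assume y: "y \<in> u \<inter> (Y \<inter> q -` ?W)"
      then obtain g where g: "path g" "path_image g \<subseteq> T" "pathstart g = q z" "pathfinish g = q y"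
        by (auto simp: path_piece_def)
      have kT: "k ` T \<subseteq> u" using k by (auto simp: homeomorphism_def)
      show "y \<in> path_piece Y z" unfolding path_piece_def
      proof (intro CollectI exI[of _ "k \<circ> g"] conjI)
        show "path (k \<circ> g)"
          by (rule path_continuous_image[OF g(1) continuous_on_subset[OF homeomorphism_cont2[OF k] g(2)]])
        show "path_image (k \<circ> g) \<subseteq> Y" unfolding path_image_compose using g(2) kT uY by blast
        show "pathstart (k \<circ> g) = z" "pathfinish (k \<circ> g) = y"
          using homeomorphism_apply1[OF k] u y g by (simp_all add: pathstart_compose pathfinish_compose)
      qed
    qed
    ultimately show ?thesis by blast
  qed
  have "openin (top_of_set Y) {z \<in> Y. (z \<in> path_piece Y y) = b}" for b
  proof (subst openin_subopen, intro ballI)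
    fix z assume z: "z \<in> {z \<in> Y. (z \<in> path_piece Y y) = b}"
    then obtain O' where O': "openin (top_of_set Y) O'" "z \<in> O'" "O' \<subseteq> path_piece Y z" using loc by blast
    have "O' \<subseteq> {z \<in> Y. (z \<in> path_piece Y y) = b}"
    proof
      fix x assume x: "x \<in> O'"
      then have "x \<in> Y" "x \<in> path_piece Y z" using O' path_piece_subset by auto
      then have "x \<in> path_piece Y y \<longleftrightarrow> z \<in> path_piece Y y"
        using path_piece_trans[of z Y y x] path_piece_trans[of x Y y z] path_piece_sym[of x Y z] by blast
      then show "x \<in> {z \<in> Y. (z \<in> path_piece Y y) = b}" using z \<open>x \<in> Y\<close> by auto
    qed
    then show "\<exists>T. openin (top_of_set Y) T \<and> z \<in> T \<and> T \<subseteq> {z \<in> Y. (z \<in> path_piece Y y) = b}" using O' by blast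
  qed
  from this[of True] this[of False]
  have o: "openin (top_of_set Y) {z \<in> Y. z \<in> path_piece Y y}" "openin (top_of_set Y) {z \<in> Y. z \<notin> path_piece Y y}" by simp_all
  have "Y - {z \<in> Y. z \<in> path_piece Y y} = {z \<in> Y. z \<notin> path_piece Y y}" by auto
  then have "closedin (top_of_set Y) {z \<in> Y. z \<in> path_piece Y y}" using o(2) by (simp add: closedin_def)
  then have "{z \<in> Y. z \<in> path_piece Y y} = {} \<or> {z \<in> Y. z \<in> path_piece Y y} = Y"
    using o(1) conn unfolding connected_clopen by blast
  moreover have "y \<in> {z \<in> Y. z \<in> path_piece Y y}" using path_piece_refl y by auto
  ultimately have "y' \<in> path_piece Y y" using y by blast
  then show thesis using that by (auto simp: path_piece_def)
qed

end


section \<open>The lifted cell structure\<close>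

locale complex_cover = fin_complex K
  for K :: "('a::t2_space, 'e, 'f) two_complex" +
  fixes Y :: "'b::topological_space set" and q :: "'b \<Rightarrow> 'a"
  assumes fcc: "finite_connected_cover Y q (points K)"
begin

definition L :: "('b, 'e \<times> 'b, 'f \<times> 'b) two_complex" where
  "L = lifted_complex Y q K"

lemma cov: "covering_space Y q (points K)" and conn: "connected Y"
  and finite_fibre: "x \<in> points K \<Longrightarrow> finite {y \<in> Y. q y = x}"
  using fcc by (auto simp: finite_connected_cover_def)

lemma q_in: "y \<in> Y \<Longrightarrow> q y \<in> points K"
  using cov by (auto simp: covering_space_def)

lemma zero_L: "zero_cells L = {y \<in> Y. q y \<in> zero_cells K}"
  and one_L: "one_cells L = {(e, y). e \<in> one_cells K \<and> y \<in> Y \<and> q y = char1 K e 0}"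
  and two_L: "two_cells L = {(f, y). f \<in> two_cells K \<and> y \<in> Y \<and> q y = char2 K f 0}"
  by (auto simp: L_def lifted_complex_def)

lemma finite_one_L: "finite (one_cells L)"
proof -
  have "one_cells L \<subseteq> (SIGMA e:one_cells K. {y \<in> Y. q y = char1 K e 0})" by (auto simp: one_L)
  moreover have "finite (SIGMA e:one_cells K. {y \<in> Y. q y = char1 K e 0})"
    using finite_cells(2) char1_in_skeleton skeleton_subset by (intro finite_SigmaI finite_fibre) auto
  ultimately show ?thesis by (rule finite_subset)
qed

lemma char1_L:
  assumes "\<epsilon> \<in> one_cells L"
  shows "path (char1 L \<epsilon>)" "path_image (char1 L \<epsilon>) \<subseteq> Y" "char1 L \<epsilon> 0 = snd \<epsilon>"
    "t \<in> {0..1} \<Longrightarrow> q (char1 L \<epsilon> t) = char1 K (fst \<epsilon>) t"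
proof -
  obtain e y where \<epsilon>: "\<epsilon> = (e, y)" "e \<in> one_cells K" "y \<in> Y" "q y = char1 K e 0" using assms by (auto simp: one_L)
  have "path (char1 K e)" "path_image (char1 K e) \<subseteq> points K" "q y = pathstart (char1 K e)"
    using char1_props(1)[OF \<epsilon>(2)] char1_in_skeleton[OF \<epsilon>(2)] skeleton_subset \<epsilon>(4)
    by (auto simp: path_def path_image_def pathstart_def)
  from covering_lift_path[OF cov this(1,2) \<epsilon>(3) this(3)]
  obtain h where "path h" "path_image h \<subseteq> Y" "pathstart h = y" "\<And>t. t \<in> {0..1} \<Longrightarrow> q (h t) = char1 K e t" by blast
  then have "\<exists>g. continuous_on {0..1} g \<and> g ` {0..1} \<subseteq> Y \<and> (\<forall>t\<in>{0..1}. q (g t) = char1 K e t) \<and> g 0 = y"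
    by (intro exI[of _ h]) (auto simp: path_def path_image_def pathstart_def)
  from someI_ex[OF this]
  have "continuous_on {0..1} (char1 L \<epsilon>) \<and> char1 L \<epsilon> ` {0..1} \<subseteq> Y \<and> (\<forall>t\<in>{0..1}. q (char1 L \<epsilon> t) = char1 K e t) \<and> char1 L \<epsilon> 0 = y"
    by (simp add: L_def lifted_complex_def \<epsilon>(1))
  then show "path (char1 L \<epsilon>)" "path_image (char1 L \<epsilon>) \<subseteq> Y" "char1 L \<epsilon> 0 = snd \<epsilon>"
    "t \<in> {0..1} \<Longrightarrow> q (char1 L \<epsilon> t) = char1 K (fst \<epsilon>) t" by (auto simp: path_def path_image_def \<epsilon>(1))
qed

lemma edges_L: "edges_are_paths L"
  unfolding edges_are_paths_def
proof (intro ballI conjI)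
  fix \<epsilon> assume e: "\<epsilon> \<in> one_cells L"
  note C = char1_L[OF e]
  show "path (char1 L \<epsilon>)" by (rule C)
  have "fst \<epsilon> \<in> one_cells K" using e by (auto simp: one_L)
  then show "pathstart (char1 L \<epsilon>) \<in> zero_cells L" "pathfinish (char1 L \<epsilon>) \<in> zero_cells L"
    using C(2) C(4)[of 0] C(4)[of 1] char1_props(3,4)
    by (auto simp: zero_L pathstart_def pathfinish_def path_image_def)
qed

lemma skeleton_L: "skeleton L \<subseteq> Y"
  using char1_L(2) unfolding skeleton_def path_image_def by (auto simp: zero_L)

lemma lift_edge_unique:
  assumes "\<epsilon> \<in> one_cells L" "path k" "path_image k \<subseteq> Y" "\<And>t. t \<in> {0..1} \<Longrightarrow> q (k t) = char1 K (fst \<epsilon>) t"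
    and "s \<in> {0..1}" "k s = char1 L \<epsilon> s" "t \<in> {0..1}"
  shows "k t = char1 L \<epsilon> t"
  by (rule path_lift_unique[OF cov assms(2,3) char1_L(1,2)[OF assms(1)] _ assms(5,6,7)])
     (use assms(4) char1_L(4)[OF assms(1)] in simp)

text \<open>The lift is made on the rectangle of polar coordinates. By uniqueness it is constant on
  the side of radius 0 and agrees on the sides of angle 0 and 1, so it descends to the disc.\<close>

lemma disc_lift:
  assumes f: "f \<in> two_cells K" and y: "y \<in> Y" "q y = char2 K f 0"
  shows "\<exists>g. continuous_on (cball 0 1) g \<and> g ` cball 0 1 \<subseteq> Y \<and> (\<forall>z\<in>cball 0 1. q (g z) = char2 K f z) \<and> g 0 = y"
proof -
  define P where "P z = of_real (fst z) * cis (2 * pi * snd z)" for z :: "real \<times> real"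
  let ?R = "{0..1::real} \<times> {0..1::real}"
  have cP: "continuous_on ?R P" unfolding P_def by (intro continuous_intros)
  have nP: "norm (P z) = fst z" if "z \<in> ?R" for z using that by (auto simp: P_def norm_mult)
  have "rect_lift Y q (char2 K f \<circ> P) 0 1 0 1"
  proof (rule covering_lift_rectangle[OF cov])
    show "continuous_on ?R (char2 K f \<circ> P)"
      by (rule continuous_on_compose[OF cP continuous_on_subset[OF char2_props(1)[OF f]]]) (use nP in auto)
    show "(char2 K f \<circ> P) ` ?R \<subseteq> points K"
      using disc.cell_in_S[OF f] by (auto simp: P_def)
  qed auto
  moreover have "q y = (char2 K f \<circ> P) (0, 0)" using y by (simp add: P_def)
  ultimately obtain g where g: "continuous_on ?R g" "g ` ?R \<subseteq> Y" "g (0, 0) = y" "\<forall>z\<in>?R. q (g z) = (char2 K f \<circ> P) z"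
    using y(1) unfolding rect_lift_def by blast
  have cg: "continuous_on {0..1} (\<lambda>t. g (t, x))" "continuous_on {0..1} (\<lambda>t. g (x, t))" if "x \<in> {0..1}" for x
    using that by (auto intro!: continuous_on_compose2[OF g(1)] continuous_intros)
  have gY: "g (s, t) \<in> Y" and qg: "q (g (s, t)) = char2 K f (P (s, t))" if "s \<in> {0..1}" "t \<in> {0..1}" for s t
    using g(2,4) that by auto
  have g0: "g (0, t) = y" if t: "t \<in> {0..1}" for t
    by (rule path_lift_unique[OF cov _ _ _ _ _ _ _ t, where g = "\<lambda>t. g (0, t)" and h = "\<lambda>_. y" and s = 0])
       (use cg(2)[of 0] gY[of 0] qg[of 0] g(3) y in \<open>auto simp: path_def path_image_def P_def\<close>)
  have g1: "g (s, 0) = g (s, 1)" if s: "s \<in> {0..1}" for s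
    by (rule path_lift_unique[OF cov _ _ _ _ _ _ _ s, where g = "\<lambda>s. g (s, 0)" and h = "\<lambda>s. g (s, 1)" and s = 0])
       (use cg(1)[of 0] cg(1)[of 1] gY[of _ 0] gY[of _ 1] qg[of _ 0] qg[of _ 1] g0[of 0] g0[of 1] in \<open>auto simp: path_def path_image_def P_def\<close>)
  define G where "G z = g (norm z, Arg2pi z / (2 * pi))" for z
  have GP: "G (P z) = g z" if z: "z \<in> ?R" for z
  proof -
    obtain \<rho> \<theta> where zz: "z = (\<rho>, \<theta>)" "\<rho> \<in> {0..1}" "\<theta> \<in> {0..1}" using z by auto
    have A01: "Arg2pi (P z) / (2 * pi) \<in> {0..1}"
      using Arg2pi_ge_0[of "P z"] Arg2pi_lt_2pi[of "P z"] by auto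
    show ?thesis
    proof (cases "\<rho> = 0")
      case True
      then show ?thesis using nP[OF z] g0[OF A01] g0[OF zz(3)] zz by (simp add: G_def)
    next
      case False
      then have \<rho>: "\<rho> > 0" using zz by auto
      show ?thesis
      proof (cases "\<theta> = 1")
        case True
        have "Arg2pi (P z) = 0"
          by (rule Arg2pi_unique[of \<rho>]) (use \<rho> True zz in \<open>auto simp: P_def cis_conv_exp[symmetric]\<close>)
        then show ?thesis using nP[OF z] g1[OF zz(2)] True zz by (simp add: G_def)
      next
        case False
        have "Arg2pi (P z) = 2 * pi * \<theta>"
          by (rule Arg2pi_unique[of \<rho>]) (use \<rho> False zz in \<open>auto simp: P_def cis_conv_exp\<close>)
        then show ?thesis using nP[OF z] zz by (simp add: G_def)
      qed
    qed
  qed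
  have sur: "cball 0 1 = P ` ?R"
  proof (intro equalityI subsetI)
    fix z :: complex assume z: "z \<in> cball 0 1"
    have "z = P (norm z, Arg2pi z / (2 * pi))"
      using Arg2pi_eq[of z] by (simp add: P_def cis_conv_exp mult.commute)
    moreover have "(norm z, Arg2pi z / (2 * pi)) \<in> ?R"
      using z Arg2pi_ge_0[of z] Arg2pi_lt_2pi[of z] by auto
    ultimately show "z \<in> P ` ?R" by blast
  qed (use nP in auto)
  show ?thesis
  proof (intro exI[of _ G] conjI ballI)
    show "continuous_on (cball 0 1) G" unfolding sur
    proof (rule continuous_on_compact_quotient[OF _ cP])
      show "compact ?R" by (intro compact_Times compact_Icc)
      show "continuous_on ?R (\<lambda>z. G (P z))" by (rule continuous_on_eq[OF g(1)]) (simp only: GP)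
    qed
    show "G ` cball 0 1 \<subseteq> Y" unfolding sur using GP g(2) by auto
    show "q (G z) = char2 K f z" if "z \<in> cball 0 1" for z using that GP g(4) unfolding sur by auto
    have "P (0, 0) = 0" by (simp add: P_def)
    then show "G 0 = y" using GP[of "(0, 0)"] g(3) by simp
  qed
qed

lemma char2_L:
  assumes "\<phi> \<in> two_cells L"
  shows "continuous_on (cball 0 1) (char2 L \<phi>)" "char2 L \<phi> ` cball 0 1 \<subseteq> Y" "char2 L \<phi> 0 = snd \<phi>"
    "z \<in> cball 0 1 \<Longrightarrow> q (char2 L \<phi> z) = char2 K (fst \<phi>) z"
proof -
  obtain f y where \<phi>: "\<phi> = (f, y)" "f \<in> two_cells K" "y \<in> Y" "q y = char2 K f 0" using assms by (auto simp: two_L)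
  from someI_ex[OF disc_lift[OF \<phi>(2-4)]]
  have "continuous_on (cball 0 1) (char2 L \<phi>) \<and> char2 L \<phi> ` cball 0 1 \<subseteq> Y \<and> (\<forall>z\<in>cball 0 1. q (char2 L \<phi> z) = char2 K f z) \<and> char2 L \<phi> 0 = y"
    by (simp add: L_def lifted_complex_def \<phi>(1))
  then show "continuous_on (cball 0 1) (char2 L \<phi>)" "char2 L \<phi> ` cball 0 1 \<subseteq> Y" "char2 L \<phi> 0 = snd \<phi>"
    "z \<in> cball 0 1 \<Longrightarrow> q (char2 L \<phi> z) = char2 K (fst \<phi>) z" by (auto simp: \<phi>(1))
qed

lemma boundary_L:
  assumes "\<phi> \<in> two_cells L"
  shows "path (boundary_path L \<phi>)" "path_image (boundary_path L \<phi>) \<subseteq> Y"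
    "q (boundary_path L \<phi> t) = boundary_path K (fst \<phi>) t" "boundary_path L \<phi> 0 = boundary_path L \<phi> 1"
proof -
  show "path (boundary_path L \<phi>)" unfolding path_def boundary_path_def
    by (rule continuous_on_compose2[OF char2_L(1)[OF assms]]) (auto intro!: continuous_intros)
  show "path_image (boundary_path L \<phi>) \<subseteq> Y" using char2_L(2)[OF assms] by (auto simp: path_image_def boundary_path_def image_subset_iff)
  show "q (boundary_path L \<phi> t) = boundary_path K (fst \<phi>) t" using char2_L(4)[OF assms] by (simp add: boundary_path_def)
qed (simp add: boundary_path_def)

lemma boundary_null:
  assumes "\<phi> \<in> two_cells L"
  shows "homotopic_paths Y (boundary_path L \<phi>) (\<lambda>_. boundary_path L \<phi> 0)"
proof -
  have "homotopic_paths Y (char2 L \<phi> \<circ> (\<lambda>t. cis (2 * pi * t))) (char2 L \<phi> \<circ> (\<lambda>_. 1))"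
    by (rule homotopic_paths_convex_image[OF _ char2_L(1,2)[OF assms]])
       (auto simp: path_def path_image_def pathstart_def pathfinish_def intro!: continuous_intros)
  then show ?thesis by (simp add: boundary_path_def comp_def)
qed

text \<open>Two lifts of a disc that agree in one point agree everywhere, and cells are indexed by
  the image of the centre.\<close>

lemma boundary_agree:
  assumes "(f, y) \<in> two_cells L" "(f, y') \<in> two_cells L" "boundary_path L (f, y) t = boundary_path L (f, y') t"
  shows "y = y'"
proof -
  have "char2 L (f, y) 0 = char2 L (f, y') 0"
    by (rule covering_lift_unique[OF cov connected_cball char2_L(1,2)[OF assms(1)] char2_L(1,2)[OF assms(2)], of "cis (2 * pi * t)"])
       (use char2_L(4)[OF assms(1)] char2_L(4)[OF assms(2)] assms(3) in \<open>auto simp: boundary_path_def\<close>)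
  then show ?thesis using char2_L(3) assms by simp
qed

text \<open>The lifted 1-cell is obtained by running the lifted boundary path through the inverse
  homeomorphism \<open>h'\<close>; its initial point \<open>k 0\<close> is its index.\<close>

lemma traverses_lift:
  assumes \<phi>: "\<phi> \<in> two_cells L" and ab: "0 \<le> a" "a < b" "b \<le> 1" and tr: "traverses K (boundary_path K (fst \<phi>)) a b s"
  shows "\<exists>y. traverses L (boundary_path L \<phi>) a b ((fst s, y), snd s)"
proof -
  obtain h h' where s: "fst s \<in> one_cells K" and h: "homeomorphism {a..b} {0..1} h h'"
      "h a = (if snd s then 0 else 1)" "\<forall>t\<in>{a..b}. boundary_path K (fst \<phi>) t = char1 K (fst s) (h t)"
    using tr unfolding traverses_def by blast
  let ?\<gamma> = "boundary_path L \<phi>"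
  define k where "k = ?\<gamma> \<circ> h'"
  have h'im: "h' t \<in> {a..b}" if "t \<in> {0..1}" for t using homeomorphism_image2[OF h(1)] that by blast
  have h'01: "h' ` {0..1} \<subseteq> {0..1}"
  proof (rule image_subsetI)
    fix t :: real assume "t \<in> {0..1}"
    from h'im[OF this] show "h' t \<in> {0..1}" using ab by auto
  qed
  have k: "path k" "path_image k \<subseteq> Y" "q (k t) = char1 K (fst s) t" if "t \<in> {0..1}" for t
  proof -
    show "path k" unfolding path_def k_def
    proof (rule continuous_on_compose[OF homeomorphism_cont2[OF h(1)]])
      show "continuous_on (h' ` {0..1}) ?\<gamma>"
        by (rule continuous_on_subset[OF boundary_L(1)[OF \<phi>, unfolded path_def] h'01])
    qed
    show "path_image k \<subseteq> Y" using boundary_L(2)[OF \<phi>] h'01 unfolding k_def path_image_def image_comp[symmetric] by blast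
    show "q (k t) = char1 K (fst s) t"
      using boundary_L(3)[OF \<phi>] h(3) h'im[OF that] homeomorphism_apply2[OF h(1) that] by (simp add: k_def)
  qed
  define \<epsilon> where "\<epsilon> = (fst s, k 0)"
  have e: "\<epsilon> \<in> one_cells L" using k[of 0] s by (auto simp: \<epsilon>_def one_L path_image_def)
  have kl: "k t = char1 L \<epsilon> t" if "t \<in> {0..1}" for t
    by (rule lift_edge_unique[OF e k(1,2) _ _ _ that, of 0 0 0]) (use k(3) char1_L(3)[OF e] in \<open>auto simp: \<epsilon>_def\<close>)
  have "?\<gamma> t = char1 L \<epsilon> (h t)" if t: "t \<in> {a..b}" for t
  proof -
    have "h t \<in> {0..1}" using homeomorphism_image1[OF h(1)] t by blast
    from kl[OF this] show ?thesis using homeomorphism_apply1[OF h(1) t] by (simp add: k_def)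
  qed
  then have "traverses L ?\<gamma> a b ((fst s, k 0), snd s)"
    unfolding traverses_def using e h(1,2) by (auto simp: \<epsilon>_def)
  then show ?thesis by blast
qed

text \<open>The subdivision of the boundary is the one below in \<open>K\<close>; only the letters
  are lifted.\<close>

lemma boundary_word_exists_L:
  assumes \<phi>: "\<phi> \<in> two_cells L"
  shows "is_boundary_word L \<phi> (boundary_word L \<phi>)"
proof -
  have "fst \<phi> \<in> two_cells K" using \<phi> by (auto simp: two_L)
  then obtain w where "is_boundary_word K (fst \<phi>) w" using char2_props(3) by blast
  then obtain t :: "nat \<Rightarrow> real" where t: "t 0 = 0" "t (length w) = 1"
     "\<And>j. j < length w \<Longrightarrow> t j < t (Suc j) \<and> traverses K (boundary_path K (fst \<phi>)) (t j) (t (Suc j)) (w ! j)"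
    unfolding is_boundary_word_def by blast
  have mono: "t i \<le> t j" if "i \<le> j" "j \<le> length w" for i j
    using that
  proof (induction j rule: dec_induct)
    case (step j)
    then show ?case using t(3)[of j] by auto
  qed simp
  have "\<exists>y. traverses L (boundary_path L \<phi>) (t j) (t (Suc j)) ((fst (w ! j), y), snd (w ! j))" if "j < length w" for j
    using t(3)[OF that] mono[of 0 j] mono[of "Suc j" "length w"] t(1,2) that by (intro traverses_lift[OF \<phi>]) auto
  then obtain y where y: "traverses L (boundary_path L \<phi>) (t j) (t (Suc j)) ((fst (w ! j), y j), snd (w ! j))" if "j < length w" for j
    by metis
  define w' where "w' = map (\<lambda>j. ((fst (w ! j), y j), snd (w ! j))) [0..<length w]"
  have "is_boundary_word L \<phi> w'"
    unfolding is_boundary_word_def using t y by (intro exI[of _ t]) (auto simp: w'_def)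
  then show ?thesis unfolding boundary_word_def by (rule someI)
qed

definition proj_letter :: "('e \<times> 'b) \<times> bool \<Rightarrow> 'e \<times> bool" where
  "proj_letter s = (fst (fst s), snd s)"

lemma boundary_word_proj:
  assumes \<phi>: "\<phi> \<in> two_cells L" and w: "is_boundary_word L \<phi> w"
  shows "is_boundary_word K (fst \<phi>) (map proj_letter w)"
proof -
  obtain t :: "nat \<Rightarrow> real" where t: "t 0 = 0" "t (length w) = 1"
     "\<And>j. j < length w \<Longrightarrow> t j < t (Suc j) \<and> traverses L (boundary_path L \<phi>) (t j) (t (Suc j)) (w ! j)"
    using w unfolding is_boundary_word_def by blast
  have "traverses K (boundary_path K (fst \<phi>)) a b (proj_letter s)" if tr: "traverses L (boundary_path L \<phi>) a b s" for a b s
  proof -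
    obtain h h' where s: "fst s \<in> one_cells L" and h: "homeomorphism {a..b} {0..1} h h'"
      "h a = (if snd s then 0 else 1)" "\<forall>t\<in>{a..b}. boundary_path L \<phi> t = char1 L (fst s) (h t)"
      using tr unfolding traverses_def by blast
    have "boundary_path K (fst \<phi>) t = char1 K (fst (fst s)) (h t)" if t: "t \<in> {a..b}" for t
    proof -
      have "h t \<in> {0..1}" using homeomorphism_image1[OF h(1)] t by blast
      then show ?thesis using boundary_L(3)[OF \<phi>, of t] h(3) t char1_L(4)[OF s] by simp
    qed
    moreover have "fst (fst s) \<in> one_cells K" using s by (auto simp: one_L)
    ultimately show ?thesis unfolding traverses_def proj_letter_def using h(1,2) by auto
  qed
  then show ?thesis unfolding is_boundary_word_def using t by (intro exI[of _ t]) auto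
qed

lemma boundary_walk_L:
  assumes \<phi>: "\<phi> \<in> two_cells L"
  shows "walk L (boundary_path L \<phi> 0) (boundary_word L \<phi>) (boundary_path L \<phi> 0)" "boundary_path L \<phi> 0 \<in> zero_cells L"
    "homotopic_paths Y (word_path L (boundary_path L \<phi> 0) (boundary_word L \<phi>)) (\<lambda>_. boundary_path L \<phi> 0)"
proof -
  note W = boundary_word_homotopic[OF edges_L boundary_word_exists_L[OF \<phi>] boundary_L(1)[OF \<phi>]]
  show "walk L (boundary_path L \<phi> 0) (boundary_word L \<phi>) (boundary_path L \<phi> 0)"
    using W(2) boundary_L(4)[OF \<phi>] by simp
  have "fst \<phi> \<in> two_cells K" using \<phi> by (auto simp: two_L)
  then show "boundary_path L \<phi> 0 \<in> zero_cells L"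
    using boundary_start_in[of "fst \<phi>"] boundary_L(2,3)[OF \<phi>] by (auto simp: zero_L path_image_def)
  show "homotopic_paths Y (word_path L (boundary_path L \<phi> 0) (boundary_word L \<phi>)) (\<lambda>_. boundary_path L \<phi> 0)"
    by (rule homotopic_paths_trans[OF homotopic_paths_subset[OF homotopic_paths_sym[OF W(3)] skeleton_L] boundary_null[OF \<phi>]])
qed

lemma edge_path_L:
  assumes "fst s \<in> one_cells L"
  shows "fst (proj_letter s) \<in> one_cells K" "t \<in> {0..1} \<Longrightarrow> q (edge_path L s t) = edge_path K (proj_letter s) t"
    "path (edge_path L s)" "path_image (edge_path L s) \<subseteq> Y"
    "q (pathstart (edge_path L s)) = pathstart (edge_path K (proj_letter s))"
    "q (pathfinish (edge_path L s)) = pathfinish (edge_path K (proj_letter s))"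
proof -
  show "fst (proj_letter s) \<in> one_cells K" using assms by (auto simp: proj_letter_def one_L)
  show *: "q (edge_path L s t) = edge_path K (proj_letter s) t" if "t \<in> {0..1}" for t
    using char1_L(4)[OF assms] that by (auto simp: edge_path_def proj_letter_def reversepath_def)
  show "path (edge_path L s)" "path_image (edge_path L s) \<subseteq> Y"
    using edge_path_props[OF edges_L assms] skeleton_L by auto
  show "q (pathstart (edge_path L s)) = pathstart (edge_path K (proj_letter s))"
    "q (pathfinish (edge_path L s)) = pathfinish (edge_path K (proj_letter s))"
    using *[of 0] *[of 1] by (auto simp: pathstart_def pathfinish_def)
qed

text \<open>A lifted edge is indexed by its initial point, so for a reversed letter the path has to
  be lifted first in order to find the index.\<close>

lemma lift_letter:
  assumes s: "fst s \<in> one_cells K" and y: "y \<in> Y" "q y = pathstart (edge_path K s)"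
  shows "\<exists>s'. fst s' \<in> one_cells L \<and> proj_letter s' = s \<and> pathstart (edge_path L s') = y"
proof (cases "snd s")
  case True
  then have "(fst s, y) \<in> one_cells L" using s y by (auto simp: one_L edge_path_def pathstart_def)
  then show ?thesis using char1_L(3) True
    by (intro exI[of _ "((fst s, y), True)"]) (auto simp: proj_letter_def edge_path_def pathstart_def prod_eq_iff)
next
  case False
  have p: "path (edge_path K s)" "path_image (edge_path K s) \<subseteq> points K"
    using edge_path_props[OF edges s] skeleton_subset by auto
  then obtain h where h: "path h" "path_image h \<subseteq> Y" "pathstart h = y" "\<And>t. t \<in> {0..1} \<Longrightarrow> q (h t) = edge_path K s t"
    using covering_lift_path[OF cov p y] by blast
  define \<epsilon> where "\<epsilon> = (fst s, h 1)"
  have e: "\<epsilon> \<in> one_cells L" using h(2) h(4)[of 1] s False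
    by (auto simp: \<epsilon>_def one_L path_image_def edge_path_def reversepath_def)
  have "reversepath h t = char1 L \<epsilon> t" if "t \<in> {0..1}" for t
  proof (rule lift_edge_unique[OF e _ _ _ _ _ that, of _ 0])
    show "q (reversepath h t) = char1 K (fst \<epsilon>) t" if "t \<in> {0..1}" for t
      using h(4)[of "1 - t"] that False by (simp add: reversepath_def edge_path_def \<epsilon>_def)
    show "reversepath h 0 = char1 L \<epsilon> 0" using char1_L(3)[OF e] by (simp add: reversepath_def \<epsilon>_def)
  qed (use h in auto)
  from this[of 1] have "char1 L \<epsilon> 1 = y" using h(3) by (simp add: reversepath_def pathstart_def)
  then show ?thesis using e False
    by (intro exI[of _ "(\<epsilon>, False)"]) (auto simp: proj_letter_def edge_path_def pathstart_def reversepath_def prod_eq_iff \<epsilon>_def)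
qed

lemma lift_walk:
  assumes "walk K u w v" "y \<in> Y" "q y = u"
  shows "\<exists>w' y'. walk L y w' y' \<and> map proj_letter w' = w"
  using assms
proof (induction w arbitrary: u y)
  case (Cons s w)
  obtain s' where s': "fst s' \<in> one_cells L" "proj_letter s' = s" "pathstart (edge_path L s') = y"
    using lift_letter[of s y] Cons.prems by auto
  have "pathfinish (edge_path L s') \<in> Y" using edge_path_L(4)[OF s'(1)] pathfinish_in_path_image by blast
  then obtain w' y' where "walk L (pathfinish (edge_path L s')) w' y'" "map proj_letter w' = w"
    using Cons.IH[of "pathfinish (edge_path K s)" "pathfinish (edge_path L s')"] Cons.prems edge_path_L(6)[OF s'(1)] s'(2) by auto
  then show ?case using s' by (intro exI[of _ "s' # w'"] exI[of _ y']) auto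
qed auto

lemma walk_proj: "walk L y w y' \<Longrightarrow> walk K (q y) (map proj_letter w) (q y')"
proof (induction w arbitrary: y)
  case (Cons s w)
  then have s: "fst s \<in> one_cells L" "pathstart (edge_path L s) = y" "walk L (pathfinish (edge_path L s)) w y'" by auto
  show ?case using Cons.IH[OF s(3)] edge_path_L[OF s(1)] s(2) by auto
qed auto

lemma word_path_proj:
  assumes "walk L y w y'" "t \<in> {0..1}"
  shows "q (word_path L y w t) = word_path K (q y) (map proj_letter w) t"
  using assms
proof (induction w arbitrary: y t)
  case (Cons s w)
  then have s: "fst s \<in> one_cells L" "pathstart (edge_path L s) = y" "walk L (pathfinish (edge_path L s)) w y'" by auto
  note E = edge_path_L[OF s(1)]
  have "q ((edge_path L s +++ word_path L (pathfinish (edge_path L s)) w) t) =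
      (edge_path K (proj_letter s) +++ word_path K (q (pathfinish (edge_path L s))) (map proj_letter w)) t"
    by (rule joinpaths_lift) (use E(2) Cons.IH[OF s(3)] Cons.prems(2) in auto)
  then show ?case using E(6) by simp
qed simp

text \<open>The path is pushed down to \<open>K\<close>, turned into a word there, and the word is
  lifted back. The cone arguments need the class \<open>t2_space\<close>, which is assumed for the
  type of points of \<open>K\<close> only.\<close>

theorem paths_are_words_L:
  assumes g: "path g" "path_image g \<subseteq> Y" "pathstart g \<in> zero_cells L" "pathfinish g \<in> zero_cells L"
  shows "\<exists>w. walk L (pathstart g) w (pathfinish g) \<and> homotopic_paths Y g (word_path L (pathstart g) w)"
proof -
  have cq: "continuous_on Y q" using cov by (rule covering_space_imp_continuous)
  have qg: "path (q \<circ> g)" "path_image (q \<circ> g) \<subseteq> points K"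
    using path_continuous_image[OF g(1) continuous_on_subset[OF cq g(2)]] g(2) q_in by (auto simp: path_image_compose)
  have e: "pathstart (q \<circ> g) = q (pathstart g)" "pathfinish (q \<circ> g) = q (pathfinish g)"
    by (simp_all add: pathstart_compose pathfinish_compose)
  obtain w where w: "walk K (q (pathstart g)) w (q (pathfinish g))" "homotopic_paths (points K) (q \<circ> g) (word_path K (q (pathstart g)) w)"
    using paths_are_words[OF qg] g(3,4) unfolding e by (auto simp: zero_L)
  have sY: "pathstart g \<in> Y" using g(3) by (simp add: zero_L)
  obtain w' y' where w': "walk L (pathstart g) w' y'" "map proj_letter w' = w" using lift_walk[OF w(1) sY] by auto
  note W = word_path_props[OF edges_L w'(1) g(3)]
  have "homotopic_paths Y g (word_path L (pathstart g) w')"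
  proof (rule homotopic_paths_lift[OF cov w(2) g(1,2)])
    show "q (word_path L (pathstart g) w' t) = word_path K (q (pathstart g)) w t" if "t \<in> {0..1}" for t
      using word_path_proj[OF w'(1) that] w'(2) by simp
  qed (use W skeleton_L in auto)
  moreover from this have "y' = pathfinish g" using homotopic_paths_imp_pathfinish W by metis
  ultimately show ?thesis using w'(1) by blast
qed

lemma L_connected:
  assumes "u \<in> zero_cells L" "v \<in> zero_cells L"
  shows "\<exists>w. walk L u w v"
proof -
  have "u \<in> Y" "v \<in> Y" using assms by (auto simp: zero_L)
  then obtain g where "path g" "path_image g \<subseteq> Y" "pathstart g = u" "pathfinish g = v"
    using cover_path_connected[OF cov conn] by metis
  then show ?thesis using paths_are_words_L[of g] assms by auto
qed

section \<open>Incidences between edges and 2-cells\<close>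

text \<open>The passages of the boundary path through midpoints of edges correspond to the letters
  of a boundary word. They depend on the attaching map only and are shared by all lifts of the
  cell.\<close>

definition midtimes :: "'f \<Rightarrow> real set" where
  "midtimes f = {t \<in> {0..1}. \<exists>e\<in>one_cells K. boundary_path K f t = char1 K e (1/2)}"

lemma mid_notin_zero: "e \<in> one_cells K \<Longrightarrow> char1 K e (1/2) \<notin> zero_cells K"
  using cells_disjoint(1) by (force simp: open_1cell_def)

lemma mid_inj:
  assumes "e \<in> one_cells K" "e' \<in> one_cells K" "0 < t" "t < 1" "char1 K e t = char1 K e' (1/2)"
  shows "e = e' \<and> t = 1/2"
proof -
  have "char1 K e t \<in> open_1cell K e" unfolding open_1cell_def using assms(3,4) by (intro imageI) simp
  moreover have "char1 K e t \<in> open_1cell K e'" using assms(5) by (auto simp: open_1cell_def intro!: image_eqI[of _ _ "1/2"])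
  ultimately have "e = e'" using cells_disjoint(4) assms by (auto simp: disjoint_family_on_def)
  moreover from this have "t = 1/2" using inj_onD[OF char1_props(2)[OF assms(1)], of t "1/2"] assms by simp
  ultimately show ?thesis by simp
qed

lemma finite_midtimes:
  assumes f: "f \<in> two_cells K"
  shows "finite (midtimes f)"
proof -
  obtain w where "is_boundary_word K f w" using char2_props(3)[OF f] by blast
  then obtain t :: "nat \<Rightarrow> real" where t: "t 0 = 0" "t (length w) = 1"
     "\<And>j. j < length w \<Longrightarrow> t j < t (Suc j) \<and> traverses K (boundary_path K f) (t j) (t (Suc j)) (w ! j)"
    unfolding is_boundary_word_def by blast
  have cover: "\<exists>j<n. x \<in> {t j..t (Suc j)}" if "x \<in> {0..t n}" "0 < n" "n \<le> length w" for x n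
    using that
  proof (induction n)
    case (Suc n)
    show ?case
    proof (cases "t n \<le> x")
      case False
      then have "0 < n" using t(1) Suc.prems by (cases n) auto
      then show ?thesis using Suc False by (auto intro: less_SucI)
    qed (use Suc.prems in auto)
  qed simp
  have small: "finite {x \<in> {t j..t (Suc j)}. x \<in> midtimes f}" if j: "j < length w" for j
  proof -
    obtain h h' where s: "fst (w ! j) \<in> one_cells K" and h: "homeomorphism {t j..t (Suc j)} {0..1} h h'"
      "\<forall>x\<in>{t j..t (Suc j)}. boundary_path K f x = char1 K (fst (w ! j)) (h x)"
      using t(3)[OF j] unfolding traverses_def by blast
    have "x = h' (1/2)" if x: "x \<in> {t j..t (Suc j)}" "x \<in> midtimes f" for x
    proof -
      obtain e where e: "e \<in> one_cells K" "char1 K (fst (w ! j)) (h x) = char1 K e (1/2)"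
        using x h(2) by (auto simp: midtimes_def)
      have hx: "h x \<in> {0..1}" using homeomorphism_image1[OF h(1)] x(1) by blast
      have "h x \<noteq> 0" "h x \<noteq> 1" using e mid_notin_zero[OF e(1)] char1_props(3,4)[OF s] by auto
      then have "h x = 1/2" using mid_inj[OF s e(1) _ _ e(2)] hx by auto
      then show ?thesis using homeomorphism_apply1[OF h(1) x(1)] by (simp only:)
    qed
    then have "{x \<in> {t j..t (Suc j)}. x \<in> midtimes f} \<subseteq> {h' (1/2)}" by blast
    then show ?thesis using finite_subset by blast
  qed
  have "w \<noteq> []" using t(1,2) by auto
  have "midtimes f \<subseteq> (\<Union>j<length w. {x \<in> {t j..t (Suc j)}. x \<in> midtimes f})"
  proof
    fix x assume x: "x \<in> midtimes f"
    then have "x \<in> {0..t (length w)}" using t(2) by (simp add: midtimes_def)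
    then obtain j where "j < length w" "x \<in> {t j..t (Suc j)}" using cover \<open>w \<noteq> []\<close> by blast
    then show "x \<in> (\<Union>j<length w. {x \<in> {t j..t (Suc j)}. x \<in> midtimes f})" using x by blast
  qed
  moreover have "finite (\<Union>j<length w. {x \<in> {t j..t (Suc j)}. x \<in> midtimes f})" using small by blast
  ultimately show ?thesis by (rule finite_subset)
qed

text \<open>Determined by \<open>K\<close> alone, so it bounds incidences uniformly in all
  covers.\<close>

definition incidence_bound :: nat where
  "incidence_bound = card (SIGMA f:two_cells K. midtimes f)"

lemma finite_incidences: "finite (SIGMA f:two_cells K. midtimes f)"
  using finite_cells(3) finite_midtimes by blast

lemma word_edge_midtime:
  assumes \<phi>: "\<phi> \<in> two_cells L" and s: "s \<in> set (boundary_word L \<phi>)"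
  shows "fst s \<in> one_cells L \<and> (\<exists>t\<in>midtimes (fst \<phi>). boundary_path L \<phi> t = char1 L (fst s) (1/2))"
proof -
  obtain t :: "nat \<Rightarrow> real" where t: "t 0 = 0" "t (length (boundary_word L \<phi>)) = 1"
     "\<And>j. j < length (boundary_word L \<phi>) \<Longrightarrow> t j < t (Suc j) \<and> traverses L (boundary_path L \<phi>) (t j) (t (Suc j)) (boundary_word L \<phi> ! j)"
    using boundary_word_exists_L[OF \<phi>] unfolding is_boundary_word_def by blast
  have mono: "t i \<le> t j" if "i \<le> j" "j \<le> length (boundary_word L \<phi>)" for i j
    using that
  proof (induction j rule: dec_induct)
    case (step j)
    then show ?case using t(3)[of j] by auto
  qed simp
  obtain j where j: "j < length (boundary_word L \<phi>)" "s = boundary_word L \<phi> ! j" using s unfolding in_set_conv_nth by auto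
  obtain h h' where e: "fst s \<in> one_cells L" and h: "homeomorphism {t j..t (Suc j)} {0..1} h h'"
      "\<forall>x\<in>{t j..t (Suc j)}. boundary_path L \<phi> x = char1 L (fst s) (h x)"
    using t(3)[OF j(1)] j(2) unfolding traverses_def by blast
  have x: "h' (1/2) \<in> {t j..t (Suc j)}"
    unfolding homeomorphism_image2[OF h(1), symmetric] by (intro imageI) simp
  have b: "boundary_path L \<phi> (h' (1/2)) = char1 L (fst s) (1/2)"
  proof -
    have "h (h' (1/2)) = 1/2" by (rule homeomorphism_apply2[OF h(1)]) simp
    then show ?thesis using bspec[OF h(2) x] by (simp only:)
  qed
  then have "boundary_path K (fst \<phi>) (h' (1/2)) = char1 K (fst (fst s)) (1/2)"
    using boundary_L(3)[OF \<phi>, of "h' (1/2)"] char1_L(4)[OF e, of "1/2"] by simp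
  moreover have "fst (fst s) \<in> one_cells K" using e by (auto simp: one_L)
  moreover have "h' (1/2) \<in> {0..1}" using x mono[of 0 j] mono[of "Suc j" "length (boundary_word L \<phi>)"] j(1) t(1,2) by auto
  ultimately have "h' (1/2) \<in> midtimes (fst \<phi>)" unfolding midtimes_def by blast
  then show ?thesis using e b by blast
qed

lemma mid_inj_L:
  assumes "\<epsilon> \<in> one_cells L" "\<epsilon>' \<in> one_cells L" "char1 L \<epsilon> (1/2) = char1 L \<epsilon>' (1/2)"
  shows "\<epsilon> = \<epsilon>'"
proof -
  have K: "fst \<epsilon> \<in> one_cells K" "fst \<epsilon>' \<in> one_cells K" using assms by (auto simp: one_L)
  have "char1 K (fst \<epsilon>) (1/2) = char1 K (fst \<epsilon>') (1/2)"
    using char1_L(4)[OF assms(1), of "1/2"] char1_L(4)[OF assms(2), of "1/2"] assms(3) by simp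
  then have e: "fst \<epsilon> = fst \<epsilon>'" using mid_inj[OF K, of "1/2"] by simp
  have "char1 L \<epsilon> 0 = char1 L \<epsilon>' 0"
    by (rule lift_edge_unique[OF assms(2) char1_L(1,2)[OF assms(1)] _ _ assms(3)])
       (use char1_L(4)[OF assms(1)] e in auto)
  then show ?thesis using char1_L(3) assms e by (simp add: prod_eq_iff)
qed

text \<open>Distinct lifted edges have distinct midpoints, so the choice of a passage time for each
  edge is injective.\<close>

lemma card_cell_edges:
  assumes \<phi>: "\<phi> \<in> two_cells L"
  shows "card (fst ` set (boundary_word L \<phi>)) \<le> incidence_bound"
proof -
  let ?E = "fst ` set (boundary_word L \<phi>)"
  have "\<forall>\<epsilon>\<in>?E. \<exists>t. t \<in> midtimes (fst \<phi>) \<and> boundary_path L \<phi> t = char1 L \<epsilon> (1/2)"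
    using word_edge_midtime[OF \<phi>] by (auto simp: Bex_def)
  from bchoice[OF this] obtain \<tau> where
    \<tau>0: "\<forall>\<epsilon>\<in>?E. \<tau> \<epsilon> \<in> midtimes (fst \<phi>) \<and> boundary_path L \<phi> (\<tau> \<epsilon>) = char1 L \<epsilon> (1/2)" by (rule exE)
  note \<tau> = bspec[OF \<tau>0]
  have E: "\<epsilon> \<in> one_cells L" if "\<epsilon> \<in> ?E" for \<epsilon> using that word_edge_midtime[OF \<phi>] by blast
  have "inj_on (\<lambda>\<epsilon>. (fst \<phi>, \<tau> \<epsilon>)) ?E"
  proof (rule inj_onI)
    fix \<epsilon> \<epsilon>' assume A: "\<epsilon> \<in> ?E" "\<epsilon>' \<in> ?E" "(fst \<phi>, \<tau> \<epsilon>) = (fst \<phi>, \<tau> \<epsilon>')"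
    then have "char1 L \<epsilon> (1/2) = char1 L \<epsilon>' (1/2)" using \<tau>[OF A(1)] \<tau>[OF A(2)] by simp
    then show "\<epsilon> = \<epsilon>'" by (rule mid_inj_L[OF E[OF A(1)] E[OF A(2)]])
  qed
  moreover have "(\<lambda>\<epsilon>. (fst \<phi>, \<tau> \<epsilon>)) ` ?E \<subseteq> (SIGMA f:two_cells K. midtimes f)"
    using \<tau> \<phi> by (auto simp: two_L)
  ultimately show ?thesis unfolding incidence_bound_def by (intro card_inj_on_le finite_incidences)
qed

text \<open>A lifted 2-cell is determined by the cell below it and one point of its boundary, hence
  by the cell below and a time at which it passes the midpoint of the given edge.\<close>

lemma card_edge_cells:
  assumes e: "\<epsilon> \<in> one_cells L"
  shows "finite {\<phi> \<in> two_cells L. \<epsilon> \<in> fst ` set (boundary_word L \<phi>)} \<and>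
    card {\<phi> \<in> two_cells L. \<epsilon> \<in> fst ` set (boundary_word L \<phi>)} \<le> incidence_bound"
proof -
  let ?A = "{\<phi> \<in> two_cells L. \<epsilon> \<in> fst ` set (boundary_word L \<phi>)}"
  have "\<forall>\<phi>\<in>?A. \<exists>t. t \<in> midtimes (fst \<phi>) \<and> boundary_path L \<phi> t = char1 L \<epsilon> (1/2)"
  proof
    fix \<phi> assume "\<phi> \<in> ?A"
    then obtain s where "\<phi> \<in> two_cells L" "s \<in> set (boundary_word L \<phi>)" "\<epsilon> = fst s" by auto
    then show "\<exists>t. t \<in> midtimes (fst \<phi>) \<and> boundary_path L \<phi> t = char1 L \<epsilon> (1/2)"
      using word_edge_midtime[of \<phi> s] by auto
  qed
  from bchoice[OF this] obtain \<tau> where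
    \<tau>0: "\<forall>\<phi>\<in>?A. \<tau> \<phi> \<in> midtimes (fst \<phi>) \<and> boundary_path L \<phi> (\<tau> \<phi>) = char1 L \<epsilon> (1/2)" by (rule exE)
  note \<tau> = bspec[OF \<tau>0]
  have inj: "inj_on (\<lambda>\<phi>. (fst \<phi>, \<tau> \<phi>)) ?A"
  proof (rule inj_onI)
    fix \<phi> \<phi>' assume A: "\<phi> \<in> ?A" "\<phi>' \<in> ?A" "(fst \<phi>, \<tau> \<phi>) = (fst \<phi>', \<tau> \<phi>')"
    then have e: "(fst \<phi>, snd \<phi>) = \<phi>" "(fst \<phi>, snd \<phi>') = \<phi>'" by (simp_all add: prod_eq_iff)
    have b: "boundary_path L (fst \<phi>, snd \<phi>) (\<tau> \<phi>) = boundary_path L (fst \<phi>, snd \<phi>') (\<tau> \<phi>)"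
      unfolding e using \<tau>[OF A(1)] \<tau>[OF A(2)] A(3) by simp
    have c: "(fst \<phi>, snd \<phi>) \<in> two_cells L" "(fst \<phi>, snd \<phi>') \<in> two_cells L" unfolding e using A by simp_all
    have "snd \<phi> = snd \<phi>'" by (rule boundary_agree[OF c b])
    then show "\<phi> = \<phi>'" using A(3) by (simp add: prod_eq_iff)
  qed
  have im: "(\<lambda>\<phi>. (fst \<phi>, \<tau> \<phi>)) ` ?A \<subseteq> (SIGMA f:two_cells K. midtimes f)"
  proof (rule image_subsetI)
    fix \<phi> assume "\<phi> \<in> ?A"
    then have "fst \<phi> \<in> two_cells K" "\<tau> \<phi> \<in> midtimes (fst \<phi>)" using \<tau> by (auto simp: two_L)
    then show "(fst \<phi>, \<tau> \<phi>) \<in> (SIGMA f:two_cells K. midtimes f)" by blast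
  qed
  show ?thesis unfolding incidence_bound_def
    by (rule conjI[OF inj_on_finite[OF inj im finite_incidences] card_inj_on_le[OF inj im finite_incidences]])
qed

text \<open>A cochain that vanishes here vanishes on the whole boundary of every 2-cell that meets
  \<open>A\<close>; this is what will permit cutting off.\<close>

definition neighbourhood :: "('e \<times> 'b) set \<Rightarrow> ('e \<times> 'b) set" where
  "neighbourhood A = A \<union> (\<Union>\<phi>\<in>{\<phi> \<in> two_cells L. fst ` set (boundary_word L \<phi>) \<inter> A \<noteq> {}}. fst ` set (boundary_word L \<phi>))"

lemma neighbourhood_subset: "A \<subseteq> one_cells L \<Longrightarrow> neighbourhood A \<subseteq> one_cells L"
proof -
  assume A: "A \<subseteq> one_cells L"
  have "fst ` set (boundary_word L \<phi>) \<subseteq> one_cells L" if "\<phi> \<in> two_cells L" for \<phi>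
    using word_edge_midtime[OF that] by auto
  then show ?thesis unfolding neighbourhood_def using A by (intro Un_least UN_least) auto
qed

text \<open>An edge lies on at most \<open>incidence_bound\<close> cells, and each of these has at
  most as many edges.\<close>

lemma card_neighbourhood:
  assumes A: "A \<subseteq> one_cells L"
  shows "card (neighbourhood A) \<le> card A * (1 + incidence_bound * incidence_bound)"
proof -
  have fA: "finite A" using A finite_one_L finite_subset by blast
  let ?C = "{\<phi> \<in> two_cells L. fst ` set (boundary_word L \<phi>) \<inter> A \<noteq> {}}"
  have C: "?C = (\<Union>\<epsilon>\<in>A. {\<phi> \<in> two_cells L. \<epsilon> \<in> fst ` set (boundary_word L \<phi>)})" by auto
  have ce: "finite {\<phi> \<in> two_cells L. \<epsilon> \<in> fst ` set (boundary_word L \<phi>)} \<and>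
      card {\<phi> \<in> two_cells L. \<epsilon> \<in> fst ` set (boundary_word L \<phi>)} \<le> incidence_bound" if "\<epsilon> \<in> A" for \<epsilon>
    by (rule card_edge_cells) (use that A in blast)
  have fC: "finite ?C" unfolding C by (rule finite_UN_I[OF fA]) (use ce in simp)
  have "card ?C \<le> (\<Sum>\<epsilon>\<in>A. card {\<phi> \<in> two_cells L. \<epsilon> \<in> fst ` set (boundary_word L \<phi>)})"
    unfolding C by (rule card_UN_le[OF fA])
  also have "\<dots> \<le> card A * incidence_bound"
    using sum_bounded_above[of A "\<lambda>\<epsilon>. card {\<phi> \<in> two_cells L. \<epsilon> \<in> fst ` set (boundary_word L \<phi>)}" incidence_bound]
      ce by simp
  finally have cC: "card ?C \<le> card A * incidence_bound" .
  have "card (\<Union>\<phi>\<in>?C. fst ` set (boundary_word L \<phi>)) \<le> (\<Sum>\<phi>\<in>?C. card (fst ` set (boundary_word L \<phi>)))"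
    by (rule card_UN_le[OF fC])
  also have "\<dots> \<le> card ?C * incidence_bound"
    using sum_bounded_above[of ?C "\<lambda>\<phi>. card (fst ` set (boundary_word L \<phi>))" incidence_bound] card_cell_edges by simp
  also have "\<dots> \<le> card A * incidence_bound * incidence_bound" using cC by simp
  finally have "card (\<Union>\<phi>\<in>?C. fst ` set (boundary_word L \<phi>)) \<le> card A * incidence_bound * incidence_bound" .
  moreover have "card (neighbourhood A) \<le> card A + card (\<Union>\<phi>\<in>?C. fst ` set (boundary_word L \<phi>))"
    unfolding neighbourhood_def by (rule card_Un_le)
  ultimately show ?thesis by (simp add: algebra_simps)
qed

end


section \<open>Cocycles, components off the support, and the dimension count\<close>

section \<open>Cochains and walks\<close>

definition ev :: "('e \<Rightarrow> 'k::field) \<Rightarrow> ('e \<times> bool) list \<Rightarrow> 'k" where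
  "ev c w = (\<Sum>s\<leftarrow>w. if snd s then c (fst s) else - c (fst s))"

lemma ev_Nil [simp]: "ev c [] = 0"
  and ev_Cons: "ev c (s # w) = (if snd s then c (fst s) else - c (fst s)) + ev c w"
  and ev_append: "ev c (w @ w') = ev c w + ev c w'"
  by (auto simp: ev_def)

lemma ev_flip: "ev c (flip_word w) = - ev c w"
  by (induction w) (auto simp: flip_word_Cons ev_append ev_Cons)

lemma ev_cong: "(\<And>s. s \<in> set w \<Longrightarrow> c (fst s) = d (fst s)) \<Longrightarrow> ev c w = ev d w"
  by (induction w) (auto simp: ev_Cons)

lemma ev_zero: "(\<And>s. s \<in> set w \<Longrightarrow> c (fst s) = 0) \<Longrightarrow> ev c w = 0"
  by (induction w) (auto simp: ev_Cons)

lemma ev_diff: "ev (c - d) w = ev c w - ev d w"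
  by (induction w) (auto simp: ev_Cons)

lemma ev_add: "ev (c + d) w = ev c w + ev d w"
  by (induction w) (auto simp: ev_Cons)

lemma ev_scale: "ev (fscale a c) w = a * ev c w"
  by (induction w) (auto simp: ev_Cons fscale_def algebra_simps)

lemma ev_repeat: "ev c (concat (replicate n w)) = of_nat n * ev c w"
  by (induction n) (auto simp: ev_append algebra_simps)

lemma ev_coboundary:
  "walk X u w v \<Longrightarrow> ev (coboundary0 X f) w = f v - f u"
proof (induction w arbitrary: u)
  case (Cons s w)
  then show ?case
    by (auto simp: ev_Cons coboundary0_def edge_path_def pathstart_def pathfinish_def reversepath_def split: if_splits)
qed simp

lemma pigeonhole_fibre:
  assumes "finite A" "finite B" "f ` A \<subseteq> B" "card B * m < card A"
  shows "\<exists>b. m < card {a \<in> A. f a = b}"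
proof (rule ccontr)
  assume "\<not> ?thesis"
  then have le: "card {a \<in> A. f a = b} \<le> m" for b by (simp add: not_less)
  have "A = (\<Union>b\<in>B. {a \<in> A. f a = b})" using assms(3) by auto
  then have "card A \<le> (\<Sum>b\<in>B. card {a \<in> A. f a = b})" using card_UN_le[OF assms(2)] by metis
  also have "\<dots> \<le> card B * m" using sum_bounded_above[of B "\<lambda>b. card {a \<in> A. f a = b}" m] le by simp
  finally show False using assms(4) by simp
qed

lemma mod_ring_of_nat_surj: "\<exists>n. x = of_nat n" for x :: "'p::prime_card mod_ring"
  using surj_of_nat_mod_ring by blast

lemma finite_cochains_on: "finite A \<Longrightarrow> finite (cochains_on A :: ('c \<Rightarrow> 'k::{field,finite}) set)"
proof -
  assume "finite A"
  then have "finite {f::'c \<Rightarrow> 'k. \<forall>x. (x \<in> A \<longrightarrow> f x \<in> UNIV) \<and> (x \<notin> A \<longrightarrow> f x = 0)}"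
    by (rule finite_set_of_finite_funs) simp
  then show ?thesis by (simp add: cochains_on_def)
qed

lemma subspace_cocycles1: "fun_space.subspace (cocycles1 X :: ('e \<Rightarrow> 'k::field) set)"
proof -
  have "coboundary1 X c = (\<lambda>f. if f \<in> two_cells X then ev c (boundary_word X f) else 0)" for c :: "'e \<Rightarrow> 'k"
    by (auto simp: coboundary1_def ev_def)
  then show ?thesis
    unfolding fun_space.subspace_def cocycles1_def cochains_on_def
    by (auto simp: ev_add ev_scale fun_eq_iff ev_zero fscale_def zero_fun_def plus_fun_def split: if_splits)
       (auto simp: ev_zero ev_add[unfolded plus_fun_def] ev_scale[unfolded fscale_def])
qed

lemma cocycle_ev: "c \<in> cocycles1 X \<Longrightarrow> f \<in> two_cells X \<Longrightarrow> ev c (boundary_word X f) = 0"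
  by (auto simp: cocycles1_def coboundary1_def ev_def fun_eq_iff split: if_splits)

lemma subspace_coboundaries1: "fun_space.subspace (coboundaries1 X :: ('e \<Rightarrow> 'k::field) set)"
  unfolding fun_space.subspace_def
proof (intro conjI ballI allI)
  show "0 \<in> (coboundaries1 X :: ('e \<Rightarrow> 'k) set)"
    unfolding coboundaries1_def by (rule image_eqI[of _ _ 0]) (auto simp: coboundary0_def cochains_on_def fun_eq_iff)
  fix a b :: "'e \<Rightarrow> 'k" assume "a \<in> coboundaries1 X" "b \<in> coboundaries1 X"
  then obtain f g where "a = coboundary0 X f" "b = coboundary0 X g" "f \<in> cochains_on (zero_cells X)" "g \<in> cochains_on (zero_cells X)"
    by (auto simp: coboundaries1_def)
  then show "a + b \<in> coboundaries1 X" unfolding coboundaries1_def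
    by (intro image_eqI[of _ _ "f + g"]) (auto simp: coboundary0_def cochains_on_def fun_eq_iff)
next
  fix r and a :: "'e \<Rightarrow> 'k" assume "a \<in> coboundaries1 X"
  then obtain f where "a = coboundary0 X f" "f \<in> cochains_on (zero_cells X)" by (auto simp: coboundaries1_def)
  then show "fscale r a \<in> coboundaries1 X" unfolding coboundaries1_def
    by (intro image_eqI[of _ _ "fscale r f"]) (auto simp: coboundary0_def cochains_on_def fun_eq_iff fscale_def algebra_simps)
qed

locale word_complex =
  fixes X :: "('b::topological_space, 'e, 'f) two_complex"
  assumes finE: "finite (one_cells X)" and edges: "edges_are_paths X"
    and conn: "\<lbrakk>u \<in> zero_cells X; v \<in> zero_cells X\<rbrakk> \<Longrightarrow> \<exists>w. walk X u w v"
    and cells: "f \<in> two_cells X \<Longrightarrow> \<exists>u\<in>zero_cells X. walk X u (boundary_word X f) u"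
begin

lemma walk_in: "walk X u w v \<Longrightarrow> u \<in> zero_cells X \<Longrightarrow> v \<in> zero_cells X"
  using word_path_props[OF edges] by blast

text \<open>The primitive at \<open>v\<close> is the integral of \<open>c\<close> along a chosen
  walk from \<open>w0\<close>; vanishing on closed walks gives the right increment along every
  edge.\<close>

lemma exact_on_edges:
  fixes c :: "'e \<Rightarrow> 'k::field"
  assumes c: "c \<in> cochains_on (one_cells X)" and w0: "w0 \<in> zero_cells X"
    and "\<And>w. walk X w0 w w0 \<Longrightarrow> ev c w = 0"
  shows "c \<in> coboundaries1 X"
proof -
  define W where "W v = (SOME w. walk X w0 w v)" for v
  have W: "walk X w0 (W v) v" if "v \<in> zero_cells X" for v
    unfolding W_def by (rule someI_ex[OF conn[OF w0 that]])
  define f where "f v = (if v \<in> zero_cells X then ev c (W v) else 0)" for v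
  have "c e = coboundary0 X f e" for e
  proof (cases "e \<in> one_cells X")
    case True
    let ?x = "char1 X e 0" and ?y = "char1 X e 1"
    have xy: "?x \<in> zero_cells X" "?y \<in> zero_cells X"
      using edges True by (auto simp: edges_are_paths_def pathstart_def pathfinish_def)
    have "walk X ?x [(e, True)] ?y" using True by (simp add: edge_path_def pathstart_def pathfinish_def)
    then have "walk X w0 (W ?x @ [(e, True)] @ flip_word (W ?y)) w0"
      using W[OF xy(1)] walk_flip[OF W[OF xy(2)]] unfolding walk_append by blast
    then have "ev c (W ?x @ [(e, True)] @ flip_word (W ?y)) = 0" by (rule assms(3))
    then have "ev c (W ?x) + c e - ev c (W ?y) = 0" by (simp add: ev_append ev_flip ev_Cons algebra_simps)
    then show ?thesis using True xy by (simp add: coboundary0_def f_def algebra_simps)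
  next
    case False
    then show ?thesis using c by (simp add: coboundary0_def cochains_on_def)
  qed
  then have "c = coboundary0 X f" by blast
  moreover have "f \<in> cochains_on (zero_cells X)" by (auto simp: f_def cochains_on_def)
  ultimately show ?thesis unfolding coboundaries1_def by blast
qed

end

text \<open>\<open>N\<close> stands for the support together with the 2-cells around it. The factor
  3 in \<open>many\<close> is made up of the two ends of a support edge, which bound the number of
  components, and of the value on the edge itself.\<close>

locale small_cocycle = word_complex X for X :: "('b::topological_space, 'e, 'f) two_complex" +
  fixes S :: "('e \<Rightarrow> 'p::prime_card mod_ring) set" and c :: "'e \<Rightarrow> 'p mod_ring" and N :: "'e set"
  assumes basis: "represents_H1_basis X S" and c: "c \<in> fun_space.span S" "c \<noteq> (\<lambda>_. 0)"
    and N: "N \<subseteq> one_cells X" "{e \<in> one_cells X. c e \<noteq> 0} \<subseteq> N"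
    and N_cells: "\<lbrakk>f \<in> two_cells X; s \<in> set (boundary_word X f); c (fst s) \<noteq> 0; s' \<in> set (boundary_word X f)\<rbrakk> \<Longrightarrow> fst s' \<in> N"
    and many: "card N + 3 * card {e \<in> one_cells X. c e \<noteq> 0} < card S"
begin

definition supp where "supp = {e \<in> one_cells X. c e \<noteq> 0}"

lemma span_eq: "fun_space.span (S \<union> coboundaries1 X) = cocycles1 X"
  and indep: "\<lbrakk>finite T; T \<subseteq> S; (\<Sum>s\<in>T. fscale (a s) s) \<in> coboundaries1 X; s \<in> T\<rbrakk> \<Longrightarrow> a s = 0"
proof -
  note b = basis[unfolded represents_H1_basis_def quotient_basis_def]
  show "fun_space.span (S \<union> coboundaries1 X) = cocycles1 X" by (rule b[THEN conjunct1])
  show "\<lbrakk>finite T; T \<subseteq> S; (\<Sum>s\<in>T. fscale (a s) s) \<in> coboundaries1 X; s \<in> T\<rbrakk> \<Longrightarrow> a s = 0"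
    by (rule b[THEN conjunct2, rule_format, of T a s]) simp_all
qed

lemma S_cocycles: "S \<subseteq> cocycles1 X"
  using fun_space.span_superset[of "S \<union> coboundaries1 X"] unfolding span_eq by (rule order.trans[OF Un_upper1])

lemma finS: "finite S"
proof (rule finite_subset)
  show "S \<subseteq> cochains_on (one_cells X)" using S_cocycles by (auto simp: cocycles1_def)
qed (rule finite_cochains_on[OF finE])

text \<open>Classes are counted by their coefficient functions, so that over the finite field
  dimension arguments become applications of the pigeonhole principle.\<close>

definition comb :: "(('e \<Rightarrow> 'p mod_ring) \<Rightarrow> 'p mod_ring) \<Rightarrow> 'e \<Rightarrow> 'p mod_ring" where
  "comb a = (\<Sum>s\<in>S. fscale (a s) s)"

lemma comb_cocycle: "comb a \<in> cocycles1 X"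
  unfolding comb_def
  by (rule fun_space.subspace_sum[OF subspace_cocycles1], rule fun_space.subspace_scale[OF subspace_cocycles1])
     (use S_cocycles in blast)

lemma comb_diff: "comb a - comb b = comb (\<lambda>s. a s - b s)"
  unfolding comb_def by (simp add: fun_space.scale_left_diff_distrib sum_subtractf)

lemma comb_inj:
  assumes "a \<in> S \<rightarrow>\<^sub>E UNIV" "b \<in> S \<rightarrow>\<^sub>E UNIV" "comb a - comb b \<in> coboundaries1 X"
  shows "a = b"
proof (rule PiE_ext[OF assms(1,2)])
  fix s assume "s \<in> S"
  then have "a s - b s = 0"
    by (intro indep[OF finS order.refl, of "\<lambda>s. a s - b s"]) (use assms(3) in \<open>simp add: comb_diff comb_def[symmetric]\<close>)
  then show "a s = b s" by simp
qed

lemma c_cocycle: "c \<in> cocycles1 X"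
  using fun_space.span_minimal[OF S_cocycles subspace_cocycles1] c(1) by blast

text \<open>Here it matters that \<open>c\<close> lies in the span of \<open>S\<close> alone:
  independence modulo coboundaries forces all its coefficients to vanish.\<close>

lemma c_not_coboundary: "c \<notin> coboundaries1 X"
proof
  assume b: "c \<in> coboundaries1 X"
  obtain u where u: "c = (\<Sum>v\<in>S. fscale (u v) v)" using c(1) unfolding fun_space.span_finite[OF finS] by auto
  have "u v = 0" if "v \<in> S" for v using indep[OF finS order.refl _ that, of u] b u by simp
  then have "c = 0" unfolding u by (intro sum.neutral) simp
  then show False using c(2) by (simp add: zero_fun_def)
qed

lemma c_off: "e \<notin> one_cells X \<Longrightarrow> c e = 0"
  using c_cocycle by (simp add: cocycles1_def cochains_on_def)

lemma c_zero_iff: "c e = 0 \<longleftrightarrow> e \<notin> supp"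
  using c_off by (auto simp: supp_def)

lemma zero_cells_nonempty: "zero_cells X \<noteq> {}"
proof
  assume z: "zero_cells X = {}"
  then have "one_cells X = {}" using edges by (auto simp: edges_are_paths_def)
  then show False using c_off c(2) by auto
qed

lemma supp_nonempty: "supp \<noteq> {}"
  using c(2) c_zero_iff by auto

lemma fin_supp: "finite supp"
  using finE by (simp add: supp_def)

text \<open>As the 1-skeleton is connected and the support is non-empty, every component off the
  support contains one of these end points, so they bound the number of components.\<close>

definition P where "P = (\<lambda>e. char1 X e 0) ` supp \<union> (\<lambda>e. char1 X e 1) ` supp"

lemma fin_P: "finite P" and card_P: "card P \<le> 2 * card supp"
proof -
  show "finite P" using fin_supp by (simp add: P_def)
  have "card P \<le> card ((\<lambda>e. char1 X e 0) ` supp) + card ((\<lambda>e. char1 X e 1) ` supp)"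
    unfolding P_def by (rule card_Un_le)
  also have "\<dots> \<le> card supp + card supp" by (intro add_mono card_image_le fin_supp)
  finally show "card P \<le> 2 * card supp" by simp
qed

lemma P_zero: "P \<subseteq> zero_cells X"
  using edges by (auto simp: P_def supp_def edges_are_paths_def pathstart_def pathfinish_def)

definition dwalk where "dwalk u w v \<longleftrightarrow> walk X u w v \<and> (\<forall>s\<in>set w. c (fst s) = 0)"

lemma dwalk_append: "dwalk u (w @ w') v \<longleftrightarrow> (\<exists>x. dwalk u w x \<and> dwalk x w' v)"
  by (auto simp: dwalk_def walk_append)

lemma dwalk_flip: "dwalk u w v \<Longrightarrow> dwalk v (flip_word w) u"
  using walk_flip by (auto simp: dwalk_def flip_word_def)

lemma dwalk_repeat: "dwalk u w u \<Longrightarrow> dwalk u (concat (replicate n w)) u"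
  by (induction n) (auto simp: dwalk_append dwalk_def walk_append)

text \<open>Keep the part of the walk after its last support edge; if there is no such edge, the
  walk itself already starts in \<open>P\<close>.\<close>

lemma dwalk_from_P:
  assumes "walk X u w v" "u \<in> P"
  shows "\<exists>r\<in>P. \<exists>w'. dwalk r w' v"
  using assms
proof (induction w arbitrary: v rule: rev_induct)
  case Nil
  then show ?case by (intro bexI[of _ u] exI[of _ "[]"]) (auto simp: dwalk_def)
next
  case (snoc s w)
  then obtain x where x: "walk X u w x" "walk X x [s] v" by (auto simp: walk_append)
  then have s: "fst s \<in> one_cells X" "pathfinish (edge_path X s) = v" by auto
  show ?case
  proof (cases "c (fst s) = 0")
    case True
    obtain r w' where "r \<in> P" "dwalk r w' x" using snoc.IH[OF x(1) snoc.prems(2)] by blast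
    moreover have "dwalk x [s] v" using x(2) True by (simp add: dwalk_def)
    ultimately show ?thesis using dwalk_append by blast
  next
    case False
    then have "v \<in> P" using s by (auto simp: P_def supp_def edge_path_def pathfinish_def reversepath_def split: if_splits)
    then show ?thesis by (intro bexI[of _ v] exI[of _ "[]"]) (auto simp: dwalk_def)
  qed
qed

text \<open>The choice is governed by a property that depends on the component only, which makes it
  constant on components.\<close>

definition rep where "rep v = (SOME r. r \<in> P \<and> (\<exists>w. dwalk r w v))"

lemma rep: "v \<in> zero_cells X \<Longrightarrow> rep v \<in> P \<and> (\<exists>w. dwalk (rep v) w v)"
proof -
  assume v: "v \<in> zero_cells X"
  obtain p0 where "p0 \<in> P" using supp_nonempty by (auto simp: P_def)
  then obtain w where "walk X p0 w v" using conn v P_zero by blast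
  from dwalk_from_P[OF this \<open>p0 \<in> P\<close>] have "\<exists>r. r \<in> P \<and> (\<exists>w. dwalk r w v)" by blast
  then show ?thesis unfolding rep_def by (rule someI_ex)
qed

lemma rep_eq:
  assumes "dwalk x w y"
  shows "rep x = rep y"
proof -
  have "(\<exists>w. dwalk r w x) \<longleftrightarrow> (\<exists>w. dwalk r w y)" for r
    using assms dwalk_flip dwalk_append by metis
  then show ?thesis by (simp add: rep_def)
qed

definition W :: "('e \<Rightarrow> 'p mod_ring) set" where
  "W = {d \<in> cocycles1 X. \<forall>e\<in>N. d e = 0}"

text \<open>The value 0 on all other words lets holonomies at \<open>x\<close> be compared and
  counted as functions.\<close>

definition hol :: "'b \<Rightarrow> ('e \<Rightarrow> 'p mod_ring) \<Rightarrow> ('e \<times> bool) list \<Rightarrow> 'p mod_ring" where "hol x d w = (if dwalk x w x then ev d w else 0)"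

text \<open>All pairs of values are realised by closed walks off the support: the two cocycles are
  independent on the component of \<open>x\<close>.\<close>

definition good :: "'b \<Rightarrow> ('e \<Rightarrow> 'p mod_ring) \<Rightarrow> ('e \<Rightarrow> 'p mod_ring) \<Rightarrow> bool" where
  "good x d1 d2 \<longleftrightarrow> (\<forall>a b. \<exists>w. dwalk x w x \<and> ev d1 w = a \<and> ev d2 w = b)"

text \<open>Elimination in a 2 by 2 matrix of values. Repeating a closed walk n times multiplies its
  values by n, and every element of the prime field is such a multiple of 1.\<close>

lemma good_if_independent:
  fixes d1 d2 :: "'e \<Rightarrow> 'p mod_ring"
  assumes w1: "dwalk x w1 x" "ev d1 w1 \<noteq> 0"
    and w2: "dwalk x w2 x" "ev d2 w2 - (ev d2 w1 / ev d1 w1) * ev d1 w2 \<noteq> 0"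
  shows "good x d1 d2"
  unfolding good_def
proof (intro allI)
  fix a b :: "'p mod_ring"
  define \<alpha> where "\<alpha> = ev d1 w1"
  define t where "t = ev d2 w1 / \<alpha>"
  define \<beta> where "\<beta> = ev d1 w2"
  define \<gamma> where "\<gamma> = ev d2 w2 - t * \<beta>"
  have nz: "\<alpha> \<noteq> 0" "\<gamma> \<noteq> 0" using assms by (auto simp: \<alpha>_def \<gamma>_def t_def \<beta>_def)
  obtain m where m: "(b - t * a) / \<gamma> = of_nat m" using mod_ring_of_nat_surj by blast
  obtain n where n: "(a - of_nat m * \<beta>) / \<alpha> = of_nat n" using mod_ring_of_nat_surj by blast
  let ?w = "concat (replicate n w1) @ concat (replicate m w2)"
  have "dwalk x ?w x" using w1(1) w2(1) dwalk_repeat dwalk_append by blast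
  moreover have e1: "ev d1 ?w = a"
    unfolding ev_append ev_repeat n[symmetric] using nz by (simp add: \<alpha>_def[symmetric] \<beta>_def[symmetric])
  moreover have "ev d2 ?w = b"
  proof -
    have d1: "ev d2 w1 = t * \<alpha>" "ev d2 w2 = \<gamma> + t * \<beta>" using nz by (auto simp: t_def \<gamma>_def)
    have "ev d2 ?w = of_nat m * \<gamma> + t * (of_nat n * \<alpha> + of_nat m * \<beta>)"
      unfolding ev_append ev_repeat d1 by (simp add: algebra_simps)
    also have "of_nat n * \<alpha> + of_nat m * \<beta> = a" using e1 unfolding ev_append ev_repeat \<alpha>_def \<beta>_def .
    also have "of_nat m * \<gamma> = b - t * a" using nz m[symmetric] by simp
    finally show ?thesis by simp
  qed
  ultimately show "\<exists>w. dwalk x w x \<and> ev d1 w = a \<and> ev d2 w = b" by blast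
qed

text \<open>Without a good pair all holonomies at \<open>x\<close> are multiples of a single
  one.\<close>

lemma card_hol:
  assumes "\<And>d1 d2. \<lbrakk>d1 \<in> W; d2 \<in> W\<rbrakk> \<Longrightarrow> \<not> good x d1 d2"
  shows "finite (hol x ` W) \<and> card (hol x ` W) \<le> CARD('p)"
proof (cases "\<exists>d1\<in>W. \<exists>w1. dwalk x w1 x \<and> ev d1 w1 \<noteq> 0")
  case True
  then obtain d1 w1 where d1: "d1 \<in> W" "dwalk x w1 x" "ev d1 w1 \<noteq> 0" by blast
  have sub: "hol x ` W \<subseteq> (\<lambda>t w. t * hol x d1 w) ` UNIV"
  proof (rule image_subsetI)
    fix d2 assume d2: "d2 \<in> W"
    define t where "t = ev d2 w1 / ev d1 w1"
    have "ev d2 w - t * ev d1 w = 0" if "dwalk x w x" for w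
      using good_if_independent[OF d1(2,3) that, of d2] assms[OF d1(1) d2] by (auto simp: t_def)
    then have "hol x d2 = (\<lambda>w. t * hol x d1 w)" by (auto simp: hol_def fun_eq_iff)
    then show "hol x d2 \<in> (\<lambda>t w. t * hol x d1 w) ` UNIV" by blast
  qed
  have cd: "card ((\<lambda>t w. t * hol x d1 w) ` UNIV) \<le> CARD('p)"
    using card_image_le[of "UNIV :: 'p mod_ring set" "\<lambda>t w. t * hol x d1 w"] by simp
  have f: "finite ((\<lambda>t w. t * hol x d1 w) ` (UNIV :: 'p mod_ring set))" by simp
  show ?thesis using finite_subset[OF sub f] order.trans[OF card_mono[OF f sub] cd] by (rule conjI)
next
  case False
  then have sub: "hol x ` W \<subseteq> {\<lambda>_. 0}" by (auto simp: hol_def fun_eq_iff)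
  have "finite (hol x ` W)" "card (hol x ` W) \<le> 1" using finite_subset[OF sub] card_mono[OF _ sub] by simp_all
  moreover have "1 \<le> CARD('p)" using prime_card[where 'a='p] prime_gt_0_nat by (simp add: Suc_leI)
  ultimately show ?thesis using order.trans by blast
qed

text \<open>The primitive is integrated inside each component from its representative; vanishing
  holonomy there makes the increments along edges off the support consistent.\<close>

lemma exact_off_support:
  assumes d: "d \<in> cochains_on (one_cells X)" and h: "\<And>x. x \<in> P \<Longrightarrow> hol x d = (\<lambda>_. 0)"
  shows "\<exists>f \<in> cochains_on (zero_cells X). \<forall>e. e \<notin> supp \<longrightarrow> d e = coboundary0 X f e"
proof -
  define T where "T v = (SOME w. dwalk (rep v) w v)" for v
  have T: "dwalk (rep v) (T v) v" if "v \<in> zero_cells X" for v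
    unfolding T_def using rep[OF that] by (auto intro: someI_ex)
  define f where "f v = (if v \<in> zero_cells X then ev d (T v) else 0)" for v
  have "d e = coboundary0 X f e" if e: "e \<notin> supp" for e
  proof (cases "e \<in> one_cells X")
    case True
    let ?x = "char1 X e 0" and ?y = "char1 X e 1"
    have xy: "?x \<in> zero_cells X" "?y \<in> zero_cells X"
      using edges True by (auto simp: edges_are_paths_def pathstart_def pathfinish_def)
    have s: "dwalk ?x [(e, True)] ?y" using True e by (simp add: dwalk_def c_zero_iff edge_path_def pathstart_def pathfinish_def)
    let ?w = "T ?x @ [(e, True)] @ flip_word (T ?y)"
    have "dwalk (rep ?x) ?w (rep ?x)"
      using T[OF xy(1)] s dwalk_flip[OF T[OF xy(2)]] rep_eq[OF s] unfolding dwalk_append by metis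
    moreover have "hol (rep ?x) d ?w = 0" using fun_cong[OF h[OF conjunct1[OF rep[OF xy(1)]]]] by simp
    ultimately have "ev d ?w = 0" by (simp only: hol_def if_True)
    then have "ev d (T ?x) + d e - ev d (T ?y) = 0" by (simp add: ev_append ev_flip ev_Cons algebra_simps)
    then show ?thesis using True xy by (simp add: coboundary0_def f_def algebra_simps)
  next
    case False
    then show ?thesis using d by (simp add: coboundary0_def cochains_on_def)
  qed
  moreover have "f \<in> cochains_on (zero_cells X)" by (auto simp: f_def cochains_on_def)
  ultimately show ?thesis by blast
qed

text \<open>If no pair were good, three successive pigeonholes would leave two different
  combinations that agree on \<open>N\<close>, have equal holonomy on every component and, after
  subtraction of primitives, agree on the support. These would be cohomologous.\<close>

lemma exists_good: "\<exists>x\<in>P. \<exists>d1\<in>W. \<exists>d2\<in>W. good x d1 d2"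
proof (rule ccontr)
  assume ng: "\<not> ?thesis"
  have p1: "1 < CARD('p)" using prime_card[where 'a='p] prime_gt_1_nat by simp
  define Fn :: "(('e \<Rightarrow> 'p mod_ring) \<Rightarrow> 'p mod_ring) set" where "Fn = S \<rightarrow>\<^sub>E UNIV"
  have finFn: "finite Fn" unfolding Fn_def by (intro finite_PiE finS) simp
  have finN: "finite N" using N(1) finE finite_subset by blast
  have cardFn: "card Fn = CARD('p) ^ card S" unfolding Fn_def by (simp add: card_PiE[OF finS])
  \<comment> \<open>Vanishing on \<open>N\<close> costs one dimension for each edge of
    \<open>N\<close>.\<close>
  have "\<exists>b. CARD('p) ^ (card P + card supp) < card {a \<in> Fn. restrict (comb a) N = b}"
  proof (rule pigeonhole_fibre[OF finFn])
    show "finite (N \<rightarrow>\<^sub>E (UNIV :: 'p mod_ring set))" by (intro finite_PiE finN) simp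
    show "(\<lambda>a. restrict (comb a) N) ` Fn \<subseteq> N \<rightarrow>\<^sub>E UNIV" by auto
    have "card N + (card P + card supp) < card S" using many card_P by (simp add: supp_def)
    then have "CARD('p) ^ (card N + (card P + card supp)) < CARD('p) ^ card S" using p1 by (rule power_strict_increasing)
    then show "card (N \<rightarrow>\<^sub>E (UNIV :: 'p mod_ring set)) * CARD('p) ^ (card P + card supp) < card Fn"
      by (simp add: card_PiE[OF finN] cardFn power_add)
  qed
  then obtain b1 where b1: "CARD('p) ^ (card P + card supp) < card {a \<in> Fn. restrict (comb a) N = b1}" by blast
  define F1 where "F1 = {a \<in> Fn. restrict (comb a) N = b1}"
  have finF1: "finite F1" using finFn by (simp add: F1_def)
  have W1: "comb a - comb b \<in> W" if "a \<in> F1" "b \<in> F1" for a b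
  proof -
    have "comb a e - comb b e = 0" if "e \<in> N" for e
    proof -
      have "restrict (comb a) N e = restrict (comb b) N e" using \<open>a \<in> F1\<close> \<open>b \<in> F1\<close> by (simp add: F1_def)
      then show ?thesis using that by simp
    qed
    then show ?thesis unfolding W_def
      using fun_space.subspace_diff[OF subspace_cocycles1 comb_cocycle comb_cocycle, of a b] by auto
  qed
  have "F1 \<noteq> {}" using b1 unfolding F1_def[symmetric] by (auto simp del: zero_less_power)
  then obtain a0 where a0: "a0 \<in> F1" by blast
  have hh: "finite (hol x ` W) \<and> card (hol x ` W) \<le> CARD('p)" if "x \<in> P" for x
    by (rule card_hol) (use ng that in blast)
  \<comment> \<open>By \<open>card_hol\<close> each vertex of \<open>P\<close> costs at most one
    dimension. Differences with \<open>comb a0\<close> are taken because it is the differences that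
    lie in \<open>W\<close>.\<close>
  have "\<exists>b. CARD('p) ^ card supp < card {a \<in> F1. restrict (\<lambda>x. hol x (comb a - comb a0)) P = b}"
  proof (rule pigeonhole_fibre[OF finF1])
    show "finite (Pi\<^sub>E P (\<lambda>x. hol x ` W))" by (intro finite_PiE fin_P) (use hh in blast)
    show "(\<lambda>a. restrict (\<lambda>x. hol x (comb a - comb a0)) P) ` F1 \<subseteq> Pi\<^sub>E P (\<lambda>x. hol x ` W)"
      using W1 a0 by auto
    have "card (Pi\<^sub>E P (\<lambda>x. hol x ` W)) = (\<Prod>x\<in>P. card (hol x ` W))" by (rule card_PiE[OF fin_P])
    also have "\<dots> \<le> (\<Prod>x\<in>P. CARD('p))" by (rule prod_mono) (use hh in auto)
    finally have "card (Pi\<^sub>E P (\<lambda>x. hol x ` W)) \<le> CARD('p) ^ card P" by simp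
    then have "card (Pi\<^sub>E P (\<lambda>x. hol x ` W)) * CARD('p) ^ card supp \<le> CARD('p) ^ card P * CARD('p) ^ card supp" by (rule mult_right_mono) simp
    then show "card (Pi\<^sub>E P (\<lambda>x. hol x ` W)) * CARD('p) ^ card supp < card F1"
      using b1 unfolding F1_def[symmetric] power_add by linarith
  qed
  then obtain b2 where b2: "CARD('p) ^ card supp < card {a \<in> F1. restrict (\<lambda>x. hol x (comb a - comb a0)) P = b2}" by blast
  define F2 where "F2 = {a \<in> F1. restrict (\<lambda>x. hol x (comb a - comb a0)) P = b2}"
  have finF2: "finite F2" using finF1 by (simp add: F2_def)
  have "F2 \<noteq> {}" using b2 unfolding F2_def[symmetric] by (auto simp del: zero_less_power)
  then obtain a2 where a2: "a2 \<in> F2" by blast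
  have "\<exists>f \<in> cochains_on (zero_cells X). \<forall>e. e \<notin> supp \<longrightarrow> (comb a - comb a2) e = coboundary0 X f e" if a: "a \<in> F2" for a
  proof (rule exact_off_support)
    show "comb a - comb a2 \<in> cochains_on (one_cells X)"
      using fun_space.subspace_diff[OF subspace_cocycles1 comb_cocycle comb_cocycle, of a a2] by (simp add: cocycles1_def)
    fix x assume x: "x \<in> P"
    have "restrict (\<lambda>x. hol x (comb a - comb a0)) P x = restrict (\<lambda>x. hol x (comb a2 - comb a0)) P x"
      using a a2 by (simp add: F2_def)
    then have eq: "hol x (comb a - comb a0) w = hol x (comb a2 - comb a0) w" for w using x by simp
    have "hol x (comb a - comb a2) w = hol x (comb a - comb a0) w - hol x (comb a2 - comb a0) w" for w
      by (simp add: hol_def ev_diff)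
    then show "hol x (comb a - comb a2) = (\<lambda>_. 0)" by (simp add: eq fun_eq_iff)
  qed
  then have "\<forall>a\<in>F2. \<exists>f. f \<in> cochains_on (zero_cells X) \<and> (\<forall>e. e \<notin> supp \<longrightarrow> (comb a - comb a2) e = coboundary0 X f e)" by blast
  from bchoice[OF this] obtain f where
    f: "\<forall>a\<in>F2. f a \<in> cochains_on (zero_cells X) \<and> (\<forall>e. e \<notin> supp \<longrightarrow> (comb a - comb a2) e = coboundary0 X (f a) e)" by (rule exE)
  \<comment> \<open>The primitives are correct off the support only; the remaining values on the
    support cost one dimension per edge.\<close>
  have "\<exists>b. 1 < card {a \<in> F2. restrict (\<lambda>e. (comb a - comb a2) e - coboundary0 X (f a) e) supp = b}"
  proof (rule pigeonhole_fibre[OF finF2])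
    show "finite (supp \<rightarrow>\<^sub>E (UNIV :: 'p mod_ring set))" by (intro finite_PiE fin_supp) simp
    show "(\<lambda>a. restrict (\<lambda>e. (comb a - comb a2) e - coboundary0 X (f a) e) supp) ` F2 \<subseteq> supp \<rightarrow>\<^sub>E UNIV" by auto
    show "card (supp \<rightarrow>\<^sub>E (UNIV :: 'p mod_ring set)) * 1 < card F2"
      using b2 by (simp add: card_PiE[OF fin_supp] F2_def)
  qed
  then obtain b3 where b3: "1 < card {a \<in> F2. restrict (\<lambda>e. (comb a - comb a2) e - coboundary0 X (f a) e) supp = b3}" by blast
  then have "\<not> (\<forall>a\<in>{a \<in> F2. restrict (\<lambda>e. (comb a - comb a2) e - coboundary0 X (f a) e) supp = b3}.
      \<forall>a'\<in>{a \<in> F2. restrict (\<lambda>e. (comb a - comb a2) e - coboundary0 X (f a) e) supp = b3}. a = a')"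
    using finF2 by (subst card_le_Suc0_iff_eq[symmetric]) auto
  then obtain a a' where aa: "a \<noteq> a'" "a \<in> F2" "a' \<in> F2"
      and r: "restrict (\<lambda>e. (comb a - comb a2) e - coboundary0 X (f a) e) supp = restrict (\<lambda>e. (comb a' - comb a2) e - coboundary0 X (f a') e) supp"
    by (simp only: mem_Collect_eq Ball_def not_all not_imp) (elim exE conjE, simp)
  have "comb a - comb a' = coboundary0 X (f a - f a')"
  proof
    fix e
    have e1: "(comb a - comb a2) e - coboundary0 X (f a) e = (comb a' - comb a2) e - coboundary0 X (f a') e"
    proof (cases "e \<in> supp")
      case True
      then show ?thesis using fun_cong[OF r, of e] by simp
    next
      case False
      then show ?thesis using f aa by simp
    qed
    have diff_cancel: "(comb a - comb a') e = g" if "(comb a - comb a2) e - h = (comb a' - comb a2) e - h'" "g = h - h'" for g h h'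
    proof -
      have "(comb a - comb a') e = ((comb a - comb a2) e - h) - ((comb a' - comb a2) e - h') + (h - h')" by simp
      then show ?thesis unfolding that by simp
    qed
    have e2: "coboundary0 X (f a - f a') e = coboundary0 X (f a) e - coboundary0 X (f a') e"
      by (simp add: coboundary0_def)
    show "(comb a - comb a') e = coboundary0 X (f a - f a') e" by (rule diff_cancel[OF e1 e2])
  qed
  moreover have "f a - f a' \<in> cochains_on (zero_cells X)" using f aa by (auto simp: cochains_on_def)
  ultimately have "comb a - comb a' \<in> coboundaries1 X" unfolding coboundaries1_def by blast
  then have "a = a'" by (rule comb_inj[rotated 2]) (use aa in \<open>auto simp: F2_def F1_def Fn_def\<close>)
  then show False using aa by simp
qed

lemma c_monodromy:
  assumes "x \<in> zero_cells X"
  shows "\<exists>w. walk X x w x \<and> ev c w \<noteq> 0"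
  using exact_on_edges[of c x] c_cocycle c_not_coboundary assms by (auto simp: cocycles1_def)

text \<open>A closed walk with non-zero \<open>c\<close>-value is cut at its edges that carry a
  restricted cocycle. These edges have both ends in \<open>C\<close> and \<open>c\<close>-value 0,
  so some piece between them has non-zero \<open>c\<close>-value; it leads from \<open>C\<close> to
  \<open>C\<close> and avoids the restricted cocycles.\<close>

theorem splitting:
  obtains z1 z2 :: "'e \<Rightarrow> 'p mod_ring" and u u' w where
    "\<And>f. f \<in> two_cells X \<Longrightarrow> (\<forall>s\<in>set (boundary_word X f). z1 (fst s) = 0 \<and> z2 (fst s) = 0) \<or> (\<forall>s\<in>set (boundary_word X f). c (fst s) = 0)"
    "\<And>f. f \<in> two_cells X \<Longrightarrow> ev c (boundary_word X f) = 0 \<and> ev z1 (boundary_word X f) = 0 \<and> ev z2 (boundary_word X f) = 0"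
    "\<And>e. c e \<noteq> 0 \<Longrightarrow> z1 e = 0 \<and> z2 e = 0"
    "u \<in> zero_cells X" "u' \<in> zero_cells X"
    "\<And>a b. \<exists>w. walk X u w u \<and> (\<forall>s\<in>set w. c (fst s) = 0) \<and> ev z1 w = a \<and> ev z2 w = b"
    "\<And>a b. \<exists>w. walk X u' w u' \<and> (\<forall>s\<in>set w. c (fst s) = 0) \<and> ev z1 w = a \<and> ev z2 w = b"
    "walk X u w u'" "\<forall>s\<in>set w. z1 (fst s) = 0 \<and> z2 (fst s) = 0" "ev c w \<noteq> 0"
proof -
  obtain x d1 d2 where x: "x \<in> P" and d: "d1 \<in> W" "d2 \<in> W" and g: "good x d1 d2" using exists_good by blast
  have x0: "x \<in> zero_cells X" using x P_zero by blast
  define C where "C = {v. \<exists>w. dwalk x w v}"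
  define cut where "cut d e = (if c e = 0 \<and> char1 X e 0 \<in> C then d e else 0)" for d :: "'e \<Rightarrow> 'p mod_ring" and e
  have C_iff: "u \<in> C \<longleftrightarrow> v \<in> C" if "dwalk u w v" for u w v
    using that dwalk_flip dwalk_append unfolding C_def by blast
  have C_edge: "char1 X (fst s) 0 \<in> C \<longleftrightarrow> u \<in> C" if "dwalk u w v" "s \<in> set w" for u w v s
    using that
  proof (induction w arbitrary: u)
    case (Cons t w)
    then have t: "dwalk u [t] (pathfinish (edge_path X t))" "dwalk (pathfinish (edge_path X t)) w v"
      by (auto simp: dwalk_def)
    have e: "char1 X (fst t) 0 \<in> C \<longleftrightarrow> u \<in> C"
      using t(1) C_iff[OF t(1)] by (auto simp: dwalk_def edge_path_def pathstart_def pathfinish_def reversepath_def split: if_splits)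
    show ?case
    proof (cases "s = t")
      case True
      then show ?thesis using e by simp
    next
      case False
      then show ?thesis using Cons.IH[OF t(2)] Cons.prems(2) C_iff[OF t(1)] by auto
    qed
  qed simp
  have cut_eq: "ev (cut d) w = (if u \<in> C then ev d w else 0)" if w: "dwalk u w v" for d u w v
  proof (cases "u \<in> C")
    case True
    then have "ev (cut d) w = ev d w"
      by (intro ev_cong) (use C_edge[OF w] w in \<open>auto simp: cut_def dwalk_def\<close>)
    then show ?thesis using True by simp
  next
    case False
    then have "ev (cut d) w = 0" by (intro ev_zero) (use C_edge[OF w] in \<open>auto simp: cut_def\<close>)
    then show ?thesis using False by simp
  qed
  have dN: "d1 e = 0 \<and> d2 e = 0" if "e \<in> N" for e using d that by (simp add: W_def)
  have cell: "(\<forall>s\<in>set (boundary_word X f). cut d1 (fst s) = 0 \<and> cut d2 (fst s) = 0) \<or> (\<forall>s\<in>set (boundary_word X f). c (fst s) = 0)"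
    if f: "f \<in> two_cells X" for f
  proof (cases "\<forall>s\<in>set (boundary_word X f). c (fst s) = 0")
    case False
    then obtain s where "s \<in> set (boundary_word X f)" "c (fst s) \<noteq> 0" by blast
    then have "fst s' \<in> N" if "s' \<in> set (boundary_word X f)" for s' using N_cells f that by blast
    then show ?thesis using dN by (auto simp: cut_def)
  qed simp
  have cell_ev: "ev c (boundary_word X f) = 0 \<and> ev (cut d1) (boundary_word X f) = 0 \<and> ev (cut d2) (boundary_word X f) = 0"
    if f: "f \<in> two_cells X" for f
  proof -
    \<comment> \<open>A boundary that avoids the support lies inside or outside \<open>C\<close> as
      a whole, so the cut-off has on it the value of the cocycle or the value 0.\<close>
    have "ev (cut d1) (boundary_word X f) = 0 \<and> ev (cut d2) (boundary_word X f) = 0"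
      using cell[OF f]
    proof
      assume "\<forall>s\<in>set (boundary_word X f). c (fst s) = 0"
      moreover obtain u where "walk X u (boundary_word X f) u" using cells[OF f] by blast
      ultimately have "dwalk u (boundary_word X f) u" by (simp add: dwalk_def)
      then show ?thesis using cut_eq cocycle_ev[OF _ f] d by (auto simp: W_def)
    qed (auto intro!: ev_zero)
    then show ?thesis using cocycle_ev[OF c_cocycle f] by blast
  qed
  have loops: "\<exists>w. walk X u w u \<and> (\<forall>s\<in>set w. c (fst s) = 0) \<and> ev (cut d1) w = a \<and> ev (cut d2) w = b" if u: "u \<in> C" for u a b
  proof -
    obtain w0 where w0: "dwalk x w0 u" using u by (auto simp: C_def)
    obtain w where w: "dwalk x w x" "ev d1 w = a" "ev d2 w = b" using g unfolding good_def by blast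
    have D: "dwalk u (flip_word w0 @ w @ w0) u" using dwalk_flip[OF w0] w(1) w0 dwalk_append by blast
    have "ev (cut d1) (flip_word w0 @ w @ w0) = a" "ev (cut d2) (flip_word w0 @ w @ w0) = b"
      using cut_eq[OF D] u w by (auto simp: ev_append ev_flip)
    then show ?thesis using D unfolding dwalk_def by blast
  qed
  define connector where "connector u w v \<longleftrightarrow> u \<in> C \<and> walk X u w v \<and> (\<forall>s\<in>set w. cut d1 (fst s) = 0 \<and> cut d2 (fst s) = 0)" for u w v
  have xC: "x \<in> C" by (auto simp: C_def dwalk_def intro: exI[of _ "[]"])
  \<comment> \<open>The invariant of the induction: as long as no suitable piece has been completed,
    the current piece carries the whole \<open>c\<close>-value of the walk so far.\<close>
  have step: "(\<exists>u w v'. connector u w v' \<and> v' \<in> C \<and> ev c w \<noteq> 0) \<or> (\<exists>u w'. connector u w' v \<and> ev c w' = ev c w)"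
    if "walk X x w v" for w v
    using that
  proof (induction w arbitrary: v rule: rev_induct)
    case Nil
    then have "connector x [] v" using xC by (simp add: connector_def)
    then show ?case by blast
  next
    case (snoc s w)
    then obtain y where y: "walk X x w y" "walk X y [s] v" by (auto simp: walk_append)
    from snoc.IH[OF y(1)] show ?case
    proof
      assume "\<exists>u w'. connector u w' y \<and> ev c w' = ev c w"
      then obtain u w' where w': "connector u w' y" "ev c w' = ev c w" by blast
      show ?case
      proof (cases "cut d1 (fst s) = 0 \<and> cut d2 (fst s) = 0")
        case True
        then have "connector u (w' @ [s]) v" using w'(1) y(2) by (auto simp: connector_def walk_append)
        moreover have "ev c (w' @ [s]) = ev c (w @ [s])" using w'(2) by (simp add: ev_append)
        ultimately show ?thesis by blast
      next
        case False
        then have s: "c (fst s) = 0" "char1 X (fst s) 0 \<in> C" by (auto simp: cut_def split: if_splits)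
        then have D: "dwalk y [s] v" using y(2) by (simp add: dwalk_def)
        have "y \<in> C" using C_edge[OF D, of s] s(2) by simp
        then have "v \<in> C" using C_iff[OF D] by simp
        show ?thesis
        proof (cases "ev c w' = 0")
          case True
          \<comment> \<open>The pieces so far contribute nothing to the \<open>c\<close>-value, so a
            new piece may start at \<open>v\<close>.\<close>
          have "ev c (w @ [s]) = ev c []" using w'(2) True s(1) by (simp add: ev_append ev_Cons)
          moreover have "connector v [] v" using \<open>v \<in> C\<close> by (simp add: connector_def)
          ultimately show ?thesis by metis
        next
          case False
          then show ?thesis using w'(1) \<open>y \<in> C\<close> by blast
        qed
      qed
    qed blast
  qed
  obtain wx where wx: "walk X x wx x" "ev c wx \<noteq> 0" using c_monodromy[OF x0] by blast
  have "\<exists>u w v'. connector u w v' \<and> v' \<in> C \<and> ev c w \<noteq> 0"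
    using step[OF wx(1)] wx(2) xC by metis
  then obtain u w u' where con: "connector u w u'" "u' \<in> C" "ev c w \<noteq> 0" by blast
  then have u: "u \<in> C" by (simp add: connector_def)
  have C0: "C \<subseteq> zero_cells X" using walk_in x0 by (auto simp: C_def dwalk_def)
  show thesis
  proof (rule that[of "cut d1" "cut d2" u u' w])
    show "cut d1 e = 0 \<and> cut d2 e = 0" if "c e \<noteq> 0" for e using that by (simp add: cut_def)
  qed (use cell cell_ev loops con u C0 in \<open>auto simp: connector_def\<close>)
qed

end


section \<open>Homology of the fundamental group against cellular cohomology of the cover\<close>

section \<open>Fundamental groups\<close>

lemma path_class_eqI: "homotopic_paths S g h \<Longrightarrow> path_class S g = path_class S h"
  unfolding path_class_def by (blast intro: homotopic_paths_trans homotopic_paths_sym)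

lemma path_class_eqD:
  assumes "path_class S g = path_class S h" "path h" "path_image h \<subseteq> S"
  shows "homotopic_paths S g h"
proof -
  have "h \<in> path_class S h" using assms(2,3) by (simp add: path_class_def)
  then show ?thesis unfolding assms(1)[symmetric] by (simp add: path_class_def)
qed

lemma based_loop_const: "x \<in> S \<Longrightarrow> based_loop S x (\<lambda>_. x)"
  by (auto simp: based_loop_def path_image_def pathstart_def pathfinish_def)

lemma based_loop_join: "based_loop S x g \<Longrightarrow> based_loop S x h \<Longrightarrow> based_loop S x (g +++ h)"
  unfolding based_loop_def by (simp add: path_image_join)

lemma based_loop_reversepath: "based_loop S x g \<Longrightarrow> based_loop S x (reversepath g)"
  unfolding based_loop_def by simp

lemma carrier_pi1: "carrier (pi1 S x) = {path_class S g | g. based_loop S x g}"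
  and one_pi1: "\<one>\<^bsub>pi1 S x\<^esub> = path_class S (\<lambda>_. x)"
  by (simp_all add: pi1_def)

lemma pi1_mult:
  assumes g: "based_loop S x g" and h: "based_loop S x h"
  shows "path_class S g \<otimes>\<^bsub>pi1 S x\<^esub> path_class S h = path_class S (g +++ h)"
proof -
  have gh: "path g" "path_image g \<subseteq> S" "path h" "path_image h \<subseteq> S" "pathfinish g = pathstart h"
    using g h by (auto simp: based_loop_def)
  have "homotopic_paths S (g +++ h) k"
    if "homotopic_paths S g g'" "homotopic_paths S h h'" "homotopic_paths S (g' +++ h') k" for g' h' k
    by (rule homotopic_paths_trans[OF homotopic_paths_join[OF that(1,2) gh(5)] that(3)])
  moreover have "g \<in> path_class S g" "h \<in> path_class S h" using gh by (auto simp: path_class_def)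
  ultimately have "(\<exists>g'\<in>path_class S g. \<exists>h'\<in>path_class S h. homotopic_paths S (g' +++ h') k) \<longleftrightarrow> k \<in> path_class S (g +++ h)" for k
    unfolding path_class_def mem_Collect_eq by blast
  then show ?thesis by (simp add: pi1_def)
qed

lemma group_pi1:
  assumes x: "x \<in> S"
  shows "group (pi1 S x)"
proof (rule groupI)
  fix a b c assume "a \<in> carrier (pi1 S x)" "b \<in> carrier (pi1 S x)" "c \<in> carrier (pi1 S x)"
  then obtain f g h where e: "a = path_class S f" "b = path_class S g" "c = path_class S h"
    and l: "based_loop S x f" "based_loop S x g" "based_loop S x h" by (auto simp: carrier_pi1)
  show "a \<otimes>\<^bsub>pi1 S x\<^esub> b \<otimes>\<^bsub>pi1 S x\<^esub> c = a \<otimes>\<^bsub>pi1 S x\<^esub> (b \<otimes>\<^bsub>pi1 S x\<^esub> c)"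
    unfolding e pi1_mult[OF l(1,2)] pi1_mult[OF l(2,3)] pi1_mult[OF based_loop_join[OF l(1,2)] l(3)] pi1_mult[OF l(1) based_loop_join[OF l(2,3)]]
    by (rule path_class_eqI, rule homotopic_paths_sym, rule homotopic_paths_assoc) (use l in \<open>auto simp: based_loop_def\<close>)
next
  fix a b assume "a \<in> carrier (pi1 S x)" "b \<in> carrier (pi1 S x)"
  then show "a \<otimes>\<^bsub>pi1 S x\<^esub> b \<in> carrier (pi1 S x)"
    by (auto simp: carrier_pi1) (metis pi1_mult based_loop_join)
next
  show "\<one>\<^bsub>pi1 S x\<^esub> \<in> carrier (pi1 S x)" using based_loop_const[OF x] by (auto simp: carrier_pi1 one_pi1)
next
  fix a assume "a \<in> carrier (pi1 S x)"
  then obtain g where a: "a = path_class S g" and g: "based_loop S x g" by (auto simp: carrier_pi1)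
  show "\<one>\<^bsub>pi1 S x\<^esub> \<otimes>\<^bsub>pi1 S x\<^esub> a = a"
    unfolding a one_pi1 pi1_mult[OF based_loop_const[OF x] g]
    by (rule path_class_eqI, rule homotopic_paths_lid_const) (use g in \<open>auto simp: based_loop_def\<close>)
  have "path_class S (reversepath g) \<otimes>\<^bsub>pi1 S x\<^esub> a = \<one>\<^bsub>pi1 S x\<^esub>"
    unfolding a one_pi1 pi1_mult[OF based_loop_reversepath[OF g] g]
    by (rule path_class_eqI, rule homotopic_paths_linv_const) (use g in \<open>auto simp: based_loop_def\<close>)
  moreover have "path_class S (reversepath g) \<in> carrier (pi1 S x)" using based_loop_reversepath[OF g] by (auto simp: carrier_pi1)
  ultimately show "\<exists>b\<in>carrier (pi1 S x). b \<otimes>\<^bsub>pi1 S x\<^esub> a = \<one>\<^bsub>pi1 S x\<^esub>" by blast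
qed


section \<open>Additive functions on a group\<close>

interpretation functional: vector_space_pair
  "fscale :: 'k::field \<Rightarrow> ('x \<Rightarrow> 'k) \<Rightarrow> 'x \<Rightarrow> 'k" "(*) :: 'k \<Rightarrow> 'k \<Rightarrow> 'k"
  by unfold_locales (auto simp: algebra_simps)

lemma quotient_basis_exists:
  assumes U: "fun_space.subspace U" and W: "fun_space.subspace W" and UW: "U \<subseteq> W"
  shows "\<exists>B. quotient_basis W U B"
proof -
  obtain A where A: "A \<subseteq> U" "fun_space.independent A" "U \<subseteq> fun_space.span A"
    using fun_space.maximal_independent_subset by metis
  obtain B where B: "A \<subseteq> B" "B \<subseteq> W" "fun_space.independent B" "W \<subseteq> fun_space.span B"
    using fun_space.maximal_independent_subset_extend[OF order.trans[OF A(1) UW] A(2)] by metis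
  have "fun_space.span (B - A \<union> U) = W"
  proof (rule antisym)
    show "fun_space.span (B - A \<union> U) \<subseteq> W" using B(2) UW by (intro fun_space.span_minimal W) auto
    have "B \<subseteq> B - A \<union> U" using A(1) by auto
    then show "W \<subseteq> fun_space.span (B - A \<union> U)" using B(4) fun_space.span_mono order.trans by metis
  qed
  moreover have "a s = 0" if T: "finite T" "T \<subseteq> B - A" "(\<Sum>s\<in>T. fscale (a s) s) \<in> U" "s \<in> T" for T a s
  proof -
    have "(\<Sum>s\<in>T. fscale (a s) s) \<in> fun_space.span A" using T(3) A(3) by blast
    then obtain R r where R: "finite R" "R \<subseteq> A" "(\<Sum>s\<in>T. fscale (a s) s) = (\<Sum>s\<in>R. fscale (r s) s)"
      unfolding fun_space.span_explicit by blast
    define g where "g s = (if s \<in> T then a s else - r s)" for s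
    have disj: "T \<inter> R = {}" using T(2) R(2) by blast
    have "(\<Sum>s\<in>T \<union> R. fscale (g s) s) = (\<Sum>s\<in>T. fscale (g s) s) + (\<Sum>s\<in>R. fscale (g s) s)"
      by (rule sum.union_disjoint[OF T(1) R(1) disj])
    also have "(\<Sum>s\<in>T. fscale (g s) s) = (\<Sum>s\<in>T. fscale (a s) s)" by (rule sum.cong) (auto simp: g_def)
    also have "(\<Sum>s\<in>R. fscale (g s) s) = - (\<Sum>s\<in>R. fscale (r s) s)"
      unfolding sum_negf[symmetric] by (rule sum.cong) (use disj in \<open>auto simp: g_def fscale_def\<close>)
    finally have "(\<Sum>s\<in>T \<union> R. fscale (g s) s) = 0" unfolding R(3) by (simp add: zero_fun_def)
    from fun_space.independentD[OF B(3) _ _ this, of s] have "g s = 0" using T R(1,2) B(1) by auto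
    then show ?thesis using T(4) by (simp add: g_def)
  qed
  ultimately show ?thesis unfolding quotient_basis_def by blast
qed

text \<open>Joined with a basis of \<open>U\<close>, the representatives in \<open>B\<close> stay
  independent, so zero on \<open>U\<close> and arbitrary values on \<open>B\<close> can be
  prescribed together.\<close>

lemma functional_with_values:
  assumes U: "fun_space.subspace U" and B: "quotient_basis W U B"
  shows "\<exists>\<Lambda>. Vector_Spaces.linear fscale (*) \<Lambda> \<and> (\<forall>u\<in>U. \<Lambda> u = 0) \<and> (\<forall>b\<in>B. \<Lambda> b = a b)"
proof -
  obtain A where A: "A \<subseteq> U" "fun_space.independent A" "U \<subseteq> fun_space.span A"
    using fun_space.maximal_independent_subset by metis
  have Bi: "r s = 0" if "finite T" "T \<subseteq> B" "(\<Sum>s\<in>T. fscale (r s) s) \<in> U" "s \<in> T" for T r s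
    using B that unfolding quotient_basis_def by blast
  have disj: "b \<notin> A" if "b \<in> B" for b
    using Bi[of "{b}" "\<lambda>_. 1" b] that A(1) by auto
  have "fun_space.independent (B \<union> A)"
  proof
    assume "fun_space.dependent (B \<union> A)"
    then obtain T r t where T: "finite T" "T \<subseteq> B \<union> A" "(\<Sum>s\<in>T. fscale (r s) s) = 0" "t \<in> T" "r t \<noteq> 0"
      unfolding fun_space.dependent_explicit by blast
    have sp: "(\<Sum>s\<in>T \<inter> B. fscale (r s) s) + (\<Sum>s\<in>T - B. fscale (r s) s) = 0"
      using sum.Int_Diff[OF T(1), of "\<lambda>s. fscale (r s) s" B] T(3) by simp
    have "(\<Sum>s\<in>T - B. fscale (r s) s) \<in> U"
      by (rule fun_space.subspace_sum[OF U], rule fun_space.subspace_scale[OF U]) (use T(2) A(1) in blast)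
    moreover have "(\<Sum>s\<in>T \<inter> B. fscale (r s) s) = - (\<Sum>s\<in>T - B. fscale (r s) s)" using sp by (simp add: eq_neg_iff_add_eq_0)
    ultimately have "(\<Sum>s\<in>T \<inter> B. fscale (r s) s) \<in> U" using fun_space.subspace_neg[OF U] by simp
    then have z: "r s = 0" if "s \<in> T \<inter> B" for s using Bi[of "T \<inter> B" r s] T(1) that by auto
    then have "(\<Sum>s\<in>T \<inter> B. fscale (r s) s) = 0" by (intro sum.neutral) simp
    then have "(\<Sum>s\<in>T - B. fscale (r s) s) = 0" using sp by simp
    from fun_space.independentD[OF A(2) _ _ this] have "r s = 0" if "s \<in> T - B" for s using that T(1,2) by blast
    then show False using z T(4,5) by blast
  qed
  from functional.linear_independent_extend[OF this, of "\<lambda>s. if s \<in> B then a s else 0"]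
  obtain \<Lambda> where \<Lambda>: "Vector_Spaces.linear fscale (*) \<Lambda>" "\<forall>s\<in>B \<union> A. \<Lambda> s = (if s \<in> B then a s else 0)" by metis
  have "\<Lambda> u = 0" if "u \<in> U" for u
    by (rule functional.linear_eq_0_on_span[OF \<Lambda>(1), of A]) (use \<Lambda>(2) disj A(3) that in auto)
  then show ?thesis using \<Lambda> by auto
qed

lemma sum_fun_apply: "(\<Sum>i\<in>A. f i) x = (\<Sum>i\<in>A. f i x)"
  for f :: "'i \<Rightarrow> 'x \<Rightarrow> 'k::comm_monoid_add"
  by (induction A rule: infinite_finite_induct) auto

lemma bar_chain_sum:
  assumes "c \<in> bar_chains1 G"
  shows "c = (\<Sum>g | c g \<noteq> 0. fscale (c g) (bar_generator g))"
proof
  fix x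
  have fin: "finite {g. c g \<noteq> 0}" using assms by (simp add: bar_chains1_def)
  have "(\<Sum>g | c g \<noteq> 0. fscale (c g) (bar_generator g)) x = (\<Sum>g | c g \<noteq> 0. if x = g then c g else 0)"
    by (subst sum_fun_apply) (auto simp: fscale_def bar_generator_def intro!: sum.cong)
  then show "c x = (\<Sum>g | c g \<noteq> 0. fscale (c g) (bar_generator g)) x" using fin by simp
qed

lemma subspace_bar_chains1: "fun_space.subspace (bar_chains1 G :: ('g \<Rightarrow> 'k::field) set)"
  unfolding fun_space.subspace_def
proof (intro conjI ballI allI)
  fix a b :: "'g \<Rightarrow> 'k" assume ab: "a \<in> bar_chains1 G" "b \<in> bar_chains1 G"
  have "{g. (a + b) g \<noteq> 0} \<subseteq> {g. a g \<noteq> 0} \<union> {g. b g \<noteq> 0}" by auto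
  then show "a + b \<in> bar_chains1 G" using ab finite_subset unfolding bar_chains1_def by blast
next
  fix r and a :: "'g \<Rightarrow> 'k" assume a: "a \<in> bar_chains1 G"
  have "{g. fscale r a g \<noteq> 0} \<subseteq> {g. a g \<noteq> 0}" by (auto simp: fscale_def)
  then show "fscale r a \<in> bar_chains1 G" using a finite_subset unfolding bar_chains1_def by blast
qed (simp add: bar_chains1_def)

lemma bar_generator_chain: "g \<in> carrier G \<Longrightarrow> bar_generator g \<in> bar_chains1 G"
  by (auto simp: bar_chains1_def bar_generator_def)

text \<open>Additive functions are the functionals on 1-chains that vanish on boundaries. The family
  \<open>\<Phi>\<close>, indexed by functions on the basis \<open>B\<close>, stands for the dual of
  the first homology and makes sense for infinite \<open>B\<close> as well.\<close>

lemma additive_functions: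
  fixes G :: "('g, 'm) monoid_scheme" and P :: "'p::prime_card itself"
  assumes cl: "\<forall>g\<in>carrier G. \<forall>h\<in>carrier G. g \<otimes>\<^bsub>G\<^esub> h \<in> carrier G"
  shows "\<exists>(B :: ('g \<Rightarrow> 'p mod_ring) set) \<Phi> :: (('g \<Rightarrow> 'p mod_ring) \<Rightarrow> 'p mod_ring) \<Rightarrow> 'g \<Rightarrow> 'p mod_ring.
    d_p P G = card B \<and>
    (\<forall>a. \<forall>g\<in>carrier G. \<forall>h\<in>carrier G. \<Phi> a (g \<otimes>\<^bsub>G\<^esub> h) = \<Phi> a g + \<Phi> a h) \<and>
    (\<forall>a a'. (\<forall>g\<in>carrier G. \<Phi> a g = \<Phi> a' g) \<longrightarrow> (\<forall>b\<in>B. a b = a' b))"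
proof -
  let ?W = "bar_chains1 G :: ('g \<Rightarrow> 'p mod_ring) set" and ?U = "bar_boundaries1 G :: ('g \<Rightarrow> 'p mod_ring) set"
  define B where "B = (SOME B. quotient_basis ?W ?U B)"
  have U: "fun_space.subspace ?U" unfolding bar_boundaries1_def by (rule fun_space.subspace_span)
  have UW: "?U \<subseteq> ?W" unfolding bar_boundaries1_def
  proof (rule fun_space.span_minimal[OF _ subspace_bar_chains1], rule subsetI)
    fix c :: "'g \<Rightarrow> 'p mod_ring"
    assume "c \<in> {bar_generator h - bar_generator (g \<otimes>\<^bsub>G\<^esub> h) + bar_generator g | g h. g \<in> carrier G \<and> h \<in> carrier G}"
    then obtain g h where c: "c = bar_generator h - bar_generator (g \<otimes>\<^bsub>G\<^esub> h) + bar_generator g" and gh: "g \<in> carrier G" "h \<in> carrier G" by blast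
    show "c \<in> ?W" unfolding c
      by (intro fun_space.subspace_add[OF subspace_bar_chains1] fun_space.subspace_diff[OF subspace_bar_chains1] bar_generator_chain cl[rule_format] gh)
  qed
  have B: "quotient_basis ?W ?U B" unfolding B_def by (rule someI_ex[OF quotient_basis_exists[OF U subspace_bar_chains1 UW]])
  define \<Lambda> where "\<Lambda> a = (SOME \<Lambda>. Vector_Spaces.linear fscale (*) \<Lambda> \<and> (\<forall>u\<in>?U. \<Lambda> u = 0) \<and> (\<forall>b\<in>B. \<Lambda> b = a b))" for a
  have \<Lambda>: "Vector_Spaces.linear fscale (*) (\<Lambda> a) \<and> (\<forall>u\<in>?U. \<Lambda> a u = 0) \<and> (\<forall>b\<in>B. \<Lambda> a b = a b)" for a
    unfolding \<Lambda>_def by (rule someI_ex[OF functional_with_values[OF U B]])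
  define \<Phi> where "\<Phi> a g = \<Lambda> a (bar_generator g)" for a g
  have add: "\<Phi> a (g \<otimes>\<^bsub>G\<^esub> h) = \<Phi> a g + \<Phi> a h" if "g \<in> carrier G" "h \<in> carrier G" for a g h
  proof -
    have "bar_generator h - bar_generator (g \<otimes>\<^bsub>G\<^esub> h) + bar_generator g \<in> ?U"
      unfolding bar_boundaries1_def by (rule fun_space.span_base) (use that in blast)
    then have "\<Lambda> a (bar_generator h - bar_generator (g \<otimes>\<^bsub>G\<^esub> h) + bar_generator g) = 0" using \<Lambda> by blast
    then have "\<Phi> a h - \<Phi> a (g \<otimes>\<^bsub>G\<^esub> h) + \<Phi> a g = 0"
      unfolding \<Phi>_def functional.linear_add[OF conjunct1[OF \<Lambda>]] functional.linear_diff[OF conjunct1[OF \<Lambda>]] .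
    then show ?thesis by (simp add: algebra_simps)
  qed
  have inj: "a b = a' b" if e: "\<forall>g\<in>carrier G. \<Phi> a g = \<Phi> a' g" and b: "b \<in> B" for a a' b
  proof -
    have "b \<in> ?W" using B b fun_space.span_base unfolding quotient_basis_def by (metis UnI1)
    then have s: "b = (\<Sum>g | b g \<noteq> 0. fscale (b g) (bar_generator g))" and c: "{g. b g \<noteq> 0} \<subseteq> carrier G"
      by (rule bar_chain_sum) (use \<open>b \<in> ?W\<close> in \<open>simp add: bar_chains1_def\<close>)
    have v: "\<Lambda> d b = (\<Sum>g | b g \<noteq> 0. b g * \<Phi> d g)" for d
    proof -
      have "\<Lambda> d b = \<Lambda> d (\<Sum>g | b g \<noteq> 0. fscale (b g) (bar_generator g))" using s by (rule arg_cong)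
      then show ?thesis
        unfolding \<Phi>_def functional.linear_sum[OF conjunct1[OF \<Lambda>]] functional.linear_scale[OF conjunct1[OF \<Lambda>]] .
    qed
    have "\<Lambda> a b = \<Lambda> a' b" unfolding v by (rule sum.cong) (use e c in auto)
    then show ?thesis using \<Lambda> b by metis
  qed
  have "d_p P G = card B" by (simp add: d_p_def quotient_dim_def B_def)
  then show ?thesis using add inj by (intro exI[of _ B] exI[of _ \<Phi>]) blast
qed


section \<open>Cohomology of a covering space and homology of its fundamental group\<close>

lemma (in fin_complex) zero_cells_nonempty: "points K \<noteq> {} \<Longrightarrow> zero_cells K \<noteq> {}"
proof
  assume "zero_cells K = {}"
  then have "one_cells K = {}" "two_cells K = {}"
    using char1_props(3) boundary_start_in by blast+
  moreover assume "points K \<noteq> {}"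
  ultimately show False using fin \<open>zero_cells K = {}\<close> by (auto simp: finite_two_complex_def)
qed

locale based_cover = complex_cover K Y q
  for K :: "('a::t2_space, 'e, 'f) two_complex" and Y :: "'b::topological_space set" and q :: "'b \<Rightarrow> 'a" +
  fixes y0 :: 'b
  assumes y0: "y0 \<in> Y"
begin

abbreviation "G \<equiv> pi1 (points K) (q y0)"
abbreviation "H \<equiv> pi1_image Y y0 q (points K)"

lemma q_path:
  assumes "path g" "path_image g \<subseteq> Y"
  shows "path (q \<circ> g)" "path_image (q \<circ> g) \<subseteq> points K"
  using path_continuous_image[OF assms(1) continuous_on_subset[OF covering_space_imp_continuous[OF cov] assms(2)]] assms(2) q_in
  by (auto simp: path_image_compose)

lemma q_loop: "based_loop Y y0 g \<Longrightarrow> based_loop (points K) (q y0) (q \<circ> g)"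
  using q_path by (auto simp: based_loop_def pathstart_compose pathfinish_compose)

lemma q_homotopic: "homotopic_paths Y g h \<Longrightarrow> homotopic_paths (points K) (q \<circ> g) (q \<circ> h)"
  by (rule homotopic_paths_continuous_image[OF _ covering_space_imp_continuous[OF cov]]) (use q_in in auto)

definition tail :: "'b \<Rightarrow> real \<Rightarrow> 'b" where
  "tail v = (SOME g. path g \<and> path_image g \<subseteq> Y \<and> pathstart g = y0 \<and> pathfinish g = v)"

lemma tail:
  assumes "v \<in> Y"
  shows "path (tail v)" "path_image (tail v) \<subseteq> Y" "pathstart (tail v) = y0" "pathfinish (tail v) = v"
proof -
  have "\<exists>g. path g \<and> path_image g \<subseteq> Y \<and> pathstart g = y0 \<and> pathfinish g = v"
    using cover_path_connected[OF cov conn y0 assms] by metis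
  from someI_ex[OF this] show "path (tail v)" "path_image (tail v) \<subseteq> Y" "pathstart (tail v) = y0" "pathfinish (tail v) = v"
    unfolding tail_def by blast+
qed

text \<open>Conjugation by chosen tails turns any path into a loop at \<open>y0\<close>, compatibly
  with concatenation up to homotopy.\<close>

definition close_up :: "(real \<Rightarrow> 'b) \<Rightarrow> real \<Rightarrow> 'b" where
  "close_up g = (tail (pathstart g) +++ g) +++ reversepath (tail (pathfinish g))"

lemma path_in_Y: "path_image g \<subseteq> Y \<Longrightarrow> pathstart g \<in> Y \<and> pathfinish g \<in> Y"
  using pathstart_in_path_image pathfinish_in_path_image by blast

lemma close_up_loop: "\<lbrakk>path g; path_image g \<subseteq> Y\<rbrakk> \<Longrightarrow> based_loop Y y0 (close_up g)"
  using tail[of "pathstart g"] tail[of "pathfinish g"] path_in_Y[of g]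
  by (auto simp: based_loop_def close_up_def path_image_join)

lemma close_up_join:
  assumes g: "path g" "path_image g \<subseteq> Y" and h: "path h" "path_image h \<subseteq> Y" and gh: "pathfinish g = pathstart h"
  shows "homotopic_paths Y (close_up g +++ close_up h) (close_up (g +++ h))"
proof -
  define a where "a = tail (pathstart g)"
  define b where "b = tail (pathfinish g)"
  define c where "c = tail (pathfinish h)"
  have a: "path a" "path_image a \<subseteq> Y" "pathfinish a = pathstart g" "pathstart a = y0"
    and b: "path b" "path_image b \<subseteq> Y" "pathfinish b = pathstart h" "pathstart b = y0"
    and c: "path c" "path_image c \<subseteq> Y" "pathfinish c = pathfinish h" "pathstart c = y0"
    unfolding a_def b_def c_def using tail path_in_Y[OF g(2)] path_in_Y[OF h(2)] gh by auto
  let ?A = "a +++ g" and ?C = "h +++ reversepath c"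
  have A: "path ?A" "path_image ?A \<subseteq> Y" "pathfinish ?A = pathstart h" and C: "path ?C" "path_image ?C \<subseteq> Y" "pathstart ?C = pathstart h"
    using a c g h gh by (auto simp: path_image_join)
  have "homotopic_paths Y ((?A +++ reversepath b) +++ ((b +++ h) +++ reversepath c)) ((?A +++ reversepath b) +++ (b +++ ?C))"
    by (intro homotopic_paths_join homotopic_paths_sym[OF homotopic_paths_assoc]) (use a b c g h gh in \<open>auto simp: path_image_join\<close>)
  moreover have "homotopic_paths Y ((?A +++ reversepath b) +++ (b +++ ?C)) (((?A +++ reversepath b) +++ b) +++ ?C)"
    by (rule homotopic_paths_assoc) (use a b c g h gh in \<open>auto simp: path_image_join\<close>)
  moreover have "homotopic_paths Y (((?A +++ reversepath b) +++ b) +++ ?C) ((?A +++ (reversepath b +++ b)) +++ ?C)"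
    by (intro homotopic_paths_join homotopic_paths_sym[OF homotopic_paths_assoc]) (use a b c g h gh in \<open>auto simp: path_image_join\<close>)
  moreover have "homotopic_paths Y ((?A +++ (reversepath b +++ b)) +++ ?C) ((?A +++ (\<lambda>_. pathstart h)) +++ ?C)"
    by (intro homotopic_paths_join homotopic_paths_linv_const) (use a b c g h gh in \<open>auto simp: path_image_join\<close>)
  moreover have "homotopic_paths Y ((?A +++ (\<lambda>_. pathstart h)) +++ ?C) (?A +++ ?C)"
    by (intro homotopic_paths_join homotopic_paths_rid_const) (use a b c g h gh in \<open>auto simp: path_image_join\<close>)
  moreover have "homotopic_paths Y (?A +++ ?C) ((?A +++ h) +++ reversepath c)"
    by (rule homotopic_paths_assoc) (use a b c g h gh in \<open>auto simp: path_image_join\<close>)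
  moreover have "homotopic_paths Y ((?A +++ h) +++ reversepath c) ((a +++ (g +++ h)) +++ reversepath c)"
    by (intro homotopic_paths_join homotopic_paths_sym[OF homotopic_paths_assoc]) (use a b c g h gh in \<open>auto simp: path_image_join\<close>)
  ultimately have "homotopic_paths Y ((?A +++ reversepath b) +++ ((b +++ h) +++ reversepath c)) ((a +++ (g +++ h)) +++ reversepath c)"
    by (blast intro: homotopic_paths_trans)
  then show ?thesis by (simp add: close_up_def a_def b_def c_def gh)
qed

text \<open>The loop \<open>g\<close> is first conjugated to \<open>v\<close> along the same tail
  that \<open>close_up\<close> uses, so that the tails cancel.\<close>

lemma close_up_conjugate:
  assumes vY: "v \<in> Y" and g: "based_loop Y y0 g"
  shows "\<exists>h. path h \<and> path_image h \<subseteq> Y \<and> pathstart h = v \<and> pathfinish h = v \<and> homotopic_paths Y (close_up h) g"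
proof -
  define t where "t = tail v"
  have t: "path t" "path_image t \<subseteq> Y" "pathstart t = y0" "pathfinish t = v" using tail[OF vY] by (simp_all add: t_def)
  have g': "path g" "path_image g \<subseteq> Y" "pathstart g = y0" "pathfinish g = y0" using g by (auto simp: based_loop_def)
  let ?h = "reversepath t +++ (g +++ t)"
  have h: "path ?h" "path_image ?h \<subseteq> Y" "pathstart ?h = v" "pathfinish ?h = v"
    using t g' by (auto simp: path_image_join)
  have "homotopic_paths Y (close_up ?h) g"
  proof -
    have e: "close_up ?h = (t +++ (reversepath t +++ (g +++ t))) +++ reversepath t" using h by (simp add: close_up_def t_def)
    have "homotopic_paths Y (close_up ?h) (((t +++ reversepath t) +++ (g +++ t)) +++ reversepath t)" unfolding e
      by (intro homotopic_paths_join homotopic_paths_assoc) (use t g' in \<open>auto simp: path_image_join\<close>)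
    moreover have "homotopic_paths Y (((t +++ reversepath t) +++ (g +++ t)) +++ reversepath t) (((\<lambda>_. y0) +++ (g +++ t)) +++ reversepath t)"
      by (intro homotopic_paths_join homotopic_paths_rinv_const) (use t g' in \<open>auto simp: path_image_join\<close>)
    moreover have "homotopic_paths Y (((\<lambda>_. y0) +++ (g +++ t)) +++ reversepath t) ((g +++ t) +++ reversepath t)"
      by (intro homotopic_paths_join homotopic_paths_lid_const) (use t g' in \<open>auto simp: path_image_join\<close>)
    moreover have "homotopic_paths Y ((g +++ t) +++ reversepath t) (g +++ (t +++ reversepath t))"
      by (rule homotopic_paths_sym, rule homotopic_paths_assoc) (use t g' in \<open>auto simp: path_image_join\<close>)
    moreover have "homotopic_paths Y (g +++ (t +++ reversepath t)) (g +++ (\<lambda>_. y0))"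
      by (intro homotopic_paths_join homotopic_paths_rinv_const) (use t g' in \<open>auto simp: path_image_join\<close>)
    moreover have "homotopic_paths Y (g +++ (\<lambda>_. y0)) g"
      by (rule homotopic_paths_rid_const) (use t g' in \<open>auto simp: path_image_join\<close>)
    ultimately show ?thesis by (blast intro: homotopic_paths_trans)
  qed
  then show ?thesis using h by blast
qed

text \<open>Both paths have the same ends, hence the same tails, and conjugating back by these
  recovers the paths.\<close>

lemma close_up_cancel:
  assumes e: "homotopic_paths Y (close_up g) (close_up h)"
    and g: "path g" "path_image g \<subseteq> Y" and h: "path h" "path_image h \<subseteq> Y"
    and s: "pathstart g = pathstart h" "pathfinish g = pathfinish h"
  shows "homotopic_paths Y g h"
proof -
  define a where "a = tail (pathstart h)"
  define b where "b = tail (pathfinish h)"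
  have a: "path a" "path_image a \<subseteq> Y" "pathfinish a = pathstart h" "pathstart a = y0"
    and b: "path b" "path_image b \<subseteq> Y" "pathfinish b = pathfinish h" "pathstart b = y0"
    unfolding a_def b_def using tail path_in_Y[OF h(2)] by auto
  have open_up: "homotopic_paths Y (reversepath a +++ (close_up k +++ b)) k"
    if k: "path k" "path_image k \<subseteq> Y" "pathstart k = pathstart h" "pathfinish k = pathfinish h" for k
  proof -
    have "close_up k = (a +++ k) +++ reversepath b" using k by (simp add: close_up_def a_def b_def)
    then have "homotopic_paths Y (reversepath a +++ (close_up k +++ b)) (reversepath a +++ ((a +++ k) +++ (reversepath b +++ b)))"
      by (simp only:, intro homotopic_paths_join homotopic_paths_sym[OF homotopic_paths_assoc]) (use a b k in \<open>auto simp: path_image_join\<close>)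
    moreover have "homotopic_paths Y (reversepath a +++ ((a +++ k) +++ (reversepath b +++ b))) (reversepath a +++ ((a +++ k) +++ (\<lambda>_. pathfinish h)))"
      by (intro homotopic_paths_join homotopic_paths_linv_const) (use a b k in \<open>auto simp: path_image_join\<close>)
    moreover have "homotopic_paths Y (reversepath a +++ ((a +++ k) +++ (\<lambda>_. pathfinish h))) (reversepath a +++ (a +++ k))"
      by (intro homotopic_paths_join homotopic_paths_rid_const) (use a b k in \<open>auto simp: path_image_join\<close>)
    moreover have "homotopic_paths Y (reversepath a +++ (a +++ k)) ((reversepath a +++ a) +++ k)"
      by (rule homotopic_paths_assoc) (use a b k in \<open>auto simp: path_image_join\<close>)
    moreover have "homotopic_paths Y ((reversepath a +++ a) +++ k) ((\<lambda>_. pathstart h) +++ k)"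
      by (intro homotopic_paths_join homotopic_paths_linv_const) (use a b k in \<open>auto simp: path_image_join\<close>)
    moreover have "homotopic_paths Y ((\<lambda>_. pathstart h) +++ k) k"
      by (rule homotopic_paths_lid_const) (use a b k in \<open>auto simp: path_image_join\<close>)
    ultimately show ?thesis by (blast intro: homotopic_paths_trans)
  qed
  have "homotopic_paths Y (reversepath a +++ (close_up g +++ b)) (reversepath a +++ (close_up h +++ b))"
    by (intro homotopic_paths_join e) (use a b g h close_up_loop[OF g] close_up_loop[OF h] in \<open>auto simp: based_loop_def path_image_join\<close>)
  then show ?thesis using open_up[OF g s] open_up[OF h refl refl] homotopic_paths_trans homotopic_paths_sym by blast
qed

text \<open>An additive function on the fundamental group extends to a function on paths that is additive under
  concatenation.\<close>

definition path_value :: "((real \<Rightarrow> 'a) set \<Rightarrow> 'k) \<Rightarrow> (real \<Rightarrow> 'b) \<Rightarrow> 'k" where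
  "path_value \<phi> g = \<phi> (path_class (points K) (q \<circ> close_up g))"

lemma close_up_in_H: "\<lbrakk>path g; path_image g \<subseteq> Y\<rbrakk> \<Longrightarrow> path_class (points K) (q \<circ> close_up g) \<in> H"
  using close_up_loop unfolding pi1_image_def by blast

lemma close_up_homotopic:
  assumes h: "homotopic_paths Y g h"
  shows "homotopic_paths Y (close_up g) (close_up h)"
proof -
  have g: "path g" "path_image g \<subseteq> Y" and e: "pathstart h = pathstart g" "pathfinish h = pathfinish g"
    using homotopic_paths_imp_path[OF h] homotopic_paths_imp_subset[OF h] homotopic_paths_imp_pathstart[OF h] homotopic_paths_imp_pathfinish[OF h] by auto
  show ?thesis unfolding close_up_def e
    by (intro homotopic_paths_join h) (use tail[of "pathstart g"] tail[of "pathfinish g"] path_in_Y[OF g(2)] in auto)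
qed

lemma path_value_homotopic: "homotopic_paths Y g h \<Longrightarrow> path_value \<phi> g = path_value \<phi> h"
  unfolding path_value_def by (rule arg_cong, rule path_class_eqI, rule q_homotopic, rule close_up_homotopic)

lemma H_mult_closed:
  assumes "a \<in> H" "b \<in> H"
  shows "a \<otimes>\<^bsub>G\<^esub> b \<in> H"
proof -
  obtain g h where g: "a = path_class (points K) (q \<circ> g)" "based_loop Y y0 g"
    and h: "b = path_class (points K) (q \<circ> h)" "based_loop Y y0 h" using assms by (auto simp: pi1_image_def)
  have "a \<otimes>\<^bsub>G\<^esub> b = path_class (points K) (q \<circ> (g +++ h))"
    unfolding g(1) h(1) pi1_mult[OF q_loop[OF g(2)] q_loop[OF h(2)]] by (simp add: path_compose_join)
  then show ?thesis unfolding pi1_image_def using based_loop_join[OF g(2) h(2)] by blast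
qed

end

locale additive_on_cover = based_cover K Y q y0
  for K :: "('a::t2_space, 'e, 'f) two_complex" and Y :: "'b::topological_space set" and q :: "'b \<Rightarrow> 'a" and y0 :: 'b +
  fixes \<phi> :: "(real \<Rightarrow> 'a) set \<Rightarrow> 'k::field"
  assumes additive: "\<lbrakk>a \<in> H; b \<in> H\<rbrakk> \<Longrightarrow> \<phi> (a \<otimes>\<^bsub>G\<^esub> b) = \<phi> a + \<phi> b"
begin

lemma path_value_join:
  assumes g: "path g" "path_image g \<subseteq> Y" and h: "path h" "path_image h \<subseteq> Y" and gh: "pathfinish g = pathstart h"
  shows "path_value \<phi> (g +++ h) = path_value \<phi> g + path_value \<phi> h"
proof -
  have "path_value \<phi> g + path_value \<phi> h = \<phi> (path_class (points K) (q \<circ> close_up g) \<otimes>\<^bsub>G\<^esub> path_class (points K) (q \<circ> close_up h))"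
    unfolding path_value_def by (rule additive[symmetric]; rule close_up_in_H[OF g] close_up_in_H[OF h])
  also have "path_class (points K) (q \<circ> close_up g) \<otimes>\<^bsub>G\<^esub> path_class (points K) (q \<circ> close_up h) =
      path_class (points K) (q \<circ> (close_up g +++ close_up h))"
    unfolding pi1_mult[OF q_loop[OF close_up_loop[OF g]] q_loop[OF close_up_loop[OF h]]] by (simp add: path_compose_join)
  also have "\<dots> = path_class (points K) (q \<circ> close_up (g +++ h))"
    by (rule path_class_eqI, rule q_homotopic, rule close_up_join[OF g h gh])
  finally show ?thesis by (simp add: path_value_def)
qed

lemma path_value_const: "y \<in> Y \<Longrightarrow> path_value \<phi> (\<lambda>_. y) = 0"
proof -
  assume y: "y \<in> Y"
  have c: "path (\<lambda>_. y)" "path_image (\<lambda>_. y) \<subseteq> Y" "pathfinish (\<lambda>_. y) = y" "pathstart (\<lambda>_. y) = y" using y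
    by (auto simp: path_image_def pathstart_def pathfinish_def)
  have "(\<lambda>_. y) +++ (\<lambda>_. y) = (\<lambda>_::real. y)" by (auto simp: joinpaths_def)
  then have "path_value \<phi> (\<lambda>_. y) + path_value \<phi> (\<lambda>_. y) = path_value \<phi> (\<lambda>_. y)"
    using path_value_join[OF c(1,2) c(1,2)] c(3,4) by metis
  then show ?thesis by (simp only: add_cancel_left_right add_cancel_right_right)
qed

lemma path_value_reverse:
  assumes g: "path g" "path_image g \<subseteq> Y"
  shows "path_value \<phi> (reversepath g) = - path_value \<phi> g"
proof -
  have "path_value \<phi> (g +++ reversepath g) = path_value \<phi> (\<lambda>_. pathstart g)"
    by (rule path_value_homotopic, rule homotopic_paths_rinv_const) (use g in auto)
  then have "path_value \<phi> g + path_value \<phi> (reversepath g) = 0"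
    using path_value_join[OF g, of "reversepath g"] path_value_const path_in_Y[OF g(2)] g by simp
  then show ?thesis by (rule minus_unique[symmetric])
qed

definition cochain :: "'e \<times> 'b \<Rightarrow> 'k" where
  "cochain \<epsilon> = (if \<epsilon> \<in> one_cells L then path_value \<phi> (char1 L \<epsilon>) else 0)"

lemma path_value_word:
  assumes "walk L u w v" "u \<in> zero_cells L"
  shows "path_value \<phi> (word_path L u w) = ev cochain w"
  using assms
proof (induction w arbitrary: u)
  case Nil
  then show ?case using path_value_const by (simp add: zero_L)
next
  case (Cons s w)
  then have s: "fst s \<in> one_cells L" "pathstart (edge_path L s) = u" "walk L (pathfinish (edge_path L s)) w v" by auto
  have z: "pathfinish (edge_path L s) \<in> zero_cells L" by (rule edge_path_props(4)[OF edges_L s(1)])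
  have W: "path (word_path L (pathfinish (edge_path L s)) w)" "path_image (word_path L (pathfinish (edge_path L s)) w) \<subseteq> Y"
    "pathfinish (edge_path L s) = pathstart (word_path L (pathfinish (edge_path L s)) w)"
    using word_path_props[OF edges_L s(3) z] skeleton_L by auto
  have "path_value \<phi> (word_path L u (s # w)) = path_value \<phi> (edge_path L s) + ev cochain w"
    using path_value_join[OF edge_path_L(3,4)[OF s(1)] W] Cons.IH[OF s(3) z] by simp
  also have "path_value \<phi> (edge_path L s) = (if snd s then cochain (fst s) else - cochain (fst s))"
    using path_value_reverse[OF char1_L(1,2)[OF s(1)]] s(1) by (simp add: edge_path_def cochain_def)
  finally show ?case by (simp add: ev_Cons)
qed

text \<open>The boundary path of a lifted 2-cell is null-homotopic through the disc, so the value of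
  the additive function on its word is 0.\<close>

lemma cochain_cocycle: "cochain \<in> cocycles1 L"
proof -
  have "ev cochain (boundary_word L f) = 0" if f: "f \<in> two_cells L" for f
  proof -
    note B = boundary_walk_L[OF f]
    have "ev cochain (boundary_word L f) = path_value \<phi> (\<lambda>_. boundary_path L f 0)"
      unfolding path_value_word[OF B(1,2), symmetric] by (rule path_value_homotopic[OF B(3)])
    then show ?thesis using path_value_const B(2) by (simp add: zero_L)
  qed
  then show ?thesis by (auto simp: cocycles1_def cochains_on_def cochain_def coboundary1_def ev_def)
qed

lemma word_for_element:
  assumes v: "v \<in> zero_cells L" and a: "a \<in> H"
  shows "\<exists>w. walk L v w v \<and> path_class (points K) (q \<circ> close_up (word_path L v w)) = a"
proof -
  obtain g where g: "a = path_class (points K) (q \<circ> g)" "based_loop Y y0 g" using a by (auto simp: pi1_image_def)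
  have vY: "v \<in> Y" using v by (simp add: zero_L)
  obtain h where h: "path h" "path_image h \<subseteq> Y" "pathstart h = v" "pathfinish h = v" "homotopic_paths Y (close_up h) g"
    using close_up_conjugate[OF vY g(2)] by metis
  obtain w where w: "walk L v w v" "homotopic_paths Y h (word_path L v w)"
    using paths_are_words_L[of h] v h by auto
  have "homotopic_paths Y (close_up (word_path L v w)) g"
    using close_up_homotopic[OF w(2)] h(5) homotopic_paths_trans homotopic_paths_sym by blast
  then have "path_class (points K) (q \<circ> close_up (word_path L v w)) = a"
    unfolding g(1) by (intro path_class_eqI q_homotopic)
  then show ?thesis using w(1) by blast
qed

end

context based_cover
begin

lemma zero_L_nonempty: "zero_cells L \<noteq> {}"
proof -
  have "points K \<noteq> {}" using q_in[OF y0] by blast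
  then obtain v where v: "v \<in> zero_cells K" using zero_cells_nonempty by blast
  then have "v \<in> q ` Y" using cov skeleton_subset by (auto simp: covering_space_def skeleton_def)
  then show ?thesis using v by (auto simp: zero_L)
qed

text \<open>Additive functions give cellular cocycles, and functions on \<open>B\<close> with
  cohomologous cocycles are equal on \<open>B\<close>. Counting over the finite field then compares
  the exponents.\<close>

theorem d_p_le_card_basis:
  fixes S :: "('e \<times> 'b \<Rightarrow> 'p::prime_card mod_ring) set"
  assumes S: "represents_H1_basis L S"
  shows "finite S" and "d_p TYPE('p) (G\<lparr>carrier := H\<rparr>) \<le> card S"
proof -
  note S' = S[unfolded represents_H1_basis_def quotient_basis_def]
  have spS: "fun_space.span (S \<union> coboundaries1 L) = cocycles1 L" by (rule S'[THEN conjunct1])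
  have "S \<subseteq> cocycles1 L" using fun_space.span_superset[of "S \<union> coboundaries1 L"] unfolding spS by (rule order.trans[OF Un_upper1])
  then have "S \<subseteq> cochains_on (one_cells L)" by (auto simp: cocycles1_def)
  then show fS: "finite S" by (rule finite_subset) (rule finite_cochains_on[OF finite_one_L])
  let ?M = "G\<lparr>carrier := H\<rparr>"
  have cl: "\<forall>g\<in>carrier ?M. \<forall>h\<in>carrier ?M. g \<otimes>\<^bsub>?M\<^esub> h \<in> carrier ?M" using H_mult_closed by simp
  obtain B :: "((real \<Rightarrow> 'a) set \<Rightarrow> 'p mod_ring) set" and \<Phi> :: "(((real \<Rightarrow> 'a) set \<Rightarrow> 'p mod_ring) \<Rightarrow> 'p mod_ring) \<Rightarrow> (real \<Rightarrow> 'a) set \<Rightarrow> 'p mod_ring"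
    where \<Phi>: "d_p TYPE('p) ?M = card B \<and>
      (\<forall>a. \<forall>g\<in>carrier ?M. \<forall>h\<in>carrier ?M. \<Phi> a (g \<otimes>\<^bsub>?M\<^esub> h) = \<Phi> a g + \<Phi> a h) \<and>
      (\<forall>a a'. (\<forall>g\<in>carrier ?M. \<Phi> a g = \<Phi> a' g) \<longrightarrow> (\<forall>b\<in>B. a b = a' b))"
    using additive_functions[of ?M "TYPE('p)", OF cl] by (elim exE)
  have d: "d_p TYPE('p) ?M = card B" by (rule \<Phi>[THEN conjunct1])
  have add: "\<Phi> a (g \<otimes>\<^bsub>G\<^esub> h) = \<Phi> a g + \<Phi> a h" if "g \<in> H" "h \<in> H" for a g h
    using \<Phi>[THEN conjunct2, THEN conjunct1, rule_format, of g h a] that by simp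
  have inj: "a b = a' b" if "\<forall>g\<in>H. \<Phi> a g = \<Phi> a' g" "b \<in> B" for a a' b
    using \<Phi>[THEN conjunct2, THEN conjunct2, rule_format, of a a' b] that by simp
  have loc: "additive_on_cover K Y q y0 (\<Phi> a)" for a
    by unfold_locales (rule add)
  define c where "c a = additive_on_cover.cochain K Y q y0 (\<Phi> a)" for a
  have cc: "c a \<in> cocycles1 L" for a unfolding c_def by (rule additive_on_cover.cochain_cocycle[OF loc])
  obtain v where v: "v \<in> zero_cells L" using zero_L_nonempty by blast
  \<comment> \<open>A coboundary vanishes on closed walks, and every element of \<open>H\<close> is
    represented by a closed walk at \<open>v\<close>.\<close>
  have diff: "a b = a' b" if cob: "c a - c a' \<in> coboundaries1 L" and b: "b \<in> B" for a a' b
  proof (rule inj[OF _ b], rule ballI)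
    fix g assume g: "g \<in> H"
    obtain w where w: "walk L v w v" "path_class (points K) (q \<circ> close_up (word_path L v w)) = g"
      using additive_on_cover.word_for_element[OF loc v g] by blast
    have val: "\<Phi> d g = ev (c d) w" for d
      using additive_on_cover.path_value_word[OF loc w(1) v, of d] w(2) by (simp add: c_def path_value_def)
    obtain f where "c a - c a' = coboundary0 L f" using cob by (auto simp: coboundaries1_def)
    then have "ev (c a - c a') w = 0" using ev_coboundary[OF w(1)] by simp
    then show "\<Phi> a g = \<Phi> a' g" by (simp add: val ev_diff)
  qed
  \<comment> \<open>The coordinates of the class of \<open>c a\<close>; they are restricted to
    \<open>S\<close> so that such coordinate functions can be counted.\<close>
  have ex: "\<exists>t. t \<in> S \<rightarrow>\<^sub>E UNIV \<and> c a - (\<Sum>s\<in>S. fscale (t s) s) \<in> coboundaries1 L" for a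
  proof -
    have "c a \<in> fun_space.span (S \<union> coboundaries1 L)" unfolding spS by (rule cc)
    then obtain r k where rk: "c a = r + k" "r \<in> fun_space.span S" "k \<in> fun_space.span (coboundaries1 L)"
      unfolding fun_space.span_Un by blast
    have k: "k \<in> coboundaries1 L" using rk(3) fun_space.span_eq_iff[THEN iffD2, OF subspace_coboundaries1] by metis
    obtain u where u: "r = (\<Sum>s\<in>S. fscale (u s) s)" using rk(2) unfolding fun_space.span_finite[OF fS] by auto
    have "(\<Sum>s\<in>S. fscale (restrict u S s) s) = r" unfolding u by (rule sum.cong) auto
    then have "c a - (\<Sum>s\<in>S. fscale (restrict u S s) s) = k" using rk(1) by simp
    then show ?thesis using k by (intro exI[of _ "restrict u S"]) simp
  qed
  define t where "t a = (SOME t. t \<in> S \<rightarrow>\<^sub>E UNIV \<and> c a - (\<Sum>s\<in>S. fscale (t s) s) \<in> coboundaries1 L)" for a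
  have t: "t a \<in> S \<rightarrow>\<^sub>E UNIV" "c a - (\<Sum>s\<in>S. fscale (t a s) s) \<in> coboundaries1 L" for a
    using someI_ex[OF ex[of a]] unfolding t_def by blast+
  show "d_p TYPE('p) ?M \<le> card S"
  \<comment> \<open>For infinite \<open>B\<close> the value of \<open>card B\<close>, and with it
    \<open>d_p\<close>, is 0.\<close>
  proof (cases "finite B")
    case True
    have "inj_on t (B \<rightarrow>\<^sub>E UNIV)"
    proof (rule inj_onI)
      fix a a' assume a: "a \<in> B \<rightarrow>\<^sub>E UNIV" "a' \<in> B \<rightarrow>\<^sub>E UNIV" and e: "t a = t a'"
      have "c a - c a' = (c a - (\<Sum>s\<in>S. fscale (t a s) s)) - (c a' - (\<Sum>s\<in>S. fscale (t a' s) s))" by (simp add: e)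
      also have "\<dots> \<in> coboundaries1 L" by (rule fun_space.subspace_diff[OF subspace_coboundaries1 t(2) t(2)])
      finally show "a = a'" by (intro PiE_ext[OF a] diff)
    qed
    then have "card (B \<rightarrow>\<^sub>E (UNIV :: 'p mod_ring set)) \<le> card (S \<rightarrow>\<^sub>E (UNIV :: 'p mod_ring set))"
      by (rule card_inj_on_le) (use t(1) fS in \<open>auto intro: finite_PiE\<close>)
    then have "CARD('p) ^ card B \<le> CARD('p) ^ card S" by (simp add: card_PiE True fS)
    moreover have "1 < CARD('p)" using prime_card[where 'a='p] prime_gt_1_nat by simp
    ultimately show ?thesis unfolding d by (simp add: power_increasing_iff)
  qed (simp add: d)
qed


text \<open>A point of the fibre is sent to the coset of the loop that runs along the image of its
  tail and returns along a fixed path \<open>\<eta>\<close>. If two such loops differ by an element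
  of \<open>H\<close>, lifting the homotopy to \<open>Y\<close> shows that the two tails have the
  same end.\<close>

lemma card_fibre_le_index:
  assumes H: "finite_index_subgroup H G" and v: "v \<in> points K"
  shows "card {y \<in> Y. q y = v} \<le> card (rcosets\<^bsub>G\<^esub> H)"
proof (cases "{y \<in> Y. q y = v} = {}")
  case False
  then obtain y1 where y1: "y1 \<in> Y" "q y1 = v" by blast
  have sub: "subgroup H G" and fin: "finite (rcosets\<^bsub>G\<^esub> H)" using H by (auto simp: finite_index_subgroup_def)
  have grp: "group G" by (rule group_pi1[OF q_in[OF y0]])
  define \<eta> where "\<eta> = q \<circ> tail y1"
  have \<eta>: "path \<eta>" "path_image \<eta> \<subseteq> points K" "pathfinish \<eta> = v" "pathstart \<eta> = q y0"
    unfolding \<eta>_def using q_path[OF tail(1,2)[OF y1(1)]] tail(3,4)[OF y1(1)] y1 by (simp_all add: pathstart_compose pathfinish_compose)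
  define \<theta> where "\<theta> y = (q \<circ> tail y) +++ reversepath \<eta>" for y
  have T: "path (q \<circ> tail y)" "path_image (q \<circ> tail y) \<subseteq> points K" "pathstart (q \<circ> tail y) = q y0" "pathfinish (q \<circ> tail y) = v"
    if "y \<in> Y" "q y = v" for y
    using q_path[OF tail(1,2)[OF that(1)]] tail(3,4)[OF that(1)] that by (simp_all add: pathstart_compose pathfinish_compose)
  have \<theta>: "based_loop (points K) (q y0) (\<theta> y)" if "y \<in> Y" "q y = v" for y
    using T[OF that] \<eta> by (auto simp: \<theta>_def based_loop_def path_image_join)
  have "inj_on (\<lambda>y. H #>\<^bsub>G\<^esub> path_class (points K) (\<theta> y)) {y \<in> Y. q y = v}"
  proof (rule inj_onI, clarify)
    fix y y' assume y: "y \<in> Y" "v = q y" and y': "y' \<in> Y" "q y' = q y"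
      and e: "H #>\<^bsub>G\<^esub> path_class (points K) (\<theta> y) = H #>\<^bsub>G\<^esub> path_class (points K) (\<theta> y')"
    have vy: "q y = v" "q y' = v" using y y' by simp_all
    have "path_class (points K) (\<theta> y) \<in> carrier G" using \<theta>[OF y(1) vy(1)] by (auto simp: carrier_pi1)
    then have "path_class (points K) (\<theta> y) \<in> H #>\<^bsub>G\<^esub> path_class (points K) (\<theta> y)" by (rule group.rcos_self[OF grp _ sub])
    then have "path_class (points K) (\<theta> y) \<in> H #>\<^bsub>G\<^esub> path_class (points K) (\<theta> y')" by (simp only: e)
    then obtain a where a: "a \<in> H" "path_class (points K) (\<theta> y) = a \<otimes>\<^bsub>G\<^esub> path_class (points K) (\<theta> y')"
      unfolding r_coset_def by blast
    obtain g where g: "a = path_class (points K) (q \<circ> g)" "based_loop Y y0 g" using a(1) by (auto simp: pi1_image_def)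
    note qg = q_loop[OF g(2)]
    have qg': "path (q \<circ> g)" "path_image (q \<circ> g) \<subseteq> points K" "pathstart (q \<circ> g) = q y0" "pathfinish (q \<circ> g) = q y0"
      using qg unfolding based_loop_def by auto
    have "homotopic_paths (points K) (\<theta> y) ((q \<circ> g) +++ \<theta> y')"
      using based_loop_join[OF qg \<theta>[OF y'(1) vy(2)]]
      by (intro path_class_eqD) (simp_all add: a(2) g(1) pi1_mult[OF qg \<theta>[OF y'(1) vy(2)]] based_loop_def)
    moreover have "homotopic_paths (points K) ((q \<circ> g) +++ \<theta> y') (((q \<circ> g) +++ (q \<circ> tail y')) +++ reversepath \<eta>)"
      unfolding \<theta>_def by (rule homotopic_paths_assoc) (use qg' T[OF y'(1) vy(2)] \<eta> in auto)
    ultimately have h: "homotopic_paths (points K) ((q \<circ> tail y) +++ reversepath \<eta>) (((q \<circ> g) +++ (q \<circ> tail y')) +++ reversepath \<eta>)"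
      unfolding \<theta>_def by (rule homotopic_paths_trans)
    have canc: "homotopic_paths (points K) ((k +++ reversepath \<eta>) +++ \<eta>) k"
      if k: "path k" "path_image k \<subseteq> points K" "pathfinish k = v" for k
    proof -
      have "homotopic_paths (points K) ((k +++ reversepath \<eta>) +++ \<eta>) (k +++ (reversepath \<eta> +++ \<eta>))"
        by (rule homotopic_paths_sym, rule homotopic_paths_assoc) (use k \<eta> in auto)
      moreover have "homotopic_paths (points K) (k +++ (reversepath \<eta> +++ \<eta>)) (k +++ (\<lambda>_. v))"
        by (intro homotopic_paths_join homotopic_paths_linv_const) (use k \<eta> in auto)
      moreover have "homotopic_paths (points K) (k +++ (\<lambda>_. v)) k"
        by (rule homotopic_paths_rid_const) (use k in auto)
      ultimately show ?thesis by (blast intro: homotopic_paths_trans)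
    qed
    let ?k = "q \<circ> (g +++ tail y')"
    have k: "?k = (q \<circ> g) +++ (q \<circ> tail y')" by (simp add: path_compose_join)
    have h2: "homotopic_paths (points K) (((q \<circ> tail y) +++ reversepath \<eta>) +++ \<eta>) ((?k +++ reversepath \<eta>) +++ \<eta>)"
      unfolding k by (intro homotopic_paths_join h) (use \<eta> in auto)
    have "homotopic_paths (points K) ((?k +++ reversepath \<eta>) +++ \<eta>) ?k"
      unfolding k by (rule canc) (use qg' T[OF y'(1) vy(2)] in \<open>auto simp: path_image_join\<close>)
    then have "homotopic_paths (points K) (q \<circ> tail y) ?k"
      using canc[OF T(1,2,4)[OF y(1) vy(1)]] h2 homotopic_paths_trans homotopic_paths_sym by blast
    then have "homotopic_paths Y (tail y) (g +++ tail y')"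
      by (rule homotopic_paths_lift[OF cov]) (use tail[OF y(1)] tail[OF y'(1)] g(2) in \<open>auto simp: based_loop_def path_image_join\<close>)
    from homotopic_paths_imp_pathfinish[OF this] show "y = y'" using tail(4)[OF y(1)] tail(4)[OF y'(1)] by simp
  qed
  then show ?thesis
  proof (rule card_inj_on_le[OF _ _ fin])
    show "(\<lambda>y. H #>\<^bsub>G\<^esub> path_class (points K) (\<theta> y)) ` {y \<in> Y. q y = v} \<subseteq> rcosets\<^bsub>G\<^esub> H"
      using \<theta> unfolding RCOSETS_def by (fastforce simp: carrier_pi1)
  qed
next
  case True
  then show ?thesis by (simp only: card.empty)
qed

lemma card_edges_le_index:
  assumes H: "finite_index_subgroup H G"
  shows "card (one_cells L) \<le> card (one_cells K) * card (rcosets\<^bsub>G\<^esub> H)"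
proof -
  have "one_cells L = (SIGMA e:one_cells K. {y \<in> Y. q y = char1 K e 0})" by (auto simp: one_L)
  then have "card (one_cells L) = (\<Sum>e\<in>one_cells K. card {y \<in> Y. q y = char1 K e 0})"
    using finite_cells(2) char1_in_skeleton skeleton_subset by (subst card_SigmaI[symmetric]) (auto intro!: finite_fibre)
  also have "\<dots> \<le> (\<Sum>e\<in>one_cells K. card (rcosets\<^bsub>G\<^esub> H))"
    by (intro sum_mono card_fibre_le_index[OF H]) (use char1_in_skeleton skeleton_subset in auto)
  finally show ?thesis by simp
qed

end


section \<open>Largeness from an action with levels\<close>

section \<open>Free groups and largeness\<close>

abbreviation act :: "('x \<times> bool) list \<Rightarrow> ('x \<times> bool) list \<Rightarrow> ('x \<times> bool) list" where
  "act u v \<equiv> foldr push_letter u v"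

lemma reduced_word_Nil [simp]: "reduced_word []"
  by (simp add: reduced_word_def)

lemma reduced_word_Cons: "reduced_word (a # w) \<longleftrightarrow> reduced_word w \<and> (w \<noteq> [] \<longrightarrow> hd w \<noteq> inv_letter a)"
proof
  assume r: "reduced_word (a # w)"
  have "reduced_word w" unfolding reduced_word_def
  proof (intro allI impI)
    fix j assume "Suc j < length w"
    then show "w ! Suc j \<noteq> inv_letter (w ! j)" using r[unfolded reduced_word_def, rule_format, of "Suc j"] by simp
  qed
  moreover have "hd w \<noteq> inv_letter a" if "w \<noteq> []"
    using r[unfolded reduced_word_def, rule_format, of 0] that by (simp add: hd_conv_nth)
  ultimately show "reduced_word w \<and> (w \<noteq> [] \<longrightarrow> hd w \<noteq> inv_letter a)" by blast
next
  assume r: "reduced_word w \<and> (w \<noteq> [] \<longrightarrow> hd w \<noteq> inv_letter a)"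
  show "reduced_word (a # w)" unfolding reduced_word_def
  proof (intro allI impI)
    fix j assume j: "Suc j < length (a # w)"
    show "(a # w) ! Suc j \<noteq> inv_letter ((a # w) ! j)"
    proof (cases j)
      case 0
      then show ?thesis using r j by (cases w) auto
    next
      case (Suc k)
      then show ?thesis using r j unfolding reduced_word_def by simp
    qed
  qed
qed

lemma push_letter_reduced: "reduced_word w \<Longrightarrow> reduced_word (push_letter a w)"
  by (cases w) (auto simp: reduced_word_Cons)

lemma push_letter_Cons_reduced: "reduced_word (a # w) \<Longrightarrow> push_letter a w = a # w"
  by (cases w) (auto simp: reduced_word_Cons)

lemma push_letter_cancel: "reduced_word w \<Longrightarrow> push_letter (inv_letter a) (push_letter a w) = w"
  by (cases w) (auto simp: push_letter_Cons_reduced)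

lemma act_reduced: "reduced_word w \<Longrightarrow> reduced_word (act u w)"
  by (induction u) (auto intro: push_letter_reduced)

text \<open>The heart of associativity: there is something to prove only if \<open>a\<close> cancels
  against the first letter of \<open>r\<close>.\<close>

lemma act_push_letter: "reduced_word r \<Longrightarrow> reduced_word s \<Longrightarrow> act (push_letter a r) s = push_letter a (act r s)"
proof (cases r)
  case (Cons b t)
  assume s: "reduced_word s"
  show ?thesis
  proof (cases "b = inv_letter a")
    case True
    then show ?thesis using Cons push_letter_cancel[OF act_reduced[OF s], of "inv_letter a" t] by simp
  qed (simp add: Cons)
qed simp

lemma act_act: "reduced_word r \<Longrightarrow> reduced_word s \<Longrightarrow> act (act u r) s = act u (act r s)"
  by (induction u) (auto simp: act_push_letter act_reduced)

lemma act_flip: "reduced_word w \<Longrightarrow> act (flip_word u) (act u w) = w"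
proof (induction u)
  case (Cons a u)
  then show ?case by (simp add: flip_word_Cons push_letter_cancel[OF act_reduced])
qed simp

lemma act_flip': "reduced_word w \<Longrightarrow> act u (act (flip_word u) w) = w"
  using act_flip[of w "flip_word u"] by (simp add: flip_word_def rev_map comp_def)

lemma push_letter_letters: "fst ` set (push_letter a w) \<subseteq> insert (fst a) (fst ` set w)"
  by (cases w) auto

lemma act_letters: "fst ` set u \<subseteq> X \<Longrightarrow> fst ` set w \<subseteq> X \<Longrightarrow> fst ` set (act u w) \<subseteq> X"
proof (induction u)
  case (Cons a u)
  then have "fst a \<in> X" "fst ` set (act u w) \<subseteq> X" by auto
  then have "insert (fst a) (fst ` set (act u w)) \<subseteq> X" by blast
  then show ?case using push_letter_letters[of a "act u w"] unfolding foldr.simps comp_def by (rule order.trans[rotated])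
qed simp

lemma carrier_free_group: "carrier (free_group X) = {w. reduced_word w \<and> fst ` set w \<subseteq> X}"
  and mult_free_group: "u \<otimes>\<^bsub>free_group X\<^esub> v = act u v"
  by (simp_all add: free_group_def)

lemma act_carrier: "\<lbrakk>u \<in> carrier (free_group X); w \<in> carrier (free_group X)\<rbrakk> \<Longrightarrow> act u w \<in> carrier (free_group X)"
  by (simp add: carrier_free_group act_reduced act_letters)

text \<open>Largeness is detected by an action on the product of a finite set and a free group that commutes with the
  right multiplications of the free group: pass to the stabiliser of a point of the finite set.\<close>

theorem large_criterion:
  fixes G :: "('g, 'm) monoid_scheme" and Q :: "'q set" and mon :: "'g \<Rightarrow> 'q \<times> ('g \<times> bool) list \<Rightarrow> 'q \<times> ('g \<times> bool) list"
  assumes G: "group G" and g: "g1 \<noteq> g2" and Q: "finite Q" "q0 \<in> Q"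
    and maps: "\<And>a z. a \<in> carrier G \<Longrightarrow> z \<in> Q \<times> carrier (free_group {g1, g2}) \<Longrightarrow> mon a z \<in> Q \<times> carrier (free_group {g1, g2})"
    and mult: "\<And>a b z. \<lbrakk>a \<in> carrier G; b \<in> carrier G; z \<in> Q \<times> carrier (free_group {g1, g2})\<rbrakk> \<Longrightarrow> mon (a \<otimes>\<^bsub>G\<^esub> b) z = mon b (mon a z)"
    and one: "\<And>z. z \<in> Q \<times> carrier (free_group {g1, g2}) \<Longrightarrow> mon \<one>\<^bsub>G\<^esub> z = z"
    and equi: "\<And>a p s. \<lbrakk>a \<in> carrier G; p \<in> Q; s \<in> carrier (free_group {g1, g2})\<rbrakk> \<Longrightarrow>
        mon a (p, s) = (fst (mon a (p, [])), act (snd (mon a (p, []))) s)"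
    and letters: "\<And>l. fst l \<in> {g1, g2} \<Longrightarrow> \<exists>a\<in>carrier G. mon a (q0, []) = (q0, [l])"
  shows "large G"
proof -
  interpret G: group G by (rule G)
  let ?W = "carrier (free_group {g1, g2})"
  have N: "[] \<in> ?W" by (simp add: carrier_free_group)
  have z0: "(q0, []) \<in> Q \<times> ?W" using N Q by simp
  \<comment> \<open>By \<open>mult\<close> the maps \<open>mon\<close> compose as a right action;
    the inverse turns this into a homomorphism.\<close>
  define \<phi> where "\<phi> a = snd (mon (inv\<^bsub>G\<^esub> a) (q0, []))" for a
  define H where "H = {a \<in> carrier G. fst (mon (inv\<^bsub>G\<^esub> a) (q0, [])) = q0}"
  have HG: "H \<subseteq> carrier G" by (auto simp: H_def)
  have val: "mon (inv\<^bsub>G\<^esub> a) (q0, []) = (q0, \<phi> a)" if "a \<in> H" for a using that by (auto simp: H_def \<phi>_def prod_eq_iff)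
  have \<phi>W: "\<phi> a \<in> ?W" if "a \<in> carrier G" for a using maps[OF G.inv_closed[OF that] z0] by (auto simp: \<phi>_def mem_Times_iff)
  have inv_mon: "mon a (mon (inv\<^bsub>G\<^esub> a) z) = z" "mon (inv\<^bsub>G\<^esub> a) (mon a z) = z" if "a \<in> carrier G" "z \<in> Q \<times> ?W" for a z
    using mult[OF G.inv_closed[OF that(1)] that] mult[OF that(1) G.inv_closed[OF that(1)] that(2)] one[OF that(2)] that(1) by simp_all
  have prod: "mon (inv\<^bsub>G\<^esub> (a \<otimes>\<^bsub>G\<^esub> b)) (q0, []) = (fst (mon (inv\<^bsub>G\<^esub> a) (q0, [])), act (\<phi> a) (\<phi> b))"
    if a: "a \<in> carrier G" and b: "b \<in> H" for a b
  proof -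
    have b': "b \<in> carrier G" using b HG by blast
    have "mon (inv\<^bsub>G\<^esub> (a \<otimes>\<^bsub>G\<^esub> b)) (q0, []) = mon (inv\<^bsub>G\<^esub> a) (q0, \<phi> b)"
      unfolding G.inv_mult_group[OF a b'] mult[OF G.inv_closed[OF b'] G.inv_closed[OF a] z0] val[OF b] ..
    then show ?thesis using equi[OF G.inv_closed[OF a] Q(2) \<phi>W[OF b']] by (simp add: \<phi>_def)
  qed
  have Hm: "a \<otimes>\<^bsub>G\<^esub> b \<in> H" and \<phi>m: "\<phi> (a \<otimes>\<^bsub>G\<^esub> b) = act (\<phi> a) (\<phi> b)" if "a \<in> H" "b \<in> H" for a b
    using prod[of a b] that HG by (auto simp: H_def \<phi>_def)
  have fix_inv: "fst (mon a (q0, [])) = q0" if a: "a \<in> H" for a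
  proof -
    have "mon a (q0, \<phi> a) = (q0, [])" using inv_mon(1)[OF _ z0, of a] val[OF a] a HG by auto
    then show ?thesis using equi[of a q0 "\<phi> a"] a HG Q(2) \<phi>W[of a] by auto
  qed
  have Hi: "inv\<^bsub>G\<^esub> a \<in> H" if "a \<in> H" for a using fix_inv[OF that] that by (auto simp: H_def)
  have sub: "subgroup H G"
  proof (rule G.subgroupI[OF HG])
    show "H \<noteq> {}" using one[OF z0] by (auto simp: H_def intro!: exI[of _ "\<one>\<^bsub>G\<^esub>"])
  qed (use Hm Hi in auto)
  \<comment> \<open>The coset of \<open>a\<close> is determined by the point of \<open>Q\<close> to
    which \<open>a\<close> moves \<open>q0\<close>, so finiteness of \<open>Q\<close> bounds the
    index.\<close>
  have coset: "H #>\<^bsub>G\<^esub> a = H #>\<^bsub>G\<^esub> b" if a: "a \<in> carrier G" and b: "b \<in> carrier G" and e: "fst (mon a (q0, [])) = fst (mon b (q0, []))" for a b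
  proof -
    have "fst (mon (inv\<^bsub>G\<^esub> (b \<otimes>\<^bsub>G\<^esub> inv\<^bsub>G\<^esub> a)) (q0, [])) = fst (mon (inv\<^bsub>G\<^esub> b) (mon a (q0, [])))"
      using G.inv_mult_group[OF b G.inv_closed[OF a]] mult[OF a G.inv_closed[OF b] z0] a by simp
    also have "mon a (q0, []) = (fst (mon b (q0, [])), snd (mon a (q0, [])))" by (rule prod_eqI) (simp_all add: e)
    also have "fst (mon (inv\<^bsub>G\<^esub> b) \<dots>) = fst (mon (inv\<^bsub>G\<^esub> b) (mon b (q0, [])))"
      using equi[OF G.inv_closed[OF b], of "fst (mon b (q0, []))"] maps[OF a z0] maps[OF b z0] by (metis fst_conv mem_Times_iff prod.collapse)
    also have "\<dots> = q0" using inv_mon(2)[OF b z0] by simp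
    finally have h: "b \<otimes>\<^bsub>G\<^esub> inv\<^bsub>G\<^esub> a \<in> H" using a b by (simp add: H_def)
    have "b = (b \<otimes>\<^bsub>G\<^esub> inv\<^bsub>G\<^esub> a) \<otimes>\<^bsub>G\<^esub> a" using a b by (simp add: G.m_assoc)
    then have "b \<in> H #>\<^bsub>G\<^esub> a" using h unfolding r_coset_def by blast
    then show ?thesis by (rule G.repr_independence[OF _ a sub])
  qed
  have "finite (rcosets\<^bsub>G\<^esub> H)"
  proof -
    define rep where "rep p = (SOME a. a \<in> carrier G \<and> fst (mon a (q0, [])) = p)" for p
    have "H #>\<^bsub>G\<^esub> a \<in> (\<lambda>p. H #>\<^bsub>G\<^esub> rep p) ` Q" if a: "a \<in> carrier G" for a
    proof (rule image_eqI[of _ _ "fst (mon a (q0, []))"])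
      have "\<exists>b. b \<in> carrier G \<and> fst (mon b (q0, [])) = fst (mon a (q0, []))" using a by blast
      from someI_ex[OF this] have "rep (fst (mon a (q0, []))) \<in> carrier G \<and> fst (mon (rep (fst (mon a (q0, [])))) (q0, [])) = fst (mon a (q0, []))"
        unfolding rep_def .
      then show "H #>\<^bsub>G\<^esub> a = H #>\<^bsub>G\<^esub> rep (fst (mon a (q0, [])))" using coset[OF a] by simp
      show "fst (mon a (q0, [])) \<in> Q" using maps[OF a z0] by (auto simp: mem_Times_iff)
    qed
    then have "rcosets\<^bsub>G\<^esub> H \<subseteq> (\<lambda>p. H #>\<^bsub>G\<^esub> rep p) ` Q" unfolding RCOSETS_def by blast
    then show ?thesis using Q(1) finite_subset by blast
  qed
  moreover have "\<phi> \<in> hom (G\<lparr>carrier := H\<rparr>) (free_group {g1, g2})"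
    using \<phi>m \<phi>W HG by (auto simp: hom_def mult_free_group)
  moreover have "\<phi> ` H = ?W"
  proof
    show "\<phi> ` H \<subseteq> ?W" using \<phi>W HG by blast
    have "w \<in> ?W \<Longrightarrow> \<exists>a\<in>H. \<phi> a = w" for w
    proof (induction w)
      case Nil
      have "\<one>\<^bsub>G\<^esub> \<in> H" "\<phi> \<one>\<^bsub>G\<^esub> = []" using one[OF z0] by (auto simp: H_def \<phi>_def)
      then show ?case by blast
    next
      case (Cons l w)
      have w: "w \<in> ?W" and l: "fst l \<in> {g1, g2}" and r: "reduced_word (l # w)" using Cons.prems by (auto simp: carrier_free_group reduced_word_Cons)
      obtain b where b: "b \<in> H" "\<phi> b = w" using Cons.IH[OF w] by blast
      obtain a where a: "a \<in> carrier G" "mon a (q0, []) = (q0, [l])" using letters[OF l] by blast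
      have "inv\<^bsub>G\<^esub> a \<in> H" "\<phi> (inv\<^bsub>G\<^esub> a) = [l]" using a by (auto simp: H_def \<phi>_def)
      then have "inv\<^bsub>G\<^esub> a \<otimes>\<^bsub>G\<^esub> b \<in> H" "\<phi> (inv\<^bsub>G\<^esub> a \<otimes>\<^bsub>G\<^esub> b) = l # w"
        using Hm b \<phi>m[OF _ b(1)] push_letter_Cons_reduced[OF r] by auto
      then show ?case by blast
    qed
    then show "?W \<subseteq> \<phi> ` H" by blast
  qed
  moreover have "\<exists>u\<in>?W. \<exists>v\<in>?W. u \<otimes>\<^bsub>free_group {g1, g2}\<^esub> v \<noteq> v \<otimes>\<^bsub>free_group {g1, g2}\<^esub> u"
    by (rule bexI[of _ "[(g1, True)]"], rule bexI[of _ "[(g2, True)]"])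
       (use g in \<open>auto simp: mult_free_group carrier_free_group reduced_word_Cons inv_letter_def\<close>)
  ultimately show ?thesis unfolding large_def finite_index_subgroup_def using sub by blast
qed


section \<open>Coverings from levelled cocycles\<close>

lemma transport_append: "transport K F \<tau> (w @ w') z = transport K F \<tau> w' (transport K F \<tau> w z)"
  by (induction w arbitrary: z) auto

lemma (in edge_transport) transport_in:
  "\<lbrakk>walk K u w v; u \<in> zero_cells K; z \<in> F u\<rbrakk> \<Longrightarrow> transport K F \<tau> w z \<in> F v"
  using lift_word by blast

lemma (in edge_transport) transport_commute:
  assumes R: "\<And>v z. z \<in> F v \<Longrightarrow> R z \<in> F v"
    and comm: "\<And>e z. \<lbrakk>e \<in> one_cells K; z \<in> F (char1 K e 0)\<rbrakk> \<Longrightarrow> \<tau> e (R z) = R (\<tau> e z)"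
  shows "\<lbrakk>walk K u w v; u \<in> zero_cells K; z \<in> F u\<rbrakk> \<Longrightarrow> transport K F \<tau> w (R z) = R (transport K F \<tau> w z)"
proof (induction w arbitrary: u z)
  case (Cons s w)
  then have s: "fst s \<in> one_cells K" "pathstart (edge_path K s) = u" "walk K (pathfinish (edge_path K s)) w v" by auto
  have z: "z \<in> F (pathstart (edge_path K s))" using Cons.prems(3) s(2) by simp
  have "trans1 s (R z) = R (trans1 s z)"
  proof (cases "snd s")
    case True
    then show ?thesis using comm[OF s(1), of z] z by (simp add: transport_letter_def edge_path_def pathstart_def)
  next
    case False
    then have z1: "z \<in> F (char1 K (fst s) 1)" using z by (simp add: edge_path_def reversepath_def pathstart_def)
    then obtain z' where z': "z' \<in> F (char1 K (fst s) 0)" "z = \<tau> (fst s) z'"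
      using bij_betw_imp_surj_on[OF bij[OF s(1)]] by blast
    note i = bij_betw_imp_inj_on[OF bij[OF s(1)]]
    have "R z = \<tau> (fst s) (R z')" using comm[OF s(1) z'(1)] z'(2) by simp
    then show ?thesis using False inv_into_f_f[OF i R[OF z'(1)]] inv_into_f_f[OF i z'(1)] by (simp add: transport_letter_def z'(2))
  qed
  then show ?case using Cons.IH[OF s(3) edge_path_props(4)[OF edges s(1)] trans1_in[OF s(1) z]] by simp
qed simp

text \<open>A lifted 2-cell is indexed by its centre, so the radius from the boundary point to the
  centre is lifted to find it.\<close>

lemma (in complex_cover) two_cell_through:
  assumes f: "f \<in> two_cells K" and y: "y \<in> Y" "q y = boundary_path K f 0"
  shows "\<exists>\<phi>\<in>two_cells L. fst \<phi> = f \<and> boundary_path L \<phi> 0 = y"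
proof -
  have y1: "q y = char2 K f 1" using y(2) by (simp add: boundary_path_def)
  have op: "char2 K f ` ball 0 1 \<subseteq> points K" using fin f by (auto simp: finite_two_complex_def open_2cell_def)
  define g :: "real \<Rightarrow> 'a" where "g r = char2 K f (complex_of_real (1 - r))" for r
  have ball: "complex_of_real (1 - r) \<in> cball 0 1" if "r \<in> {0..1}" for r
    using that by (simp add: norm_of_real del: of_real_diff)
  have g: "path g" "path_image g \<subseteq> points K" "q y = pathstart g"
  proof -
    show "path g" unfolding path_def g_def
      by (rule continuous_on_compose2[OF char2_props(1)[OF f]]) (use ball in \<open>auto intro!: continuous_intros\<close>)
    show "path_image g \<subseteq> points K" unfolding path_image_def
    proof (rule image_subsetI)
      fix r :: real assume r: "r \<in> {0..1}"
      show "g r \<in> points K"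
      proof (cases "r = 0")
        case True
        then show ?thesis using q_in[OF y(1)] y1 by (simp add: g_def)
      next
        case False
        then have "complex_of_real (1 - r) \<in> ball 0 1" using r by (simp add: norm_of_real del: of_real_diff)
        then show ?thesis using op unfolding g_def by blast
      qed
    qed
    show "q y = pathstart g" using y1 by (simp add: g_def pathstart_def)
  qed
  obtain h where h: "path h" "path_image h \<subseteq> Y" "pathstart h = y" "\<And>t. t \<in> {0..1} \<Longrightarrow> q (h t) = g t"
    using covering_lift_path[OF cov g(1,2) y(1) g(3)] by blast
  define \<phi> where "\<phi> = (f, h 1)"
  have "q (h 1) = char2 K f 0" using h(4)[of 1] by (simp add: g_def)
  moreover have "h 1 \<in> Y" using h(2) by (auto simp: path_image_def)
  ultimately have \<phi>: "\<phi> \<in> two_cells L" using f by (simp add: \<phi>_def two_L)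
  define k where "k r = char2 L \<phi> (complex_of_real (1 - r))" for r
  have k: "path k" "path_image k \<subseteq> Y"
  proof -
    show "path k" unfolding path_def k_def
      by (rule continuous_on_compose2[OF char2_L(1)[OF \<phi>]]) (use ball in \<open>auto intro!: continuous_intros\<close>)
    show "path_image k \<subseteq> Y" using char2_L(2)[OF \<phi>] ball unfolding path_image_def k_def by blast
  qed
  have "k 0 = h 0"
  proof (rule path_lift_unique[OF cov k h(1,2), of 1])
    show "q (k t) = q (h t)" if "t \<in> {0..1}" for t
      using char2_L(4)[OF \<phi> ball[OF that]] h(4)[OF that] by (simp add: k_def g_def \<phi>_def)
    show "k 1 = h 1" using char2_L(3)[OF \<phi>] by (simp add: k_def \<phi>_def)
  qed auto
  then have "boundary_path L \<phi> 0 = y" using h(3) by (simp add: k_def boundary_path_def pathstart_def)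
  moreover have "fst \<phi> = f" by (simp add: \<phi>_def)
  ultimately show ?thesis using \<phi> by blast
qed

text \<open>Sheets over a vertex \<open>v\<close> are triples of a point of \<open>Y\<close> over \<open>v\<close>, a level in the field and a point of \<open>D\<close>. An edge
  changes the level by \<open>c\<close> and acts on \<open>D\<close> through \<open>z1\<close> and \<open>z2\<close>, in a way that depends on the level.\<close>

locale level_transport = complex_cover K Y q
  for K :: "('a::t2_space, 'e, 'f) two_complex" and Y :: "'b::topological_space set" and q :: "'b \<Rightarrow> 'a" +
  fixes c z1 z2 :: "'e \<times> 'b \<Rightarrow> 'k::field" and D :: "'d set" and M :: "'k \<Rightarrow> 'k \<times> 'k \<Rightarrow> 'd \<Rightarrow> 'd"
  assumes disj: "c \<epsilon> \<noteq> 0 \<Longrightarrow> z1 \<epsilon> = 0 \<and> z2 \<epsilon> = 0"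
    and cell: "\<phi> \<in> two_cells L \<Longrightarrow>
      (\<forall>s\<in>set (boundary_word L \<phi>). z1 (fst s) = 0 \<and> z2 (fst s) = 0) \<or> (\<forall>s\<in>set (boundary_word L \<phi>). c (fst s) = 0)"
    and cell_ev: "\<phi> \<in> two_cells L \<Longrightarrow> ev c (boundary_word L \<phi>) = 0 \<and> ev z1 (boundary_word L \<phi>) = 0 \<and> ev z2 (boundary_word L \<phi>) = 0"
    and D: "D \<noteq> {}" and M_in: "t \<in> D \<Longrightarrow> M k d t \<in> D" and M_0: "t \<in> D \<Longrightarrow> M k (0, 0) t = t"
    and M_add: "t \<in> D \<Longrightarrow> M k (a, b) (M k (a', b') t) = M k (a' + a, b' + b) t"
begin

definition Fib :: "'a \<Rightarrow> ('b \<times> 'k \<times> 'd) set" where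
  "Fib v = {(y, k, t). y \<in> Y \<and> q y = v \<and> t \<in> D}"

definition edge_map :: "'e \<Rightarrow> 'b \<times> 'k \<times> 'd \<Rightarrow> 'b \<times> 'k \<times> 'd" where
  "edge_map e = (\<lambda>(y, k, t). (char1 L (e, y) 1, k + c (e, y), M k (z1 (e, y), z2 (e, y)) t))"

lemma edge_in_L: "\<lbrakk>e \<in> one_cells K; y \<in> Y; q y = char1 K e 0\<rbrakk> \<Longrightarrow> (e, y) \<in> one_cells L"
  by (simp add: one_L)

lemma edge_map_bij:
  assumes e: "e \<in> one_cells K"
  shows "bij_betw (edge_map e) (Fib (char1 K e 0)) (Fib (char1 K e 1))"
  unfolding bij_betw_def
proof
  show "inj_on (edge_map e) (Fib (char1 K e 0))"
  proof (rule inj_onI, clarify)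
    fix y k t y' k' t'
    assume "(y, k, t) \<in> Fib (char1 K e 0)" "(y', k', t') \<in> Fib (char1 K e 0)" and eq: "edge_map e (y, k, t) = edge_map e (y', k', t')"
    then have y: "y \<in> Y" "q y = char1 K e 0" "t \<in> D" and y': "y' \<in> Y" "q y' = char1 K e 0" "t' \<in> D" by (auto simp: Fib_def)
    note C = char1_L[OF edge_in_L[OF e y(1,2)]] and C' = char1_L[OF edge_in_L[OF e y'(1,2)]]
    have "char1 L (e, y) 0 = char1 L (e, y') 0"
      by (rule path_lift_unique[OF cov C(1,2) C'(1,2), of 1]) (use eq C(4) C'(4) in \<open>auto simp: edge_map_def\<close>)
    then have yy: "y = y'" using C(3) C'(3) by simp
    then have kk: "k = k'" using eq by (simp add: edge_map_def)
    have "M k (z1 (e, y), z2 (e, y)) t = M k (z1 (e, y), z2 (e, y)) t'" using eq yy kk by (simp add: edge_map_def)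
    then have "M k (- z1 (e, y), - z2 (e, y)) (M k (z1 (e, y), z2 (e, y)) t) = M k (- z1 (e, y), - z2 (e, y)) (M k (z1 (e, y), z2 (e, y)) t')" by simp
    then show "y = y' \<and> (k, t) = (k', t')" using yy kk by (simp add: M_add M_0 y(3) y'(3))
  qed
  show "edge_map e ` Fib (char1 K e 0) = Fib (char1 K e 1)"
  proof
    show "edge_map e ` Fib (char1 K e 0) \<subseteq> Fib (char1 K e 1)"
    proof (rule image_subsetI, clarify)
      fix y k t assume "(y, k, t) \<in> Fib (char1 K e 0)"
      then have y: "y \<in> Y" "q y = char1 K e 0" "t \<in> D" by (auto simp: Fib_def)
      note C = char1_L[OF edge_in_L[OF e y(1,2)]]
      show "edge_map e (y, k, t) \<in> Fib (char1 K e 1)"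
        using C(2) C(4)[of 1] M_in[OF y(3)] by (auto simp: edge_map_def Fib_def path_image_def)
    qed
    show "Fib (char1 K e 1) \<subseteq> edge_map e ` Fib (char1 K e 0)"
    proof clarify
      fix y k t assume "(y, k, t) \<in> Fib (char1 K e 1)"
      then have y: "y \<in> Y" "q y = char1 K e 1" "t \<in> D" by (auto simp: Fib_def)
      obtain s where s: "fst s \<in> one_cells L" "proj_letter s = (e, False)" "pathstart (edge_path L s) = y"
        using lift_letter[of "(e, False)" y] e y by (auto simp: edge_path_def reversepath_def pathstart_def)
      obtain y' where s': "s = ((e, y'), False)" using s(2) by (cases s) (auto simp: proj_letter_def)
      have y': "y' \<in> Y" "q y' = char1 K e 0" "char1 L (e, y') 1 = y" using s unfolding s' by (auto simp: one_L edge_path_def reversepath_def pathstart_def)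
      let ?k = "k - c (e, y')"
      have "edge_map e (y', ?k, M ?k (- z1 (e, y'), - z2 (e, y')) t) = (y, k, t)"
        by (simp add: edge_map_def y' M_add M_0 y(3))
      moreover have "(y', ?k, M ?k (- z1 (e, y'), - z2 (e, y')) t) \<in> Fib (char1 K e 0)" using y' M_in[OF y(3)] by (simp add: Fib_def)
      ultimately show "(y, k, t) \<in> edge_map e ` Fib (char1 K e 0)" by (metis image_eqI)
    qed
  qed
qed

abbreviation "tr \<equiv> transport K Fib edge_map"

lemma transport_letter_formula:
  assumes s: "fst s \<in> one_cells L" and t: "t \<in> D"
  shows "transport_letter K Fib edge_map (proj_letter s) (pathstart (edge_path L s), k, t) =
    (pathfinish (edge_path L s), k + ev c [s], M k (ev z1 [s], ev z2 [s]) t)"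
proof -
  obtain e y b where s': "s = ((e, y), b)" by (metis prod.collapse)
  have y: "e \<in> one_cells K" "y \<in> Y" "q y = char1 K e 0" using s unfolding s' by (auto simp: one_L)
  have 0: "char1 L (e, y) 0 = y" using char1_L(3)[OF s] unfolding s' by simp
  show ?thesis
  proof (cases b)
    case True
    then show ?thesis using 0 by (simp add: s' transport_letter_def proj_letter_def edge_path_def pathstart_def pathfinish_def edge_map_def ev_Cons)
  next
    case False
    let ?z = "(y, k - c (e, y), M k (- z1 (e, y), - z2 (e, y)) t)"
    have "inv_into (Fib (char1 K e 0)) (edge_map e) (char1 L (e, y) 1, k, t) = ?z"
    proof (rule inv_into_f_eq[OF bij_betw_imp_inj_on[OF edge_map_bij[OF y(1)]]])
      show "?z \<in> Fib (char1 K e 0)" using y M_in[OF t] by (simp add: Fib_def)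
      show "edge_map e ?z = (char1 L (e, y) 1, k, t)"
      \<comment> \<open>Here \<open>?z\<close> uses \<open>M\<close> at level \<open>k\<close>,
        while \<open>edge_map\<close> applies it at level \<open>k - c (e, y)\<close>. By
        \<open>disj\<close> either the levels agree or both maps are trivial.\<close>
      proof (cases "c (e, y) = 0")
        case True
        then show ?thesis by (simp add: edge_map_def M_add M_0 t)
      next
        case False
        then show ?thesis using disj[of "(e, y)"] by (simp add: edge_map_def M_0 t)
      qed
    qed
    then show ?thesis using False 0
      by (simp add: s' transport_letter_def proj_letter_def edge_path_def reversepath_def pathstart_def pathfinish_def ev_Cons)
  qed
qed

lemma transport_level:
  assumes "walk L y w y'" "\<forall>s\<in>set w. c (fst s) = 0" "t \<in> D"
  shows "tr (map proj_letter w) (y, k, t) = (y', k, M k (ev z1 w, ev z2 w) t)"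
  using assms
proof (induction w arbitrary: y t)
  case (Cons s w)
  then have s: "fst s \<in> one_cells L" "pathstart (edge_path L s) = y" "walk L (pathfinish (edge_path L s)) w y'" "c (fst s) = 0" by auto
  show ?case
    using transport_letter_formula[OF s(1) Cons.prems(3), of k] Cons.IH[OF s(3) _ M_in[OF Cons.prems(3)]] Cons.prems(2)
    by (simp add: s(2,4) ev_Cons M_add[OF Cons.prems(3)])
qed (simp add: M_0)

lemma transport_between_levels:
  assumes "walk L y w y'" "\<forall>s\<in>set w. z1 (fst s) = 0 \<and> z2 (fst s) = 0" "t \<in> D"
  shows "tr (map proj_letter w) (y, k, t) = (y', k + ev c w, t)"
  using assms
proof (induction w arbitrary: y k)
  case (Cons s w)
  then have s: "fst s \<in> one_cells L" "pathstart (edge_path L s) = y" "walk L (pathfinish (edge_path L s)) w y'" "z1 (fst s) = 0" "z2 (fst s) = 0" by auto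
  have "ev c (s # w) = ev c [s] + ev c w" using ev_append[of c "[s]" w] by simp
  moreover have "ev z1 [s] = 0" "ev z2 [s] = 0" by (simp_all add: ev_Cons s(4,5))
  ultimately show ?case
    using transport_letter_formula[OF s(1) Cons.prems(3), of k] Cons.IH[OF s(3) _ Cons.prems(3), of "k + ev c [s]"] Cons.prems(2)
    by (simp add: s(2) M_0[OF Cons.prems(3)] add.assoc)
qed simp

text \<open>By \<open>cell\<close> the boundary of a lifted 2-cell either stays on one level or does
  not act on \<open>D\<close>; in both cases \<open>cell_ev\<close> makes the total effect
  trivial.\<close>

lemma level_edge_transport: "edge_transport K Fib edge_map"
proof unfold_locales
  fix v assume "v \<in> zero_cells K"
  then have "v \<in> q ` Y" using cov skeleton_subset by (auto simp: covering_space_def skeleton_def)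
  then show "Fib v \<noteq> {}" using D by (auto simp: Fib_def)
next
  fix f z assume f: "f \<in> two_cells K" and z: "z \<in> Fib (boundary_path K f 0)"
  obtain y k t where z': "z = (y, k, t)" "y \<in> Y" "q y = boundary_path K f 0" "t \<in> D" using z by (auto simp: Fib_def)
  obtain \<phi> where \<phi>: "\<phi> \<in> two_cells L" "fst \<phi> = f" "boundary_path L \<phi> 0 = y" using two_cell_through[OF f z'(2,3)] by blast
  have "is_boundary_word K f (map proj_letter (boundary_word L \<phi>))"
    using boundary_word_proj[OF \<phi>(1) boundary_word_exists_L[OF \<phi>(1)]] \<phi>(2) by simp
  moreover have "tr (map proj_letter (boundary_word L \<phi>)) z = z"
  proof -
    have w: "walk L y (boundary_word L \<phi>) y" using boundary_walk_L(1)[OF \<phi>(1)] \<phi>(3) by simp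
    show ?thesis
      using cell[OF \<phi>(1)] transport_level[OF w _ z'(4), of k] transport_between_levels[OF w _ z'(4), of k] cell_ev[OF \<phi>(1)]
      by (auto simp: z'(1) M_0[OF z'(4)])
  qed
  ultimately show "\<exists>w. is_boundary_word K f w \<and> tr w z = z" by blast
qed (rule edge_map_bij)

end

text \<open>A word attached to each point of the grid. The action on level 0 will be translation in
  \<open>x\<close>, conjugated by left multiplication with these words; so it is an action whatever
  the words are.\<close>

definition corner :: "'x \<Rightarrow> 'x \<Rightarrow> 'k::field \<times> 'k \<Rightarrow> 'k \<Rightarrow> ('x \<times> bool) list" where
  "corner g1 g2 x b = (if b = 1 \<and> x = (1, 0) then [(g1, True)] else if b = 1 \<and> x = (0, 1) then [(g2, True)] else [])"

text \<open>On level \<open>0\<close> the first coordinate moves and on level \<open>k1\<close> the second one. The commutator of a move in the first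
  coordinate with a move in the second one multiplies the free group component by a generator.\<close>

definition level_action ::
  "'x \<Rightarrow> 'x \<Rightarrow> 'k::field \<Rightarrow> 'k \<Rightarrow> 'k \<times> 'k \<Rightarrow> ('k \<times> 'k) \<times> 'k \<times> ('x \<times> bool) list \<Rightarrow> ('k \<times> 'k) \<times> 'k \<times> ('x \<times> bool) list" where
  "level_action g1 g2 k1 k d = (\<lambda>(x, b, s).
     if k = 0 then (x + d, b, act (corner g1 g2 (x + d) b) (act (flip_word (corner g1 g2 x b)) s))
     else if k = k1 then (x, b + fst d, s) else (x, b, s))"

definition level_states :: "'x \<Rightarrow> 'x \<Rightarrow> (('k::field \<times> 'k) \<times> 'k \<times> ('x \<times> bool) list) set" where
  "level_states g1 g2 = UNIV \<times> UNIV \<times> carrier (free_group {g1, g2})"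

lemma corner_letters: "fst ` set (corner g1 g2 x b) \<subseteq> {g1, g2}" "fst ` set (flip_word (corner g1 g2 x b)) \<subseteq> {g1, g2}"
  by (auto simp: corner_def flip_word_def)

lemma act_in_free_group: "\<lbrakk>fst ` set u \<subseteq> X; w \<in> carrier (free_group X)\<rbrakk> \<Longrightarrow> act u w \<in> carrier (free_group X)"
  by (simp add: carrier_free_group act_reduced act_letters)

lemma level_action_in: "t \<in> level_states g1 g2 \<Longrightarrow> level_action g1 g2 k1 k d t \<in> level_states g1 g2"
  by (cases t) (simp add: level_states_def level_action_def act_in_free_group corner_letters)

lemma level_action_0: "t \<in> level_states g1 g2 \<Longrightarrow> level_action g1 g2 k1 k (0, 0) t = t"
  by (auto simp: level_states_def level_action_def carrier_free_group act_flip' zero_prod_def[symmetric])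

lemma level_action_add:
  assumes "t \<in> level_states g1 g2"
  shows "level_action g1 g2 k1 k (a, b) (level_action g1 g2 k1 k (a', b') t) = level_action g1 g2 k1 k (a' + a, b' + b) t"
proof -
  have "x + (a' + a, b' + b) = x + (a', b') + (a, b)" for x by (simp add: add.assoc)
  then show ?thesis using assms
    by (auto simp: level_states_def level_action_def carrier_free_group act_flip act_reduced add.assoc)
qed

lemma level_action_right:
  assumes "(x, b, r) \<in> level_states g1 g2" "s \<in> carrier (free_group {g1, g2})" "level_action g1 g2 k1 k d (x, b, r) = (x', b', r')"
  shows "level_action g1 g2 k1 k d (x, b, act r s) = (x', b', act r' s)"
  using assms by (auto simp: level_states_def level_action_def carrier_free_group act_act act_reduced split: if_splits)


section \<open>Loops and monodromy\<close>

text \<open>Viewing the base as a cover of itself makes \<open>close_up\<close> and its laws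
  available for paths in \<open>K\<close>.\<close>

lemma (in fin_complex) trivial_cover:
  assumes "connected (points K)" "x \<in> points K"
  shows "based_cover K (points K) (\<lambda>x. x) x"
proof unfold_locales
  have "covering_space (points K) (\<lambda>x. x) (points K)"
    by (rule homeomorphism_imp_covering_space[of _ _ _ "\<lambda>x. x"]) (auto simp: homeomorphism_def)
  moreover have "finite {y \<in> points K. y = z}" for z by (rule finite_subset[of _ "{z}"]) auto
  ultimately show "finite_connected_cover (points K) (\<lambda>x. x) (points K)" using assms by (simp add: finite_connected_cover_def)
qed (rule assms)

text \<open>The base point \<open>x\<close> may lie anywhere, while words need a vertex
  \<open>v\<close>; \<open>close_up\<close> changes between the two.\<close>

locale vertex_loops = fin_complex K for K :: "('a::t2_space, 'e, 'f) two_complex" +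
  fixes x v :: 'a
  assumes K_conn: "connected (points K)" and x: "x \<in> points K" and v: "v \<in> zero_cells K"
begin

sublocale I: based_cover K "points K" "\<lambda>x. x" x
  by (rule trivial_cover[OF K_conn x])

abbreviation "P1 \<equiv> pi1 (points K) x"

definition loop_class :: "('e \<times> bool) list \<Rightarrow> (real \<Rightarrow> 'a) set" where
  "loop_class w = path_class (points K) (I.close_up (word_path K v w))"

lemma word_loop:
  assumes "walk K v w v"
  shows "path (word_path K v w)" "path_image (word_path K v w) \<subseteq> points K"
    "pathstart (word_path K v w) = v" "pathfinish (word_path K v w) = v"
  using word_path_props[OF edges assms v] skeleton_subset by auto

lemma loop_class_in: "walk K v w v \<Longrightarrow> loop_class w \<in> carrier P1"
  using I.close_up_loop[OF word_loop(1,2)] by (auto simp: loop_class_def carrier_pi1)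

lemma loop_class_append:
  assumes w: "walk K v w v" and w': "walk K v w' v"
  shows "loop_class (w @ w') = loop_class w \<otimes>\<^bsub>P1\<^esub> loop_class w'"
proof -
  note W = word_loop[OF w] and W' = word_loop[OF w']
  have "homotopic_paths (points K) (I.close_up (word_path K v (w @ w'))) (I.close_up (word_path K v w +++ word_path K v w'))"
    by (rule I.close_up_homotopic[OF word_path_append[OF edges w w' v skeleton_subset]])
  moreover have "homotopic_paths (points K) (I.close_up (word_path K v w +++ word_path K v w')) (I.close_up (word_path K v w) +++ I.close_up (word_path K v w'))"
    by (rule homotopic_paths_sym, rule I.close_up_join[OF W(1,2) W'(1,2)]) (simp add: W W')
  ultimately show ?thesis
    unfolding loop_class_def pi1_mult[OF I.close_up_loop[OF W(1,2)] I.close_up_loop[OF W'(1,2)]]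
    by (intro path_class_eqI) (rule homotopic_paths_trans)
qed

lemma loop_class_Nil: "loop_class [] = \<one>\<^bsub>P1\<^esub>"
proof -
  have "loop_class [] \<otimes>\<^bsub>P1\<^esub> loop_class [] = loop_class []" using loop_class_append[of "[]" "[]"] by simp
  then show ?thesis using group.l_cancel_one[OF group_pi1[OF x], of "loop_class []" "loop_class []"] loop_class_in[of "[]"] by simp
qed

lemma loop_class_surj:
  assumes "a \<in> carrier P1"
  shows "\<exists>w. walk K v w v \<and> loop_class w = a"
proof -
  obtain g where g: "a = path_class (points K) g" "based_loop (points K) x g" using assms by (auto simp: carrier_pi1)
  have "v \<in> points K" using v skeleton_subset by (auto simp: skeleton_def)
  then obtain h where h: "path h" "path_image h \<subseteq> points K" "pathstart h = v" "pathfinish h = v"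
    "homotopic_paths (points K) (I.close_up h) g"
    using I.close_up_conjugate[OF _ g(2)] by metis
  obtain w where w: "walk K v w v" "homotopic_paths (points K) h (word_path K v w)"
    using paths_are_words[OF h(1,2)] v h(3,4) by auto
  have "homotopic_paths (points K) (I.close_up (word_path K v w)) g"
    using I.close_up_homotopic[OF w(2)] h(5) homotopic_paths_trans homotopic_paths_sym by blast
  then show ?thesis using w(1) path_class_eqI unfolding g(1) loop_class_def by blast
qed

lemma loop_class_eqD:
  assumes w: "walk K v w v" and w': "walk K v w' v" and e: "loop_class w = loop_class w'"
  shows "homotopic_paths (points K) (word_path K v w) (word_path K v w')"
proof (rule I.close_up_cancel)
  note W = word_loop[OF w] and W' = word_loop[OF w']
  show "homotopic_paths (points K) (I.close_up (word_path K v w)) (I.close_up (word_path K v w'))"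
    using path_class_eqD[OF e[unfolded loop_class_def]] I.close_up_loop[OF W'(1,2)] by (auto simp: based_loop_def)
qed (use word_loop[OF w] word_loop[OF w'] in auto)

end

context based_cover
begin

text \<open>Closed walks at \<open>u\<close> act on level 0, and those at \<open>u'\<close>,
  conjugated by \<open>wc\<close>, act on level \<open>k1\<close>. Suitable commutators of the two
  kinds change only the free group component.\<close>

theorem large_if_split:
  fixes c z1 z2 :: "'e \<times> 'b \<Rightarrow> 'p::prime_card mod_ring"
  assumes cell: "\<And>f. f \<in> two_cells L \<Longrightarrow> (\<forall>s\<in>set (boundary_word L f). z1 (fst s) = 0 \<and> z2 (fst s) = 0) \<or> (\<forall>s\<in>set (boundary_word L f). c (fst s) = 0)"
    and cell_ev: "\<And>f. f \<in> two_cells L \<Longrightarrow> ev c (boundary_word L f) = 0 \<and> ev z1 (boundary_word L f) = 0 \<and> ev z2 (boundary_word L f) = 0"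
    and disj: "\<And>e. c e \<noteq> 0 \<Longrightarrow> z1 e = 0 \<and> z2 e = 0"
    and u: "u \<in> zero_cells L" and u': "u' \<in> zero_cells L"
    and loops: "\<And>a b. \<exists>w. walk L u w u \<and> (\<forall>s\<in>set w. c (fst s) = 0) \<and> ev z1 w = a \<and> ev z2 w = b"
    and loops': "\<And>a b. \<exists>w. walk L u' w u' \<and> (\<forall>s\<in>set w. c (fst s) = 0) \<and> ev z1 w = a \<and> ev z2 w = b"
    and wc: "walk L u wc u'" "\<forall>s\<in>set wc. z1 (fst s) = 0 \<and> z2 (fst s) = 0" "ev c wc \<noteq> 0"
  shows "large G"
proof -
  \<comment> \<open>Any two distinct objects of the type of group elements serve as free
    generators.\<close>
  define g1 g2 :: "(real \<Rightarrow> 'a) set" where "g1 = {}" and "g2 = UNIV"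
  have g12: "g1 \<noteq> g2" by (simp add: g1_def g2_def)
  define k1 where "k1 = ev c wc"
  have k1: "k1 \<noteq> 0" using wc(3) by (simp add: k1_def)
  define D :: "(('p mod_ring \<times> 'p mod_ring) \<times> 'p mod_ring \<times> ((real \<Rightarrow> 'a) set \<times> bool) list) set" where "D = level_states g1 g2"
  define M where "M = level_action g1 g2 k1"
  define v where "v = q u"
  have uY: "u \<in> Y" and v: "v \<in> zero_cells K" using u by (auto simp: zero_L v_def)
  interpret LT: level_transport K Y q c z1 z2 D M
  proof unfold_locales
    show "D \<noteq> {}" by (auto simp: D_def level_states_def carrier_free_group intro!: exI[of _ "[]"])
  qed (use cell cell_ev disj level_action_in level_action_0 level_action_add in \<open>auto simp: D_def M_def\<close>)
  interpret VL: vertex_loops K "q y0" v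
  proof unfold_locales
    have "points K = q ` Y" using cov by (auto simp: covering_space_def)
    then show "connected (points K)" using connected_continuous_image[OF covering_space_imp_continuous[OF cov] conn] by simp
  qed (use q_in[OF y0] v in auto)
  note ET = LT.level_edge_transport
  have Fib: "(y, k, x, b, s) \<in> LT.Fib w \<longleftrightarrow> y \<in> Y \<and> q y = w \<and> s \<in> carrier (free_group {g1, g2})" for y k x b s w
    unfolding LT.Fib_def by (simp add: D_def level_states_def)
  have edge_map: "LT.edge_map e (y, k, t) = (char1 L (e, y) 1, k + c (e, y), level_action g1 g2 k1 k (z1 (e, y), z2 (e, y)) t)" for e y k t
    unfolding LT.edge_map_def by (simp add: M_def)
  define Fv where "Fv = LT.Fib v"
  have tr_in: "LT.tr w z \<in> Fv" if "walk K v w v" "z \<in> Fv" for w z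
    using edge_transport.transport_in[OF ET that(1) v] that(2) by (simp add: Fv_def)
  \<comment> \<open>The action of a group element is read off from a chosen word;
    \<open>tr_eq\<close> shows that the choice has no influence.\<close>
  define word_of where "word_of a = (SOME w. walk K v w v \<and> VL.loop_class w = a)" for a
  have word_of: "walk K v (word_of a) v" "VL.loop_class (word_of a) = a" if "a \<in> carrier G" for a
    using someI_ex[OF VL.loop_class_surj[OF that]] unfolding word_of_def by blast+
  have tr_eq: "LT.tr (word_of a) z = LT.tr w z" if "walk K v w v" "VL.loop_class w = a" "z \<in> Fv" for a w z
  proof (rule edge_transport.transport_homotopic[OF ET v])
    have a: "a \<in> carrier G" using VL.loop_class_in[OF that(1)] that(2) by simp
    show "walk K v (word_of a) v" by (rule word_of(1)[OF a])
    show "homotopic_paths (points K) (word_path K v (word_of a)) (word_path K v w)"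
      by (rule VL.loop_class_eqD[OF word_of(1)[OF a] that(1)]) (simp add: word_of(2)[OF a] that(2))
  qed (use that in \<open>auto simp: Fv_def\<close>)
  \<comment> \<open>Only a rearrangement of tuples, which separates the finite part of a sheet from
    its free group component.\<close>
  define enc :: "('b \<times> 'p mod_ring \<times> ('p mod_ring \<times> 'p mod_ring) \<times> 'p mod_ring) \<times> ((real \<Rightarrow> 'a) set \<times> bool) list \<Rightarrow> _"
    where "enc = (\<lambda>((y, k, x, b), s). (y, k, x, b, s))"
  define dec :: "_ \<Rightarrow> ('b \<times> 'p mod_ring \<times> ('p mod_ring \<times> 'p mod_ring) \<times> 'p mod_ring) \<times> ((real \<Rightarrow> 'a) set \<times> bool) list"
    where "dec = (\<lambda>(y, k, x, b, s). ((y, k, x, b), s))"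
  have ed [simp]: "enc (dec z) = z" "dec (enc z') = z'" for z z' by (auto simp: enc_def dec_def split: prod.splits)
  define Q where "Q = {y \<in> Y. q y = v} \<times> (UNIV :: ('p mod_ring \<times> ('p mod_ring \<times> 'p mod_ring) \<times> 'p mod_ring) set)"
  have enc_in: "enc z \<in> Fv \<longleftrightarrow> z \<in> Q \<times> carrier (free_group {g1, g2})" for z
    by (auto simp: enc_def Fv_def Fib Q_def split: prod.splits)
  have dec_in: "dec z \<in> Q \<times> carrier (free_group {g1, g2})" if "z \<in> Fv" for z
    using enc_in[of "dec z"] that by simp
  define mon where "mon a z = dec (LT.tr (word_of a) (enc z))" for a z
  have mon_eq: "mon a z = dec (LT.tr w (enc z))" if "walk K v w v" "VL.loop_class w = a" "z \<in> Q \<times> carrier (free_group {g1, g2})" for a w z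
    unfolding mon_def using tr_eq[OF that(1,2)] enc_in that(3) by simp
  show ?thesis
  proof (rule large_criterion[OF group_pi1[OF q_in[OF y0]] g12])
    have "v \<in> points K" using v skeleton_subset by (auto simp: skeleton_def)
    then show "finite Q" unfolding Q_def by (intro finite_cartesian_product finite_fibre finite)
    show "(u, 0, (0, 0), 0) \<in> Q" using uY by (simp add: Q_def v_def)
  next
    fix a z assume a: "a \<in> carrier G" and z: "z \<in> Q \<times> carrier (free_group {g1, g2})"
    show "mon a z \<in> Q \<times> carrier (free_group {g1, g2})"
      unfolding mon_def by (rule dec_in[OF tr_in[OF word_of(1)[OF a]]]) (use z enc_in in blast)
  next
    fix a b z assume a: "a \<in> carrier G" and b: "b \<in> carrier G" and z: "z \<in> Q \<times> carrier (free_group {g1, g2})"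
    have w: "walk K v (word_of a @ word_of b) v" using word_of(1)[OF a] word_of(1)[OF b] walk_append by blast
    have "VL.loop_class (word_of a @ word_of b) = a \<otimes>\<^bsub>G\<^esub> b"
      by (simp add: VL.loop_class_append[OF word_of(1)[OF a] word_of(1)[OF b]] word_of(2) a b)
    from mon_eq[OF w this z] show "mon (a \<otimes>\<^bsub>G\<^esub> b) z = mon b (mon a z)" by (simp add: mon_def transport_append)
  next
    fix z assume z: "z \<in> Q \<times> carrier (free_group {g1, g2})"
    show "mon \<one>\<^bsub>G\<^esub> z = z" using mon_eq[OF _ VL.loop_class_Nil z] by simp
  next
    fix a p s assume a: "a \<in> carrier G" and p: "p \<in> Q" and s: "s \<in> carrier (free_group {g1, g2})"
    \<comment> \<open>Right multiplication by \<open>s\<close>. Transport commutes with it because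
      edges act on the free group by left multiplications.\<close>
    define R where "R = (\<lambda>(y :: 'b, k :: 'p mod_ring, x :: 'p mod_ring \<times> 'p mod_ring, b :: 'p mod_ring, r). (y, k, x, b, act r s))"
    have R_in: "R z \<in> LT.Fib w" if "z \<in> LT.Fib w" for w z
      using that s by (cases z) (auto simp: R_def Fib intro: act_carrier)
    have R_comm: "LT.edge_map e (R z) = R (LT.edge_map e z)" if z: "z \<in> LT.Fib w" for e w z
    proof -
      obtain y k x b r where z': "z = (y, k, x, b, r)" by (cases z) auto
      have d: "(x, b, r) \<in> level_states g1 g2" using z by (simp add: z' Fib level_states_def)
      obtain x' b' r' where m: "level_action g1 g2 k1 k (z1 (e, y), z2 (e, y)) (x, b, r) = (x', b', r')" by (metis prod.collapse)
      show ?thesis using level_action_right[OF d s m] m by (simp add: z' R_def edge_map)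
    qed
    have N: "[] \<in> carrier (free_group {g1, g2})" by (simp add: carrier_free_group)
    have e: "enc (p, s) = R (enc (p, []))" by (cases p) (simp add: enc_def R_def)
    have in0: "enc (p, []) \<in> LT.Fib v" using enc_in[of "(p, [])"] p N by (simp add: Fv_def)
    have "LT.tr (word_of a) (enc (p, s)) = R (LT.tr (word_of a) (enc (p, [])))" unfolding e
      by (rule edge_transport.transport_commute[OF ET _ _ word_of(1)[OF a] v in0]) (use R_in R_comm in blast)+
    moreover have "dec (R z) = (fst (dec z), act (snd (dec z)) s)" for z by (auto simp: dec_def R_def split: prod.splits)
    ultimately show "mon a (p, s) = (fst (mon a (p, [])), act (snd (mon a (p, []))) s)" by (simp add: mon_def)
  next
    fix l :: "(real \<Rightarrow> 'a) set \<times> bool" assume l: "fst l \<in> {g1, g2}"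
    define \<alpha> where "\<alpha> d = (SOME w. walk L u w u \<and> (\<forall>s\<in>set w. c (fst s) = 0) \<and> ev z1 w = fst d \<and> ev z2 w = snd d)" for d
    have \<alpha>: "walk L u (\<alpha> d) u" "\<forall>s\<in>set (\<alpha> d). c (fst s) = 0" "ev z1 (\<alpha> d) = fst d" "ev z2 (\<alpha> d) = snd d" for d
      using someI_ex[OF loops[of "fst d" "snd d"]] unfolding \<alpha>_def by blast+
    define \<beta> where "\<beta> r = (SOME w. walk L u' w u' \<and> (\<forall>s\<in>set w. c (fst s) = 0) \<and> ev z1 w = r \<and> ev z2 w = 0)" for r
    have \<beta>: "walk L u' (\<beta> r) u'" "\<forall>s\<in>set (\<beta> r). c (fst s) = 0" "ev z1 (\<beta> r) = r" "ev z2 (\<beta> r) = 0" for r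
      using someI_ex[OF loops'[of r 0]] unfolding \<beta>_def by blast+
    \<comment> \<open>The detour along \<open>wc\<close> raises the level from 0 to
      \<open>k1\<close> and \<open>flip_word wc\<close> undoes this; on both ways nothing acts on
      \<open>D\<close>.\<close>
    define B where "B r = wc @ \<beta> r @ flip_word wc" for r
    have B: "walk L u (B r) u" for r using wc(1) \<beta>(1) walk_flip[OF wc(1)] unfolding B_def walk_append by blast
    have ta: "LT.tr (map proj_letter (\<alpha> d)) (u, 0, t) = (u, 0, M 0 d t)" if "t \<in> D" for d t
      using LT.transport_level[OF \<alpha>(1,2) that, of d 0] by (simp add: \<alpha>(3,4))
    have tb: "LT.tr (map proj_letter (B r)) (u, 0, t) = (u, 0, M k1 (r, 0) t)" if t: "t \<in> D" for r t
    proof -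
      have fl: "\<forall>s\<in>set (flip_word wc). z1 (fst s) = 0 \<and> z2 (fst s) = 0" using wc(2) by (auto simp: flip_word_def)
      have t': "M k1 (r, 0) t \<in> D" using t by (simp add: D_def M_def level_action_in)
      show ?thesis
        using LT.transport_between_levels[OF wc(1,2) t, of 0] LT.transport_level[OF \<beta>(1,2) t, of r k1]
          LT.transport_between_levels[OF walk_flip[OF wc(1)] fl t', of k1]
        by (simp add: B_def transport_append k1_def[symmetric] \<beta>(3,4) ev_flip)
    qed
    have fin: "\<exists>a\<in>carrier G. mon a ((u, 0, (0, 0), 0), []) = ((u, 0, (0, 0), 0), [l])"
      if w: "walk L u w u" and t: "LT.tr (map proj_letter w) (u, 0, (0, 0), 0, []) = (u, 0, (0, 0), 0, [l])" for w
    proof (rule bexI[OF _ VL.loop_class_in])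
      show W: "walk K v (map proj_letter w) v" using walk_proj[OF w] by (simp add: v_def)
      have "((u, 0, (0, 0), 0), []) \<in> Q \<times> carrier (free_group {g1, g2})" using uY by (simp add: Q_def v_def carrier_free_group)
      from mon_eq[OF W refl this] show "mon (VL.loop_class (map proj_letter w)) ((u, 0, (0, 0), 0), []) = ((u, 0, (0, 0), 0), [l])"
        by (simp add: enc_def dec_def t)
    qed
    define d :: "'p mod_ring \<times> 'p mod_ring" where "d = (if fst l = g1 then (1, 0) else (0, 1))"
    have st: "(x, b, []) \<in> D" "(x, b, [l]) \<in> D" for x b using l by (auto simp: D_def level_states_def carrier_free_group reduced_word_Cons)
    have l': "corner g1 g2 d 1 = [(fst l, True)]" using l g12 by (auto simp: d_def corner_def)
    have c0: "corner g1 g2 x 0 = []" "corner g1 g2 (0, 0) b = []" for x b by (auto simp: corner_def)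
    have dd: "(0, 0) + d = d" "d + - d = (0, 0)" by (auto simp: d_def zero_prod_def)
    show "\<exists>a\<in>carrier G. mon a ((u, 0, (0, 0), 0), []) = ((u, 0, (0, 0), 0), [l])"
    proof (cases "snd l")
      case True
      then have lt: "[l] = [(fst l, True)]" by (simp add: prod_eq_iff)
      show ?thesis
      proof (rule fin)
        \<comment> \<open>From the origin of the grid, \<open>b\<close> is moved to 1,
          \<open>x\<close> to \<open>d\<close>, \<open>b\<close> back to 0 and \<open>x\<close> back
          to 0. The letter is picked up on arrival at the corner \<open>(d, 1)\<close>; where
          \<open>b\<close> is 0 all corner words are empty.\<close>
        show "walk L u (B 1 @ \<alpha> d @ B (- 1) @ \<alpha> (- d)) u" using B \<alpha>(1) walk_append by blast
        have 1: "M k1 (1, 0) ((0, 0), 0, []) = ((0, 0), 1, [])" using k1 by (simp add: M_def level_action_def)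
        have 2: "M 0 d ((0, 0), 1, []) = (d, 1, [l])" by (simp only: M_def level_action_def split if_True refl dd c0 l' lt) (simp add: c0)
        have 3: "M k1 (- 1, 0) (d, 1, [l]) = (d, 0, [l])" using k1 by (simp add: M_def level_action_def)
        have 4: "M 0 (- d) (d, 0, [l]) = ((0, 0), 0, [l])" by (simp add: M_def level_action_def dd c0 zero_prod_def)
        show "LT.tr (map proj_letter (B 1 @ \<alpha> d @ B (- 1) @ \<alpha> (- d))) (u, 0, (0, 0), 0, []) = (u, 0, (0, 0), 0, [l])"
          by (simp add: transport_append ta tb st 1 2 3 4)
      qed
    next
      case False
      then have lt: "[l] = [(fst l, False)]" by (simp add: prod_eq_iff)
      have lt': "flip_word [(fst l, True)] = [l]" using lt by (simp add: flip_word_def inv_letter_def)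
      show ?thesis
      proof (rule fin)
        \<comment> \<open>The same square in the opposite direction: now the level 0 move leaves the
          corner \<open>(d, 1)\<close>, which contributes the inverse letter.\<close>
        show "walk L u (\<alpha> d @ B 1 @ \<alpha> (- d) @ B (- 1)) u" using B \<alpha>(1) walk_append by blast
        have 1: "M 0 d ((0, 0), 0, []) = (d, 0, [])" by (simp add: M_def level_action_def dd c0 zero_prod_def)
        have 2: "M k1 (1, 0) (d, 0, []) = (d, 1, [])" using k1 by (simp add: M_def level_action_def)
        have 3: "M 0 (- d) (d, 1, []) = ((0, 0), 1, [l])" by (simp only: M_def level_action_def split if_True refl dd c0 l' lt') simp
        have 4: "M k1 (- 1, 0) ((0, 0), 1, [l]) = ((0, 0), 0, [l])" using k1 by (simp add: M_def level_action_def)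
        show "LT.tr (map proj_letter (\<alpha> d @ B 1 @ \<alpha> (- d) @ B (- 1))) (u, 0, (0, 0), 0, []) = (u, 0, (0, 0), 0, [l])"
          by (simp add: transport_append ta tb st 1 2 3 4)
      qed
    qed
  qed
qed

end


section \<open>The codes\<close>

text \<open>Per support edge, the neighbourhood accounts for
  \<open>1 + incidence_bound * incidence_bound\<close> and the dimension count for 3 more. A larger
  basis would leave room for a splitting.\<close>

lemma (in based_cover) large_or_large_support:
  fixes S :: "('e \<times> 'b \<Rightarrow> 'p::prime_card mod_ring) set"
  assumes S: "represents_H1_basis L S" and c: "c \<in> fun_space.span S" "c \<noteq> (\<lambda>_. 0)" and nl: "\<not> large G"
  shows "card S \<le> (4 + incidence_bound * incidence_bound) * card {e \<in> one_cells L. c e \<noteq> 0}"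
proof (rule ccontr)
  assume less: "\<not> ?thesis"
  let ?A = "{e \<in> one_cells L. c e \<noteq> 0}"
  have sub: "?A \<subseteq> one_cells L" by blast
  have "card (neighbourhood ?A) \<le> card ?A * (1 + incidence_bound * incidence_bound)" by (rule card_neighbourhood[OF sub])
  then have many: "card (neighbourhood ?A) + 3 * card ?A < card S" using less by (simp add: algebra_simps)
  have c_off: "e \<in> one_cells L" if "c e \<noteq> 0" for e
  proof -
    have "S \<subseteq> cocycles1 L"
      using S fun_space.span_superset[of "S \<union> coboundaries1 L"] unfolding represents_H1_basis_def quotient_basis_def by simp
    then have "c \<in> cocycles1 L" using fun_space.span_minimal[OF _ subspace_cocycles1] c(1) by blast
    then have "c \<in> cochains_on (one_cells L)" by (simp add: cocycles1_def)
    then show ?thesis using that unfolding cochains_on_def by blast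
  qed
  interpret SC: small_cocycle L S c "neighbourhood ?A"
  proof unfold_locales
    show "\<exists>u\<in>zero_cells L. walk L u (boundary_word L f) u" if "f \<in> two_cells L" for f
      using boundary_walk_L(1,2)[OF that] by blast
    show "fst s' \<in> neighbourhood ?A"
      if "f \<in> two_cells L" "s \<in> set (boundary_word L f)" "c (fst s) \<noteq> 0" "s' \<in> set (boundary_word L f)" for f s s'
      using that c_off unfolding neighbourhood_def by blast
    show "?A \<subseteq> neighbourhood ?A" by (auto simp: neighbourhood_def)
  qed (use finite_one_L edges_L L_connected S c neighbourhood_subset[OF sub] many in auto)
  have "large G"
  proof (rule SC.splitting)
    fix z1 z2 :: "'e \<times> 'b \<Rightarrow> 'p mod_ring" and u u' w assume *:
    "\<And>f. f \<in> two_cells L \<Longrightarrow> (\<forall>s\<in>set (boundary_word L f). z1 (fst s) = 0 \<and> z2 (fst s) = 0) \<or> (\<forall>s\<in>set (boundary_word L f). c (fst s) = 0)"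
    "\<And>f. f \<in> two_cells L \<Longrightarrow> ev c (boundary_word L f) = 0 \<and> ev z1 (boundary_word L f) = 0 \<and> ev z2 (boundary_word L f) = 0"
    "\<And>e. c e \<noteq> 0 \<Longrightarrow> z1 e = 0 \<and> z2 e = 0"
    "u \<in> zero_cells L" "u' \<in> zero_cells L"
    "\<And>a b. \<exists>w. walk L u w u \<and> (\<forall>s\<in>set w. c (fst s) = 0) \<and> ev z1 w = a \<and> ev z2 w = b"
    "\<And>a b. \<exists>w. walk L u' w u' \<and> (\<forall>s\<in>set w. c (fst s) = 0) \<and> ev z1 w = a \<and> ev z2 w = b"
    "walk L u w u'" "\<forall>s\<in>set w. z1 (fst s) = 0 \<and> z2 (fst s) = 0" "ev c w \<noteq> 0"
    show "large G" by (rule large_if_split[of z1 z2 c u u' w]) (fact *)+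
  qed
  then show False using nl by blast
qed

lemma independent_if_quotient_basis:
  assumes "quotient_basis W U S" "fun_space.subspace U"
  shows "fun_space.independent S"
proof
  assume "fun_space.dependent S"
  then obtain T r t where T: "finite T" "T \<subseteq> S" "(\<Sum>s\<in>T. fscale (r s) s) = 0" "t \<in> T" "r t \<noteq> 0"
    unfolding fun_space.dependent_explicit by blast
  have "(\<Sum>s\<in>T. fscale (r s) s) \<in> U" using T(3) fun_space.subspace_0[OF assms(2)] by simp
  then show False using assms(1) T unfolding quotient_basis_def by blast
qed

theorem theorem6p4:
  fixes K :: "('a::t2_space, 'e, 'f) two_complex"
    and x :: 'a
    and I :: "'i set"
    and Y :: "'i \<Rightarrow> 'b::topological_space set"
    and q :: "'i \<Rightarrow> 'b \<Rightarrow> 'a"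
    and y :: "'i \<Rightarrow> 'b"
    and S :: "'i \<Rightarrow> ('e \<times> 'b \<Rightarrow> 'p::prime_card mod_ring) set"
  assumes "finite_two_complex K" and "connected (points K)" and "x \<in> points K"
    and "infinite I"
    and "\<And>i. i \<in> I \<Longrightarrow> finite_connected_cover (Y i) (q i) (points K)"
    and "\<And>i. i \<in> I \<Longrightarrow> y i \<in> Y i \<and> q i (y i) = x"
    and "linear_growth_mod_p TYPE('p) (pi1 (points K) x) I
           (\<lambda>i. pi1_image (Y i) (y i) (q i) (points K))"
    and "\<And>i. i \<in> I \<Longrightarrow> represents_H1_basis (lifted_complex (Y i) (q i) K) (S i)"
  shows "large (pi1 (points K) x) \<or>
         asymptotically_good I (\<lambda>i. one_cells (lifted_complex (Y i) (q i) K))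
           (\<lambda>i. fun_space.span (S i))"
proof (rule disjCI)
  let ?G = "pi1 (points K) x"
  let ?H = "\<lambda>i. pi1_image (Y i) (y i) (q i) (points K)"
  let ?C = "\<lambda>i. one_cells (lifted_complex (Y i) (q i) K)"
  let ?r = "\<lambda>i. real (d_p TYPE('p) (?G\<lparr>carrier := ?H i\<rparr>)) / real (card (rcosets\<^bsub>?G\<^esub> (?H i)))"
  assume ng: "\<not> asymptotically_good I ?C (\<lambda>i. fun_space.span (S i))"
  show "large ?G"
  proof (rule ccontr)
    assume nl: "\<not> large ?G"
    define \<delta> where "\<delta> = (INF i\<in>I. ?r i)"
    have \<delta>: "\<delta> > 0" and index: "\<And>i. i \<in> I \<Longrightarrow> finite_index_subgroup (?H i) ?G"
      using assms(7) by (auto simp: linear_growth_mod_p_def \<delta>_def)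
    interpret FK: fin_complex K by unfold_locales (rule assms(1))
    define E where "E = real (card (one_cells K))"
    define N where "N = real (4 + complex_cover.incidence_bound K * complex_cover.incidence_bound K)"
    have N: "N > 0" unfolding N_def of_nat_0_less_iff by simp
    have main: "\<delta> * card (?C i) \<le> E * card (S i) \<and> 0 < card (?C i) \<and> 0 < E \<and> fun_space.dim (fun_space.span (S i)) = card (S i) \<and>
        real (card (S i)) \<le> N * hamming_distance (?C i) (fun_space.span (S i))" if i: "i \<in> I" for i
    proof -
      have x: "x = q i (y i)" using assms(6)[OF i] by simp
      interpret BC: based_cover K "Y i" "q i" "y i"
        by unfold_locales (use assms(5,6)[OF i] in auto)
      note L = BC.L_def[symmetric]
      have S: "represents_H1_basis BC.L (S i)" using assms(8)[OF i] by (simp add: L)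
      have fH: "finite_index_subgroup BC.H BC.G" using index[OF i] by (simp add: x)
      have fS: "finite (S i)" and dS: "d_p TYPE('p) (BC.G\<lparr>carrier := BC.H\<rparr>) \<le> card (S i)" by (rule BC.d_p_le_card_basis[OF S])+
      \<comment> \<open>The ratios are non-negative, which makes the infimum of the hypothesis an
        actual lower bound.\<close>
      have "bdd_below (?r ` I)" by (rule bdd_belowI[of _ 0]) auto
      then have d: "\<delta> \<le> ?r i" unfolding \<delta>_def by (rule cINF_lower[OF _ i])
      then have "0 < ?r i" using \<delta> by linarith
      then have r0: "0 < real (card (rcosets\<^bsub>?G\<^esub> (?H i)))" and d0: "0 < d_p TYPE('p) (?G\<lparr>carrier := ?H i\<rparr>)"
        by (auto simp: zero_less_divide_iff)
      have d': "\<delta> * card (rcosets\<^bsub>?G\<^esub> (?H i)) \<le> card (S i)"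
      proof -
        have "\<delta> * card (rcosets\<^bsub>?G\<^esub> (?H i)) \<le> d_p TYPE('p) (?G\<lparr>carrier := ?H i\<rparr>)" using d r0 by (simp add: pos_le_divide_eq)
        also have "\<dots> \<le> card (S i)" using dS by (simp add: x)
        finally show ?thesis .
      qed
      have S0: "0 < card (S i)" using d0 dS by (simp add: x)
      have edges: "real (card (?C i)) \<le> E * card (rcosets\<^bsub>?G\<^esub> (?H i))"
        using BC.card_edges_le_index[OF fH] unfolding E_def of_nat_mult[symmetric] of_nat_le_iff by (simp add: L x)
      \<comment> \<open>The length of the code is at most \<open>E\<close> times the index, and the
        index is at most the dimension divided by \<open>\<delta>\<close>.\<close>
      have 1: "\<delta> * card (?C i) \<le> E * card (S i)"
      proof -
        have "\<delta> * card (?C i) \<le> \<delta> * (E * card (rcosets\<^bsub>?G\<^esub> (?H i)))" using edges \<delta> by (intro mult_left_mono) auto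
        also have "\<dots> = E * (\<delta> * card (rcosets\<^bsub>?G\<^esub> (?H i)))" by simp
        also have "\<dots> \<le> E * card (S i)" using d' by (intro mult_left_mono) (auto simp: E_def)
        finally show ?thesis .
      qed
      have ind: "fun_space.independent (S i)"
        using independent_if_quotient_basis S subspace_coboundaries1 unfolding represents_H1_basis_def by blast
      have dim: "fun_space.dim (fun_space.span (S i)) = card (S i)"
        using fun_space.dim_span fun_space.dim_eq_card_independent[OF ind] by metis
      define Ham where "Ham = {card {e \<in> ?C i. c e \<noteq> 0} | c. c \<in> fun_space.span (S i) \<and> c \<noteq> (\<lambda>_. 0)}"
      have bound: "card (S i) \<le> (4 + complex_cover.incidence_bound K * complex_cover.incidence_bound K) * n" if "n \<in> Ham" for n
        using that BC.large_or_large_support[OF S] nl unfolding Ham_def by (auto simp: L x)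
      \<comment> \<open>Positive homology provides a non-zero code word, so \<open>Ham\<close> is
        non-empty and its infimum is attained.\<close>
      obtain s where s: "s \<in> S i" using S0 by fastforce
      have "s \<noteq> 0" using ind s fun_space.dependent_zero by blast
      then have "card {e \<in> ?C i. s e \<noteq> 0} \<in> Ham" using s fun_space.span_base unfolding Ham_def zero_fun_def by blast
      then have "Ham \<noteq> {}" by blast
      then have "Inf Ham \<in> Ham" by (rule Inf_nat_def1)
      then have h: "card (S i) \<le> (4 + complex_cover.incidence_bound K * complex_cover.incidence_bound K) * hamming_distance (?C i) (fun_space.span (S i))"
        unfolding hamming_distance_def Ham_def[symmetric] by (rule bound)
      \<comment> \<open>The same bound applied to \<open>s\<close> shows that its support is
        non-empty, hence that the cover and \<open>K\<close> have edges.\<close>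
      have "card (S i) \<le> (4 + complex_cover.incidence_bound K * complex_cover.incidence_bound K) * card {e \<in> ?C i. s e \<noteq> 0}"
        by (rule bound) fact
      then have "{e \<in> ?C i. s e \<noteq> 0} \<noteq> {}" using S0 by (metis card.empty mult_0_right not_le)
      then obtain e where e: "e \<in> ?C i" by blast
      have c0: "0 < card (?C i)" using e BC.finite_one_L unfolding L by (auto simp: card_gt_0_iff)
      have "fst e \<in> one_cells K" using e BC.one_L unfolding L by auto
      then have "0 < E" using FK.finite_cells(2) by (auto simp: E_def card_gt_0_iff)
      then show ?thesis using 1 c0 dim h unfolding N_def of_nat_mult[symmetric] of_nat_le_iff by simp
    qed
    have rate: "\<delta> / E \<le> code_rate (?C i) (fun_space.span (S i))" and dist: "\<delta> / (E * N) \<le> hamming_distance (?C i) (fun_space.span (S i)) / card (?C i)"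
      and E0: "0 < E" if i: "i \<in> I" for i
    proof -
      have m1: "\<delta> * card (?C i) \<le> E * card (S i)" and m2: "0 < real (card (?C i))" and m3: "0 < E"
        and m4: "fun_space.dim (fun_space.span (S i)) = card (S i)"
        and m5: "real (card (S i)) \<le> N * hamming_distance (?C i) (fun_space.span (S i))"
        using main[OF i] by auto
      show "\<delta> / E \<le> code_rate (?C i) (fun_space.span (S i))"
        unfolding code_rate_def m4 using m1 m2 m3 by (simp add: pos_le_divide_eq pos_divide_le_eq mult.commute)
      have "\<delta> * card (?C i) \<le> E * (N * hamming_distance (?C i) (fun_space.span (S i)))"
        using m1 mult_left_mono[OF m5, of E] m3 by linarith
      then show "\<delta> / (E * N) \<le> hamming_distance (?C i) (fun_space.span (S i)) / card (?C i)"
        using m2 m3 N by (simp add: pos_le_divide_eq pos_divide_le_eq mult.commute mult.left_commute mult.assoc)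
      show "0 < E" by (rule m3)
    qed
    \<comment> \<open>The bounds do not depend on the index, so a single one suffices to see that
      \<open>E\<close>, and with it both bounds, are positive.\<close>
    obtain i0 where "i0 \<in> I" using assms(4) by fastforce
    then have "0 < \<delta> / E" "0 < \<delta> / (E * N)" using E0 \<delta> N by auto
    then have "asymptotically_good I ?C (\<lambda>i. fun_space.span (S i))"
      unfolding asymptotically_good_def using rate dist by blast
    then show False using ng by blast
  qed
qed

end
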